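(* There exists a monotone, homogeneous, lower semicontinuous functional $F:\Pi\to[0,\infty]$ such that $$F(\Gamma_{\sigma^2}^\infty)=\sigma\quad\text{and}\quad F(rI^\infty)=\frac r{\sqrt{2\pi}}\qquad\text{for all }\sigma,r>0,$$ and moreover such that the following holds: if a pyramid $P$ is $\ell_2$-idempotent and $F(P)=\sqrt{V(P)}$, then $P=\Gamma^\infty_{V(P)}$.
   Context: A pm-space is a triple $X=(X,d_X,m_X)$ with $(X,d_X)$ a complete separable metric space and $m_X$ a Borel probability measure. Two pm-spaces are isomorphic if there is an isometry $\operatorname{supp} m_X\to\operatorname{supp} m_Y$ pushing $m_X$ forward to $m_Y$; $\mathcal X$ is the set of isomorphism classes, and a class is always represented by a space with $\operatorname{supp}m_X=X$; $\ast$ is the one-point space. Lipschitz order: $Y\prec X$ iff there is a $1$-Lipschitz map $\phi:X\to Y$ with $\phi_\#m_X=m_Y$. Box distance: a parameter of $X$ is a Borel map $a:[0,1]\to X$ with $a_\#\mathcal L^1=m_X$; $\square(X,Y)$ is the infimum of $\epsilon>0$ such that there are parameters $a$ of $X$, $b$ of $Y$ and a Borel set $I_0\subset[0,1]$ with $\mathcal L^1(I_0)\ge1-\epsilon$ and $|d_X(a(s),a(t))-d_Y(b(s),b(t))|\le\epsilon$ for all $s,t\in I_0$. A pyramid is a non-empty, $\square$-closed subset $P\subset\mathcal X$ that is downward-closed for $\prec$ and directed (any $X,Y\in P$ have some $Z\in P$ with $X,Y\prec Z$). $\Pi$ is the set of pyramids; $\mathcal PX=\{Y\in\mathcal X\mid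 Y\prec X\}\in\Pi$. Pyramids $P_n$ converge weakly to $P$ if (1) every $X\in P$ is a $\square$-limit of some $X_n\in P_n$, and (2) $\liminf_n\inf_{Y\in P_n}\square(X,Y)>0$ for every $X\notin P$; this is convergence for a compact metrizable topology on $\Pi$ (the weak topology). For $t>0$: $tX=(X,td_X,m_X)$ and $tP=\{tX\mid X\in P\}$. $F:\Pi\to[0,\infty]$ is monotone if $P\subset Q$ implies $F(P)\le F(Q)$; homogeneous if for some $d>0$, $F(tP)=t^dF(P)$ for all $t>0$, $P\in\Pi$; lower semicontinuous means with respect to the weak topology. For pyramids $P,Q$, $P\otimes_2Q$ is the $\square$-closure of $\bigcup\{\mathcal P(X\times_2Y)\mid X\in P,Y\in Q\}$, where $X\times_2Y$ is the product with $\ell_2$-product metric and product measure. $P$ is $\ell_2$-idempotent if $P\otimes_2P=P$. For a pm-space $X$, $X_2^n$ is the $n$-fold $\ell_2$-product and $X_2^\infty=\overline{\bigcup_{n}\mathcal PX_2^n}$. $\Gamma_{\sigma^2}^\infty=(\mathbb R,|\cdot|,\gamma^1_{\sigma^2})_2^\infty$ with $\gamma^1_{\sigma^2}$ the centered Gaussian measure of variance $\sigma^2\in(0,\infty)$; by convention $\Gamma_0^\infty=\{\ast\}$, $\Gamma_\infty^\infty=\mathcal X$. $rI^\infty=([0,r],|\cdot|,r^{-1}\mathcal L^1)_2^\infty$. $V(X)=\sup\{\frac12\int_{X\times X}(f(x)-f(y))^2dm_X^{\otimes2}\mid f:X\to\mathbb R\ 1\text{-Lipschitz}\}$ and $V(P)=\sup_{X\in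 P}V(X)$. *)

theory Defs
  imports "HOL-Probability.Probability"
begin

section \<open>pm-spaces\<close>

text \<open>A pair of a metric space and a measure, both living on a subset of the type \<open>'a\<close>.\<close>

type_synonym 'a metric_measure = "'a metric \<times> 'a measure"

definition borel_sigma :: "'a metric \<Rightarrow> 'a measure" where
  "borel_sigma d = sigma (mspace d) {U. openin (mtopology_of d) U}"

definition pm_space :: "'a metric_measure \<Rightarrow> bool" where
  "pm_space X \<longleftrightarrow>
     mcomplete_of (fst X) \<and> separable_space (mtopology_of (fst X)) \<and>
     space (snd X) = mspace (fst X) \<and> sets (snd X) = sets (borel_sigma (fst X)) \<and>
     prob_space (snd X)"

definition pm_support :: "'a metric_measure \<Rightarrow> 'a set" where
  "pm_support X = {x \<in> mspace (fst X).
     \<forall>U. openin (mtopology_of (fst X)) U \<and> x \<in> U \<longrightarrow> emeasure (snd X) U > 0}"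

definition full_pm_space :: "'a metric_measure \<Rightarrow> bool" where
  "full_pm_space X \<longleftrightarrow> pm_space X \<and> pm_support X = mspace (fst X)"

definition one_lipschitz :: "'a metric \<Rightarrow> 'b metric \<Rightarrow> ('a \<Rightarrow> 'b) \<Rightarrow> bool" where
  "one_lipschitz d e f \<longleftrightarrow> f \<in> mspace d \<rightarrow> mspace e \<and>
     (\<forall>x\<in>mspace d. \<forall>y\<in>mspace d. mdist e (f x) (f y) \<le> mdist d x y)"

text \<open>
  Both relations below are only used between full-support spaces. The maps occurring in them are
  continuous, hence Borel measurable, so \<^const>\<open>distr\<close> is the push-forward. They relate spaces over
  possibly different types.
\<close>

definition pm_iso :: "'a metric_measure \<Rightarrow> 'b metric_measure \<Rightarrow> bool" where
  "pm_iso X Y \<longleftrightarrow> (\<exists>f. bij_betw f (mspace (fst X)) (mspace (fst Y)) \<and>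
     (\<forall>x\<in>mspace (fst X). \<forall>y\<in>mspace (fst X). mdist (fst Y) (f x) (f y) = mdist (fst X) x y) \<and>
     distr (snd X) (snd Y) f = snd Y)"

definition lip_le :: "'b metric_measure \<Rightarrow> 'a metric_measure \<Rightarrow> bool" where
  "lip_le Y X \<longleftrightarrow> (\<exists>\<phi>. one_lipschitz (fst X) (fst Y) \<phi> \<and> distr (snd X) (snd Y) \<phi> = snd Y)"

lemma one_lipschitz_measurable:
  assumes "one_lipschitz (fst X) (fst Y) f" "pm_space X" "pm_space Y"
  shows "f \<in> measurable (snd X) (snd Y)"
proof -
  have "Lipschitz_continuous_map (fst X) (fst Y) f"
    using assms(1) unfolding one_lipschitz_def Lipschitz_continuous_map_def
    by (metis mult_1)
  then have c: "continuous_map (mtopology_of (fst X)) (mtopology_of (fst Y)) f"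
    by (rule Lipschitz_continuous_imp_continuous_map)
  have "f \<in> measurable (borel_sigma (fst X)) (borel_sigma (fst Y))"
    unfolding borel_sigma_def
  proof (rule measurable_measure_of)
    show "{U. openin (mtopology_of (fst Y)) U} \<subseteq> Pow (mspace (fst Y))"
      using openin_subset by force
    show "f \<in> space (sigma (mspace (fst X)) {U. openin (mtopology_of (fst X)) U}) \<rightarrow> mspace (fst Y)"
      using assms(1) by (simp add: one_lipschitz_def space_measure_of_conv)
    fix U assume "U \<in> {U. openin (mtopology_of (fst Y)) U}"
    then have "openin (mtopology_of (fst X)) {x \<in> mspace (fst X). f x \<in> U}"
      using c by (auto simp: continuous_map_def)
    moreover have "{U. openin (mtopology_of (fst X)) U} \<subseteq> Pow (mspace (fst X))"
      using openin_subset by force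
    ultimately show "f -` U \<inter> space (sigma (mspace (fst X)) {U. openin (mtopology_of (fst X)) U})
        \<in> sets (sigma (mspace (fst X)) {U. openin (mtopology_of (fst X)) U})"
      by (auto simp: space_measure_of_conv vimage_def Int_def conj_commute intro!: sigma_sets.Basic)
  qed
  then show ?thesis
    using assms(2,3) by (simp add: pm_space_def cong: measurable_cong_sets)
qed

lemma pm_iso_refl: "pm_iso X X"
  unfolding pm_iso_def by (rule exI[of _ id]) (auto simp: distr_id2 id_def bij_betw_def)

lemma pm_iso_sym:
  assumes "pm_iso X Y" "pm_space X" "pm_space Y"
  shows "pm_iso Y X"
proof -
  obtain f where f: "bij_betw f (mspace (fst X)) (mspace (fst Y))"
    and d: "\<And>x y. x \<in> mspace (fst X) \<Longrightarrow> y \<in> mspace (fst X) \<Longrightarrow>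
              mdist (fst Y) (f x) (f y) = mdist (fst X) x y"
    and p: "distr (snd X) (snd Y) f = snd Y"
    using assms(1) unfolding pm_iso_def by blast
  define g where "g = the_inv_into (mspace (fst X)) f"
  have g: "bij_betw g (mspace (fst Y)) (mspace (fst X))"
    unfolding g_def using f by (rule bij_betw_the_inv_into)
  have gf: "g (f x) = x" if "x \<in> mspace (fst X)" for x
    using f that by (simp add: g_def bij_betw_def the_inv_into_f_f)
  have fg: "f (g y) = y" if "y \<in> mspace (fst Y)" for y
    using f that by (simp add: g_def f_the_inv_into_f_bij_betw)
  have gin: "g y \<in> mspace (fst X)" if "y \<in> mspace (fst Y)" for y
    using g that by (rule bij_betwE[THEN bspec])
  have gd: "mdist (fst X) (g x) (g y) = mdist (fst Y) x y"
    if "x \<in> mspace (fst Y)" "y \<in> mspace (fst Y)" for x y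
    using d[of "g x" "g y"] that by (simp add: gin fg)
  have mf: "f \<in> measurable (snd X) (snd Y)"
    using f d assms by (intro one_lipschitz_measurable) (auto simp: one_lipschitz_def bij_betw_def)
  have mg: "g \<in> measurable (snd Y) (snd X)"
    using g gd assms by (intro one_lipschitz_measurable) (auto simp: one_lipschitz_def bij_betw_def)
  have "distr (snd Y) (snd X) g = distr (distr (snd X) (snd Y) f) (snd X) g"
    by (simp add: p)
  also have "\<dots> = distr (snd X) (snd X) (g \<circ> f)"
    using mg mf by (rule distr_distr)
  also have "\<dots> = distr (snd X) (snd X) (\<lambda>x. x)"
    using assms(2) gf by (intro distr_cong) (auto simp: pm_space_def)
  finally show ?thesis
    unfolding pm_iso_def using g gd by (auto simp: distr_id2)
qed

lemma pm_iso_trans: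
  assumes "pm_iso X Y" "pm_iso Y Z" "pm_space X" "pm_space Y" "pm_space Z"
  shows "pm_iso X Z"
proof -
  obtain f where f: "bij_betw f (mspace (fst X)) (mspace (fst Y))"
    and d: "\<And>x y. x \<in> mspace (fst X) \<Longrightarrow> y \<in> mspace (fst X) \<Longrightarrow>
              mdist (fst Y) (f x) (f y) = mdist (fst X) x y"
    and p: "distr (snd X) (snd Y) f = snd Y"
    using assms(1) unfolding pm_iso_def by blast
  obtain g where g: "bij_betw g (mspace (fst Y)) (mspace (fst Z))"
    and e: "\<And>x y. x \<in> mspace (fst Y) \<Longrightarrow> y \<in> mspace (fst Y) \<Longrightarrow>
              mdist (fst Z) (g x) (g y) = mdist (fst Y) x y"
    and q: "distr (snd Y) (snd Z) g = snd Z"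
    using assms(2) unfolding pm_iso_def by blast
  have fin: "f x \<in> mspace (fst Y)" if "x \<in> mspace (fst X)" for x
    using f that by (rule bij_betwE[THEN bspec])
  have mf: "f \<in> measurable (snd X) (snd Y)"
    using f d assms by (intro one_lipschitz_measurable) (auto simp: one_lipschitz_def bij_betw_def)
  have mg: "g \<in> measurable (snd Y) (snd Z)"
    using g e assms by (intro one_lipschitz_measurable) (auto simp: one_lipschitz_def bij_betw_def)
  have "distr (snd X) (snd Z) (g \<circ> f) = snd Z"
    using distr_distr[OF mg mf] p q by simp
  then show ?thesis
    unfolding pm_iso_def using bij_betw_trans[OF f g] d e fin
    by (intro exI[of _ "g \<circ> f"]) auto
qed

section \<open>Isomorphism classes\<close>

text \<open>
  The set of isomorphism classes is the type \<open>pm_class\<close> (so the set of all classes is \<^term>\<open>UNIV\<close>).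
  A separable metric space has at most the cardinality of the continuum, so every pm-space is
  isomorphic to one whose points are real numbers (with an arbitrary metric, unrelated to that of
  the line). Isomorphism classes over this single type are thus all isomorphism classes.
\<close>

definition pm_rel :: "real metric_measure \<Rightarrow> real metric_measure \<Rightarrow> bool" where
  "pm_rel X Y \<longleftrightarrow> full_pm_space X \<and> full_pm_space Y \<and> pm_iso X Y"

definition one_point :: "real metric_measure" where
  "one_point = (submetric euclidean_metric {0}, return (count_space {0}) 0)"

lemma full_pm_space_one_point: "full_pm_space one_point"
proof -
  have top: "openin (mtopology_of (submetric euclidean_metric {0::real})) U \<longleftrightarrow> U = {} \<or> U = {0}" for U
    unfolding mtopology_of_submetric mtopology_of_euclidean openin_subtopology
    by (auto intro: exI[of _ UNIV] exI[of _ "{}"])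
  have "mcomplete_of (submetric euclidean_metric {0::real})"
    unfolding mcomplete_of_def Metric_space.mcomplete_def[OF Metric_space_mspace_mdist]
      Metric_space.MCauchy_def[OF Metric_space_mspace_mdist]
      Metric_space.limitin_metric[OF Metric_space_mspace_mdist]
    by (auto simp: image_subset_iff intro!: exI[of _ "0::real"] always_eventually)
  moreover have "separable_space (mtopology_of (submetric euclidean_metric {0::real}))"
    unfolding separable_space_def
    by (rule exI[of _ "{0}"]) (auto simp: closure_of_topspace[of "mtopology_of (submetric euclidean_metric {0::real})", simplified])
  moreover have "sets (borel_sigma (submetric euclidean_metric {0::real})) = Pow {0}"
    unfolding borel_sigma_def
    by (auto simp: sets_measure_of_conv top Pow_def subset_singleton_iff
        intro: sigma_sets.Basic sigma_sets.Empty dest: sigma_sets_into_sp[rotated])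
  moreover have "prob_space (return (count_space {0::real}) 0)"
    by (rule prob_space_return) simp
  ultimately show ?thesis
    by (auto simp: full_pm_space_def pm_space_def pm_support_def one_point_def top)
qed

quotient_type pm_class = "real metric_measure" / partial: pm_rel
proof (rule part_equivpI)
  show "\<exists>X. pm_rel X X"
    using full_pm_space_one_point pm_iso_refl unfolding pm_rel_def by blast
  show "symp pm_rel"
    by (auto simp: symp_def pm_rel_def full_pm_space_def intro: pm_iso_sym)
  show "transp pm_rel"
    by (auto simp: transp_def pm_rel_def full_pm_space_def intro: pm_iso_trans)
qed

lemma full_pm_space_rep: "full_pm_space (rep_pm_class X)"
  using Quotient3_rep_reflp[OF Quotient3_pm_class, of X] by (simp add: pm_rel_def)

lemma pm_iso_rep_abs: "full_pm_space X \<Longrightarrow> pm_iso (rep_pm_class (abs_pm_class X)) X"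
  using rep_abs_rsp_left[OF Quotient3_pm_class, of X X] pm_iso_refl[of X] by (simp add: pm_rel_def)

text \<open>
  All notions on classes are read off from a full-support representative; they do not depend on
  which one is taken.
\<close>

definition lip_le_class :: "pm_class \<Rightarrow> pm_class \<Rightarrow> bool" (infix "\<preceq>\<^sub>L" 50) where
  "Y \<preceq>\<^sub>L X \<longleftrightarrow> lip_le (rep_pm_class Y) (rep_pm_class X)"

definition parameter :: "'a metric_measure \<Rightarrow> (real \<Rightarrow> 'a) \<Rightarrow> bool" where
  "parameter X a \<longleftrightarrow> a \<in> measurable (restrict_space lborel {0..1}) (snd X) \<and>
     distr (restrict_space lborel {0..1}) (snd X) a = snd X"

definition box_dist :: "'a metric_measure \<Rightarrow> 'b metric_measure \<Rightarrow> real" where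
  "box_dist X Y = Inf {\<epsilon>. \<epsilon> > 0 \<and> (\<exists>a b I. parameter X a \<and> parameter Y b \<and>
     I \<in> sets borel \<and> I \<subseteq> {0..1} \<and> measure lborel I \<ge> 1 - \<epsilon> \<and>
     (\<forall>s\<in>I. \<forall>t\<in>I. \<bar>mdist (fst X) (a s) (a t) - mdist (fst Y) (b s) (b t)\<bar> \<le> \<epsilon>))}"

definition box_class :: "pm_class \<Rightarrow> pm_class \<Rightarrow> real" where
  "box_class X Y = box_dist (rep_pm_class X) (rep_pm_class Y)"

definition box_closure :: "pm_class set \<Rightarrow> pm_class set" where
  "box_closure A = {X. \<forall>\<epsilon>>0. \<exists>Y\<in>A. box_class X Y < \<epsilon>}"

section \<open>Pyramids and the weak topology\<close>

definition pyramids :: "pm_class set set" where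
  "pyramids = {P. P \<noteq> {} \<and> box_closure P = P \<and>
     (\<forall>X\<in>P. \<forall>Y. Y \<preceq>\<^sub>L X \<longrightarrow> Y \<in> P) \<and>
     (\<forall>X\<in>P. \<forall>Y\<in>P. \<exists>Z\<in>P. X \<preceq>\<^sub>L Z \<and> Y \<preceq>\<^sub>L Z)}"

definition pyramid_of :: "'a metric_measure \<Rightarrow> pm_class set" where
  "pyramid_of X = {Y. lip_le (rep_pm_class Y) X}"

definition weakly_converges :: "(nat \<Rightarrow> pm_class set) \<Rightarrow> pm_class set \<Rightarrow> bool" where
  "weakly_converges S P \<longleftrightarrow>
     (\<forall>X\<in>P. \<exists>x. (\<forall>n. x n \<in> S n) \<and> (\<lambda>n. box_class (x n) X) \<longlonglongrightarrow> 0) \<and>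
     (\<forall>X. X \<notin> P \<longrightarrow> liminf (\<lambda>n. INF Y\<in>S n. ereal (box_class X Y)) > 0)"

text \<open>
  Weak convergence is convergence in a metrizable topology. A metrizable topology is determined by
  its convergent sequences: its open sets are the sequentially open sets.
\<close>

definition weakly_open :: "pm_class set set \<Rightarrow> bool" where
  "weakly_open U \<longleftrightarrow> U \<subseteq> pyramids \<and>
     (\<forall>P\<in>U. \<forall>S. (\<forall>n. S n \<in> pyramids) \<and> weakly_converges S P \<longrightarrow>
        (\<forall>\<^sub>F n in sequentially. S n \<in> U))"

definition weak_topology :: "pm_class set topology" where
  "weak_topology = topology weakly_open"

lemma istopology_weakly_open: "istopology weakly_open"
  unfolding istopology_def
proof (intro conjI allI impI)
  fix U V assume "weakly_open U" "weakly_open V"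
  then show "weakly_open (U \<inter> V)"
    unfolding weakly_open_def by (auto intro: eventually_conj)
next
  fix K assume K: "\<forall>U\<in>K. weakly_open U"
  show "weakly_open (\<Union> K)"
    unfolding weakly_open_def
  proof (intro conjI ballI allI impI)
    show "\<Union> K \<subseteq> pyramids"
      using K by (auto simp: weakly_open_def)
    fix P S assume "P \<in> \<Union> K" and S: "(\<forall>n. S n \<in> pyramids) \<and> weakly_converges S P"
    then obtain U where "U \<in> K" "P \<in> U" by blast
    then have "\<forall>\<^sub>F n in sequentially. S n \<in> U"
      using K S by (auto simp: weakly_open_def)
    then show "\<forall>\<^sub>F n in sequentially. S n \<in> \<Union> K"
      by eventually_elim (use \<open>U \<in> K\<close> in blast)
  qed
qed

lemma openin_weak_topology: "openin weak_topology U \<longleftrightarrow> weakly_open U"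
  by (simp add: weak_topology_def topology_inverse' istopology_weakly_open)

section \<open>Functionals on pyramids\<close>

definition scale_metric :: "real \<Rightarrow> 'a metric \<Rightarrow> 'a metric" where
  "scale_metric t d = metric (mspace d, \<lambda>x y. t * mdist d x y)"

definition scale_pm :: "real \<Rightarrow> 'a metric_measure \<Rightarrow> 'a metric_measure" where
  "scale_pm t X = (scale_metric t (fst X), snd X)"

lemma Metric_space_scale:
  assumes "Metric_space M d" "t > 0"
  shows "Metric_space M (\<lambda>x y. t * d x y)"
proof -
  interpret Metric_space M d by fact
  show ?thesis
    using assms(2)
    by unfold_locales (auto simp: commute simp flip: distrib_left intro: triangle)
qed

lemma
  assumes "t > 0"
  shows mspace_scale_metric: "mspace (scale_metric t d) = mspace d"
    and mdist_scale_metric: "mdist (scale_metric t d) = (\<lambda>x y. t * mdist d x y)"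
  using Metric_space_scale[OF Metric_space_mspace_mdist assms, of d]
  by (simp_all add: scale_metric_def Metric_space.mspace_metric Metric_space.mdist_metric)

lemma mtopology_of_scale_metric:
  assumes "t > 0"
  shows "mtopology_of (scale_metric t d) = mtopology_of d"
proof (rule topology_eq[THEN iffD2], intro allI)
  fix U
  let ?d = "scale_metric t d"
  have b: "mball_of ?d x (t * r) = mball_of d x r" for x r
    using assms by (auto simp: set_eq_iff mspace_scale_metric mdist_scale_metric)
  have b': "mball_of ?d x r = mball_of d x (r / t)" for x r
    using b[of x "r / t"] assms by simp
  have "(\<exists>r>0. mball_of ?d x r \<subseteq> U) \<longleftrightarrow> (\<exists>r>0. mball_of d x r \<subseteq> U)" for x
    using b b' assms by (metis divide_pos_pos mult_pos_pos)
  then show "openin (mtopology_of ?d) U \<longleftrightarrow> openin (mtopology_of d) U"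
    unfolding mtopology_of_def Metric_space.openin_mtopology[OF Metric_space_mspace_mdist]
      mball_of_def
    unfolding mspace_scale_metric[OF assms] by simp
qed

lemma mcomplete_of_scale_metric:
  assumes "t > 0" "mcomplete_of d"
  shows "mcomplete_of (scale_metric t d)"
proof -
  have "Metric_space.MCauchy (mspace d) (mdist d) \<sigma>"
    if "Metric_space.MCauchy (mspace (scale_metric t d)) (mdist (scale_metric t d)) \<sigma>" for \<sigma>
    unfolding Metric_space.MCauchy_def[OF Metric_space_mspace_mdist]
  proof (intro conjI allI impI)
    show "range \<sigma> \<subseteq> mspace d"
      using that unfolding Metric_space.MCauchy_def[OF Metric_space_mspace_mdist]
      unfolding mspace_scale_metric[OF assms(1)] by blast
    fix \<epsilon> :: real assume "\<epsilon> > 0"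
    then have "t * \<epsilon> > 0" using assms(1) by simp
    with that obtain N where
      "\<forall>n n'. N \<le> n \<longrightarrow> N \<le> n' \<longrightarrow> mdist (scale_metric t d) (\<sigma> n) (\<sigma> n') < t * \<epsilon>"
      unfolding Metric_space.MCauchy_def[OF Metric_space_mspace_mdist] by blast
    then show "\<exists>N. \<forall>n n'. N \<le> n \<longrightarrow> N \<le> n' \<longrightarrow> mdist d (\<sigma> n) (\<sigma> n') < \<epsilon>"
      using assms(1) by (auto simp: mdist_scale_metric)
  qed
  then show ?thesis
    using assms(2) mtopology_of_scale_metric[OF assms(1), of d]
    unfolding mcomplete_of_def Metric_space.mcomplete_def[OF Metric_space_mspace_mdist]
      mtopology_of_def by metis
qed

lemma full_pm_space_scale_pm: "t > 0 \<Longrightarrow> full_pm_space X \<Longrightarrow> full_pm_space (scale_pm t X)"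
  by (auto simp: full_pm_space_def pm_space_def pm_support_def scale_pm_def borel_sigma_def
      mspace_scale_metric mtopology_of_scale_metric mcomplete_of_scale_metric)

definition scale_pyramid :: "real \<Rightarrow> pm_class set \<Rightarrow> pm_class set" where
  "scale_pyramid t P = (\<lambda>X. abs_pm_class (scale_pm t (rep_pm_class X))) ` P"

definition monotone_functional :: "(pm_class set \<Rightarrow> ennreal) \<Rightarrow> bool" where
  "monotone_functional F \<longleftrightarrow> (\<forall>P\<in>pyramids. \<forall>Q\<in>pyramids. P \<subseteq> Q \<longrightarrow> F P \<le> F Q)"

definition homogeneous_functional :: "(pm_class set \<Rightarrow> ennreal) \<Rightarrow> bool" where
  "homogeneous_functional F \<longleftrightarrow> (\<exists>d>0. \<forall>t>0. \<forall>P\<in>pyramids.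
     F (scale_pyramid t P) = ennreal (t powr d) * F P)"

definition lsc_functional :: "(pm_class set \<Rightarrow> ennreal) \<Rightarrow> bool" where
  "lsc_functional F \<longleftrightarrow> (\<forall>c. openin weak_topology {P \<in> pyramids. F P > c})"

section \<open>Products\<close>

definition prod_pm :: "'a metric_measure \<Rightarrow> 'b metric_measure \<Rightarrow> ('a \<times> 'b) metric_measure" where
  "prod_pm X Y = (prod_metric (fst X) (fst Y), snd X \<Otimes>\<^sub>M snd Y)"

definition pyramid_prod :: "pm_class set \<Rightarrow> pm_class set \<Rightarrow> pm_class set" where
  "pyramid_prod P Q =
     box_closure (\<Union>X\<in>P. \<Union>Y\<in>Q. pyramid_of (prod_pm (rep_pm_class X) (rep_pm_class Y)))"

definition l2_idempotent :: "pm_class set \<Rightarrow> bool" where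
  "l2_idempotent P \<longleftrightarrow> pyramid_prod P P = P"

definition power_metric :: "nat \<Rightarrow> 'a metric \<Rightarrow> (nat \<Rightarrow> 'a) metric" where
  "power_metric n d = metric (PiE {..<n} (\<lambda>_. mspace d),
     \<lambda>x y. sqrt (\<Sum>i<n. (mdist d (x i) (y i))\<^sup>2))"

lemma Metric_space_power:
  fixes d :: "'a metric" and n :: nat
  shows "Metric_space (PiE {..<n} (\<lambda>_. mspace d)) (\<lambda>x y. sqrt (\<Sum>i<n. (mdist d (x i) (y i))\<^sup>2))"
proof -
  interpret Metric_space "mspace d" "mdist d" by simp
  show ?thesis
  proof
    fix x y :: "nat \<Rightarrow> 'a"
    show "0 \<le> sqrt (\<Sum>i<n. (mdist d (x i) (y i))\<^sup>2)"
      by (simp add: sum_nonneg)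
    show "sqrt (\<Sum>i<n. (mdist d (x i) (y i))\<^sup>2) = sqrt (\<Sum>i<n. (mdist d (y i) (x i))\<^sup>2)"
      by (simp add: commute)
  next
    fix x y assume xy: "x \<in> PiE {..<n} (\<lambda>_. mspace d)" "y \<in> PiE {..<n} (\<lambda>_. mspace d)"
    have mem: "x i \<in> mspace d" "y i \<in> mspace d" if "i < n" for i
      using xy that by (auto simp: PiE_mem)
    have "sqrt (\<Sum>i<n. (mdist d (x i) (y i))\<^sup>2) = 0 \<longleftrightarrow> (\<forall>i\<in>{..<n}. x i = y i)"
      using xy mem by (auto simp: sum_nonneg_eq_0_iff)
    also have "\<dots> \<longleftrightarrow> x = y"
      using xy by (auto intro: PiE_ext)
    finally show "sqrt (\<Sum>i<n. (mdist d (x i) (y i))\<^sup>2) = 0 \<longleftrightarrow> x = y" .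
  next
    fix x y z assume xyz: "x \<in> PiE {..<n} (\<lambda>_. mspace d)" "y \<in> PiE {..<n} (\<lambda>_. mspace d)"
      "z \<in> PiE {..<n} (\<lambda>_. mspace d)"
    have "L2_set (\<lambda>i. mdist d (x i) (z i)) {..<n}
        \<le> L2_set (\<lambda>i. mdist d (x i) (y i) + mdist d (y i) (z i)) {..<n}"
      using xyz by (intro L2_set_mono) (auto intro!: triangle simp: PiE_mem)
    also have "\<dots> \<le> L2_set (\<lambda>i. mdist d (x i) (y i)) {..<n} + L2_set (\<lambda>i. mdist d (y i) (z i)) {..<n}"
      by (rule L2_set_triangle_ineq)
    finally show "sqrt (\<Sum>i<n. (mdist d (x i) (z i))\<^sup>2)
        \<le> sqrt (\<Sum>i<n. (mdist d (x i) (y i))\<^sup>2) + sqrt (\<Sum>i<n. (mdist d (y i) (z i))\<^sup>2)"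
      by (simp add: L2_set_def)
  qed
qed

lemma mspace_power_metric: "mspace (power_metric n d) = PiE {..<n} (\<lambda>_. mspace d)"
  and mdist_power_metric: "mdist (power_metric n d) = (\<lambda>x y. sqrt (\<Sum>i<n. (mdist d (x i) (y i))\<^sup>2))"
  using Metric_space_power[of n d]
  by (simp_all add: power_metric_def Metric_space.mspace_metric Metric_space.mdist_metric)

definition power_pm :: "nat \<Rightarrow> 'a metric_measure \<Rightarrow> (nat \<Rightarrow> 'a) metric_measure" where
  "power_pm n X = (power_metric n (fst X), PiM {..<n} (\<lambda>_. snd X))"

definition infinite_power :: "'a metric_measure \<Rightarrow> pm_class set" where
  "infinite_power X = box_closure (\<Union>n\<in>{1..}. pyramid_of (power_pm n X))"

section \<open>Gaussian and interval pyramids, observable variance\<close>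

definition gaussian_line :: "real \<Rightarrow> real metric_measure" where
  "gaussian_line \<sigma> = (euclidean_metric, density lborel (\<lambda>x. ennreal (normal_density 0 \<sigma> x)))"

text \<open>The argument of \<open>gaussian_pyramid\<close> is the variance, not the standard deviation.\<close>

definition gaussian_pyramid :: "ennreal \<Rightarrow> pm_class set" where
  "gaussian_pyramid v =
     (if v = 0 then {abs_pm_class one_point}
      else if v = \<infinity> then UNIV
      else infinite_power (gaussian_line (sqrt (enn2real v))))"

definition interval_pm :: "real \<Rightarrow> real metric_measure" where
  "interval_pm r = (submetric euclidean_metric {0..r},
     scale_measure (ennreal (1 / r)) (restrict_space lborel {0..r}))"

definition interval_pyramid :: "real \<Rightarrow> pm_class set" where
  "interval_pyramid r = infinite_power (interval_pm r)"

definition obs_variance :: "'a metric_measure \<Rightarrow> ennreal" where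
  "obs_variance X = (SUP f\<in>{f :: 'a \<Rightarrow> real. one_lipschitz (fst X) euclidean_metric f}.
     1 / 2 * (\<integral>\<^sup>+ p. ennreal ((f (fst p) - f (snd p))\<^sup>2) \<partial>(snd X \<Otimes>\<^sub>M snd X)))"

definition pyramid_variance :: "pm_class set \<Rightarrow> ennreal" where
  "pyramid_variance P = (SUP X\<in>P. obs_variance (rep_pm_class X))"

definition ennreal_sqrt :: "ennreal \<Rightarrow> ennreal" where
  "ennreal_sqrt v = (if v = \<infinity> then \<infinity> else ennreal (sqrt (enn2real v)))"

end

theory Submission
  imports Defs
begin

text \<open>The functional sends a pyramid to the least \<open>\<sigma>\<close> for which it lies below the Gaussian pyramid
  \<open>G \<sigma>\<close> of standard deviation \<open>\<sigma>\<close>. Monotonicity is immediate, homogeneity comes from scaling, and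
  semicontinuity from the box-closedness of each \<open>G \<sigma>\<close>. The distribution function pushes a Gaussian
  of standard deviation \<open>r / sqrt (2 * pi)\<close> onto the uniform law of \<open>{0..r}\<close> with Lipschitz constant 1,
  so the cube lies below that Gaussian pyramid. No smaller one contains even the interval: by the
  Gaussian Cheeger inequality at the median, a 1-Lipschitz image of a Gaussian measure cannot be
  close to a uniform law of larger width.

  If \<open>P\<close> is idempotent, then normalised sums of a 1-Lipschitz function of variance \<open>v\<close> stay in \<open>P\<close>; by
  the central limit theorem the Gaussian of variance \<open>v\<close> belongs to \<open>P\<close>, and hence
  \<open>G (sqrt (V P))\<close> is contained in \<open>P\<close>. The equality assumption gives the reverse inclusion. When the
  variance is infinite, every space is a box limit of 1-Lipschitz images of wide Gaussians on the
  line.\<close>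

section \<open>Parameters\<close>

text \<open>One obstruction, for intervals, settles both prescribed values: the interval of length
  \<open>\<sigma> * sqrt (2 * pi)\<close> is the longest one below \<open>G \<sigma>\<close>, so
  intervals also tell the Gaussian pyramids apart. The bound is needed only at the median, where a
  rotation argument gives the sharp constant. Two independent Gaussian vectors x and y are joined by
  a quarter circle of Gaussian vectors, so the mean of |g(x) - g(y)| is at most pi/2 times the mean
  of the linear form (grad g(x), y), whose absolute value has mean \<sigma> sqrt(2/pi) |grad g(x)|.
  The product \<sigma> sqrt(pi/2) is attained by half-spaces through the origin. A 1-Lipschitz map
  into an abstract space has no gradient; semiconcave regularisation replaces it by one-sided linear
  bounds. In the rigidity part, finite positive variance gives the lower inclusion for every
  idempotent pyramid, and the equality only caps \<open>P\<close> from above. Classes are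
  represented on the reals, whereas powers and products live on other types. Bit codes of points
  move spaces between carriers, and also produce a parameter of every space.\<close>

abbreviation unit_leb :: "real measure" where
  "unit_leb \<equiv> restrict_space lborel {0..1}"

lemma space_unit_leb [simp]: "space unit_leb = {0..1}"
  by (simp add: space_restrict_space)

lemma prob_space_unit_leb: "prob_space unit_leb"
  by (rule prob_spaceI) (simp add: emeasure_restrict_space space_restrict_space)

text \<open>Two maps are often compared on an auxiliary probability space. If that space is itself
  an image of the unit interval, composing with this image turns every measure-preserving map out of
  it into a parameter; \<open>box_okI\<close> exploits this.\<close>

definition lebesgue_image :: "'a measure \<Rightarrow> bool" where
  "lebesgue_image M \<longleftrightarrow> (\<exists>w\<in>measurable unit_leb M. distr unit_leb M w = M)"

lemma lebesgue_image_distr: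
  assumes "lebesgue_image M" "h \<in> measurable M N" "distr M N h = N"
  shows "lebesgue_image N"
proof -
  obtain w where w: "w \<in> measurable unit_leb M" "distr unit_leb M w = M"
    using assms(1) unfolding lebesgue_image_def by blast
  have "distr unit_leb N (h \<circ> w) = N"
    using distr_distr[OF assms(2) w(1)] w(2) assms(3) by simp
  then show ?thesis
    unfolding lebesgue_image_def using measurable_comp[OF w(1) assms(2)] by blast
qed

text \<open>The quantile function \<open>I\<close> represents the law on the open unit interval. The
  two end points are Lebesgue null, so the value 0 given there does no harm.\<close>

lemma real_distribution_quantile:
  assumes "real_distribution M"
  shows "\<exists>q\<in>borel_measurable unit_leb. distr unit_leb borel q = M"
proof -
  interpret cdf_distribution M
    unfolding cdf_distribution_def by fact
  let ?V = "restrict_space lborel {0<..<1::real}"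
  define q where "q s = (if s \<in> {0<..<1} then I s else 0)" for s
  have I: "I \<in> borel_measurable ?V"
    using measurable_CI by (simp cong: measurable_cong_sets add: sets_restrict_space)
  have q0: "q \<in> borel_measurable lborel"
    unfolding q_def
    using I by (intro measurable_If_restrict_space_iff[THEN iffD2]) (auto simp: greaterThanLessThan_def greaterThan_def lessThan_def Int_def)
  then have q: "q \<in> borel_measurable unit_leb"
    by (simp add: measurable_restrict_space1)
  have "distr unit_leb borel q = distr ?V borel I"
  proof (rule measure_eqI)
    fix A :: "real set" assume "A \<in> sets (distr unit_leb borel q)"
    then have A: "A \<in> sets borel" by simp
    have 1: "q -` A \<in> sets lborel"
      using measurable_sets[OF q0, of A] A by simp
    have "emeasure (distr unit_leb borel q) A = emeasure lborel (q -` A \<inter> {0..1})"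
      using A q 1 by (simp add: emeasure_distr emeasure_restrict_space)
    also have "\<dots> = emeasure lborel (q -` A \<inter> {0<..<1})"
    proof (rule emeasure_eq_AE)
      show "AE s in lborel. s \<in> q -` A \<inter> {0..1} \<longleftrightarrow> s \<in> q -` A \<inter> {0<..<1}"
        using AE_lborel_singleton[of 0] AE_lborel_singleton[of 1]
        by eventually_elim auto
    qed (use 1 in auto)
    also have "q -` A \<inter> {0<..<1} = I -` A \<inter> {0<..<1}"
      by (auto simp: q_def)
    also have "emeasure lborel \<dots> = emeasure (distr ?V borel I) A"
      using A I measurable_sets[OF I, of A]
      by (simp add: emeasure_distr emeasure_restrict_space space_restrict_space sets_restrict_space_iff)
    finally show "emeasure (distr unit_leb borel q) A = emeasure (distr ?V borel I) A" .
  qed simp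
  then show ?thesis
    using distr_I_eq_M q by auto
qed

section \<open>Dense sequences and Borel sets of separable metrics\<close>

lemma mdist_self [simp]: "x \<in> mspace d \<Longrightarrow> mdist d x x = 0"
  by simp

lemma openin_mtopology_of:
  "openin (mtopology_of d) U \<longleftrightarrow> U \<subseteq> mspace d \<and> (\<forall>x\<in>U. \<exists>r>0. mball_of d x r \<subseteq> U)"
  unfolding mtopology_of_def mball_of_def
  by (auto simp: Metric_space.openin_mtopology[OF Metric_space_mspace_mdist])

lemma openin_mball_of: "openin (mtopology_of d) (mball_of d x r)"
  unfolding mtopology_of_def mball_of_def
  by (simp add: Metric_space.openin_mball[OF Metric_space_mspace_mdist])

definition dense_seq :: "'a metric \<Rightarrow> (nat \<Rightarrow> 'a) \<Rightarrow> bool" where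
  "dense_seq d x \<longleftrightarrow> range x \<subseteq> mspace d \<and> (\<forall>y\<in>mspace d. \<forall>e>0. \<exists>k. mdist d (x k) y < e)"

lemma dense_seq_exists:
  assumes "separable_space (mtopology_of d)" "mspace d \<noteq> {}"
  shows "\<exists>x. dense_seq d x"
proof -
  obtain C where C: "countable C" "C \<subseteq> mspace d" "mtopology_of d closure_of C = mspace d"
    using assms(1) unfolding separable_space_def by auto
  have "C \<noteq> {}" using C assms(2) by auto
  moreover have "\<exists>z\<in>C. mdist d z y < e" if "y \<in> mspace d" "e > 0" for y e
  proof -
    have "y \<in> mtopology_of d closure_of C" using C that by simp
    moreover have "y \<in> mball_of d y e" using that by simp
    ultimately have "\<exists>z. z \<in> C \<and> z \<in> mball_of d y e"
      using openin_mball_of[of d y e] unfolding in_closure_of by blast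
    then show ?thesis by (auto simp: mdist_commute)
  qed
  moreover have "range (from_nat_into C) = C"
    using C(1) \<open>C \<noteq> {}\<close> by (rule range_from_nat_into[rotated])
  ultimately have "dense_seq d (from_nat_into C)"
    unfolding dense_seq_def using C(2) by (metis rangeE)
  then show ?thesis by blast
qed

lemma dense_seq_separable:
  assumes "dense_seq d x"
  shows "separable_space (mtopology_of d)"
proof -
  have "mtopology_of d closure_of range x = mspace d"
  proof (rule antisym)
    show "mspace d \<subseteq> mtopology_of d closure_of range x"
    proof
      fix y assume y: "y \<in> mspace d"
      show "y \<in> mtopology_of d closure_of range x"
        unfolding in_closure_of
      proof (intro conjI allI impI)
        show "y \<in> topspace (mtopology_of d)" using y by simp
        fix T assume "y \<in> T \<and> openin (mtopology_of d) T"
        then obtain r where "r > 0" "mball_of d y r \<subseteq> T"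
          unfolding openin_mtopology_of by auto
        moreover obtain k where "mdist d (x k) y < r"
          using assms y \<open>r > 0\<close> unfolding dense_seq_def by blast
        moreover have "x k \<in> mspace d" using assms unfolding dense_seq_def by auto
        ultimately have "x k \<in> T" using y by (auto simp: subset_iff mdist_commute)
        then show "\<exists>z. z \<in> range x \<and> z \<in> T" by blast
      qed
    qed
  qed (use closure_of_subset_topspace in force)
  then show ?thesis
    using assms unfolding separable_space_def dense_seq_def
    by (intro exI[of _ "range x"]) auto
qed

lemma pm_space_nonempty: "pm_space X \<Longrightarrow> mspace (fst X) \<noteq> {}"
  using prob_space.not_empty unfolding pm_space_def by metis

lemma pm_space_dense_seq: "pm_space X \<Longrightarrow> \<exists>x. dense_seq (fst X) x"
  using dense_seq_exists pm_space_nonempty unfolding pm_space_def by blast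

lemma pm_space_openin_sets:
  "pm_space X \<Longrightarrow> openin (mtopology_of (fst X)) U \<Longrightarrow> U \<in> sets (snd X)"
proof -
  have "{U. openin (mtopology_of (fst X)) U} \<subseteq> Pow (mspace (fst X))"
    using openin_subset by force
  then show "pm_space X \<Longrightarrow> openin (mtopology_of (fst X)) U \<Longrightarrow> U \<in> sets (snd X)"
    by (auto simp: pm_space_def borel_sigma_def)
qed

lemma space_borel_sigma: "space (borel_sigma d) = mspace d"
  unfolding borel_sigma_def by (simp add: space_measure_of_conv)

lemma measurable_borel_sigmaI:
  assumes "f \<in> space M \<rightarrow> mspace d"
    and "\<And>U. openin (mtopology_of d) U \<Longrightarrow> f -` U \<inter> space M \<in> sets M"
    and "sets N = sets (borel_sigma d)"
  shows "f \<in> measurable M N"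
proof -
  have "f \<in> measurable M (borel_sigma d)"
    unfolding borel_sigma_def
    by (rule measurable_measure_of) (use assms openin_subset in force)+
  then show ?thesis using assms(3) by (simp cong: measurable_cong_sets)
qed

text \<open>Open sets are stable under intersection and generate the Borel sets, so they determine a
  probability measure.\<close>

lemma pm_space_eqI:
  assumes X: "pm_space X" and N: "prob_space N" "sets N = sets (snd X)"
    and eq: "\<And>U. openin (mtopology_of (fst X)) U \<Longrightarrow> emeasure N U = emeasure (snd X) U"
  shows "N = snd X"
proof (rule measure_eqI_generator_eq)
  let ?E = "{U. openin (mtopology_of (fst X)) U}"
  show "Int_stable ?E" by (auto simp: Int_stable_def)
  show "?E \<subseteq> Pow (mspace (fst X))" using openin_subset by force
  then have s: "sets (snd X) = sigma_sets (mspace (fst X)) ?E"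
    using X unfolding pm_space_def borel_sigma_def by simp
  then show "sets (snd X) = sigma_sets (mspace (fst X)) ?E" "sets N = sigma_sets (mspace (fst X)) ?E"
    using N by simp_all
  show "range (\<lambda>i::nat. mspace (fst X)) \<subseteq> ?E"
    using openin_topspace[of "mtopology_of (fst X)"] by auto
  interpret N: prob_space N by fact
  have "space N = mspace (fst X)"
    using X sets_eq_imp_space_eq[OF N(2)] by (simp add: pm_space_def)
  then show "\<And>i. emeasure N (mspace (fst X)) \<noteq> \<infinity>"
    using N.emeasure_space_1 by auto
qed (use eq in auto)

text \<open>By separability an open set is a countable union of balls with centres in the dense
  sequence and radii 1/(n+1). This is how the Borel sets are compared with trace and product
  sigma-algebras.\<close>

lemma sets_borel_sigma_subset:
  assumes "dense_seq d x" "space N = mspace d"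
    and b: "\<And>k r. mball_of d (x k) r \<in> sets N"
  shows "sets (borel_sigma d) \<subseteq> sets N"
proof -
  have "U \<in> sets N" if U: "openin (mtopology_of d) U" for U
  proof -
    let ?J = "{(k, n::nat). mball_of d (x k) (1 / (real n + 1)) \<subseteq> U}"
    have "U = (\<Union>(k,n)\<in>?J. mball_of d (x k) (1 / (real n + 1)))"
    proof (rule antisym)
      show "U \<subseteq> (\<Union>(k,n)\<in>?J. mball_of d (x k) (1 / (real n + 1)))"
      proof
        fix y assume y: "y \<in> U"
        then obtain r where r: "r > 0" "mball_of d y r \<subseteq> U" using U unfolding openin_mtopology_of by auto
        have ym: "y \<in> mspace d" using y U unfolding openin_mtopology_of by auto
        obtain n :: nat where n: "1 / (real n + 1) < r / 2"
          using r(1) by (metis half_gt_zero nat_approx_posE of_nat_Suc add.commute)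
        obtain k where k: "mdist d (x k) y < 1 / (n+1)"
          using assms(1) ym unfolding dense_seq_def
          by (metis add_is_0 neq0_conv of_nat_0_less_iff one_neq_zero zero_less_divide_1_iff)
        have xk: "x k \<in> mspace d" using assms(1) unfolding dense_seq_def by auto
        have "mball_of d (x k) (1 / (real n + 1)) \<subseteq> mball_of d y r"
        proof
          fix z assume z: "z \<in> mball_of d (x k) (1 / (real n + 1))"
          then have "mdist d y z \<le> mdist d y (x k) + mdist d (x k) z"
            using ym xk by (intro mdist_triangle) auto
          also have "\<dots> < 1 / (real n + 1) + 1 / (real n + 1)" using k z by (simp add: mdist_commute add.commute)
          also have "\<dots> < r" using n by simp
          finally show "z \<in> mball_of d y r" using z ym by simp
        qed
        then show "y \<in> (\<Union>(k,n)\<in>?J. mball_of d (x k) (1 / (real n + 1)))"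
          using k xk ym r(2) by (intro UN_I[of "(k,n)"]) (auto simp: add.commute)
      qed
    qed auto
    also have "\<dots> \<in> sets N" using b by (intro sets.countable_UN'') auto
    finally show ?thesis .
  qed
  then have "sigma_sets (space N) {U. openin (mtopology_of d) U} \<subseteq> sets N"
    by (intro sets.sigma_sets_subset) auto
  moreover have "{U. openin (mtopology_of d) U} \<subseteq> Pow (mspace d)"
    using openin_subset by force
  ultimately show ?thesis
    unfolding borel_sigma_def using assms(2)
    by (simp add: sets_measure_of)
qed

lemma sets_borel_sigma_euclidean: "sets (borel_sigma euclidean_metric) = sets borel"
  unfolding borel_sigma_def borel_def by simp

lemma pm_space_euclidean:
  fixes M :: "'a::polish_space measure"
  assumes "prob_space M" "sets M = sets borel"
  shows "pm_space (euclidean_metric, M)"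
proof -
  have "mcomplete_of (euclidean_metric :: 'a metric)"
    unfolding mcomplete_of_def by (simp add: mcomplete_iff_complete complete_UNIV)
  moreover have "separable_space (euclidean :: 'a topology)"
  proof -
    obtain D :: "'a set" where D: "countable D" "\<And>X. open X \<Longrightarrow> X \<noteq> {} \<Longrightarrow> \<exists>d\<in>D. d \<in> X"
      using countable_dense_setE by blast
    have "closure D = UNIV"
      using D(2) by (auto simp: closure_iff_nhds_not_empty) (metis Int_iff empty_iff in_mono)
    then show ?thesis unfolding separable_space_def using D(1) by auto
  qed
  moreover have "space M = UNIV" using sets_eq_imp_space_eq[OF assms(2)] by simp
  ultimately show ?thesis
    using assms by (simp add: pm_space_def sets_borel_sigma_euclidean)
qed

lemma one_lipschitz_borel_measurable:
  fixes f :: "'a \<Rightarrow> 'b::polish_space"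
  assumes "pm_space X" "one_lipschitz (fst X) euclidean_metric f"
  shows "f \<in> borel_measurable (snd X)"
proof -
  \<comment> \<open>The target has no measure of its own; a point mass makes it a pm-space, so that
    \<open>one_lipschitz_measurable\<close> applies.\<close>
  let ?Y = "(euclidean_metric, return borel (undefined::'b))"
  have "pm_space ?Y" by (intro pm_space_euclidean prob_space_return) auto
  then have "f \<in> measurable (snd X) (snd ?Y)"
    using assms one_lipschitz_measurable[of X ?Y f] by simp
  then show ?thesis by (simp cong: measurable_cong_sets)
qed

lemma one_lipschitz_mdist: "x \<in> mspace d \<Longrightarrow> one_lipschitz d euclidean_metric (mdist d x)"
  unfolding one_lipschitz_def
proof (intro conjI ballI)
  fix y z assume "x \<in> mspace d" "y \<in> mspace d" "z \<in> mspace d"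
  then show "mdist euclidean_metric (mdist d x y) (mdist d x z) \<le> mdist d y z"
    using mdist_triangle[of x d y z] mdist_triangle[of x d z y]
    by (simp add: dist_real_def mdist_commute abs_le_iff)
qed simp

lemma mdist_borel_measurable:
  "pm_space X \<Longrightarrow> x \<in> mspace (fst X) \<Longrightarrow> mdist (fst X) x \<in> borel_measurable (snd X)"
  by (intro one_lipschitz_borel_measurable one_lipschitz_mdist)

subsection \<open>Coding points by bits\<close>

text \<open>Only the ternary digits 0 and 2 occur. Unlike binary expansions, such expansions are
  unambiguous, and the gap between 1/3 and 2/3 lets a Borel function read the digits.\<close>

definition cantor_code :: "(nat \<Rightarrow> bool) \<Rightarrow> real" where
  "cantor_code \<beta> = (\<Sum>j. (if \<beta> j then 2 else 0) / 3 ^ Suc j)"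

text \<open>Removes the leading digit of a point of the Cantor set: that digit is 2 exactly when the
  point is at least 2/3.\<close>

definition cantor_shift :: "real \<Rightarrow> real" where
  "cantor_shift r = 3 * r - (if r \<ge> 2/3 then 2 else 0)"

definition cantor_bit :: "nat \<Rightarrow> real \<Rightarrow> bool" where
  "cantor_bit j r \<longleftrightarrow> (cantor_shift ^^ j) r \<ge> 2/3"

lemma summable_cantor: "summable (\<lambda>j. (if \<beta> j then 2 else 0) / 3 ^ Suc j :: real)"
  and sums_cantor_const: "(\<lambda>j. 2 / 3 ^ Suc j :: real) sums 1"
proof -
  have "(\<lambda>n. (2/3) * (1/3::real)^n) sums ((2/3) * (1 / (1 - 1/3)))"
    by (intro sums_mult geometric_sums) auto
  then show s: "(\<lambda>j. 2 / 3 ^ Suc j :: real) sums 1"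
    by (simp add: power_one_over field_simps)
  show "summable (\<lambda>j. (if \<beta> j then 2 else 0) / 3 ^ Suc j :: real)"
    by (rule summable_comparison_test[OF _ sums_summable[OF s]]) (auto intro!: exI[of _ 0])
qed

lemma cantor_code_bounds: "0 \<le> cantor_code \<beta>" "cantor_code \<beta> \<le> 1"
proof -
  show "0 \<le> cantor_code \<beta>"
    unfolding cantor_code_def by (intro suminf_nonneg summable_cantor) auto
  have "cantor_code \<beta> \<le> (\<Sum>j. 2 / 3 ^ Suc j)"
    unfolding cantor_code_def
    by (intro suminf_le summable_cantor sums_summable[OF sums_cantor_const]) auto
  then show "cantor_code \<beta> \<le> 1" using sums_unique[OF sums_cantor_const] by simp
qed

lemma cantor_code_step:
  "3 * cantor_code \<beta> = (if \<beta> 0 then 2 else 0) + cantor_code (\<lambda>j. \<beta> (Suc j))"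
proof -
  have "cantor_code \<beta> = (\<Sum>j. (if \<beta> (Suc j) then 2 else 0) / 3 ^ Suc (Suc j)) + (if \<beta> 0 then 2 else 0) / 3 ^ Suc 0"
    unfolding cantor_code_def using suminf_split_head[OF summable_cantor[of \<beta>]] by simp
  moreover have "(\<Sum>j. (if \<beta> (Suc j) then 2 else 0) / 3 ^ Suc (Suc j)) = cantor_code (\<lambda>j. \<beta> (Suc j)) / 3"
    unfolding cantor_code_def
    by (subst suminf_divide[symmetric]) (use summable_cantor[of "\<lambda>j. \<beta> (Suc j)"] in \<open>auto simp: mult.commute\<close>)
  ultimately show ?thesis by simp
qed

text \<open>The tail contributes at most 1/3, so the leading digit alone decides on which side of
  the middle gap the code lies.\<close>

lemma cantor_code_ge: "cantor_code \<beta> \<ge> 2/3 \<longleftrightarrow> \<beta> 0"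
  using cantor_code_step[of \<beta>] cantor_code_bounds[of "\<lambda>j. \<beta> (Suc j)"] by (auto split: if_splits)

lemma cantor_shift_code: "cantor_shift (cantor_code \<beta>) = cantor_code (\<lambda>j. \<beta> (Suc j))"
  using cantor_code_step[of \<beta>] cantor_code_ge[of \<beta>] by (auto simp: cantor_shift_def)

lemma cantor_bit_code: "cantor_bit j (cantor_code \<beta>) \<longleftrightarrow> \<beta> j"
proof -
  have "(cantor_shift ^^ j) (cantor_code \<beta>) = cantor_code (\<lambda>i. \<beta> (i + j))"
    by (induction j) (simp_all add: cantor_shift_code)
  then show ?thesis using cantor_code_ge[of "\<lambda>i. \<beta> (i + j)"] by (simp only: cantor_bit_def) simp
qed

lemma cantor_bit_measurable [measurable]: "Measurable.pred borel (cantor_bit j)"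
proof -
  have [measurable]: "cantor_shift \<in> borel_measurable borel"
    unfolding cantor_shift_def by measurable
  have [measurable]: "(\<lambda>r. (cantor_shift ^^ j) r) \<in> borel_measurable borel"
    by (induction j) auto
  show ?thesis unfolding cantor_bit_def by measurable
qed

lemma cantor_code_measurable:
  assumes [measurable]: "\<And>j. Measurable.pred M (\<lambda>x. \<beta> x j)"
  shows "(\<lambda>x. cantor_code (\<beta> x)) \<in> borel_measurable M"
  unfolding cantor_code_def by measurable

definition point_bits :: "'a metric \<Rightarrow> (nat \<Rightarrow> 'a) \<Rightarrow> 'a \<Rightarrow> nat \<Rightarrow> bool" where
  "point_bits d x y i \<longleftrightarrow> mdist d (x (fst (prod_decode i))) y < 1 / (real (snd (prod_decode i)) + 1)"

lemma point_bits_encode [simp]: "point_bits d x y (prod_encode (k, n)) \<longleftrightarrow> mdist d (x k) y < 1 / (real n + 1)"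
  by (simp add: point_bits_def)

text \<open>Points with the same bits share a ball of radius 1/(n+1) for every n, hence are closer
  than 2/(n+1).\<close>

lemma inj_on_cantor_code_point_bits:
  assumes x: "dense_seq d x"
  shows "inj_on (\<lambda>y. cantor_code (point_bits d x y)) (mspace d)"
proof (rule inj_onI, rule ccontr)
  fix y z assume yz: "y \<in> mspace d" "z \<in> mspace d" "y \<noteq> z"
    "cantor_code (point_bits d x y) = cantor_code (point_bits d x z)"
  then have b: "point_bits d x y i = point_bits d x z i" for i
    using cantor_bit_code by metis
  have "mdist d y z > 0" using yz mdist_zero[of y d z] mdist_nonneg[of d y z] by linarith
  then obtain n :: nat where n: "1 / (real n + 1) < mdist d y z / 2"
    by (metis half_gt_zero nat_approx_posE of_nat_Suc add.commute)
  have "1 / (real n + 1) > 0" by simp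
  then obtain k where k: "mdist d (x k) y < 1 / (real n + 1)"
    using x yz(1) unfolding dense_seq_def by blast
  with b[of "prod_encode (k,n)"] have "mdist d (x k) z < 1 / (real n + 1)" by simp
  moreover have "x k \<in> mspace d" using x by (auto simp: dense_seq_def)
  then have "mdist d y z \<le> mdist d y (x k) + mdist d (x k) z"
    using mdist_triangle[OF yz(1) _ yz(2)] by blast
  ultimately have "mdist d y z < 1 / (real n + 1) + 1 / (real n + 1)"
    using k by (simp add: mdist_commute add.commute)
  then show False using n by linarith
qed

text \<open>Coding by bits turns \<open>m_X\<close> into a law on the line, and a quantile function
  parametrises that law. Decoding uses completeness: a consistent bit sequence determines a Cauchy
  sequence of points. It remains to see that almost every code met by the quantile function is
  consistent and that decoding restores the measure.\<close>

lemma parameter_exists: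
  assumes X: "pm_space X"
  shows "\<exists>a. parameter X a"
proof -
  define d where "d = fst X"
  define M where "M = snd X"
  interpret M: prob_space M using X unfolding pm_space_def M_def by simp
  have spM: "space M = mspace d" using X unfolding pm_space_def M_def d_def by simp
  obtain x where x: "dense_seq d x" using pm_space_dense_seq[OF X] d_def by blast
  have xm: "x k \<in> mspace d" for k using x unfolding dense_seq_def by auto
  let ?\<beta> = "point_bits d x"
  have dm [measurable]: "mdist d (x k) \<in> borel_measurable M" for k
    using mdist_borel_measurable[OF X, of "x k"] xm unfolding d_def M_def by simp
  have [measurable]: "Measurable.pred M (\<lambda>y. ?\<beta> y i)" for i
    unfolding point_bits_def by measurable
  define f where "f y = cantor_code (?\<beta> y)" for y
  have f [measurable]: "f \<in> borel_measurable M"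
    unfolding f_def by (rule cantor_code_measurable) measurable
  have fb: "cantor_bit i (f y) \<longleftrightarrow> ?\<beta> y i" for i y
    unfolding f_def by (rule cantor_bit_code)
  interpret D: real_distribution "distr M borel f" by (rule M.real_distribution_distr) measurable
  obtain q where q [measurable]: "q \<in> borel_measurable unit_leb" and dq: "distr unit_leb borel q = distr M borel f"
    using real_distribution_quantile[OF D.real_distribution_axioms] by blast
  interpret U: prob_space unit_leb by (rule prob_space_unit_leb)
  \<comment> \<open>The first condition provides points realising longer and longer initial pieces
    of the code. The second puts one ball of each radius into the code, which forces those points to
    be Cauchy.\<close>
  define good where "good r \<longleftrightarrow> (\<forall>j. \<exists>y\<in>mspace d. \<forall>i\<le>j. ?\<beta> y i = cantor_bit i r) \<and>
    (\<forall>n. \<exists>k. cantor_bit (prod_encode (k,n)) r)" for r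
  have pm: "Measurable.pred borel (\<lambda>r. \<exists>y\<in>mspace d. \<forall>i\<le>j. ?\<beta> y i = cantor_bit i r)" for j
  proof -
    \<comment> \<open>The quantifier over the possibly uncountable carrier is replaced by one over
      the finitely many patterns of the first \<open>j\<close> bits, which makes the condition
      Borel.\<close>
    have *: "(\<exists>y\<in>mspace d. \<forall>i\<le>j. ?\<beta> y i = cantor_bit i r) \<longleftrightarrow>
        (\<exists>A\<in>{A \<in> Pow {..j}. \<exists>y\<in>mspace d. \<forall>i\<le>j. ?\<beta> y i = (i \<in> A)}. \<forall>i\<in>{..j}. (i \<in> A) = cantor_bit i r)"
      (is "?L = ?R") for r
    proof
      assume ?L
      then obtain y where y: "y \<in> mspace d" "\<forall>i\<le>j. ?\<beta> y i = cantor_bit i r" by blast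
      then show ?R by (intro bexI[of _ "{i. i \<le> j \<and> cantor_bit i r}"]) (auto intro!: bexI[of _ y])
    next
      assume ?R then show ?L by fastforce
    qed
    show ?thesis unfolding * by (intro pred_intros_finite pred_intros_logic) auto
  qed
  have [measurable]: "Measurable.pred borel good"
    unfolding good_def using pm by measurable
  have gf: "good (f y)" if "y \<in> mspace d" for y
  proof -
    have "\<exists>k. mdist d (x k) y < 1 / (real n + 1)" for n :: nat
      using x that unfolding dense_seq_def by (simp add: add_nonneg_pos)
    then show ?thesis unfolding good_def fb using that by auto
  qed
  have AEg: "AE s in unit_leb. good (q s)"
  proof -
    have "AE r in distr M borel f. good r"
      by (subst AE_distr_iff) (use gf spM in \<open>auto simp flip: pred_def\<close>)
    then show ?thesis unfolding dq[symmetric] by (subst (asm) AE_distr_iff) (auto simp flip: pred_def)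
  qed
  \<comment> \<open>Once bit \<open>(k, n)\<close> is reached, all later approximating points lie in
    the ball of radius 1/(n+1) about \<open>x k\<close>. Their limit satisfies only the non-strict
    inequality.\<close>
  have ex: "\<exists>y\<in>mspace d. \<forall>k n. cantor_bit (prod_encode (k,n)) r \<longrightarrow> mdist d (x k) y \<le> 1 / (real n+1)"
    if g: "good r" for r
  proof -
    interpret Metric_space "mspace d" "mdist d" by simp
    obtain a where a: "\<And>j. a j \<in> mspace d" "\<And>i j. i \<le> j \<Longrightarrow> ?\<beta> (a j) i = cantor_bit i r"
      using g unfolding good_def by metis
    have near: "mdist d (x k) (a j) < 1 / (real n + 1)" if "cantor_bit (prod_encode (k,n)) r" "prod_encode (k,n) \<le> j" for k n j
      using a(2)[OF that(2)] that(1) by simp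
    have "MCauchy a"
      unfolding MCauchy_def
    proof (intro conjI allI impI)
      show "range a \<subseteq> mspace d" using a by auto
      fix \<epsilon> :: real assume "\<epsilon> > 0"
      then obtain n :: nat where n: "1 / (real n + 1) < \<epsilon> / 2"
        by (metis half_gt_zero nat_approx_posE of_nat_Suc add.commute)
      obtain k where k: "cantor_bit (prod_encode (k,n)) r" using g unfolding good_def by blast
      have "mdist d (a i) (a j) < \<epsilon>" if "prod_encode (k,n) \<le> i" "prod_encode (k,n) \<le> j" for i j
        using triangle[of "a i" "x k" "a j"] near[OF k that(1)] near[OF k that(2)] n a(1) xm commute[of "a i" "x k"]
        by force
      then show "\<exists>N. \<forall>i j. N \<le> i \<longrightarrow> N \<le> j \<longrightarrow> mdist d (a i) (a j) < \<epsilon>" by blast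
    qed
    then obtain l where l: "limitin mtopology a l sequentially"
      using X unfolding pm_space_def mcomplete_of_def mcomplete_def d_def[symmetric] by blast
    then have lm: "l \<in> mspace d" by (rule limitin_mspace)
    have "mdist d (x k) l \<le> 1 / (real n + 1)" if "cantor_bit (prod_encode (k,n)) r" for k n
    proof (rule field_le_epsilon)
      fix e :: real assume "e > 0"
      then obtain N where "\<forall>j\<ge>N. mdist d (a j) l < e"
        using l unfolding limit_metric_sequentially by blast
      then have "mdist d (a (max N (prod_encode (k,n)))) l < e" by simp
      moreover have "mdist d (x k) (a (max N (prod_encode (k,n)))) < 1 / (real n + 1)"
        using near[OF that] by simp
      ultimately show "mdist d (x k) l \<le> 1 / (real n + 1) + e"
        using triangle[of "x k" "a (max N (prod_encode (k,n)))" l] a(1) xm lm by force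
    qed
    then show ?thesis using lm by blast
  qed
  define b where "b r = (if good r then (SOME y. y \<in> mspace d \<and>
      (\<forall>k n. cantor_bit (prod_encode (k,n)) r \<longrightarrow> mdist d (x k) y \<le> 1 / (real n+1))) else x 0)" for r
  have b: "b r \<in> mspace d" "\<And>k n. good r \<Longrightarrow> cantor_bit (prod_encode (k,n)) r \<Longrightarrow> mdist d (x k) (b r) \<le> 1 / (real n+1)" for r
    using someI_ex[OF ex[of r, unfolded Bex_def]] xm unfolding b_def by auto
  \<comment> \<open>The doubled radius absorbs the non-strict inequality satisfied by decoded
    points. The same bits then decide membership in \<open>W\<close> both for \<open>b r\<close> and
    for a point \<open>y\<close> with code \<open>f y\<close>, so the two laws agree on open
    sets.\<close>
  define J where "J W = {(k, n::nat). mball_of d (x k) (2 / (real n + 1)) \<subseteq> W}" for W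
  have bU: "b r \<in> W \<longleftrightarrow> (\<exists>(k,n)\<in>J W. cantor_bit (prod_encode (k,n)) r)"
    if W: "openin (mtopology_of d) W" and g: "good r" for W r
  proof
    assume "b r \<in> W"
    then obtain \<rho> where \<rho>: "\<rho> > 0" "mball_of d (b r) \<rho> \<subseteq> W" using W unfolding openin_mtopology_of by auto
    then obtain n :: nat where n: "1 / (real n + 1) < \<rho> / 3"
      by (metis divide_pos_pos zero_less_numeral nat_approx_posE of_nat_Suc add.commute)
    obtain k where k: "cantor_bit (prod_encode (k,n)) r" using g unfolding good_def by blast
    have "mball_of d (x k) (2 / (real n + 1)) \<subseteq> mball_of d (b r) \<rho>"
    proof
      fix z assume z: "z \<in> mball_of d (x k) (2 / (real n + 1))"
      then have "mdist d (b r) z \<le> mdist d (x k) (b r) + mdist d (x k) z"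
        using mdist_triangle[of "b r" d "x k" z] b(1) xm by (simp add: mdist_commute)
      also have "\<dots> < 1 / (real n + 1) + 2 / (real n+1)"
        using b(2)[OF g k] z by (simp add: add.commute)
      also have "\<dots> = 3 * (1 / (real n + 1))" by (simp add: field_simps)
      also have "\<dots> < \<rho>" using n by simp
      finally show "z \<in> mball_of d (b r) \<rho>" using z b(1) by simp
    qed
    then show "\<exists>(k,n)\<in>J W. cantor_bit (prod_encode (k,n)) r"
      using k \<rho>(2) unfolding J_def by blast
  next
    assume "\<exists>(k,n)\<in>J W. cantor_bit (prod_encode (k,n)) r"
    then obtain k n where kn: "mball_of d (x k) (2 / (real n + 1)) \<subseteq> W" "cantor_bit (prod_encode (k,n)) r"
      unfolding J_def by auto
    have "mdist d (x k) (b r) \<le> 1 / (real n + 1)" using b(2)[OF g kn(2)] .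
    also have "\<dots> < 2 / (real n + 1)" by (simp add: divide_strict_right_mono)
    finally show "b r \<in> W" using kn(1) xm b(1) by (auto simp: subset_iff add.commute)
  qed
  have yU: "y \<in> W \<longleftrightarrow> (\<exists>(k,n)\<in>J W. cantor_bit (prod_encode (k,n)) (f y))"
    if W: "openin (mtopology_of d) W" and y: "y \<in> mspace d" for W y
  proof
    assume "y \<in> W"
    then obtain \<rho> where \<rho>: "\<rho> > 0" "mball_of d y \<rho> \<subseteq> W" using W unfolding openin_mtopology_of by auto
    then obtain n :: nat where n: "1 / (real n + 1) < \<rho> / 3"
      by (metis divide_pos_pos zero_less_numeral nat_approx_posE of_nat_Suc add.commute)
    have "1 / (real n + 1) > 0" by simp
    then obtain k where k: "mdist d (x k) y < 1 / (real n + 1)"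
      using x y unfolding dense_seq_def by blast
    have "mball_of d (x k) (2 / (real n + 1)) \<subseteq> mball_of d y \<rho>"
    proof
      fix z assume z: "z \<in> mball_of d (x k) (2 / (real n + 1))"
      then have "mdist d y z \<le> mdist d (x k) y + mdist d (x k) z"
        using mdist_triangle[of "y" d "x k" z] y xm by (simp add: mdist_commute)
      also have "\<dots> < 1 / (real n + 1) + 2 / (real n+1)"
        using k z by (simp add: add.commute)
      also have "\<dots> = 3 * (1 / (real n + 1))" by (simp add: field_simps)
      also have "\<dots> < \<rho>" using n by simp
      finally show "z \<in> mball_of d y \<rho>" using z y by simp
    qed
    then have "(k,n) \<in> J W" unfolding J_def using \<rho>(2) by blast
    moreover have "cantor_bit (prod_encode (k,n)) (f y)" using k by (simp add: fb add.commute)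
    ultimately show "\<exists>(k,n)\<in>J W. cantor_bit (prod_encode (k,n)) (f y)" by blast
  next
    assume "\<exists>(k,n)\<in>J W. cantor_bit (prod_encode (k,n)) (f y)"
    then obtain k n where kn: "mball_of d (x k) (2 / (real n + 1)) \<subseteq> W" "mdist d (x k) y < 1 / (real n + 1)"
      unfolding J_def by (auto simp: fb add.commute)
    note kn(2)
    also have "1 / (real n + 1) < 2 / (real n + 1)" by (simp add: divide_strict_right_mono)
    finally show "y \<in> W" using kn(1) xm y by (auto simp: subset_iff add.commute)
  qed
  have hm [measurable]: "Measurable.pred borel (\<lambda>r. \<exists>(k,n)\<in>J W. cantor_bit (prod_encode (k,n)) r)" for W
    by (intro pred_intros_countable_bounded) auto
  let ?a = "\<lambda>s. b (q s)"
  have pre: "?a -` W \<inter> space unit_leb =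
      {s \<in> space unit_leb. if good (q s) then (\<exists>(k,n)\<in>J W. cantor_bit (prod_encode (k,n)) (q s)) else x 0 \<in> W}"
    if "openin (mtopology_of d) W" for W
    using bU[OF that] by (auto simp: b_def)
  have a [measurable]: "?a \<in> measurable unit_leb M"
  proof (rule measurable_borel_sigmaI)
    show "sets M = sets (borel_sigma d)" using X unfolding pm_space_def M_def d_def by simp
    fix W assume W: "openin (mtopology_of d) W"
    show "?a -` W \<inter> space unit_leb \<in> sets unit_leb" unfolding pre[OF W] by measurable
  qed (simp add: b(1))
  have "distr unit_leb M ?a = snd X"
  proof (rule pm_space_eqI[OF X])
    show "prob_space (distr unit_leb M ?a)" by (rule U.prob_space_distr) measurable
    show "sets (distr unit_leb M ?a) = sets (snd X)" by (simp add: M_def)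
    fix W assume "openin (mtopology_of (fst X)) W"
    then have W: "openin (mtopology_of d) W" by (simp add: d_def)
    have WM: "W \<in> sets M" using pm_space_openin_sets[OF X] W unfolding d_def M_def by blast
    let ?S = "{r. \<exists>(k,n)\<in>J W. cantor_bit (prod_encode (k,n)) r}"
    have "emeasure (distr unit_leb M ?a) W = emeasure unit_leb (?a -` W \<inter> space unit_leb)"
      by (rule emeasure_distr[OF a WM])
    also have "\<dots> = emeasure unit_leb (q -` ?S \<inter> space unit_leb)"
    proof (rule emeasure_eq_AE)
      show "AE s in unit_leb. s \<in> ?a -` W \<inter> space unit_leb \<longleftrightarrow> s \<in> q -` ?S \<inter> space unit_leb"
        using AEg by eventually_elim (use bU[OF W] in auto)
    next
      have "?S \<in> sets borel" using hm[of W] by (simp add: pred_def)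
      then show "q -` ?S \<inter> space unit_leb \<in> sets unit_leb" by (rule measurable_sets[OF q])
    qed (use measurable_sets[OF a WM] in simp)
    also have "\<dots> = emeasure (distr unit_leb borel q) ?S" by (subst emeasure_distr) auto
    also have "\<dots> = emeasure M (f -` ?S \<inter> space M)" unfolding dq by (subst emeasure_distr) auto
    also have "f -` ?S \<inter> space M = W"
      using yU[OF W] spM sets.sets_into_space[OF WM] by auto
    finally show "emeasure (distr unit_leb M ?a) W = emeasure (snd X) W" by (simp add: M_def)
  qed
  then show ?thesis using a unfolding parameter_def M_def by blast
qed

lemma pm_space_lebesgue_image: "pm_space X \<Longrightarrow> lebesgue_image (snd X)"
  using parameter_exists unfolding parameter_def lebesgue_image_def by blast

section \<open>Box distance\<close>

text \<open>The witnesses behind one admissible value, handled directly instead of through the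
  infimum. In contrast to \<open>box_dist\<close>, the value 0 is permitted, as isomorphic spaces
  require.\<close>

definition box_ok :: "'a metric_measure \<Rightarrow> 'b metric_measure \<Rightarrow> real \<Rightarrow> bool" where
  "box_ok X Y \<epsilon> \<longleftrightarrow> (\<exists>a b I. parameter X a \<and> parameter Y b \<and>
     I \<in> sets borel \<and> I \<subseteq> {0..1} \<and> measure lborel I \<ge> 1 - \<epsilon> \<and>
     (\<forall>s\<in>I. \<forall>t\<in>I. \<bar>mdist (fst X) (a s) (a t) - mdist (fst Y) (b s) (b t)\<bar> \<le> \<epsilon>))"

lemma box_ok_mono: "box_ok X Y \<epsilon> \<Longrightarrow> \<epsilon> \<le> \<delta> \<Longrightarrow> box_ok X Y \<delta>"
  unfolding box_ok_def by (meson diff_left_mono order_trans)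

lemma box_ok_sym: "box_ok X Y \<epsilon> \<Longrightarrow> box_ok Y X \<epsilon>"
  unfolding box_ok_def by (metis abs_minus_commute)

lemma box_dist_less_iff:
  assumes "pm_space X" "pm_space Y"
  shows "box_dist X Y < e \<longleftrightarrow> (\<exists>\<delta>>0. \<delta> < e \<and> box_ok X Y \<delta>)"
proof -
  let ?S = "{\<epsilon>. \<epsilon> > 0 \<and> box_ok X Y \<epsilon>}"
  obtain a b where "parameter X a" "parameter Y b" using parameter_exists assms by metis
  \<comment> \<open>The value 1 admits the empty exceptional complement \<open>I = {}\<close>, so
    the infimum is taken over a non-empty set.\<close>
  then have "1 \<in> ?S" unfolding box_ok_def by auto
  then have ne: "?S \<noteq> {}" by blast
  have bd: "bdd_below ?S" by (rule bdd_belowI[of _ 0]) auto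
  have "box_dist X Y = Inf ?S" unfolding box_dist_def box_ok_def by simp
  then have "box_dist X Y < e \<longleftrightarrow> (\<exists>\<delta>\<in>?S. \<delta> < e)"
    using cInf_less_iff[OF ne bd, of e] by simp
  then show ?thesis by blast
qed

lemma box_okI:
  assumes \<Omega>: "prob_space \<Omega>" "lebesgue_image \<Omega>"
    and A: "A \<in> measurable \<Omega> (snd X)" "distr \<Omega> (snd X) A = snd X"
    and B: "B \<in> measurable \<Omega> (snd Y)" "distr \<Omega> (snd Y) B = snd Y"
    and S: "S \<in> sets \<Omega>" "measure \<Omega> S \<ge> 1 - \<epsilon>"
    and d: "\<And>s t. s \<in> S \<Longrightarrow> t \<in> S \<Longrightarrow> \<bar>mdist (fst X) (A s) (A t) - mdist (fst Y) (B s) (B t)\<bar> \<le> \<epsilon>"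
  shows "box_ok X Y \<epsilon>"
proof -
  obtain w where w: "w \<in> measurable unit_leb \<Omega>" "distr unit_leb \<Omega> w = \<Omega>"
    using \<Omega>(2) unfolding lebesgue_image_def by blast
  define I where "I = w -` S \<inter> {0..1}"
  have Is: "I \<in> sets unit_leb" using measurable_sets[OF w(1) S(1)] by (simp add: I_def)
  then have I: "I \<in> sets borel" "I \<subseteq> {0..1}"
    by (auto simp: sets_restrict_space_iff I_def)
  have "measure lborel I = measure unit_leb I"
    using I by (simp add: measure_restrict_space)
  also have "\<dots> = measure (distr unit_leb \<Omega> w) S"
    using measure_distr[OF w(1) S(1)] by (simp add: I_def)
  finally have "measure lborel I \<ge> 1 - \<epsilon>" using S w by simp
  moreover have "parameter X (A \<circ> w)" "parameter Y (B \<circ> w)"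
    using distr_distr[OF A(1) w(1)] distr_distr[OF B(1) w(1)] w A B
    unfolding parameter_def by (auto intro: measurable_comp)
  ultimately show ?thesis
    unfolding box_ok_def using I d by (intro exI[of _ "A \<circ> w"] exI[of _ "B \<circ> w"] exI[of _ I]) (auto simp: I_def)
qed

lemma lebesgue_image_polish:
  fixes M :: "'a::polish_space measure"
  assumes "prob_space M" "sets M = sets borel"
  shows "lebesgue_image M"
  using pm_space_lebesgue_image[OF pm_space_euclidean[OF assms]] by simp

text \<open>The distance error is multiplied by \<open>t\<close>, while the measure of the
  exceptional set stays the same. One factor \<open>u\<close> serves both, whence
  \<open>t \<le> u\<close> and \<open>1 \<le> u\<close>.\<close>

lemma box_ok_lip_transport:
  assumes "box_ok X Y \<epsilon>" and "pm_space X'" "pm_space Y'"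
    and f: "f \<in> measurable (snd X) (snd X')" "distr (snd X) (snd X') f = snd X'"
      "\<And>x y. x \<in> mspace (fst X) \<Longrightarrow> y \<in> mspace (fst X) \<Longrightarrow> mdist (fst X') (f x) (f y) = t * mdist (fst X) x y"
    and g: "g \<in> measurable (snd Y) (snd Y')" "distr (snd Y) (snd Y') g = snd Y'"
      "\<And>x y. x \<in> mspace (fst Y) \<Longrightarrow> y \<in> mspace (fst Y) \<Longrightarrow> mdist (fst Y') (g x) (g y) = t * mdist (fst Y) x y"
    and X: "pm_space X" "pm_space Y" and t: "t > 0" "t \<le> u" "1 \<le> u"
  shows "box_ok X' Y' (u * \<epsilon>)"
proof -
  obtain a b I where ab: "parameter X a" "parameter Y b" "I \<in> sets borel" "I \<subseteq> {0..1}" "measure lborel I \<ge> 1 - \<epsilon>"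
    "\<And>s t. s\<in>I \<Longrightarrow> t\<in>I \<Longrightarrow> \<bar>mdist (fst X) (a s) (a t) - mdist (fst Y) (b s) (b t)\<bar> \<le> \<epsilon>"
    using assms(1) unfolding box_ok_def by blast
  have "measure lborel I \<le> measure lborel {0..1::real}"
    using ab(3,4) by (intro measure_mono_fmeasurable) (auto intro: fmeasurableI2)
  then have "\<epsilon> \<ge> 0" using ab(5) by simp
  then have u: "\<epsilon> \<le> u * \<epsilon>" "t * \<epsilon> \<le> u * \<epsilon>" using t by (auto intro: mult_right_mono mult_left_mono simp: mult_le_cancel_right1)
  have p: "parameter X' (f \<circ> a)" "parameter Y' (g \<circ> b)"
    using ab(1,2) f g distr_distr[of f "snd X" "snd X'" a unit_leb] distr_distr[of g "snd Y" "snd Y'" b unit_leb]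
    unfolding parameter_def by (auto intro: measurable_comp)
  have sp: "a s \<in> mspace (fst X)" "b s \<in> mspace (fst Y)" if "s \<in> I" for s
    using that ab(1,2,4) measurable_space[of a unit_leb "snd X" s] measurable_space[of b unit_leb "snd Y" s] X
    unfolding parameter_def pm_space_def by auto
  have "\<bar>mdist (fst X') (f (a r)) (f (a s)) - mdist (fst Y') (g (b r)) (g (b s))\<bar> \<le> u * \<epsilon>" if "r \<in> I" "s \<in> I" for r s
  proof -
    have "\<bar>mdist (fst X') (f (a r)) (f (a s)) - mdist (fst Y') (g (b r)) (g (b s))\<bar> = t * \<bar>mdist (fst X) (a r) (a s) - mdist (fst Y) (b r) (b s)\<bar>"
      using that t by (simp add: f(3) g(3) sp abs_mult flip: right_diff_distrib)
    also have "\<dots> \<le> t * \<epsilon>" using ab(6)[OF that] t by simp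
    finally show ?thesis using u by simp
  qed
  then show ?thesis
    unfolding box_ok_def using ab(3-5) u p
    by (intro exI[of _ "f \<circ> a"] exI[of _ "g \<circ> b"] exI[of _ I]) auto
qed

text \<open>The two coordinates are independent conditionally on their common label.\<close>

lemma (in prob_space) label_coupling_measure:
  fixes l l' :: "'a \<Rightarrow> nat"
  assumes l [measurable]: "l \<in> measurable M (count_space UNIV)"
    and l' [measurable]: "l' \<in> measurable M (count_space UNIV)"
    and eq: "distr M (count_space UNIV) l = distr M (count_space UNIV) l'"
  shows "\<exists>\<nu>. prob_space \<nu> \<and> sets \<nu> = sets (M \<Otimes>\<^sub>M M) \<and>
    fst \<in> measurable \<nu> M \<and> distr \<nu> M fst = M \<and>
    snd \<in> measurable \<nu> M \<and> distr \<nu> M snd = M \<and>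
    (AE p in \<nu>. l (fst p) = l' (snd p))"
proof -
  interpret UU: pair_prob_space M M ..
  define m where "m k = emeasure M {s \<in> space M. l s = k}" for k
  have m': "m k = emeasure M {s \<in> space M. l' s = k}" for k
  proof -
    have "m k = emeasure (distr M (count_space UNIV) l) {k}"
      unfolding m_def by (subst emeasure_distr) (auto intro!: arg_cong[where f="emeasure _"])
    also have "\<dots> = emeasure M {s \<in> space M. l' s = k}"
      unfolding eq by (subst emeasure_distr) (auto intro!: arg_cong[where f="emeasure _"])
    finally show ?thesis .
  qed
  have mfin: "m k < \<infinity>" for k unfolding m_def using emeasure_finite by (simp add: less_top[symmetric])
  \<comment> \<open>The density of the coupling with respect to the product: on the rectangle of
    pairs with common label k it is the inverse of the common mass of that label. Labels of mass 0
    give an infinite value, but only on a null set.\<close>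
  define g :: "'a \<times> 'a \<Rightarrow> ennreal" where "g p = (if l (fst p) = l' (snd p) then inverse (m (l (fst p))) else 0)" for p
  have lf [measurable]: "(\<lambda>p. l (fst p)) \<in> measurable (M \<Otimes>\<^sub>M M) (count_space UNIV)"
    by (rule measurable_compose[OF measurable_fst l])
  have lf' [measurable]: "(\<lambda>p. l' (snd p)) \<in> measurable (M \<Otimes>\<^sub>M M) (count_space UNIV)"
    by (rule measurable_compose[OF measurable_snd l'])
  have [measurable]: "(\<lambda>p. m (l (fst p))) \<in> borel_measurable (M \<Otimes>\<^sub>M M)"
    by (rule measurable_compose[OF lf]) simp
  have "{p \<in> space (M \<Otimes>\<^sub>M M). l (fst p) = l' (snd p)} =
      (\<Union>k. ((\<lambda>p. l (fst p)) -` {k} \<inter> space (M \<Otimes>\<^sub>M M)) \<inter> ((\<lambda>p. l' (snd p)) -` {k} \<inter> space (M \<Otimes>\<^sub>M M)))"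
    by auto
  also have "\<dots> \<in> sets (M \<Otimes>\<^sub>M M)"
    using lf lf' by (intro sets.countable_UN' sets.Int measurable_sets) auto
  finally have [measurable]: "Measurable.pred (M \<Otimes>\<^sub>M M) (\<lambda>p. l (fst p) = l' (snd p))"
    by (simp add: pred_def)
  have g [measurable]: "g \<in> borel_measurable (M \<Otimes>\<^sub>M M)"
    unfolding g_def by (intro measurable_If borel_measurable_inverse_ennreal) measurable
  define \<nu> where "\<nu> = density (M \<Otimes>\<^sub>M M) g"
  have s\<nu>: "sets \<nu> = sets (M \<Otimes>\<^sub>M M)" unfolding \<nu>_def by simp
  have sp\<nu>: "space \<nu> = space M \<times> space M" unfolding \<nu>_def by (simp add: space_pair_measure)
  have fm: "fst \<in> measurable \<nu> M" "snd \<in> measurable \<nu> M"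
    using measurable_fst[of M M] measurable_snd[of M M] measurable_cong_sets[OF s\<nu> refl] by blast+
  have pos: "AE s in M. m (l s) \<noteq> 0" "AE s in M. m (l' s) \<noteq> 0"
  proof -
    have "AE s in M. \<forall>k. m k = 0 \<longrightarrow> l s \<noteq> k"
      unfolding AE_all_countable
    proof
      fix k show "AE s in M. m k = 0 \<longrightarrow> l s \<noteq> k"
        by (cases "m k = 0") (auto simp: m_def intro!: AE_I[of _ _ "{s \<in> space M. l s = k}"])
    qed
    then show "AE s in M. m (l s) \<noteq> 0" by eventually_elim auto
    have "AE s in M. \<forall>k. m k = 0 \<longrightarrow> l' s \<noteq> k"
      unfolding AE_all_countable
    proof
      fix k show "AE s in M. m k = 0 \<longrightarrow> l' s \<noteq> k"
        by (cases "m k = 0") (auto simp: m' intro!: AE_I[of _ _ "{s \<in> space M. l' s = k}"])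
    qed
    then show "AE s in M. m (l' s) \<noteq> 0" by eventually_elim auto
  qed
  have mm: "inverse (m k) * m k = 1" if "m k \<noteq> 0" for k
    using that mfin[of k] by (metis ennreal_inverse_mult less_top mult.commute infinity_ennreal_def ennreal_divide_self divide_ennreal_def)
  have i1: "(\<integral>\<^sup>+ t. g (s, t) \<partial>M) = 1" if "m (l s) \<noteq> 0" "s \<in> space M" for s
  proof -
    have "(\<integral>\<^sup>+ t. g (s, t) \<partial>M) = (\<integral>\<^sup>+ t. inverse (m (l s)) * indicator {t \<in> space M. l' t = l s} t \<partial>M)"
      by (intro nn_integral_cong) (auto simp: g_def)
    also have "\<dots> = inverse (m (l s)) * m (l s)"
      unfolding m' by (subst nn_integral_cmult_indicator) auto
    finally show ?thesis using mm that by simp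
  qed
  have i2: "(\<integral>\<^sup>+ s. g (s, t) \<partial>M) = 1" if "m (l' t) \<noteq> 0" "t \<in> space M" for t
  proof -
    have "(\<integral>\<^sup>+ s. g (s, t) \<partial>M) = (\<integral>\<^sup>+ s. inverse (m (l' t)) * indicator {s \<in> space M. l s = l' t} s \<partial>M)"
      by (intro nn_integral_cong) (auto simp: g_def)
    also have "\<dots> = inverse (m (l' t)) * m (l' t)"
      unfolding m_def by (subst nn_integral_cmult_indicator) auto
    finally show ?thesis using mm that by simp
  qed
  have d1: "distr \<nu> M fst = M"
  proof (rule measure_eqI)
    fix A assume "A \<in> sets (distr \<nu> M fst)"
    then have A [measurable]: "A \<in> sets M" by simp
    have "emeasure (distr \<nu> M fst) A = emeasure \<nu> (fst -` A \<inter> space \<nu>)"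
      by (rule emeasure_distr[OF fm(1) A])
    also have "fst -` A \<inter> space \<nu> = A \<times> space M"
      using sets.sets_into_space[OF A] sp\<nu> by auto
    also have "emeasure \<nu> \<dots> = (\<integral>\<^sup>+ p. g p * indicator (A \<times> space M) p \<partial>(M \<Otimes>\<^sub>M M))"
      unfolding \<nu>_def by (rule emeasure_density) auto
    also have "\<dots> = (\<integral>\<^sup>+ s. \<integral>\<^sup>+ t. g (s, t) * indicator (A \<times> space M) (s, t) \<partial>M \<partial>M)"
      by (rule nn_integral_fst[symmetric]) measurable
    also have "\<dots> = (\<integral>\<^sup>+ s. indicator A s \<partial>M)"
    proof (rule nn_integral_cong_AE)
      show "AE s in M. (\<integral>\<^sup>+ t. g (s, t) * indicator (A \<times> space M) (s, t) \<partial>M) = indicator A s"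
        using pos(1) AE_space
      proof eventually_elim
        case (elim s)
        have "(\<integral>\<^sup>+ t. g (s, t) * indicator (A \<times> space M) (s, t) \<partial>M) = (\<integral>\<^sup>+ t. g (s, t) * indicator A s \<partial>M)"
          by (intro nn_integral_cong) (auto split: split_indicator)
        also have "\<dots> = indicator A s"
          using i1[OF elim] elim(2) by (subst nn_integral_multc) auto
        finally show ?case .
      qed
    qed
    finally show "emeasure (distr \<nu> M fst) A = emeasure M A" by simp
  qed simp
  have d2: "distr \<nu> M snd = M"
  proof (rule measure_eqI)
    fix A assume "A \<in> sets (distr \<nu> M snd)"
    then have A [measurable]: "A \<in> sets M" by simp
    have "emeasure (distr \<nu> M snd) A = emeasure \<nu> (snd -` A \<inter> space \<nu>)"
      by (rule emeasure_distr[OF fm(2) A])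
    also have "snd -` A \<inter> space \<nu> = space M \<times> A"
      using sets.sets_into_space[OF A] sp\<nu> by auto
    also have "emeasure \<nu> \<dots> = (\<integral>\<^sup>+ p. g p * indicator (space M \<times> A) p \<partial>(M \<Otimes>\<^sub>M M))"
      unfolding \<nu>_def by (rule emeasure_density) auto
    also have "\<dots> = (\<integral>\<^sup>+ t. \<integral>\<^sup>+ s. g (s, t) * indicator (space M \<times> A) (s, t) \<partial>M \<partial>M)"
      by (rule UU.nn_integral_snd[symmetric]) measurable
    also have "\<dots> = (\<integral>\<^sup>+ t. indicator A t \<partial>M)"
    proof (rule nn_integral_cong_AE)
      show "AE t in M. (\<integral>\<^sup>+ s. g (s, t) * indicator (space M \<times> A) (s, t) \<partial>M) = indicator A t"
        using pos(2) AE_space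
      proof eventually_elim
        case (elim t)
        have "(\<integral>\<^sup>+ s. g (s, t) * indicator (space M \<times> A) (s, t) \<partial>M) = (\<integral>\<^sup>+ s. g (s, t) * indicator A t \<partial>M)"
          by (intro nn_integral_cong) (auto split: split_indicator)
        also have "\<dots> = indicator A t"
          using i2[OF elim] elim(2) by (subst nn_integral_multc) auto
        finally show ?case .
      qed
    qed
    finally show "emeasure (distr \<nu> M snd) A = emeasure M A" by simp
  qed simp
  have prob: "prob_space \<nu>"
    using prob_space_distrD[OF fm(1)] d1 prob_space_axioms by simp
  have ae: "AE p in \<nu>. l (fst p) = l' (snd p)"
    unfolding \<nu>_def by (subst AE_density) (auto simp: g_def)
  show ?thesis using prob s\<nu> fm d1 d2 ae by blast
qed

text \<open>The coupling must itself be an image of the unit interval. Read as a Borel measure on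
  the plane, a Polish space, it is one; clamping both coordinates to the unit interval brings it
  back to the square.\<close>

lemma label_coupling:
  fixes l l' :: "real \<Rightarrow> nat"
  assumes l [measurable]: "l \<in> measurable unit_leb (count_space UNIV)"
    and l' [measurable]: "l' \<in> measurable unit_leb (count_space UNIV)"
    and eq: "distr unit_leb (count_space UNIV) l = distr unit_leb (count_space UNIV) l'"
  shows "\<exists>\<nu> :: (real \<times> real) measure. prob_space \<nu> \<and> lebesgue_image \<nu> \<and>
    fst \<in> measurable \<nu> unit_leb \<and> distr \<nu> unit_leb fst = unit_leb \<and>
    snd \<in> measurable \<nu> unit_leb \<and> distr \<nu> unit_leb snd = unit_leb \<and>
    (AE p in \<nu>. l (fst p) = l' (snd p))"
proof -
  interpret U: prob_space unit_leb by (rule prob_space_unit_leb)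
  obtain \<nu> where \<nu>: "prob_space \<nu>" and s\<nu>: "sets \<nu> = sets (unit_leb \<Otimes>\<^sub>M unit_leb)"
    and fm: "fst \<in> measurable \<nu> unit_leb" "snd \<in> measurable \<nu> unit_leb"
    and d1: "distr \<nu> unit_leb fst = unit_leb" and d2: "distr \<nu> unit_leb snd = unit_leb"
    and ae: "AE p in \<nu>. l (fst p) = l' (snd p)"
    using U.label_coupling_measure[OF assms] by blast
  have sp\<nu>: "space \<nu> = {0..1} \<times> {0..1}"
    using sets_eq_imp_space_eq[OF s\<nu>] by (simp add: space_pair_measure)
  interpret N: prob_space \<nu> by fact
  let ?B = "distr \<nu> borel (\<lambda>p. p)"
  have idm [measurable]: "(\<lambda>p. p) \<in> measurable \<nu> (borel :: (real \<times> real) measure)"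
  proof -
    have "fst \<in> measurable \<nu> (lborel :: real measure)" "snd \<in> measurable \<nu> (lborel :: real measure)"
      using measurable_compose[OF fm(1), of "\<lambda>x. x"] measurable_compose[OF fm(2), of "\<lambda>x. x"]
      by (auto simp: measurable_restrict_space1)
    then have "(\<lambda>p. (fst p, snd p)) \<in> measurable \<nu> (borel \<Otimes>\<^sub>M borel :: (real \<times> real) measure)"
      by (intro measurable_Pair) auto
    then show ?thesis by (simp add: borel_prod)
  qed
  have lB: "lebesgue_image ?B"
    by (rule lebesgue_image_polish) (auto intro: N.prob_space_distr idm)
  define c :: "real \<Rightarrow> real" where "c r = max 0 (min 1 r)" for r
  have c: "c \<in> measurable borel unit_leb"
    unfolding c_def by (rule measurable_restrict_space2) auto
  let ?h = "\<lambda>p. (c (fst p), c (snd p))"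
  have "?h \<in> measurable borel (unit_leb \<Otimes>\<^sub>M unit_leb)"
    by (intro measurable_Pair measurable_compose[OF _ c] borel_measurable_continuous_onI continuous_intros)
  then have h: "?h \<in> measurable ?B \<nu>"
    using measurable_cong_sets[OF sets_distr s\<nu>] by blast
  have "distr ?B \<nu> ?h = distr \<nu> \<nu> (?h \<circ> (\<lambda>p. p))"
    by (rule distr_distr) (use h idm in auto)
  also have "\<dots> = distr \<nu> \<nu> (\<lambda>p. p)"
    by (rule distr_cong) (auto simp: sp\<nu> c_def)
  finally have "distr ?B \<nu> ?h = \<nu>" by (simp add: distr_id2)
  then have "lebesgue_image \<nu>"
    using lebesgue_image_distr[OF lB h] by simp
  then show ?thesis using \<nu> fm d1 d2 ae by blast
qed

section \<open>Triangle inequality for the box distance, and box closures\<close>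

lemma dense_seqD: "dense_seq d x \<Longrightarrow> y \<in> mspace d \<Longrightarrow> 0 < e \<Longrightarrow> \<exists>k. mdist d (x k) y < e"
  by (simp add: dense_seq_def)

text \<open>The label is the first index of the dense sequence within \<open>e / 2\<close> of the
  point. It cuts the space into countably many small Borel pieces.\<close>

lemma countable_labels:
  assumes X: "pm_space X" and e: "e > 0"
  shows "\<exists>l :: 'a \<Rightarrow> nat. l \<in> measurable (snd X) (count_space UNIV) \<and>
    (\<forall>y\<in>mspace (fst X). \<forall>z\<in>mspace (fst X). l y = l z \<longrightarrow> mdist (fst X) y z < e)"
proof -
  obtain x where x: "dense_seq (fst X) x" using pm_space_dense_seq[OF X] by blast
  have xm: "x k \<in> mspace (fst X)" for k using x unfolding dense_seq_def by auto
  have [measurable]: "mdist (fst X) (x k) \<in> borel_measurable (snd X)" for k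
    using mdist_borel_measurable[OF X, of "x k"] xm by simp
  define l where "l y = (LEAST k. mdist (fst X) (x k) y < e / 2)" for y
  have lm: "l \<in> measurable (snd X) (count_space UNIV)" unfolding l_def by measurable
  have near: "mdist (fst X) (x (l y)) y < e / 2" if "y \<in> mspace (fst X)" for y
  proof -
    have "e / 2 > 0" using e by simp
    from dense_seqD[OF x that this] obtain k where "mdist (fst X) (x k) y < e / 2" by (elim exE)
    then show ?thesis unfolding l_def by (rule LeastI)
  qed
  have "mdist (fst X) y z < e" if "y \<in> mspace (fst X)" "z \<in> mspace (fst X)" "l y = l z" for y z
    using near[OF that(1), unfolded that(3)] near[OF that(2)] mdist_triangle[OF that(1) xm that(2), of "l z"]
      mdist_commute[of "fst X" y "x (l z)"] by linarith
  then show ?thesis using lm by blast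
qed

text \<open>The two given parameters of \<open>Y\<close> may differ. Their arguments are coupled so
  that almost surely both values fall into the same piece of diameter at most
  \<open>\<delta> / 2\<close>. Comparing a pair of points costs this twice, once for each point,
  which is the slack \<open>\<delta>\<close>; the exceptional measures simply add up.\<close>

lemma box_ok_triangle:
  assumes "box_ok X Y \<epsilon>" "box_ok Y Z \<epsilon>'" "\<delta> > 0" and Y: "pm_space Y"
  shows "box_ok X Z (\<epsilon> + \<epsilon>' + \<delta>)"
proof -
  obtain a b I where ab: "parameter X a" "parameter Y b" "I \<in> sets borel" "I \<subseteq> {0..1}" "measure lborel I \<ge> 1 - \<epsilon>"
    "\<And>s t. s\<in>I \<Longrightarrow> t\<in>I \<Longrightarrow> \<bar>mdist (fst X) (a s) (a t) - mdist (fst Y) (b s) (b t)\<bar> \<le> \<epsilon>"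
    using assms(1) unfolding box_ok_def by blast
  obtain b' c J where bc: "parameter Y b'" "parameter Z c" "J \<in> sets borel" "J \<subseteq> {0..1}" "measure lborel J \<ge> 1 - \<epsilon>'"
    "\<And>s t. s\<in>J \<Longrightarrow> t\<in>J \<Longrightarrow> \<bar>mdist (fst Y) (b' s) (b' t) - mdist (fst Z) (c s) (c t)\<bar> \<le> \<epsilon>'"
    using assms(2) unfolding box_ok_def by blast
  obtain l where l [measurable]: "l \<in> measurable (snd Y) (count_space (UNIV::nat set))"
    and ld: "\<And>y z. y\<in>mspace (fst Y) \<Longrightarrow> z\<in>mspace (fst Y) \<Longrightarrow> l y = l z \<Longrightarrow> mdist (fst Y) y z < \<delta>/2"
    using countable_labels[OF Y, of "\<delta>/2"] assms(3) by auto
  have m: "a \<in> measurable unit_leb (snd X)" "distr unit_leb (snd X) a = snd X"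
    "b \<in> measurable unit_leb (snd Y)" "distr unit_leb (snd Y) b = snd Y"
    "b' \<in> measurable unit_leb (snd Y)" "distr unit_leb (snd Y) b' = snd Y"
    "c \<in> measurable unit_leb (snd Z)" "distr unit_leb (snd Z) c = snd Z"
    using ab(1,2) bc(1,2) unfolding parameter_def by auto
  note [measurable] = m(1,3,5,7)
  have lb: "(l \<circ> b) \<in> measurable unit_leb (count_space UNIV)" "(l \<circ> b') \<in> measurable unit_leb (count_space UNIV)"
    using measurable_comp[OF m(3) l] measurable_comp[OF m(5) l] by auto
  have "distr unit_leb (count_space UNIV) (l \<circ> b) = distr unit_leb (count_space UNIV) (l \<circ> b')"
    using distr_distr[OF l m(3)] distr_distr[OF l m(5)] m(4,6) by simp
  then obtain \<nu> :: "(real \<times> real) measure" where \<nu>: "prob_space \<nu>" "lebesgue_image \<nu>"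
    "fst \<in> measurable \<nu> unit_leb" "distr \<nu> unit_leb fst = unit_leb"
    "snd \<in> measurable \<nu> unit_leb" "distr \<nu> unit_leb snd = unit_leb"
    and ae: "AE p in \<nu>. (l \<circ> b) (fst p) = (l \<circ> b') (snd p)"
    using label_coupling[OF lb] by blast
  interpret N: prob_space \<nu> by fact
  note [measurable] = \<nu>(3,5)
  have IJ [measurable]: "I \<in> sets unit_leb" "J \<in> sets unit_leb"
    using ab(3,4) bc(3,4) by (auto simp: sets_restrict_space_iff)
  define A where "A = {p \<in> space \<nu>. fst p \<in> I}"
  define B where "B = {p \<in> space \<nu>. snd p \<in> J}"
  define E where "E = {p \<in> space \<nu>. l (b (fst p)) = l (b' (snd p))}"
  have As [measurable]: "A \<in> sets \<nu>" and Bs [measurable]: "B \<in> sets \<nu>"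
    using measurable_sets[OF \<nu>(3) IJ(1)] measurable_sets[OF \<nu>(5) IJ(2)]
    by (simp_all add: A_def B_def vimage_def Int_def conj_commute)
  have "E = (\<Union>k. ((l \<circ> b \<circ> fst) -` {k} \<inter> space \<nu>) \<inter> ((l \<circ> b' \<circ> snd) -` {k} \<inter> space \<nu>))"
    by (auto simp: E_def)
  also have "\<dots> \<in> sets \<nu>"
    using measurable_comp[OF \<nu>(3) lb(1)] measurable_comp[OF \<nu>(5) lb(2)]
    by (intro sets.countable_UN' sets.Int measurable_sets) auto
  finally have [measurable]: "E \<in> sets \<nu>" .
  have "N.prob A = measure unit_leb I"
    using measure_distr[OF \<nu>(3) IJ(1)] \<nu>(4) by (simp add: A_def vimage_def Int_def conj_commute)
  then have PA: "N.prob A \<ge> 1 - \<epsilon>" using ab by (simp add: measure_restrict_space)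
  have "N.prob B = measure unit_leb J"
    using measure_distr[OF \<nu>(5) IJ(2)] \<nu>(6) by (simp add: B_def vimage_def Int_def conj_commute)
  then have PB: "N.prob B \<ge> 1 - \<epsilon>'" using bc by (simp add: measure_restrict_space)
  have "N.prob (A \<inter> B) + N.prob (A \<union> B) = N.prob A + N.prob B"
    using N.finite_measure_Union'[of A B] N.finite_measure_Diff'[of B A] by (simp add: Int_commute)
  then have PAB: "N.prob (A \<inter> B) \<ge> 1 - (\<epsilon> + \<epsilon>')"
    using PA PB N.prob_le_1[of "A \<union> B"] by linarith
  have "N.prob (A \<inter> B \<inter> E) = N.prob (A \<inter> B)"
  proof (rule N.finite_measure_eq_AE)
    show "AE p in \<nu>. p \<in> A \<inter> B \<inter> E \<longleftrightarrow> p \<in> A \<inter> B"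
      using ae by eventually_elim (auto simp: E_def A_def)
  qed measurable
  then have PE: "N.prob (A \<inter> B \<inter> E) \<ge> 1 - (\<epsilon> + \<epsilon>' + \<delta>)"
    using PAB assms(3) by simp
  have sY: "b s \<in> mspace (fst Y)" "b' s \<in> mspace (fst Y)" if "s \<in> {0..1}" for s
    using that measurable_space[OF m(3), of s] measurable_space[OF m(5), of s] Y by (auto simp: pm_space_def)
  show ?thesis
  proof (rule box_okI[OF \<nu>(1,2), where A="a \<circ> fst" and B="c \<circ> snd" and S="A \<inter> B \<inter> E"])
    show "a \<circ> fst \<in> measurable \<nu> (snd X)" "c \<circ> snd \<in> measurable \<nu> (snd Z)"
      using measurable_comp[OF \<nu>(3) m(1)] measurable_comp[OF \<nu>(5) m(7)] by auto
    show "distr \<nu> (snd X) (a \<circ> fst) = snd X" "distr \<nu> (snd Z) (c \<circ> snd) = snd Z"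
      using distr_distr[OF m(1) \<nu>(3)] distr_distr[OF m(7) \<nu>(5)] \<nu> m by auto
    fix p q assume pq: "p \<in> A \<inter> B \<inter> E" "q \<in> A \<inter> B \<inter> E"
    then have in01: "fst p \<in> {0..1}" "fst q \<in> {0..1}" "snd p \<in> {0..1}" "snd q \<in> {0..1}"
      using ab(4) bc(4) by (auto simp: A_def B_def)
    have "mdist (fst Y) (b (fst p)) (b' (snd p)) < \<delta> / 2" "mdist (fst Y) (b (fst q)) (b' (snd q)) < \<delta> / 2"
      using pq ld[OF sY(1)[OF in01(1)] sY(2)[OF in01(3)]] ld[OF sY(1)[OF in01(2)] sY(2)[OF in01(4)]]
      by (simp_all only: E_def Int_iff mem_Collect_eq)
    moreover have "mdist (fst Y) (b (fst p)) (b (fst q)) \<le> mdist (fst Y) (b (fst p)) (b' (snd p)) + mdist (fst Y) (b' (snd p)) (b' (snd q)) + mdist (fst Y) (b' (snd q)) (b (fst q))"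
      using mdist_triangle[OF sY(1)[OF in01(1)] sY(2)[OF in01(3)] sY(1)[OF in01(2)]]
        mdist_triangle[OF sY(2)[OF in01(3)] sY(2)[OF in01(4)] sY(1)[OF in01(2)]] by linarith
    moreover have "mdist (fst Y) (b' (snd p)) (b' (snd q)) \<le> mdist (fst Y) (b' (snd p)) (b (fst p)) + mdist (fst Y) (b (fst p)) (b (fst q)) + mdist (fst Y) (b (fst q)) (b' (snd q))"
      using mdist_triangle[OF sY(2)[OF in01(3)] sY(1)[OF in01(1)] sY(2)[OF in01(4)]]
        mdist_triangle[OF sY(1)[OF in01(1)] sY(1)[OF in01(2)] sY(2)[OF in01(4)]] by linarith
    moreover have "\<bar>mdist (fst X) (a (fst p)) (a (fst q)) - mdist (fst Y) (b (fst p)) (b (fst q))\<bar> \<le> \<epsilon>"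
      using pq by (auto simp: A_def intro!: ab(6))
    moreover have "\<bar>mdist (fst Y) (b' (snd p)) (b' (snd q)) - mdist (fst Z) (c (snd p)) (c (snd q))\<bar> \<le> \<epsilon>'"
      using pq by (auto simp: B_def intro!: bc(6))
    ultimately show "\<bar>mdist (fst X) ((a \<circ> fst) p) ((a \<circ> fst) q) - mdist (fst Z) ((c \<circ> snd) p) ((c \<circ> snd) q)\<bar> \<le> \<epsilon> + \<epsilon>' + \<delta>"
      unfolding o_def mdist_commute[of "fst Y" "b' (snd p)" "b (fst p)"] mdist_commute[of "fst Y" "b' (snd q)" "b (fst q)"]
      by linarith
  qed (use PE in auto)
qed

lemma pm_space_rep [simp]: "pm_space (rep_pm_class X)"
  using full_pm_space_rep[of X] unfolding full_pm_space_def by blast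

lemma box_class_less_iff:
  "box_class X Y < e \<longleftrightarrow> (\<exists>\<delta>>0. \<delta> < e \<and> box_ok (rep_pm_class X) (rep_pm_class Y) \<delta>)"
  unfolding box_class_def by (rule box_dist_less_iff) simp_all

lemma box_ok_refl:
  assumes "pm_space X" "0 \<le> \<epsilon>"
  shows "box_ok X X \<epsilon>"
proof -
  obtain a where "parameter X a" using parameter_exists assms(1) by blast
  then show ?thesis unfolding box_ok_def using assms(2)
    by (intro exI[of _ a] exI[of _ a] exI[of _ "{0..1}"]) auto
qed

lemma box_class_self_less: "0 < e \<Longrightarrow> box_class X X < e"
  unfolding box_class_less_iff using box_ok_refl[of "rep_pm_class X" "e/2"] by (intro exI[of _ "e/2"]) auto

lemma box_class_sym: "box_class X Y = box_class Y X"
proof (rule antisym; rule dense_ge)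
  fix e assume "box_class Y X < e" then show "box_class X Y \<le> e"
    by (intro less_imp_le) (auto simp: box_class_less_iff intro: box_ok_sym)
next
  fix e assume "box_class X Y < e" then show "box_class Y X \<le> e"
    by (intro less_imp_le) (auto simp: box_class_less_iff intro: box_ok_sym)
qed

lemma box_class_triangle: "box_class X Z \<le> box_class X Y + box_class Y Z"
proof (rule field_le_epsilon)
  fix e :: real assume e: "e > 0"
  obtain d where d: "d > 0" "d < box_class X Y + e/3" "box_ok (rep_pm_class X) (rep_pm_class Y) d"
    using box_class_less_iff[of X Y "box_class X Y + e/3"] e by auto
  obtain d' where d': "d' > 0" "d' < box_class Y Z + e/3" "box_ok (rep_pm_class Y) (rep_pm_class Z) d'"
    using box_class_less_iff[of Y Z "box_class Y Z + e/3"] e by auto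
  have "box_ok (rep_pm_class X) (rep_pm_class Z) (d + d' + e/3)"
    using box_ok_triangle[OF d(3) d'(3), of "e/3"] e by simp
  then have "box_class X Z < box_class X Y + box_class Y Z + e"
    unfolding box_class_less_iff using d d' e by (intro exI[of _ "d + d' + e/3"]) auto
  then show "box_class X Z \<le> box_class X Y + box_class Y Z + e" by simp
qed

lemma subset_box_closure: "A \<subseteq> box_closure A"
  unfolding box_closure_def using box_class_self_less by blast

lemma box_closure_mono: "A \<subseteq> B \<Longrightarrow> box_closure A \<subseteq> box_closure B"
  unfolding box_closure_def by blast

lemma in_box_closureD: "X \<in> box_closure A \<Longrightarrow> 0 < e \<Longrightarrow> \<exists>Y\<in>A. box_class X Y < e"
  by (simp add: box_closure_def)

lemma box_closure_idem: "box_closure (box_closure A) = box_closure A"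
proof (rule antisym)
  show "box_closure (box_closure A) \<subseteq> box_closure A"
  proof
    fix X assume X: "X \<in> box_closure (box_closure A)"
    show "X \<in> box_closure A"
      unfolding box_closure_def
    proof (intro CollectI allI impI)
      fix e :: real assume e: "e > 0"
      obtain Y where Y: "Y \<in> box_closure A" "box_class X Y < e/2"
        using in_box_closureD[OF X, of "e/2"] e by auto
      obtain Z where Z: "Z \<in> A" "box_class Y Z < e/2"
        using in_box_closureD[OF Y(1), of "e/2"] e by auto
      have "box_class X Z < e" using box_class_triangle[of X Z Y] Y Z by linarith
      then show "\<exists>Y\<in>A. box_class X Y < e" using Z by blast
    qed
  qed
qed (rule subset_box_closure)

section \<open>Isomorphism classes of spaces over arbitrary types\<close>

lemma lip_le_trans:
  assumes "lip_le Z Y" "lip_le Y X" "pm_space X" "pm_space Y" "pm_space Z"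
  shows "lip_le Z X"
proof -
  obtain f where f: "one_lipschitz (fst Y) (fst Z) f" "distr (snd Y) (snd Z) f = snd Z"
    using assms(1) unfolding lip_le_def by blast
  obtain g where g: "one_lipschitz (fst X) (fst Y) g" "distr (snd X) (snd Y) g = snd Y"
    using assms(2) unfolding lip_le_def by blast
  have "one_lipschitz (fst X) (fst Z) (f \<circ> g)"
    unfolding one_lipschitz_def
  proof (intro conjI ballI)
    show "f \<circ> g \<in> mspace (fst X) \<rightarrow> mspace (fst Z)"
      using f(1) g(1) by (auto simp: one_lipschitz_def)
    fix x y assume xy: "x \<in> mspace (fst X)" "y \<in> mspace (fst X)"
    then have "g x \<in> mspace (fst Y)" "g y \<in> mspace (fst Y)" using g(1) by (auto simp: one_lipschitz_def)
    then have "mdist (fst Z) (f (g x)) (f (g y)) \<le> mdist (fst Y) (g x) (g y)"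
      using f(1) by (simp add: one_lipschitz_def)
    also have "\<dots> \<le> mdist (fst X) x y" using g(1) xy by (simp add: one_lipschitz_def)
    finally show "mdist (fst Z) ((f \<circ> g) x) ((f \<circ> g) y) \<le> mdist (fst X) x y" by simp
  qed
  moreover have "distr (snd X) (snd Z) (f \<circ> g) = snd Z"
    using distr_distr[OF one_lipschitz_measurable[OF f(1) assms(4,5)] one_lipschitz_measurable[OF g(1) assms(3,4)]] f g
    by simp
  ultimately show ?thesis unfolding lip_le_def by blast
qed

lemma pm_iso_imp_lip_le: "pm_iso X Y \<Longrightarrow> lip_le Y X"
  unfolding lip_le_def pm_iso_def one_lipschitz_def bij_betw_def by (metis Pi_I imageI order_refl)

lemma pm_iso_box_ok:
  assumes "pm_iso X Y" "pm_space X" "pm_space Y" "0 \<le> \<epsilon>"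
  shows "box_ok X Y \<epsilon>"
proof -
  obtain f where f: "bij_betw f (mspace (fst X)) (mspace (fst Y))"
     "\<And>x y. x\<in>mspace (fst X) \<Longrightarrow> y\<in>mspace (fst X) \<Longrightarrow> mdist (fst Y) (f x) (f y) = mdist (fst X) x y"
     "distr (snd X) (snd Y) f = snd Y"
    using assms(1) unfolding pm_iso_def by blast
  have m: "f \<in> measurable (snd X) (snd Y)"
    using f(1,2) assms(2,3) by (intro one_lipschitz_measurable) (auto simp: one_lipschitz_def bij_betw_def)
  have "box_ok X Y (1 * \<epsilon>)"
    by (rule box_ok_lip_transport[OF box_ok_refl[OF assms(2,4)] assms(2,3), of "\<lambda>x. x" 1 f])
       (use assms f m in \<open>auto simp: distr_id2\<close>)
  then show ?thesis by simp
qed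

section \<open>Transport of a space to another carrier\<close>

definition copy_pm :: "('a \<Rightarrow> 'b) \<Rightarrow> 'a metric_measure \<Rightarrow> 'b metric_measure" where
  "copy_pm \<phi> X = (let M = mspace (fst X); \<psi> = the_inv_into M \<phi>;
     d = metric (\<phi> ` M, \<lambda>r s. mdist (fst X) (\<psi> r) (\<psi> s)) in (d, distr (snd X) (borel_sigma d) \<phi>))"

text \<open>By construction \<open>\<phi>\<close> is an isometry onto its image, so every property
  is pulled back along its inverse \<open>\<psi>\<close>. The copy carries the Borel sets of the
  transported metric, which need not be related to any structure of the new type.\<close>

lemma copy_pm:
  assumes X: "full_pm_space X" and inj: "inj_on \<phi> (mspace (fst X))"
  shows "full_pm_space (copy_pm \<phi> X)" "pm_iso X (copy_pm \<phi> X)"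
proof -
  define M where "M = mspace (fst X)"
  define d where "d = mdist (fst X)"
  define \<psi> where "\<psi> = the_inv_into M \<phi>"
  define S where "S = \<phi> ` M"
  define e where "e = metric (S, \<lambda>r s. d (\<psi> r) (\<psi> s))"
  define N where "N = distr (snd X) (borel_sigma e) \<phi>"
  have Xp: "pm_space X" using X unfolding full_pm_space_def by blast
  interpret P: prob_space "snd X" using Xp unfolding pm_space_def by blast
  have spX: "space (snd X) = M" using Xp unfolding pm_space_def M_def by blast
  interpret X: Metric_space M d unfolding M_def d_def by simp
  have \<psi>\<phi>: "\<psi> (\<phi> x) = x" if "x \<in> M" for x
    using inj that unfolding \<psi>_def M_def by (rule the_inv_into_f_f)
  have ms: "Metric_space S (\<lambda>r s. d (\<psi> r) (\<psi> s))"
    by standard (auto simp: S_def \<psi>\<phi> X.commute X.triangle)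
  interpret E: Metric_space S "\<lambda>r s. d (\<psi> r) (\<psi> s)" by (rule ms)
  have me: "mspace e = S" "mdist e = (\<lambda>r s. d (\<psi> r) (\<psi> s))" unfolding e_def by simp_all
  have Y: "copy_pm \<phi> X = (e, N)"
    unfolding copy_pm_def Let_def N_def e_def S_def \<psi>_def M_def d_def by simp
  have pre: "openin (mtopology_of (fst X)) {x \<in> M. \<phi> x \<in> U}" if U: "openin (mtopology_of e) U" for U
    unfolding openin_mtopology_of
  proof (intro conjI ballI)
    fix x assume x: "x \<in> {x \<in> M. \<phi> x \<in> U}"
    then obtain r where r: "r > 0" "mball_of e (\<phi> x) r \<subseteq> U"
      using U unfolding openin_mtopology_of by auto
    have "mball_of (fst X) x r \<subseteq> {x \<in> M. \<phi> x \<in> U}"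
    proof
      fix y assume y: "y \<in> mball_of (fst X) x r"
      then have ym: "y \<in> M" "d x y < r" by (auto simp: M_def d_def)
      then have "\<phi> y \<in> mball_of e (\<phi> x) r" using x by (simp add: me \<psi>\<phi> S_def)
      then show "y \<in> {x \<in> M. \<phi> x \<in> U}" using r(2) ym by auto
    qed
    then show "\<exists>r>0. mball_of (fst X) x r \<subseteq> {x \<in> M. \<phi> x \<in> U}" using r(1) by blast
  qed (auto simp: M_def)
  have meas: "\<phi> \<in> measurable (snd X) (borel_sigma e)"
  proof (rule measurable_borel_sigmaI)
    show "\<phi> \<in> space (snd X) \<rightarrow> mspace e" by (auto simp: spX me S_def)
    fix U assume "openin (mtopology_of e) U"
    from pm_space_openin_sets[OF Xp pre[OF this]]
    show "\<phi> -` U \<inter> space (snd X) \<in> sets (snd X)" by (simp add: spX vimage_def Int_def conj_commute)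
  qed simp
  obtain x where x: "dense_seq (fst X) x" using pm_space_dense_seq[OF Xp] by blast
  have "dense_seq e (\<phi> \<circ> x)"
    unfolding dense_seq_def
  proof (intro conjI ballI allI impI)
    have xm: "x k \<in> M" for k using x by (auto simp: dense_seq_def M_def)
    then show "range (\<phi> \<circ> x) \<subseteq> mspace e" by (auto simp: me S_def)
    fix y \<epsilon> assume "y \<in> mspace e" and e: "0 < (\<epsilon>::real)"
    then obtain z where z: "z \<in> M" "y = \<phi> z" by (auto simp: me S_def)
    then obtain k where "d (x k) z < \<epsilon>" using dense_seqD[OF x _ e, of z] by (auto simp: M_def d_def)
    then show "\<exists>k. mdist e ((\<phi> \<circ> x) k) y < \<epsilon>" using z xm by (auto simp: me \<psi>\<phi>)
  qed
  then have sep: "separable_space (mtopology_of e)" by (rule dense_seq_separable)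
  have comp: "mcomplete_of e"
    unfolding mcomplete_of_def me E.mcomplete_def
  proof (intro allI impI)
    fix \<sigma> assume \<sigma>: "E.MCauchy \<sigma>"
    then have r: "range \<sigma> \<subseteq> S" by (simp add: E.MCauchy_def)
    then have \<psi>\<sigma>: "\<psi> (\<sigma> n) \<in> M" "\<phi> (\<psi> (\<sigma> n)) = \<sigma> n" for n
      by (auto simp: S_def subset_iff image_iff) (metis \<psi>\<phi>)+
    have "X.MCauchy (\<psi> \<circ> \<sigma>)"
      using \<sigma> \<psi>\<sigma> by (auto simp: E.MCauchy_def X.MCauchy_def)
    then obtain l where l: "limitin X.mtopology (\<psi> \<circ> \<sigma>) l sequentially"
      using Xp unfolding pm_space_def mcomplete_of_def X.mcomplete_def M_def[symmetric] d_def[symmetric] by blast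
    then have "limitin E.mtopology \<sigma> (\<phi> l) sequentially"
      using r \<psi>\<sigma> unfolding E.limit_metric_sequentially X.limit_metric_sequentially
      by (auto simp: S_def \<psi>\<phi> subset_iff)
    then show "\<exists>l. limitin E.mtopology \<sigma> l sequentially" by blast
  qed
  have "pm_space (e, N)"
    unfolding pm_space_def fst_conv snd_conv N_def
    using comp sep P.prob_space_distr[OF meas] by (simp add: space_borel_sigma)
  moreover have "pm_support (e, N) = mspace e"
  proof (rule antisym)
    show "mspace e \<subseteq> pm_support (e, N)"
    proof
      fix y assume "y \<in> mspace e"
      then obtain x where xy: "x \<in> M" "y = \<phi> x" by (auto simp: me S_def)
      have "emeasure N U > 0" if U: "openin (mtopology_of e) U" "y \<in> U" for U
      proof -
        have "U \<in> sets (borel_sigma e)" using U(1) openin_subset[of "mtopology_of e"]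
          unfolding borel_sigma_def by (subst sets_measure_of) (force intro: sigma_sets.Basic)+
        then have "emeasure N U = emeasure (snd X) {x \<in> M. \<phi> x \<in> U}"
          unfolding N_def by (simp add: emeasure_distr meas spX vimage_def Int_def conj_commute)
        moreover have "x \<in> pm_support X" using X xy(1) unfolding full_pm_space_def M_def by simp
        then have "emeasure (snd X) {x \<in> M. \<phi> x \<in> U} > 0"
          using pre[OF U(1)] xy U(2) unfolding pm_support_def by auto
        ultimately show ?thesis by simp
      qed
      then show "y \<in> pm_support (e, N)" using \<open>y \<in> mspace e\<close> unfolding pm_support_def by auto
    qed
  qed (auto simp: pm_support_def)
  ultimately show "full_pm_space (copy_pm \<phi> X)" unfolding Y full_pm_space_def by simp
  show "pm_iso X (copy_pm \<phi> X)"
    unfolding Y pm_iso_def fst_conv snd_conv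
  proof (intro exI[of _ \<phi>] conjI ballI)
    show "bij_betw \<phi> (mspace (fst X)) (mspace e)"
      using inj unfolding bij_betw_def me S_def M_def by blast
    show "distr (snd X) N \<phi> = N" unfolding N_def by (rule distr_cong) auto
  qed (auto simp: me \<psi>\<phi> M_def d_def)
qed

definition class_of :: "'a metric_measure \<Rightarrow> pm_class" where
  "class_of X = abs_pm_class (SOME Y. full_pm_space Y \<and> pm_iso X Y)"

text \<open>The injective code of the point bits copies a space over any type to a space on the
  reals; hence the choice in \<open>class_of\<close> is never void.\<close>

lemma pm_iso_class_of:
  assumes X: "full_pm_space X"
  shows "pm_iso X (rep_pm_class (class_of X))"
proof -
  have Xp: "pm_space X" using X unfolding full_pm_space_def by blast
  obtain x where x: "dense_seq (fst X) x" using pm_space_dense_seq[OF Xp] by blast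
  define Y :: "real metric_measure" where "Y = (SOME Y. full_pm_space Y \<and> pm_iso X Y)"
  have "\<exists>Y :: real metric_measure. full_pm_space Y \<and> pm_iso X Y"
    using copy_pm[OF X inj_on_cantor_code_point_bits[OF x]] by blast
  then have Y: "full_pm_space Y \<and> pm_iso X Y" unfolding Y_def by (rule someI_ex)
  then have Yp: "pm_space Y" unfolding full_pm_space_def by blast
  have "pm_iso Y (rep_pm_class (abs_pm_class Y))"
    using pm_iso_sym[OF pm_iso_rep_abs] Y Yp by simp
  then show ?thesis
    unfolding class_of_def Y_def[symmetric] using pm_iso_trans[OF _ _ Xp Yp pm_space_rep] Y by blast
qed

lemma class_of_rep: "class_of (rep_pm_class X) = X"
proof -
  have "pm_rel (rep_pm_class X) (rep_pm_class (class_of (rep_pm_class X)))"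
    unfolding pm_rel_def using pm_iso_class_of full_pm_space_rep by blast
  then show ?thesis using Quotient3_rel_rep[OF Quotient3_pm_class] by metis
qed

lemma full_pm_space_imp_pm_space: "full_pm_space X \<Longrightarrow> pm_space X"
  unfolding full_pm_space_def by blast

lemma lip_le_class_of:
  assumes "full_pm_space X"
  shows "lip_le (rep_pm_class (class_of X)) X" "lip_le X (rep_pm_class (class_of X))"
  using pm_iso_class_of[OF assms] pm_iso_sym[OF pm_iso_class_of[OF assms]] full_pm_space_imp_pm_space[OF assms]
  by (auto intro: pm_iso_imp_lip_le)

lemma pm_class_eqI: "pm_iso (rep_pm_class X) (rep_pm_class Y) \<Longrightarrow> X = Y"
  using Quotient3_rel_rep[OF Quotient3_pm_class, of X Y] full_pm_space_rep unfolding pm_rel_def by blast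

lemma abs_pm_class_eq:
  assumes "full_pm_space Y"
  shows "abs_pm_class Y = class_of Y"
proof (rule pm_class_eqI)
  have p: "pm_space Y" using assms by (rule full_pm_space_imp_pm_space)
  show "pm_iso (rep_pm_class (abs_pm_class Y)) (rep_pm_class (class_of Y))"
    using pm_iso_trans[OF pm_iso_rep_abs[OF assms] pm_iso_class_of[OF assms]] p by simp
qed

lemma class_of_cong:
  assumes "pm_iso X Y" "full_pm_space X" "full_pm_space Y"
  shows "class_of X = class_of Y"
proof (rule pm_class_eqI)
  have p: "pm_space Y" "pm_space X" using assms full_pm_space_imp_pm_space by blast+
  have "pm_iso (rep_pm_class (class_of X)) X" using pm_iso_sym[OF pm_iso_class_of[OF assms(2)]] p by simp
  then have "pm_iso (rep_pm_class (class_of X)) Y" using pm_iso_trans[OF _ assms(1) pm_space_rep p(2,1)] by blast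
  then show "pm_iso (rep_pm_class (class_of X)) (rep_pm_class (class_of Y))"
    using pm_iso_trans[OF _ pm_iso_class_of[OF assms(3)] pm_space_rep p(1) pm_space_rep] by blast
qed

lemma box_class_class_of_less:
  assumes "box_ok X Y \<epsilon>" "\<epsilon> < e" "0 \<le> \<epsilon>" "full_pm_space X" "full_pm_space Y"
  shows "box_class (class_of X) (class_of Y) < e"
proof -
  have p: "pm_space Y" "pm_space X" using assms full_pm_space_imp_pm_space by blast+
  \<comment> \<open>Passing to the two representatives takes two applications of the triangle
    inequality, each costing one \<open>\<delta>\<close>; a quarter of the gap keeps the total
    strictly below \<open>e\<close>.\<close>
  define \<delta> where "\<delta> = (e - \<epsilon>) / 4"
  have \<delta>: "\<delta> > 0" using assms by (simp add: \<delta>_def)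
  have "box_ok (rep_pm_class (class_of X)) Y (0 + \<epsilon> + \<delta>)"
    by (rule box_ok_triangle[OF box_ok_sym[OF pm_iso_box_ok[OF pm_iso_class_of[OF assms(4)]]] assms(1) \<delta>]) (use p in auto)
  then have "box_ok (rep_pm_class (class_of X)) (rep_pm_class (class_of Y)) (0 + \<epsilon> + \<delta> + 0 + \<delta>)"
    by (rule box_ok_triangle[OF _ pm_iso_box_ok[OF pm_iso_class_of[OF assms(5)]] \<delta>]) (use p in auto)
  then show ?thesis unfolding box_class_less_iff
    using \<delta> assms(2,3) by (intro exI[of _ "0 + \<epsilon> + \<delta> + 0 + \<delta>"]) (auto simp: \<delta>_def field_simps)
qed

subsection \<open>Restriction to the support\<close>

definition supp_pm :: "'a metric_measure \<Rightarrow> 'a metric_measure" where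
  "supp_pm X = (submetric (fst X) (pm_support X), restrict_space (snd X) (pm_support X))"

lemma pm_support_subset: "pm_support X \<subseteq> mspace (fst X)"
  unfolding pm_support_def by blast

lemma closedin_pm_support: "closedin (mtopology_of (fst X)) (pm_support X)"
  unfolding closedin_def
proof
  have "\<exists>T. openin (mtopology_of (fst X)) T \<and> x \<in> T \<and> T \<subseteq> topspace (mtopology_of (fst X)) - pm_support X"
    if x: "x \<in> topspace (mtopology_of (fst X)) - pm_support X" for x
  proof -
    obtain T where T: "openin (mtopology_of (fst X)) T" "x \<in> T" "\<not> emeasure (snd X) T > 0"
      using x unfolding pm_support_def by auto
    moreover have "T \<subseteq> topspace (mtopology_of (fst X)) - pm_support X"
      using T(1,3) openin_subset[OF T(1)] unfolding pm_support_def by blast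
    ultimately show ?thesis by blast
  qed
  then show "openin (mtopology_of (fst X)) (topspace (mtopology_of (fst X)) - pm_support X)"
    by (subst openin_subopen) blast
qed (simp add: pm_support_subset)

lemma pm_support_sets: "pm_space X \<Longrightarrow> pm_support X \<in> sets (snd X)"
proof -
  assume X: "pm_space X"
  have "mspace (fst X) - pm_support X \<in> sets (snd X)"
    using pm_space_openin_sets[OF X] closedin_pm_support[of X] unfolding closedin_def by simp
  then have "space (snd X) - (mspace (fst X) - pm_support X) \<in> sets (snd X)" by blast
  moreover have "space (snd X) - (mspace (fst X) - pm_support X) = pm_support X"
    using X pm_support_subset[of X] unfolding pm_space_def by blast
  ultimately show ?thesis by simp
qed

lemma small_ball_between:
  assumes x: "dense_seq d x" and U: "openin (mtopology_of d) U" "y \<in> U"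
  shows "\<exists>k n. y \<in> mball_of d (x k) (1 / (real n + 1)) \<and> mball_of d (x k) (1 / (real n + 1)) \<subseteq> U"
proof -
  obtain r where r: "r > 0" "mball_of d y r \<subseteq> U" using U unfolding openin_mtopology_of by auto
  have ym: "y \<in> mspace d" using U openin_subset[OF U(1)] by auto
  obtain n :: nat where n: "1 / (real n + 1) < r / 2"
    using r(1) by (metis half_gt_zero nat_approx_posE of_nat_Suc add.commute)
  have "0 < 1 / (real n + 1)" by simp
  from dense_seqD[OF x ym this] obtain k where k: "mdist d (x k) y < 1 / (real n + 1)" by (elim exE)
  have xk: "x k \<in> mspace d" using x unfolding dense_seq_def by auto
  have "mball_of d (x k) (1 / (real n + 1)) \<subseteq> mball_of d y r"
  proof
    fix z assume z: "z \<in> mball_of d (x k) (1 / (real n + 1))"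
    then have zm: "z \<in> mspace d" "mdist d (x k) z < 1 / (real n + 1)" by auto
    have "mdist d y z \<le> mdist d y (x k) + mdist d (x k) z"
      using ym xk zm(1) by (rule mdist_triangle)
    then have "mdist d y z < r" using k zm(2) n mdist_commute[of d y "x k"] by linarith
    then show "z \<in> mball_of d y r" using zm ym by simp
  qed
  moreover have "y \<in> mball_of d (x k) (1 / (real n + 1))" using k xk ym by simp
  ultimately show ?thesis using r(2) by blast
qed

text \<open>Every point outside the support lies in a null ball of the countable family centred at
  the dense sequence, so the complement of the support is covered by countably many null
  sets.\<close>

lemma emeasure_pm_support:
  assumes X: "pm_space X"
  shows "emeasure (snd X) (pm_support X) = 1"
proof -
  interpret P: prob_space "snd X" using X unfolding pm_space_def by blast
  obtain x where x: "dense_seq (fst X) x" using pm_space_dense_seq[OF X] by blast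
  let ?B = "\<lambda>(k,n). mball_of (fst X) (x k) (1 / (real n + 1))"
  let ?J = "{p :: nat \<times> nat. emeasure (snd X) (?B p) = 0}"
  have B: "?B p \<in> sets (snd X)" for p
    using pm_space_openin_sets[OF X openin_mball_of] by (cases p) simp
  have N: "(\<Union>p\<in>?J. ?B p) \<in> null_sets (snd X)"
  proof (rule null_sets_UN')
    fix p assume "p \<in> ?J"
    then show "?B p \<in> null_sets (snd X)" using B[of p] by (intro null_setsI) simp_all
  qed simp
  have "space (snd X) - pm_support X \<subseteq> (\<Union>p\<in>?J. ?B p)"
  proof
    fix y assume "y \<in> space (snd X) - pm_support X"
    then have "y \<in> mspace (fst X)" "y \<notin> pm_support X" using X unfolding pm_space_def by auto
    then obtain T where T: "openin (mtopology_of (fst X)) T" "y \<in> T" "\<not> emeasure (snd X) T > 0"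
      unfolding pm_support_def by auto
    obtain k n where kn: "y \<in> ?B (k,n)" "?B (k,n) \<subseteq> T" using small_ball_between[OF x T(1,2)] by auto
    have "emeasure (snd X) (?B (k,n)) \<le> emeasure (snd X) T"
      using kn(2) pm_space_openin_sets[OF X T(1)] by (rule emeasure_mono)
    then have "emeasure (snd X) (?B (k,n)) = 0" using T(3) by simp
    then show "y \<in> (\<Union>p\<in>?J. ?B p)" using kn(1) by blast
  qed
  then have "{y \<in> space (snd X). \<not> y \<in> pm_support X} \<subseteq> (\<Union>p\<in>?J. ?B p)"
    by (simp only: set_diff_eq)
  then have "AE y in snd X. y \<in> pm_support X"
    by (rule AE_I'[OF N])
  then have "P.prob (pm_support X) = 1"
    using P.AE_in_set_eq_1[OF pm_support_sets[OF X]] by simp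
  then show ?thesis by (simp add: P.emeasure_eq_measure)
qed

text \<open>The given dense points may all miss \<open>S\<close>. For each pair (k, n) a point of
  \<open>S\<close> within 1/(n+1) of \<open>x k\<close> is chosen if there is one, and the fixed
  point \<open>s0\<close> otherwise.\<close>

lemma dense_seq_subset:
  assumes x: "dense_seq d x" and S: "S \<subseteq> mspace d" "S \<noteq> {}"
  shows "\<exists>y. dense_seq (submetric d S) y"
proof -
  obtain s0 where s0: "s0 \<in> S" using S(2) by blast
  define y where "y i = (let (k,n) = prod_decode i in
      if \<exists>z\<in>S. mdist d (x k) z < 1 / (real n + 1) then SOME z. z \<in> S \<and> mdist d (x k) z < 1 / (real n + 1) else s0)" for i
  have yS: "y i \<in> S" for i
  proof -
    obtain k n where kn: "prod_decode i = (k,n)" by fastforce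
    show ?thesis
    proof (cases "\<exists>z\<in>S. mdist d (x k) z < 1 / (real n + 1)")
      case True
      then have "\<exists>z. z \<in> S \<and> mdist d (x k) z < 1 / (real n + 1)" by blast
      from someI_ex[OF this] show ?thesis using True by (simp add: y_def kn)
    qed (simp add: y_def kn s0)
  qed
  have "\<exists>i. mdist d (y i) z < e" if z: "z \<in> S" "0 < e" for z e
  proof -
    have zm: "z \<in> mspace d" using z S by blast
    obtain n :: nat where n: "1 / (real n + 1) < e / 2"
      using z(2) by (metis half_gt_zero nat_approx_posE of_nat_Suc add.commute)
    have "0 < 1 / (real n + 1)" by simp
    from dense_seqD[OF x zm this] obtain k where k: "mdist d (x k) z < 1 / (real n + 1)" by (elim exE)
    have exz: "\<exists>z. z \<in> S \<and> mdist d (x k) z < 1 / (real n + 1)" using k z(1) by (intro exI[of _ z] conjI)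
    have "y (prod_encode (k,n)) = (SOME z. z \<in> S \<and> mdist d (x k) z < 1 / (real n + 1))"
      using k z(1) unfolding y_def prod_encode_inverse by auto
    with someI_ex[OF exz] have y: "mdist d (x k) (y (prod_encode (k,n))) < 1 / (real n + 1)" by simp
    have "range x \<subseteq> mspace d" using x by (simp add: dense_seq_def)
    then have "x k \<in> mspace d" by blast
    moreover have "y (prod_encode (k,n)) \<in> mspace d" using yS S by blast
    ultimately have "mdist d (y (prod_encode (k,n))) z \<le> mdist d (y (prod_encode (k,n))) (x k) + mdist d (x k) z"
      using zm by (intro mdist_triangle)
    then have "mdist d (y (prod_encode (k,n))) z < e"
      using y k n mdist_commute[of d "y (prod_encode (k,n))" "x k"] by linarith
    then show ?thesis by blast
  qed
  moreover have "range y \<subseteq> S \<inter> mspace d" using yS S(1) by blast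
  ultimately have "dense_seq (submetric d S) y"
    unfolding dense_seq_def mspace_submetric mdist_submetric by simp
  then show ?thesis by blast
qed

text \<open>Balls of the submetric are traces of open sets, which gives one inclusion; the inclusion
  map is continuous, hence Borel, which gives the other.\<close>

lemma sets_restrict_borel_sigma:
  assumes X: "pm_space X" and S: "S \<in> sets (snd X)" "S \<noteq> {}"
  shows "sets (restrict_space (snd X) S) = sets (borel_sigma (submetric (fst X) S))"
proof (rule antisym)
  have SM: "S \<subseteq> mspace (fst X)" using sets.sets_into_space[OF S(1)] X unfolding pm_space_def by simp
  have spR: "space (restrict_space (snd X) S) = S"
    using sets.sets_into_space[OF S(1)] by (simp add: space_restrict_space Int_absorb2)
  have open_sub: "openin (mtopology_of (submetric (fst X) S)) U \<longleftrightarrow> (\<exists>T. openin (mtopology_of (fst X)) T \<and> U = T \<inter> S)" for U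
    unfolding mtopology_of_submetric openin_subtopology by blast
  obtain x where "dense_seq (fst X) x" using pm_space_dense_seq[OF X] by blast
  then obtain y where y: "dense_seq (submetric (fst X) S) y" using dense_seq_subset SM S(2) by blast
  show "sets (borel_sigma (submetric (fst X) S)) \<subseteq> sets (restrict_space (snd X) S)"
  proof (rule sets_borel_sigma_subset[OF y])
    show "space (restrict_space (snd X) S) = mspace (submetric (fst X) S)"
      using SM by (simp add: spR Int_absorb2)
    fix k r
    obtain T where "openin (mtopology_of (fst X)) T" "mball_of (submetric (fst X) S) (y k) r = T \<inter> S"
      using openin_mball_of[of "submetric (fst X) S"] unfolding open_sub by blast
    then show "mball_of (submetric (fst X) S) (y k) r \<in> sets (restrict_space (snd X) S)"
      using pm_space_openin_sets[OF X] S by (auto simp: sets_restrict_space_iff)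
  qed
  have "(\<lambda>x. x) \<in> measurable (borel_sigma (submetric (fst X) S)) (snd X)"
  proof (rule measurable_borel_sigmaI)
    show "sets (snd X) = sets (borel_sigma (fst X))" using X unfolding pm_space_def by blast
    show "(\<lambda>x. x) \<in> space (borel_sigma (submetric (fst X) S)) \<rightarrow> mspace (fst X)"
      by (auto simp: space_borel_sigma)
    fix U assume "openin (mtopology_of (fst X)) U"
    then have "openin (mtopology_of (submetric (fst X) S)) (U \<inter> S)" unfolding open_sub by blast
    moreover have "(\<lambda>x. x) -` U \<inter> space (borel_sigma (submetric (fst X) S)) = U \<inter> S"
      using SM by (auto simp: space_borel_sigma)
    moreover have "{U. openin (mtopology_of (submetric (fst X) S)) U} \<subseteq> Pow (mspace (submetric (fst X) S))"
      using openin_subset by force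
    ultimately show "(\<lambda>x. x) -` U \<inter> space (borel_sigma (submetric (fst X) S)) \<in> sets (borel_sigma (submetric (fst X) S))"
      unfolding borel_sigma_def by (auto simp: sets_measure_of intro: sigma_sets.Basic)
  qed
  from measurable_sets[OF this] have "U \<inter> S \<in> sets (borel_sigma (submetric (fst X) S))" if "U \<in> sets (snd X)" for U
    using that SM by (auto simp: space_borel_sigma Int_absorb2)
  then show "sets (restrict_space (snd X) S) \<subseteq> sets (borel_sigma (submetric (fst X) S))"
    by (auto simp: sets_restrict_space Int_commute)
qed

text \<open>The support is closed, hence complete, and has full measure. A relatively open set
  around a support point is the trace of an open set of positive mass, and taking the trace loses no
  mass.\<close>

lemma full_pm_space_supp_pm:
  assumes X: "pm_space X"
  shows "full_pm_space (supp_pm X)"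
proof -
  let ?S = "pm_support X"
  interpret P: prob_space "snd X" using X unfolding pm_space_def by blast
  have S: "?S \<in> sets (snd X)" by (rule pm_support_sets[OF X])
  have SM: "?S \<subseteq> mspace (fst X)" by (rule pm_support_subset)
  have Sne: "?S \<noteq> {}" using emeasure_pm_support[OF X] by (metis emeasure_empty zero_neq_one)
  note S = S SM Sne
  obtain x where "dense_seq (fst X) x" using pm_space_dense_seq[OF X] by blast
  then obtain y where y: "dense_seq (submetric (fst X) ?S) y" using dense_seq_subset S by blast
  interpret Sub: Submetric "mspace (fst X)" "mdist (fst X)" ?S
    by (auto simp: Submetric_def Submetric_axioms_def S(2))
  have "Sub.sub.mcomplete"
    using closedin_pm_support[of X] X
    by (intro Sub.closedin_mcomplete_imp_mcomplete) (auto simp: pm_space_def mcomplete_of_def mtopology_of_def)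
  then have comp: "mcomplete_of (submetric (fst X) ?S)"
    unfolding mcomplete_of_def using S(2) by (simp add: Int_absorb2)
  have spR: "space (restrict_space (snd X) ?S) = ?S"
    using sets.sets_into_space[OF S(1)] by (simp add: space_restrict_space Int_absorb2)
  have "prob_space (restrict_space (snd X) ?S)"
    using S(1) emeasure_pm_support[OF X] spR
    by (intro prob_spaceI) (simp add: emeasure_restrict_space)
  then have pm: "pm_space (supp_pm X)"
    unfolding pm_space_def supp_pm_def fst_conv snd_conv
    using comp dense_seq_separable[OF y] spR S sets_restrict_borel_sigma[OF X S(1,3)] by (simp add: Int_absorb2)
  have "mspace (fst (supp_pm X)) \<subseteq> pm_support (supp_pm X)"
  proof
    fix y assume "y \<in> mspace (fst (supp_pm X))"
    then have y: "y \<in> ?S" by (simp add: supp_pm_def)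
    have "emeasure (restrict_space (snd X) ?S) U > 0"
      if U: "openin (mtopology_of (submetric (fst X) ?S)) U" "y \<in> U" for U
    proof -
      obtain T where T: "openin (mtopology_of (fst X)) T" "U = T \<inter> ?S"
        using U(1) unfolding mtopology_of_submetric openin_subtopology by blast
      have TM: "T \<in> sets (snd X)" using pm_space_openin_sets[OF X T(1)] .
      have "emeasure (restrict_space (snd X) ?S) U = emeasure (snd X) (T \<inter> ?S)"
        using T S(1) by (subst emeasure_restrict_space) auto
      also have "\<dots> = emeasure (snd X) T"
      proof (rule emeasure_eq_AE)
        have "AE z in snd X. z \<in> ?S" using emeasure_pm_support[OF X] P.AE_in_set_eq_1[OF S(1)]
          by (simp add: measure_def)
        then show "AE z in snd X. z \<in> T \<inter> ?S \<longleftrightarrow> z \<in> T" by eventually_elim auto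
      qed (use TM S(1) in auto)
      also have "\<dots> > 0" using y T U(2) unfolding pm_support_def by auto
      finally show ?thesis .
    qed
    then show "y \<in> pm_support (supp_pm X)"
      using y S(2) unfolding pm_support_def[of "supp_pm X"] by (auto simp: supp_pm_def)
  qed
  then show ?thesis
    unfolding full_pm_space_def using pm pm_support_subset[of "supp_pm X"] by blast
qed

section \<open>Scaling\<close>

lemma pm_space_scale_pm: "t > 0 \<Longrightarrow> pm_space X \<Longrightarrow> pm_space (scale_pm t X)"
  by (auto simp: pm_space_def scale_pm_def borel_sigma_def
      mspace_scale_metric mtopology_of_scale_metric mcomplete_of_scale_metric)

lemma scale_pm_simps:
  assumes "t > 0"
  shows "mspace (fst (scale_pm t X)) = mspace (fst X)" "mdist (fst (scale_pm t X)) x y = t * mdist (fst X) x y"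
    "snd (scale_pm t X) = snd X"
  using assms by (simp_all add: scale_pm_def mspace_scale_metric mdist_scale_metric)

lemma lip_le_scale_pm:
  assumes "t > 0" "lip_le Y X"
  shows "lip_le (scale_pm t Y) (scale_pm t X)"
  using assms(2) unfolding lip_le_def one_lipschitz_def scale_pm_simps[OF assms(1)]
  using assms(1) by auto

lemma pm_iso_scale_pm:
  assumes "t > 0" "pm_iso X Y"
  shows "pm_iso (scale_pm t X) (scale_pm t Y)"
  using assms(2) unfolding pm_iso_def scale_pm_simps[OF assms(1)] by metis

lemma pm_iso_scale_scale:
  assumes "s > 0" "t > 0"
  shows "pm_iso (scale_pm s (scale_pm t X)) (scale_pm (s * t) X)"
proof -
  have "s * t > 0" using assms by simp
  then show ?thesis
    unfolding pm_iso_def scale_pm_simps[OF assms(1)] scale_pm_simps[OF assms(2)] scale_pm_simps[OF \<open>s * t > 0\<close>]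
    by (intro exI[of _ "\<lambda>x. x"]) (auto simp: bij_betw_def distr_id2)
qed

lemma pm_iso_scale_one: "pm_iso (scale_pm 1 X) X"
  unfolding pm_iso_def scale_pm_simps[OF zero_less_one]
  by (intro exI[of _ "\<lambda>x. x"]) (auto simp: bij_betw_def distr_id2)

lemma box_ok_scale_pm:
  assumes "box_ok X Y \<epsilon>" "pm_space X" "pm_space Y" "t > 0" "t \<le> u" "1 \<le> u"
  shows "box_ok (scale_pm t X) (scale_pm t Y) (u * \<epsilon>)"
  by (rule box_ok_lip_transport[OF assms(1), of _ _ "\<lambda>x. x" t "\<lambda>x. x"])
     (use assms in \<open>simp_all add: pm_space_scale_pm scale_pm_simps distr_id2\<close>)

text \<open>The identity couples a space with its scaled copy. On a ball of large radius, which
  carries almost all the mass, distances are bounded and so change uniformly little.\<close>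

lemma box_ok_scale_near_one:
  assumes X: "pm_space X" and e: "\<epsilon> > 0"
  shows "\<exists>\<eta>>0. \<forall>t>0. \<bar>t - 1\<bar> < \<eta> \<longrightarrow> box_ok (scale_pm t X) X \<epsilon>"
proof -
  interpret P: prob_space "snd X" using X unfolding pm_space_def by blast
  have spX: "space (snd X) = mspace (fst X)" using X unfolding pm_space_def by blast
  obtain x0 where x0: "x0 \<in> mspace (fst X)" using pm_space_nonempty[OF X] by blast
  have dm [measurable]: "mdist (fst X) x0 \<in> borel_measurable (snd X)" by (rule mdist_borel_measurable[OF X x0])
  define A where "A n = {y \<in> space (snd X). mdist (fst X) x0 y \<le> real n}" for n
  have [measurable]: "A n \<in> sets (snd X)" for n unfolding A_def by measurable
  have "(\<lambda>n. P.prob (A n)) \<longlonglongrightarrow> P.prob (\<Union>n. A n)"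
    by (rule P.finite_Lim_measure_incseq) (auto simp: A_def incseq_def)
  moreover have "(\<Union>n. A n) = space (snd X)"
    by (auto simp: A_def intro: real_arch_simple)
  ultimately have "(\<lambda>n. P.prob (A n)) \<longlonglongrightarrow> 1" using P.prob_space by simp
  then have "eventually (\<lambda>n. 1 - \<epsilon> < P.prob (A n)) sequentially"
    using e by (intro order_tendstoD(1)) auto
  then obtain n where n: "1 - \<epsilon> \<le> P.prob (A n)"
    using eventually_happens'[OF sequentially_bot] less_imp_le by blast
  \<comment> \<open>Distances inside \<open>A n\<close> are at most 2n; adding 1 keeps the quotient
    defined for n = 0.\<close>
  define \<eta> where "\<eta> = \<epsilon> / (2 * real n + 1)"
  have \<eta>: "\<eta> > 0" "\<eta> * (2 * real n) \<le> \<epsilon>"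
    using e by (auto simp: \<eta>_def field_simps)
  have "box_ok (scale_pm t X) X \<epsilon>" if t: "t > 0" "\<bar>t - 1\<bar> < \<eta>" for t
  proof (rule box_okI[where \<Omega>="snd X" and A="\<lambda>x. x" and B="\<lambda>x. x" and S="A n"])
    show "lebesgue_image (snd X)" by (rule pm_space_lebesgue_image[OF X])
    fix y z assume yz: "y \<in> A n" "z \<in> A n"
    then have m: "y \<in> mspace (fst X)" "z \<in> mspace (fst X)" "mdist (fst X) x0 y \<le> real n" "mdist (fst X) x0 z \<le> real n"
      by (auto simp: A_def spX)
    then have "mdist (fst X) y z \<le> 2 * real n"
      using mdist_triangle[OF m(1) x0 m(2)] mdist_commute[of "fst X" y x0] by linarith
    then have "\<bar>t - 1\<bar> * mdist (fst X) y z \<le> \<eta> * (2 * real n)"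
      using t by (intro mult_mono) auto
    moreover have "\<bar>t * mdist (fst X) y z - mdist (fst X) y z\<bar> = \<bar>t - 1\<bar> * mdist (fst X) y z"
      using abs_mult[of "t - 1" "mdist (fst X) y z"] by (simp add: left_diff_distrib)
    ultimately show "\<bar>mdist (fst (scale_pm t X)) y z - mdist (fst X) y z\<bar> \<le> \<epsilon>"
      using \<eta>(2) by (simp add: scale_pm_simps[OF t(1)])
  qed (use n P.prob_space_axioms in \<open>simp_all add: scale_pm_simps[OF t(1)] distr_id2\<close>)
  then show ?thesis using \<eta>(1) by blast
qed

definition scale_class :: "real \<Rightarrow> pm_class \<Rightarrow> pm_class" where
  "scale_class t X = class_of (scale_pm t (rep_pm_class X))"

lemma full_pm_space_scale_rep: "t > 0 \<Longrightarrow> full_pm_space (scale_pm t (rep_pm_class X))"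
  by (intro full_pm_space_scale_pm full_pm_space_rep)

lemma scale_pyramid_eq: "t > 0 \<Longrightarrow> scale_pyramid t P = scale_class t ` P"
  unfolding scale_pyramid_def scale_class_def
  by (intro image_cong refl abs_pm_class_eq full_pm_space_scale_rep)

lemma pm_iso_scale_class: "t > 0 \<Longrightarrow> pm_iso (scale_pm t (rep_pm_class X)) (rep_pm_class (scale_class t X))"
  unfolding scale_class_def by (intro pm_iso_class_of full_pm_space_scale_rep)

lemma scale_class_inverse:
  assumes "t > 0"
  shows "scale_class (1 / t) (scale_class t X) = X"
proof -
  let ?X = "rep_pm_class X"
  have t: "1 / t > 0" using assms by simp
  have p: "pm_space (scale_pm t ?X)" "pm_space (scale_pm (1/t) (scale_pm t ?X))" "pm_space (scale_pm 1 ?X)"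
    using assms t by (intro pm_space_scale_pm pm_space_rep; simp)+
  have f: "full_pm_space (scale_pm t ?X)" "full_pm_space (scale_pm (1/t) (scale_pm t ?X))"
    using assms t by (intro full_pm_space_scale_pm full_pm_space_rep; simp)+
  have "class_of (scale_pm (1/t) (rep_pm_class (scale_class t X))) = class_of (scale_pm (1/t) (scale_pm t ?X))"
    by (rule class_of_cong[OF pm_iso_scale_pm[OF t pm_iso_scale_class[OF assms]] f(2) full_pm_space_scale_rep[OF t], symmetric])
  also have "pm_iso (scale_pm (1/t) (scale_pm t ?X)) (scale_pm 1 ?X)"
    using pm_iso_scale_scale[OF t assms, of ?X] assms by simp
  then have "pm_iso (scale_pm (1/t) (scale_pm t ?X)) ?X"
    by (rule pm_iso_trans[OF _ pm_iso_scale_one p(2,3) pm_space_rep])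
  then have "class_of (scale_pm (1/t) (scale_pm t ?X)) = class_of ?X"
    by (rule class_of_cong[OF _ f(2) full_pm_space_rep])
  finally show ?thesis unfolding scale_class_def[of "1/t"] by (simp add: class_of_rep)
qed

lemma box_class_scale_class_near_one:
  assumes "e > 0"
  shows "\<exists>\<eta>>0. \<forall>t>0. \<bar>t - 1\<bar> < \<eta> \<longrightarrow> box_class X (scale_class t X) < e"
proof -
  obtain \<eta> where \<eta>: "\<eta> > 0" "\<And>t. t > 0 \<Longrightarrow> \<bar>t - 1\<bar> < \<eta> \<Longrightarrow> box_ok (scale_pm t (rep_pm_class X)) (rep_pm_class X) (e/2)"
    using box_ok_scale_near_one[of "rep_pm_class X" "e/2"] assms by auto
  have "box_class X (scale_class t X) < e" if "t > 0" "\<bar>t - 1\<bar> < \<eta>" for t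
    using box_class_class_of_less[OF box_ok_sym[OF \<eta>(2)[OF that]], of e] assms full_pm_space_rep full_pm_space_scale_rep[OF that(1)]
    by (simp add: class_of_rep scale_class_def)
  then show ?thesis using \<eta>(1) by blast
qed

lemma box_class_scale_class_less:
  assumes "box_class X Y < e / u" "t > 0" "t \<le> u" "1 \<le> u"
  shows "box_class (scale_class t X) (scale_class t Y) < e"
proof -
  obtain \<delta> where d: "\<delta> > 0" "\<delta> < e / u" "box_ok (rep_pm_class X) (rep_pm_class Y) \<delta>"
    using assms(1) unfolding box_class_less_iff by blast
  have "box_ok (scale_pm t (rep_pm_class X)) (scale_pm t (rep_pm_class Y)) (u * \<delta>)"
    by (rule box_ok_scale_pm[OF d(3)]) (use assms in auto)
  moreover have "u * \<delta> < e" "0 \<le> u * \<delta>" using d assms by (auto simp: field_simps)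
  ultimately show ?thesis
    unfolding scale_class_def using full_pm_space_scale_rep[OF assms(2)] by (intro box_class_class_of_less)
qed

section \<open>Powers\<close>

lemma fst_power_pm [simp]: "fst (power_pm n X) = power_metric n (fst X)"
  and snd_power_pm [simp]: "snd (power_pm n X) = PiM {..<n} (\<lambda>_. snd X)"
  by (simp_all add: power_pm_def)

lemma mdist_power_le_sum: "mdist (power_metric n d) x y \<le> (\<Sum>i<n. mdist d (x i) (y i))"
  unfolding mdist_power_metric using L2_set_le_sum[of "{..<n}" "\<lambda>i. mdist d (x i) (y i)"]
  by (simp add: L2_set_def)

lemma mdist_component_le_power:
  assumes "i < n"
  shows "mdist d (x i) (y i) \<le> mdist (power_metric n d) x y"
  unfolding mdist_power_metric using member_le_L2_set[of "{..<n}" i "\<lambda>i. mdist d (x i) (y i)"] assms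
  by (simp add: L2_set_def)

text \<open>The l2-distance is bounded crudely by the sum of the coordinate distances; dividing by n
  + 1 rather than n makes the estimate strict and covers n = 0.\<close>

lemma mdist_power_less:
  assumes "\<And>i. i < n \<Longrightarrow> mdist d (x i) (y i) < e / (real n + 1)" "e > 0"
  shows "mdist (power_metric n d) x y < e"
proof -
  have "mdist (power_metric n d) x y \<le> (\<Sum>i<n. mdist d (x i) (y i))" by (rule mdist_power_le_sum)
  also have "\<dots> \<le> (\<Sum>i<n. e / (real n + 1))" using assms(1) by (intro sum_mono less_imp_le) auto
  also have "\<dots> = real n * (e / (real n + 1))" by simp
  also have "\<dots> < e" using assms(2) by (simp add: field_simps)
  finally show ?thesis .
qed

lemma pm_support_pos:
  "x \<in> pm_support X \<Longrightarrow> openin (mtopology_of (fst X)) U \<Longrightarrow> x \<in> U \<Longrightarrow> 0 < emeasure (snd X) U"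
  unfolding pm_support_def by simp

text \<open>Coordinates are 1-Lipschitz, and every l2-ball contains a product of balls of radius
  r/(n+1). So the l2-metric induces the product topology, separability identifies its Borel sets
  with the product sigma-algebra, completeness is checked coordinatewise, and full support follows
  from the positive mass of products of balls.\<close>

lemma full_pm_space_power_pm:
  assumes X: "full_pm_space X"
  shows "full_pm_space (power_pm n X)"
proof -
  have Xp: "pm_space X" using X by (rule full_pm_space_imp_pm_space)
  define d where "d = fst X"
  define M where "M = snd X"
  interpret M: prob_space M using Xp unfolding pm_space_def M_def by blast
  interpret PM: product_prob_space "\<lambda>_. M" "{..<n}" by unfold_locales
  have spM: "space M = mspace d" using Xp unfolding pm_space_def M_def d_def by blast
  let ?e = "power_metric n d"
  let ?N = "PiM {..<n} (\<lambda>_. M)"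
  have spN: "space ?N = mspace ?e" by (simp add: space_PiM spM mspace_power_metric)
  obtain x where x: "dense_seq d x" using pm_space_dense_seq[OF Xp] unfolding d_def by blast
  have xm: "x k \<in> mspace d" for k using x by (auto simp: dense_seq_def)
  define C where "C = PiE {..<n} (\<lambda>_. range x)"
  have C: "countable C" "C \<subseteq> mspace ?e" "C \<noteq> {}"
    unfolding C_def mspace_power_metric using xm by (auto intro!: countable_PiE PiE_mono simp: PiE_eq_empty_iff)
  have near: "\<exists>c\<in>C. mdist ?e c y < e" if y: "y \<in> mspace ?e" and e: "e > 0" for y e
  proof -
    have "\<exists>k. mdist d (x k) (y i) < e / (real n + 1)" if "i < n" for i
      using y that e by (intro dense_seqD[OF x]) (auto simp: mspace_power_metric PiE_mem)
    then obtain k where k: "\<And>i. i < n \<Longrightarrow> mdist d (x (k i)) (y i) < e / (real n + 1)" by metis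
    have "mdist ?e (\<lambda>i\<in>{..<n}. x (k i)) y < e" using k e by (intro mdist_power_less) auto
    moreover have "(\<lambda>i\<in>{..<n}. x (k i)) \<in> C" unfolding C_def by auto
    ultimately show ?thesis by blast
  qed
  have ran: "range (from_nat_into C) = C" using C by (intro range_from_nat_into)
  have ds: "dense_seq ?e (from_nat_into C)"
    unfolding dense_seq_def ran
  proof (intro conjI ballI allI impI C(2))
    fix y e assume "y \<in> mspace ?e" "0 < (e::real)"
    from near[OF this] obtain c where "c \<in> C" "mdist ?e c y < e" by blast
    then show "\<exists>k. mdist ?e (from_nat_into C k) y < e" using ran by (metis rangeE)
  qed
  have sub1: "sets (borel_sigma ?e) \<subseteq> sets ?N"
  proof (rule sets_borel_sigma_subset[OF ds spN])
    fix k r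
    define c where "c = from_nat_into C k"
    have cm: "c \<in> mspace ?e" using ran C(2) unfolding c_def by blast
    then have "c i \<in> mspace d" if "i < n" for i using that by (auto simp: mspace_power_metric)
    then have [measurable]: "(\<lambda>y. mdist d (c i) (y i)) \<in> borel_measurable ?N" if "i \<in> {..<n}" for i
      using that mdist_borel_measurable[OF Xp, of "c i"] unfolding M_def d_def
      by (intro measurable_compose[OF measurable_component_singleton[OF that]]) auto
    have dm: "mdist ?e c \<in> borel_measurable ?N"
      unfolding mdist_power_metric by measurable
    have "mball_of ?e c r = mdist ?e c -` {..<r} \<inter> space ?N" unfolding spN using cm by auto
    then show "mball_of ?e (from_nat_into C k) r \<in> sets ?N"
      unfolding c_def[symmetric] using measurable_sets[OF dm, of "{..<r}"] by simp
  qed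
  have proj: "(\<lambda>y. y i) \<in> measurable (borel_sigma ?e) M" if i: "i \<in> {..<n}" for i
  proof (rule measurable_borel_sigmaI[where d=d])
    show "sets M = sets (borel_sigma d)" using Xp unfolding pm_space_def M_def d_def by blast
    show "(\<lambda>y. y i) \<in> space (borel_sigma ?e) \<rightarrow> mspace d"
      using i by (auto simp: space_borel_sigma mspace_power_metric)
    fix U assume U: "openin (mtopology_of d) U"
    have "openin (mtopology_of ?e) ((\<lambda>y. y i) -` U \<inter> mspace ?e)"
      unfolding openin_mtopology_of
    proof (intro conjI ballI)
      fix y assume y: "y \<in> (\<lambda>y. y i) -` U \<inter> mspace ?e"
      then obtain r where r: "r > 0" "mball_of d (y i) r \<subseteq> U" using U unfolding openin_mtopology_of by auto
      have "mball_of ?e y r \<subseteq> (\<lambda>y. y i) -` U \<inter> mspace ?e"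
      proof
        fix z assume z: "z \<in> mball_of ?e y r"
        then have zm: "z \<in> mspace ?e" "y \<in> mspace ?e" "mdist ?e y z < r" by auto
        have "mdist d (y i) (z i) < r" using mdist_component_le_power[of i n d y z] zm(3) i by simp
        moreover have "y i \<in> mspace d" "z i \<in> mspace d" using zm i by (auto simp: mspace_power_metric)
        ultimately have "z i \<in> U" using r(2) by auto
        then show "z \<in> (\<lambda>y. y i) -` U \<inter> mspace ?e" using zm by simp
      qed
      then show "\<exists>r>0. mball_of ?e y r \<subseteq> (\<lambda>y. y i) -` U \<inter> mspace ?e" using r(1) by blast
    qed simp
    moreover have "{U. openin (mtopology_of ?e) U} \<subseteq> Pow (mspace ?e)" using openin_subset by force
    ultimately show "(\<lambda>y. y i) -` U \<inter> space (borel_sigma ?e) \<in> sets (borel_sigma ?e)"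
      unfolding space_borel_sigma unfolding borel_sigma_def by (simp add: sets_measure_of sigma_sets.Basic)
  qed
  have "(\<lambda>y. \<lambda>i\<in>{..<n}. y i) \<in> measurable (borel_sigma ?e) ?N"
    by (rule measurable_restrict[OF proj])
  then have "(\<lambda>y. y) \<in> measurable (borel_sigma ?e) ?N"
    by (rule measurable_cong[THEN iffD1, rotated]) (auto simp: space_borel_sigma mspace_power_metric PiE_restrict)
  note idm = this
  have "U \<in> sets (borel_sigma ?e)" if "U \<in> sets ?N" for U
  proof -
    have "U \<inter> mspace ?e = U" using sets.sets_into_space[OF that] unfolding spN by (rule Int_absorb2)
    then show ?thesis using measurable_sets[OF idm that] by (simp add: space_borel_sigma)
  qed
  then have setsN: "sets ?N = sets (borel_sigma ?e)" using sub1 by blast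
  have comp: "mcomplete_of ?e"
    unfolding mcomplete_of_def Metric_space.mcomplete_def[OF Metric_space_mspace_mdist]
  proof (intro allI impI)
    fix \<sigma> assume \<sigma>: "Metric_space.MCauchy (mspace ?e) (mdist ?e) \<sigma>"
    then have \<sigma>m: "\<sigma> k \<in> mspace ?e" for k
      unfolding Metric_space.MCauchy_def[OF Metric_space_mspace_mdist] by auto
    have \<sigma>mi: "\<sigma> k i \<in> mspace d" if "i < n" for k i using \<sigma>m[of k] that by (auto simp: mspace_power_metric)
    have "\<exists>l. limitin (mtopology_of d) (\<lambda>k. \<sigma> k i) l sequentially" if i: "i < n" for i
    proof -
      have "Metric_space.MCauchy (mspace d) (mdist d) (\<lambda>k. \<sigma> k i)"
        unfolding Metric_space.MCauchy_def[OF Metric_space_mspace_mdist]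
      proof (intro conjI allI impI)
        show "range (\<lambda>k. \<sigma> k i) \<subseteq> mspace d" using \<sigma>mi[OF i] by auto
        fix e :: real assume "0 < e"
        then obtain N where "\<And>k k'. N \<le> k \<Longrightarrow> N \<le> k' \<Longrightarrow> mdist ?e (\<sigma> k) (\<sigma> k') < e"
          using \<sigma> unfolding Metric_space.MCauchy_def[OF Metric_space_mspace_mdist] by metis
        then show "\<exists>N. \<forall>k k'. N \<le> k \<longrightarrow> N \<le> k' \<longrightarrow> mdist d (\<sigma> k i) (\<sigma> k' i) < e"
          using mdist_component_le_power[OF i, of d] le_less_trans by meson
      qed
      then show ?thesis
        using Xp unfolding pm_space_def mcomplete_of_def Metric_space.mcomplete_def[OF Metric_space_mspace_mdist] d_def[symmetric] mtopology_of_def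
        by blast
    qed
    then obtain l where l: "\<And>i. i < n \<Longrightarrow> limitin (mtopology_of d) (\<lambda>k. \<sigma> k i) (l i) sequentially" by metis
    define l' where "l' = (\<lambda>i\<in>{..<n}. l i)"
    have lm: "l i \<in> mspace d" if "i < n" for i
      using l[OF that] unfolding mtopology_of_def Metric_space.limit_metric_sequentially[OF Metric_space_mspace_mdist] by blast
    have "limitin (Metric_space.mtopology (mspace ?e) (mdist ?e)) \<sigma> l' sequentially"
      unfolding Metric_space.limitin_metric[OF Metric_space_mspace_mdist]
    proof (intro conjI allI impI)
      show l'm: "l' \<in> mspace ?e" using lm by (auto simp: mspace_power_metric l'_def)
      fix e :: real assume e: "e > 0"
      have "\<forall>\<^sub>F k in sequentially. \<forall>i\<in>{..<n}. mdist d (\<sigma> k i) (l i) < e / (real n + 1)"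
      proof (rule eventually_ball_finite)
        show "\<forall>i\<in>{..<n}. \<forall>\<^sub>F k in sequentially. mdist d (\<sigma> k i) (l i) < e / (real n + 1)"
        proof
          fix i assume i: "i \<in> {..<n}"
          have "e / (real n + 1) > 0" using e by simp
          then show "\<forall>\<^sub>F k in sequentially. mdist d (\<sigma> k i) (l i) < e / (real n + 1)"
            using l[of i] i unfolding mtopology_of_def Metric_space.limitin_metric[OF Metric_space_mspace_mdist]
            by (auto elim: eventually_mono)
        qed
      qed simp
      then show "\<forall>\<^sub>F k in sequentially. \<sigma> k \<in> mspace ?e \<and> mdist ?e (\<sigma> k) l' < e"
        by eventually_elim (use \<sigma>m e in \<open>auto simp: l'_def intro!: mdist_power_less\<close>)
    qed
    then show "\<exists>l. limitin (Metric_space.mtopology (mspace ?e) (mdist ?e)) \<sigma> l sequentially" by blast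
  qed
  have pm: "pm_space (power_pm n X)"
    unfolding pm_space_def fst_power_pm snd_power_pm d_def[symmetric] M_def[symmetric]
    using comp dense_seq_separable[OF ds] spN setsN PM.prob_space_axioms by blast
  have "mspace ?e \<subseteq> pm_support (power_pm n X)"
  proof
    fix y assume y: "y \<in> mspace ?e"
    have "emeasure ?N U > 0" if U: "openin (mtopology_of ?e) U" "y \<in> U" for U
    proof -
      obtain r where r: "r > 0" "mball_of ?e y r \<subseteq> U" using U unfolding openin_mtopology_of by auto
      have yi: "y i \<in> mspace d" if "i < n" for i using y that by (auto simp: mspace_power_metric)
      let ?B = "\<lambda>i. mball_of d (y i) (r / (real n + 1))"
      have B: "?B i \<in> sets M" for i using pm_space_openin_sets[OF Xp openin_mball_of] unfolding M_def d_def .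
      have pos: "emeasure M (?B i) > 0" if "i < n" for i
      proof -
        have "y i \<in> pm_support X" using X yi[OF that] unfolding full_pm_space_def d_def by metis
        moreover have "y i \<in> ?B i" using yi[OF that] r(1) by simp
        moreover have "openin (mtopology_of (fst X)) (?B i)" unfolding d_def by (rule openin_mball_of)
        ultimately show ?thesis unfolding M_def using pm_support_pos by metis
      qed
      have "PiE {..<n} ?B \<subseteq> U"
      proof
        fix z assume z: "z \<in> PiE {..<n} ?B"
        then have zi: "z i \<in> ?B i" if "i < n" for i using that by (auto simp: PiE_def Pi_def)
        have "z \<in> mspace ?e" using z by (auto simp: mspace_power_metric PiE_def Pi_def)
        moreover have "mdist ?e y z < r" using zi r(1) by (intro mdist_power_less) auto
        ultimately show "z \<in> U" using r(2) y by auto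
      qed
      moreover have "U \<in> sets ?N"
        using pm_space_openin_sets[OF pm, of U] U(1) by (simp add: d_def M_def)
      ultimately have "emeasure ?N (PiE {..<n} ?B) \<le> emeasure ?N U" by (rule emeasure_mono)
      moreover have "emeasure ?N (PiE {..<n} ?B) = (\<Prod>i<n. emeasure M (?B i))"
        by (rule PM.emeasure_PiM) (use B in auto)
      moreover have "(\<Prod>i<n. emeasure M (?B i)) > 0"
        using pos by (simp add: zero_less_iff_neq_zero)
      ultimately show ?thesis by simp
    qed
    then show "y \<in> pm_support (power_pm n X)" using y unfolding pm_support_def by (auto simp: d_def M_def)
  qed
  then show ?thesis
    unfolding full_pm_space_def using pm pm_support_subset[of "power_pm n X"] by (auto simp: d_def)
qed

lemma lip_le_power_pm:
  assumes "lip_le Y X" "pm_space X" "pm_space Y"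
  shows "lip_le (power_pm n Y) (power_pm n X)"
proof -
  obtain f where f: "one_lipschitz (fst X) (fst Y) f" "distr (snd X) (snd Y) f = snd Y"
    using assms(1) unfolding lip_le_def by blast
  have m: "f \<in> measurable (snd X) (snd Y)" by (rule one_lipschitz_measurable[OF f(1) assms(2,3)])
  have p: "prob_space (snd X)" "prob_space (snd Y)" using assms unfolding pm_space_def by blast+
  have "one_lipschitz (power_metric n (fst X)) (power_metric n (fst Y)) (compose {..<n} f)"
    unfolding one_lipschitz_def
  proof (intro conjI ballI)
    show "compose {..<n} f \<in> mspace (power_metric n (fst X)) \<rightarrow> mspace (power_metric n (fst Y))"
      using f(1) by (auto simp: mspace_power_metric one_lipschitz_def compose_def PiE_def Pi_def)
    fix x y assume "x \<in> mspace (power_metric n (fst X))" "y \<in> mspace (power_metric n (fst X))"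
    then have "x i \<in> mspace (fst X)" "y i \<in> mspace (fst X)" if "i < n" for i
      using that by (auto simp: mspace_power_metric)
    then have "mdist (fst Y) (f (x i)) (f (y i)) \<le> mdist (fst X) (x i) (y i)" if "i < n" for i
      using that f(1) unfolding one_lipschitz_def by blast
    then show "mdist (power_metric n (fst Y)) (compose {..<n} f x) (compose {..<n} f y) \<le> mdist (power_metric n (fst X)) x y"
      unfolding mdist_power_metric by (auto intro!: real_sqrt_le_mono sum_mono power_mono simp: compose_def)
  qed
  moreover have "distr (PiM {..<n} (\<lambda>_. snd X)) (PiM {..<n} (\<lambda>_. snd Y)) (compose {..<n} f) = PiM {..<n} (\<lambda>_. snd Y)"
    using distr_PiM_finite_prob_space'[of "{..<n}" "\<lambda>_. snd X" "\<lambda>_. snd Y" f] p m f(2) by simp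
  ultimately show ?thesis unfolding lip_le_def by auto
qed

lemma scale_power_pm:
  assumes t: "t > 0"
  shows "scale_pm t (power_pm n X) = power_pm n (scale_pm t X)"
proof -
  have "sqrt (\<Sum>i<n. (t * mdist (fst X) (x i) (y i))\<^sup>2) = t * sqrt (\<Sum>i<n. (mdist (fst X) (x i) (y i))\<^sup>2)" for x y
    using t by (simp add: power_mult_distrib real_sqrt_mult flip: sum_distrib_left)
  then have "power_metric n (scale_metric t (fst X)) = scale_metric t (power_metric n (fst X))"
    unfolding scale_metric_def[of t "power_metric n (fst X)"] mspace_power_metric mdist_power_metric
    unfolding power_metric_def mspace_scale_metric[OF t] mdist_scale_metric[OF t] by simp
  then show ?thesis unfolding power_pm_def scale_pm_def by simp
qed

lemma infinite_power_mono:
  assumes "lip_le Y X" "full_pm_space X" "full_pm_space Y"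
  shows "infinite_power Y \<subseteq> infinite_power X"
proof -
  note p = full_pm_space_imp_pm_space
  have "pyramid_of (power_pm n Y) \<subseteq> pyramid_of (power_pm n X)" for n
    unfolding pyramid_of_def
    using lip_le_trans[OF _ lip_le_power_pm[OF assms(1) p[OF assms(2)] p[OF assms(3)]]
        p[OF full_pm_space_power_pm[OF assms(2)]] p[OF full_pm_space_power_pm[OF assms(3)]] pm_space_rep] by blast
  then show ?thesis unfolding infinite_power_def by (intro box_closure_mono UN_mono) auto
qed

lemma box_closure_infinite_power: "box_closure (infinite_power X) = infinite_power X"
  unfolding infinite_power_def by (rule box_closure_idem)

text \<open>Scaling commutes with powers, so it maps the spaces below powers of \<open>X\<close> to
  spaces below powers of \<open>X'\<close>. The closure survives because scaling is Lipschitz for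
  the box distance.\<close>

lemma scale_class_infinite_power:
  assumes Y: "Y \<in> infinite_power X" and t: "t > 0" and X': "lip_le (scale_pm t X) X'"
    and f: "full_pm_space X" "full_pm_space X'"
  shows "scale_class t Y \<in> infinite_power X'"
  unfolding infinite_power_def box_closure_def
proof (intro CollectI allI impI)
  note p = full_pm_space_imp_pm_space
  fix e :: real assume e: "e > 0"
  \<comment> \<open>The Lipschitz factor of scaling for the box distance is not \<open>t\<close> but
    \<open>max 1 t\<close>, since the exceptional measure does not scale.\<close>
  define u where "u = max 1 t"
  have u: "t \<le> u" "1 \<le> u" "e / u > 0" using e by (auto simp: u_def)
  obtain Z where Z: "Z \<in> (\<Union>n\<in>{1..}. pyramid_of (power_pm n X))" "box_class Y Z < e / u"
    using in_box_closureD[OF _ u(3)] Y unfolding infinite_power_def by blast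
  then obtain n where n: "n \<in> {1..}" "lip_le (rep_pm_class Z) (power_pm n X)"
    unfolding pyramid_of_def by auto
  have fs: "full_pm_space (scale_pm t X)" by (rule full_pm_space_scale_pm[OF t f(1)])
  have "lip_le (scale_pm t (rep_pm_class Z)) (power_pm n (scale_pm t X))"
    using lip_le_scale_pm[OF t n(2)] unfolding scale_power_pm[OF t] .
  then have "lip_le (scale_pm t (rep_pm_class Z)) (power_pm n X')"
    by (rule lip_le_trans[OF _ lip_le_power_pm[OF X' p[OF f(2)] p[OF fs]]])
       (intro p full_pm_space_power_pm f fs full_pm_space_scale_rep t)+
  then have "lip_le (rep_pm_class (scale_class t Z)) (power_pm n X')"
    by (rule lip_le_trans[OF lip_le_class_of(1)[OF full_pm_space_scale_rep[OF t], folded scale_class_def]])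
       (intro p full_pm_space_power_pm f full_pm_space_scale_rep t full_pm_space_rep)+
  then have "scale_class t Z \<in> (\<Union>n\<in>{1..}. pyramid_of (power_pm n X'))"
    using n(1) unfolding pyramid_of_def by blast
  moreover have "box_class (scale_class t Y) (scale_class t Z) < e"
    by (rule box_class_scale_class_less[OF Z(2) t u(1,2)])
  ultimately show "\<exists>Z\<in>\<Union>n\<in>{1..}. pyramid_of (power_pm n X'). box_class (scale_class t Y) Z < e" by blast
qed

section \<open>Gaussian measures\<close>

abbreviation gauss :: "real \<Rightarrow> real measure" where
  "gauss \<sigma> \<equiv> density lborel (\<lambda>x. ennreal (normal_density 0 \<sigma> x))"

lemma gaussian_line_simps [simp]: "fst (gaussian_line \<sigma>) = euclidean_metric" "snd (gaussian_line \<sigma>) = gauss \<sigma>"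
  by (simp_all add: gaussian_line_def)

lemma prob_space_gauss: "\<sigma> > 0 \<Longrightarrow> prob_space (gauss \<sigma>)"
  by (rule prob_space_normal_density)

section \<open>Rotation invariance of Gaussian products\<close>

lemma normal_density_rotate:
  assumes "c\<^sup>2 + s\<^sup>2 = 1"
  shows "normal_density 0 \<sigma> (c * x + s * y) * normal_density 0 \<sigma> (c * y - s * x) = normal_density 0 \<sigma> x * normal_density 0 \<sigma> y"
proof -
  have neg: "- A / D + - B / D = - (A + B) / D" for A B D :: real by (simp add: diff_divide_distrib)
  have "(c * x + s * y)\<^sup>2 + (c * y - s * x)\<^sup>2 = (c\<^sup>2 + s\<^sup>2) * (x\<^sup>2 + y\<^sup>2)"
    by (simp add: power2_eq_square algebra_simps)
  then have "(c * x + s * y)\<^sup>2 + (c * y - s * x)\<^sup>2 = x\<^sup>2 + y\<^sup>2" using assms by simp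
  then have "- (c * x + s * y)\<^sup>2 / (2 * \<sigma>\<^sup>2) + - (c * y - s * x)\<^sup>2 / (2 * \<sigma>\<^sup>2) = - x\<^sup>2 / (2 * \<sigma>\<^sup>2) + - y\<^sup>2 / (2 * \<sigma>\<^sup>2)"
    using neg[of "(c * x + s * y)\<^sup>2" "2 * \<sigma>\<^sup>2" "(c * y - s * x)\<^sup>2"] neg[of "x\<^sup>2" "2 * \<sigma>\<^sup>2" "y\<^sup>2"] by metis
  then show ?thesis
    by (simp add: normal_density_def mult_exp_exp)
qed

text \<open>The rotation is split into two one-variable substitutions: u = c x + s y for fixed y,
  and after exchanging the integrals v = (y - s u)/c for fixed u. Their Jacobians 1/c and c cancel;
  the division is the reason for \<open>c > 0\<close>.\<close>

lemma nn_integral_rotate_lborel: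
  fixes F :: "real \<times> real \<Rightarrow> ennreal"
  assumes [measurable]: "F \<in> borel_measurable (lborel \<Otimes>\<^sub>M lborel)" and c: "c > 0" "c\<^sup>2 + s\<^sup>2 = 1"
  shows "(\<integral>\<^sup>+ y. \<integral>\<^sup>+ x. F (c * x + s * y, c * y - s * x) \<partial>lborel \<partial>lborel) = (\<integral>\<^sup>+ x. \<integral>\<^sup>+ y. F (x, y) \<partial>lborel \<partial>lborel)"
proof -
  have 1: "(\<integral>\<^sup>+ x. F (c * x + s * y, c * y - s * x) \<partial>lborel) = ennreal (1 / c) * (\<integral>\<^sup>+ u. F (u, (y - s * u) / c) \<partial>lborel)" for y
  proof -
    have "(\<integral>\<^sup>+ x. F (c * x + s * y, c * y - s * x) \<partial>lborel)
        = \<bar>1 / c\<bar> * (\<integral>\<^sup>+ u. F (c * (- (s * y / c) + 1 / c * u) + s * y, c * y - s * (- (s * y / c) + 1 / c * u)) \<partial>lborel)"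
      by (rule nn_integral_real_affine[where t="- (s * y / c)" and c="1/c"]) (use c in auto)
    also have "(\<lambda>u. F (c * (- (s * y / c) + 1 / c * u) + s * y, c * y - s * (- (s * y / c) + 1 / c * u))) = (\<lambda>u. F (u, (y - s * u) / c))"
    proof (intro ext arg_cong[where f=F])
      fix u
      have "c * (- (s * y / c) + 1 / c * u) + s * y = u" using c by (simp add: field_simps)
      moreover have "c * y - s * (- (s * y / c) + 1 / c * u) = ((c\<^sup>2 + s\<^sup>2) * y - s * u) / c"
        using c(1) by (simp add: field_simps power2_eq_square)
      ultimately show "(c * (- (s * y / c) + 1 / c * u) + s * y, c * y - s * (- (s * y / c) + 1 / c * u)) = (u, (y - s * u) / c)"
        using c(2) by simp
    qed
    finally show ?thesis using c by simp
  qed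
  have "(\<integral>\<^sup>+ y. \<integral>\<^sup>+ x. F (c * x + s * y, c * y - s * x) \<partial>lborel \<partial>lborel)
      = (\<integral>\<^sup>+ y. \<integral>\<^sup>+ u. ennreal (1 / c) * F (u, (y - s * u) / c) \<partial>lborel \<partial>lborel)"
    unfolding 1 by (simp add: nn_integral_cmult)
  also have "\<dots> = (\<integral>\<^sup>+ u. \<integral>\<^sup>+ y. ennreal (1 / c) * F (u, (y - s * u) / c) \<partial>lborel \<partial>lborel)"
    by (rule lborel_pair.Fubini'[symmetric]) measurable
  also have "\<dots> = (\<integral>\<^sup>+ u. \<integral>\<^sup>+ v. F (u, v) \<partial>lborel \<partial>lborel)"
  proof (rule nn_integral_cong)
    fix u :: real
    have "(\<integral>\<^sup>+ y. ennreal (1 / c) * F (u, (y - s * u) / c) \<partial>lborel)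
       = \<bar>c\<bar> * (\<integral>\<^sup>+ v. ennreal (1 / c) * F (u, ((s * u + c * v) - s * u) / c) \<partial>lborel)"
      by (rule nn_integral_real_affine) (use c in auto)
    also have "\<dots> = ennreal c * (ennreal (1 / c) * (\<integral>\<^sup>+ v. F (u, v) \<partial>lborel))"
      using c by (simp add: nn_integral_cmult)
    also have "\<dots> = (\<integral>\<^sup>+ v. F (u, v) \<partial>lborel)"
      using c by (simp add: mult.assoc[symmetric] ennreal_mult[symmetric])
    finally show "(\<integral>\<^sup>+ y. ennreal (1 / c) * F (u, (y - s * u) / c) \<partial>lborel) = (\<integral>\<^sup>+ v. F (u, v) \<partial>lborel)" .
  qed
  finally show ?thesis .
qed

definition rot2 :: "real \<Rightarrow> real \<Rightarrow> real \<times> real \<Rightarrow> real \<times> real" where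
  "rot2 c s p = (c * fst p + s * snd p, c * snd p - s * fst p)"

lemma rot2_measurable [measurable]: "rot2 c s \<in> measurable (borel \<Otimes>\<^sub>M borel) (borel \<Otimes>\<^sub>M borel)"
  unfolding rot2_def by measurable

text \<open>Both the joint density and Lebesgue measure on the plane are invariant under
  rotation.\<close>

lemma distr_rot2_gauss:
  assumes \<sigma>: "\<sigma> > 0" and c: "c > 0" "c\<^sup>2 + s\<^sup>2 = 1"
  shows "distr (gauss \<sigma> \<Otimes>\<^sub>M gauss \<sigma>) (gauss \<sigma> \<Otimes>\<^sub>M gauss \<sigma>) (rot2 c s) = gauss \<sigma> \<Otimes>\<^sub>M gauss \<sigma>" (is "?L = ?R")
proof (rule measure_eqI)
  let ?f = "\<lambda>x. ennreal (normal_density 0 \<sigma> x)"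
  interpret N: prob_space "gauss \<sigma>" using \<sigma> by (rule prob_space_gauss)
  interpret NN: pair_prob_space "gauss \<sigma>" "gauss \<sigma>" ..
  have s: "sets (gauss \<sigma> \<Otimes>\<^sub>M gauss \<sigma>) = sets (borel \<Otimes>\<^sub>M borel)" by (intro sets_pair_measure_cong) auto
  have rm: "rot2 c s \<in> measurable (gauss \<sigma> \<Otimes>\<^sub>M gauss \<sigma>) (gauss \<sigma> \<Otimes>\<^sub>M gauss \<sigma>)"
    using rot2_measurable measurable_cong_sets[OF s s] by blast
  fix A assume "A \<in> sets ?L"
  then have AN: "A \<in> sets (gauss \<sigma> \<Otimes>\<^sub>M gauss \<sigma>)" by simp
  then have A [measurable]: "A \<in> sets (borel \<Otimes>\<^sub>M borel)" unfolding s .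
  have dbl: "(\<integral>\<^sup>+ p. g p \<partial>(gauss \<sigma> \<Otimes>\<^sub>M gauss \<sigma>)) = (\<integral>\<^sup>+ y. \<integral>\<^sup>+ x. ?f x * ?f y * g (x, y) \<partial>lborel \<partial>lborel)"
    if g [measurable]: "g \<in> borel_measurable (borel \<Otimes>\<^sub>M borel)" for g :: "real \<times> real \<Rightarrow> ennreal"
  proof -
    have g': "g \<in> borel_measurable (gauss \<sigma> \<Otimes>\<^sub>M gauss \<sigma>)" using g measurable_cong_sets[OF s refl] by blast
    have "(\<integral>\<^sup>+ p. g p \<partial>(gauss \<sigma> \<Otimes>\<^sub>M gauss \<sigma>)) = (\<integral>\<^sup>+ y. \<integral>\<^sup>+ x. g (x, y) \<partial>gauss \<sigma> \<partial>gauss \<sigma>)"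
      by (rule NN.nn_integral_snd[symmetric, OF g'])
    also have "\<dots> = (\<integral>\<^sup>+ y. ?f y * (\<integral>\<^sup>+ x. ?f x * g (x, y) \<partial>lborel) \<partial>lborel)"
      by (subst nn_integral_density; (subst nn_integral_density)?; measurable?)
    also have "\<dots> = (\<integral>\<^sup>+ y. \<integral>\<^sup>+ x. ?f x * ?f y * g (x, y) \<partial>lborel \<partial>lborel)"
      by (simp add: nn_integral_cmult[symmetric] ac_simps)
    finally show ?thesis .
  qed
  define F where "F p = ?f (fst p) * ?f (snd p) * indicator A p" for p :: "real \<times> real"
  have [measurable]: "F \<in> borel_measurable (lborel \<Otimes>\<^sub>M lborel)" unfolding F_def by measurable
  have "emeasure ?L A = emeasure (gauss \<sigma> \<Otimes>\<^sub>M gauss \<sigma>) (rot2 c s -` A \<inter> space (gauss \<sigma> \<Otimes>\<^sub>M gauss \<sigma>))"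
    by (rule emeasure_distr[OF rm AN])
  also have "\<dots> = (\<integral>\<^sup>+ p. indicator A (rot2 c s p) \<partial>(gauss \<sigma> \<Otimes>\<^sub>M gauss \<sigma>))"
    unfolding nn_integral_indicator[OF measurable_sets[OF rm AN], symmetric]
    by (rule nn_integral_cong) (simp split: split_indicator)
  also have "\<dots> = (\<integral>\<^sup>+ y. \<integral>\<^sup>+ x. ?f x * ?f y * indicator A (rot2 c s (x, y)) \<partial>lborel \<partial>lborel)"
    by (rule dbl) measurable
  also have "\<dots> = (\<integral>\<^sup>+ y. \<integral>\<^sup>+ x. F (c * x + s * y, c * y - s * x) \<partial>lborel \<partial>lborel)"
    by (simp add: F_def rot2_def normal_density_rotate[OF c(2)] flip: ennreal_mult)
  also have "\<dots> = (\<integral>\<^sup>+ x. \<integral>\<^sup>+ y. F (x, y) \<partial>lborel \<partial>lborel)"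
    by (rule nn_integral_rotate_lborel[OF _ c]) measurable
  also have "\<dots> = (\<integral>\<^sup>+ y. \<integral>\<^sup>+ x. F (x, y) \<partial>lborel \<partial>lborel)"
    by (rule lborel_pair.Fubini'[symmetric]) measurable
  also have "\<dots> = (\<integral>\<^sup>+ p. indicator A p \<partial>(gauss \<sigma> \<Otimes>\<^sub>M gauss \<sigma>))"
    unfolding F_def fst_conv snd_conv by (rule dbl[symmetric]) measurable
  finally show "emeasure ?L A = emeasure ?R A" using AN by simp
qed simp

text \<open>It regroups a pair of vectors into a vector of pairs, so that a planar rotation can act
  in each coordinate. On boxes the two measures agree because the slice at \<open>x\<close> of the
  preimage of a box is again a box.\<close>

lemma distr_zip_PiM:
  assumes M: "prob_space M" and I: "finite I"
  shows "distr (PiM I (\<lambda>_. M) \<Otimes>\<^sub>M PiM I (\<lambda>_. M)) (PiM I (\<lambda>_. M \<Otimes>\<^sub>M M)) (\<lambda>(x, y). \<lambda>i\<in>I. (x i, y i)) = PiM I (\<lambda>_. M \<Otimes>\<^sub>M M)"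
proof -
  interpret M: prob_space M by fact
  interpret MM: pair_prob_space M M ..
  interpret P1: product_prob_space "\<lambda>_. M" I by unfold_locales
  interpret P2: product_prob_space "\<lambda>_. M \<Otimes>\<^sub>M M" I by unfold_locales
  let ?P = "PiM I (\<lambda>_. M)" and ?Z = "\<lambda>(x, y). \<lambda>i\<in>I. (x i, y i)"
  interpret PP: pair_prob_space ?P ?P ..
  have Z: "?Z \<in> measurable (?P \<Otimes>\<^sub>M ?P) (PiM I (\<lambda>_. M \<Otimes>\<^sub>M M))"
    unfolding case_prod_beta by measurable
  show ?thesis
  proof (rule P2.PiM_eqI[OF I])
    fix A assume A: "\<And>i. i \<in> I \<Longrightarrow> A i \<in> sets (M \<Otimes>\<^sub>M M)"
    have As: "PiE I A \<in> sets (PiM I (\<lambda>_. M \<Otimes>\<^sub>M M))" using I A by (intro sets_PiM_I_finite) auto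
    let ?Q = "?Z -` PiE I A \<inter> space (?P \<Otimes>\<^sub>M ?P)"
    have Q: "?Q \<in> sets (?P \<Otimes>\<^sub>M ?P)" by (rule measurable_sets[OF Z As])
    have "emeasure (distr (?P \<Otimes>\<^sub>M ?P) (PiM I (\<lambda>_. M \<Otimes>\<^sub>M M)) ?Z) (PiE I A) = emeasure (?P \<Otimes>\<^sub>M ?P) ?Q"
      by (rule emeasure_distr[OF Z As])
    also have "\<dots> = (\<integral>\<^sup>+ x. emeasure ?P (Pair x -` ?Q) \<partial>?P)"
      by (rule P1.emeasure_pair_measure_alt[OF Q])
    also have "\<dots> = (\<integral>\<^sup>+ x. (\<Prod>i\<in>I. emeasure M (Pair (x i) -` A i)) \<partial>?P)"
    proof (rule nn_integral_cong)
      fix x assume x: "x \<in> space ?P"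
      have "Pair x -` ?Q = PiE I (\<lambda>i. Pair (x i) -` A i)"
      proof (intro equalityI subsetI)
        fix y assume "y \<in> Pair x -` ?Q"
        then have y: "y \<in> space ?P" "\<And>i. i \<in> I \<Longrightarrow> (x i, y i) \<in> A i"
          using x by (auto simp: space_pair_measure PiE_iff)
        then show "y \<in> PiE I (\<lambda>i. Pair (x i) -` A i)" by (auto simp: space_PiM PiE_iff)
      next
        fix y assume y: "y \<in> PiE I (\<lambda>i. Pair (x i) -` A i)"
        then have "(x i, y i) \<in> space (M \<Otimes>\<^sub>M M)" if "i \<in> I" for i
          using sets.sets_into_space[OF A[OF that]] that by (auto simp: PiE_iff)
        then show "y \<in> Pair x -` ?Q" using x y by (auto simp: space_pair_measure space_PiM PiE_iff)
      qed
      also have "emeasure ?P \<dots> = (\<Prod>i\<in>I. emeasure M (Pair (x i) -` A i))"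
        using A by (intro P1.emeasure_PiM I sets_Pair1) auto
      finally show "emeasure ?P (Pair x -` ?Q) = (\<Prod>i\<in>I. emeasure M (Pair (x i) -` A i))" .
    qed
    also have "\<dots> = (\<Prod>i\<in>I. \<integral>\<^sup>+ t. emeasure M (Pair t -` A i) \<partial>M)"
      using A by (intro P1.product_nn_integral_prod I M.measurable_emeasure_Pair) auto
    also have "\<dots> = (\<Prod>i\<in>I. emeasure (M \<Otimes>\<^sub>M M) (A i))"
      using A by (intro prod.cong refl M.emeasure_pair_measure_alt[symmetric])
    finally show "emeasure (distr (?P \<Otimes>\<^sub>M ?P) (PiM I (\<lambda>_. M \<Otimes>\<^sub>M M)) ?Z) (PiE I A) = (\<Prod>i\<in>I. emeasure (M \<Otimes>\<^sub>M M) (A i))" .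
  qed simp
qed

text \<open>The restriction keeps linear combinations inside the extensional functions that form the
  space of the finite product.\<close>

definition comb :: "nat \<Rightarrow> real \<Rightarrow> (nat \<Rightarrow> real) \<Rightarrow> real \<Rightarrow> (nat \<Rightarrow> real) \<Rightarrow> nat \<Rightarrow> real" where
  "comb n c x s y = (\<lambda>i\<in>{..<n}. c * x i + s * y i)"

text \<open>Zip the two vectors, rotate every pair, and unzip: the first and the last operation are
  mutually inverse on the underlying space, and the middle one preserves the law of pairs.\<close>

lemma distr_rotate_gauss_power:
  fixes n :: nat
  assumes \<sigma>: "\<sigma> > 0" and c: "c > 0" "c\<^sup>2 + s\<^sup>2 = 1"
  defines "P \<equiv> PiM {..<n} (\<lambda>_. gauss \<sigma>)"
  shows "distr (P \<Otimes>\<^sub>M P) (P \<Otimes>\<^sub>M P) (\<lambda>(x, y). (comb n c x s y, comb n (- s) x c y)) = P \<Otimes>\<^sub>M P"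
proof -
  let ?N = "gauss \<sigma>" and ?I = "{..<n}"
  interpret N: prob_space ?N using \<sigma> by (rule prob_space_gauss)
  interpret NN: pair_prob_space ?N ?N ..
  interpret P1: product_prob_space "\<lambda>_. ?N" ?I by unfold_locales
  let ?P2 = "PiM ?I (\<lambda>_. ?N \<Otimes>\<^sub>M ?N)"
  let ?Z = "\<lambda>(x, y). \<lambda>i\<in>?I. (x i, y i) :: real \<times> real"
  let ?U = "\<lambda>z. (\<lambda>i\<in>?I. fst (z i :: real \<times> real), \<lambda>i\<in>?I. snd (z i))"
  have Z: "?Z \<in> measurable (P \<Otimes>\<^sub>M P) ?P2"
    unfolding case_prod_beta P_def by measurable
  have U: "?U \<in> measurable ?P2 (P \<Otimes>\<^sub>M P)"
    unfolding P_def by measurable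
  have s: "sets (?N \<Otimes>\<^sub>M ?N) = sets (borel \<Otimes>\<^sub>M borel)" by (intro sets_pair_measure_cong) auto
  have rm: "rot2 c s \<in> measurable (?N \<Otimes>\<^sub>M ?N) (?N \<Otimes>\<^sub>M ?N)"
    using rot2_measurable measurable_cong_sets[OF s s] by blast
  have R: "compose ?I (rot2 c s) \<in> measurable ?P2 ?P2"
    unfolding compose_def
    by (rule measurable_restrict, rule measurable_compose[OF _ rm], rule measurable_component_singleton)
  have dZ: "distr (P \<Otimes>\<^sub>M P) ?P2 ?Z = ?P2"
    unfolding P_def by (rule distr_zip_PiM) (auto intro: N.prob_space_axioms)
  have dR: "distr ?P2 ?P2 (compose ?I (rot2 c s)) = ?P2"
    using distr_PiM_finite_prob_space'[of ?I "\<lambda>_. ?N \<Otimes>\<^sub>M ?N" "\<lambda>_. ?N \<Otimes>\<^sub>M ?N" "rot2 c s"] rm distr_rot2_gauss[OF assms(1-3)]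
      NN.prob_space_axioms by simp
  have spP: "space P = PiE ?I (\<lambda>_. UNIV)" unfolding P_def by (simp add: space_PiM)
  have "distr (P \<Otimes>\<^sub>M P) (P \<Otimes>\<^sub>M P) (\<lambda>(x, y). (comb n c x s y, comb n (- s) x c y))
      = distr (P \<Otimes>\<^sub>M P) (P \<Otimes>\<^sub>M P) (?U \<circ> (compose ?I (rot2 c s) \<circ> ?Z))"
    by (rule distr_cong) (auto simp: comb_def rot2_def compose_def fun_eq_iff)
  also have "\<dots> = distr ?P2 (P \<Otimes>\<^sub>M P) ?U"
    using distr_distr[OF U measurable_comp[OF Z R]] distr_distr[OF R Z] dZ dR by simp
  also have "\<dots> = distr (P \<Otimes>\<^sub>M P) (P \<Otimes>\<^sub>M P) (?U \<circ> ?Z)"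
    using distr_distr[OF U Z] dZ by simp
  also have "\<dots> = distr (P \<Otimes>\<^sub>M P) (P \<Otimes>\<^sub>M P) (\<lambda>z. z)"
    by (rule distr_cong) (auto simp: space_pair_measure spP PiE_def extensional_def fun_eq_iff)
  finally show ?thesis by (simp add: distr_id2)
qed

text \<open>A linear form in independent centred Gaussians is Gaussian with deviation \<sigma>|v|,
  and a centred Gaussian of deviation \<tau> has mean absolute value \<tau> sqrt(2/pi). Zero
  coefficients are discarded beforehand, since a degenerate summand has no normal density.\<close>

lemma nn_integral_abs_linear_gauss:
  fixes v :: "nat \<Rightarrow> real"
  assumes \<sigma>: "\<sigma> > 0" and v: "(\<Sum>i<n. (v i)\<^sup>2) \<le> 1"
  shows "(\<integral>\<^sup>+ y. ennreal \<bar>\<Sum>i<n. v i * y i\<bar> \<partial>PiM {..<n} (\<lambda>_. gauss \<sigma>)) \<le> ennreal (\<sigma> * sqrt (2 / pi))"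
proof -
  let ?P = "PiM {..<n} (\<lambda>_. gauss \<sigma>)" and ?J = "{i \<in> {..<n}. v i \<noteq> 0}"
  interpret N: prob_space "gauss \<sigma>" using \<sigma> by (rule prob_space_gauss)
  interpret P: product_prob_space "\<lambda>_. gauss \<sigma>" "{..<n}" by unfold_locales
  have sJ: "(\<Sum>i<n. v i * y i) = (\<Sum>i\<in>?J. v i * y i)" for y
    by (rule sum.mono_neutral_right) auto
  show ?thesis
  proof (cases "?J = {}")
    case True
    then show ?thesis unfolding sJ by simp
  next
    case False
    define \<tau> where "\<tau> = sqrt (\<Sum>i\<in>?J. (\<bar>v i\<bar> * \<sigma>)\<^sup>2)"
    have \<tau>0: "\<tau> > 0" unfolding \<tau>_def using False \<sigma> by (auto intro!: sum_pos)
    have ind: "P.indep_vars (\<lambda>_. borel) (\<lambda>i y. y i) {..<n}"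
    proof -
      have "P.indep_vars (\<lambda>_. gauss \<sigma>) (\<lambda>i y. y i) {..<n}"
      proof -
        have ne: "{..<n} \<noteq> {}" using False by auto
        show ?thesis
        proof (subst P.indep_vars_iff_distr_eq_PiM'[OF ne])
          have "distr ?P ?P (\<lambda>x. \<lambda>i\<in>{..<n}. x i) = distr ?P ?P (\<lambda>x. x)"
            by (rule distr_cong) (auto simp: space_PiM PiE_restrict)
          moreover have "(\<Pi>\<^sub>M i\<in>{..<n}. distr ?P (gauss \<sigma>) (\<lambda>y. y i)) = ?P"
            using distr_PiM_component[of "{..<n}" "\<lambda>_. gauss \<sigma>"] N.prob_space_axioms by (intro PiM_cong refl) blast
          ultimately show "distr ?P (Pi\<^sub>M {..<n} (\<lambda>_. gauss \<sigma>)) (\<lambda>x. \<lambda>i\<in>{..<n}. x i) = (\<Pi>\<^sub>M i\<in>{..<n}. distr ?P (gauss \<sigma>) (\<lambda>y. y i))"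
            by (simp add: distr_id2)
        qed simp
      qed
      then show ?thesis
        by (rule P.indep_vars_compose2[where Y="\<lambda>_ x. x", simplified]) auto
    qed
    have "P.indep_vars (\<lambda>_. borel) (\<lambda>i y. v i * y i) ?J"
      using P.indep_vars_compose2[OF P.indep_vars_subset[OF ind, of ?J], of "\<lambda>i t. v i * t" "\<lambda>_. borel"] by auto
    moreover have "distributed ?P lborel (\<lambda>y. v i * y i) (normal_density 0 (\<bar>v i\<bar> * \<sigma>))" if i: "i \<in> ?J" for i
    proof -
      have "distr ?P (gauss \<sigma>) (\<lambda>y. y i) = gauss \<sigma>"
        using i N.prob_space_axioms by (intro distr_PiM_component) auto
      moreover have "distr ?P lborel (\<lambda>y. y i) = distr ?P (gauss \<sigma>) (\<lambda>y. y i)"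
        by (rule distr_cong) auto
      ultimately have "distributed ?P lborel (\<lambda>y. y i) (normal_density 0 \<sigma>)"
        using i unfolding distributed_def by (auto intro!: measurable_compose[OF measurable_component_singleton])
      from P.normal_density_affine[OF this \<sigma>, of "v i" 0] show ?thesis using i by simp
    qed
    ultimately have D: "distributed ?P lborel (\<lambda>y. \<Sum>i\<in>?J. v i * y i) (normal_density (\<Sum>i\<in>?J. 0) \<tau>)"
      unfolding \<tau>_def using \<sigma> False by (intro P.sum_indep_normal) auto
    have "(\<integral>\<^sup>+ y. ennreal \<bar>\<Sum>i\<in>?J. v i * y i\<bar> \<partial>?P) = (\<integral>\<^sup>+ t. ennreal (normal_density 0 \<tau> t) * ennreal \<bar>t\<bar> \<partial>lborel)"
      using distributed_nn_integral[OF D, of "\<lambda>t. ennreal \<bar>t\<bar>"] by simp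
    also have "\<dots> = (\<integral>\<^sup>+ t. ennreal (normal_density 0 \<tau> t * \<bar>t\<bar>) \<partial>lborel)"
      by (simp add: ennreal_mult)
    also have "\<dots> = ennreal (\<tau> * sqrt (2 / pi))"
    proof -
      have "has_bochner_integral lborel (\<lambda>t. normal_density 0 \<tau> t * \<bar>t\<bar>) (\<tau> * sqrt (2 / pi))"
        using normal_moment_abs_odd[OF \<tau>0, of 0 0] by simp
      then show ?thesis by (simp add: nn_integral_eq_integral has_bochner_integral_iff)
    qed
    also have "\<dots> \<le> ennreal (\<sigma> * sqrt (2 / pi))"
    proof (intro ennreal_leI mult_right_mono)
      have "(\<Sum>i\<in>?J. (\<bar>v i\<bar> * \<sigma>)\<^sup>2) = (\<Sum>i<n. (v i)\<^sup>2) * \<sigma>\<^sup>2"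
        unfolding sum_distrib_right by (rule sum.mono_neutral_cong_left) (auto simp: power_mult_distrib)
      also have "\<dots> \<le> 1 * \<sigma>\<^sup>2" using v by (intro mult_right_mono) auto
      finally show "\<tau> \<le> \<sigma>" unfolding \<tau>_def using \<sigma> by (simp add: real_le_lsqrt)
    qed simp
    finally show ?thesis unfolding sJ .
  qed
qed

section \<open>A Cheeger-type inequality for Gaussian products\<close>

abbreviation nsq :: "nat \<Rightarrow> (nat \<Rightarrow> real) \<Rightarrow> real" where
  "nsq n w \<equiv> (\<Sum>i<n. (w i)\<^sup>2)"

abbreviation gpow :: "nat \<Rightarrow> real \<Rightarrow> (nat \<Rightarrow> real) measure" where
  "gpow n \<sigma> \<equiv> PiM {..<n} (\<lambda>_. gauss \<sigma>)"

lemma space_gpow: "space (gpow n \<sigma>) = PiE {..<n} (\<lambda>_. UNIV)"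
  by (simp add: space_PiM)

lemma nsq_nonneg: "0 \<le> nsq n w"
  by (simp add: sum_nonneg)

text \<open>The second moment enters the rotation estimate only in terms of second order in the
  angle, which disappear in the limit; its finiteness is what keeps them under control.\<close>

lemma gauss_second_moment_finite:
  assumes \<sigma>: "\<sigma> > 0"
  shows "(\<integral>\<^sup>+ x. ennreal (nsq n x) \<partial>gpow n \<sigma>) < \<infinity>"
proof -
  interpret N: prob_space "gauss \<sigma>" using \<sigma> by (rule prob_space_gauss)
  have "(\<integral>\<^sup>+ t. ennreal (t\<^sup>2) \<partial>gauss \<sigma>) = (\<integral>\<^sup>+ t. ennreal (normal_density 0 \<sigma> t * t\<^sup>2) \<partial>lborel)"
    by (subst nn_integral_density) (auto simp: ennreal_mult)
  also have "\<dots> < \<infinity>"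
    using integrable_normal_moment[OF \<sigma>, of 0 2] by (simp add: integrable_iff_bounded)
  finally have fin: "(\<integral>\<^sup>+ t. ennreal (t\<^sup>2) \<partial>gauss \<sigma>) < \<infinity>" .
  have cm: "(\<lambda>x. x i) \<in> measurable (gpow n \<sigma>) (gauss \<sigma>)" if "i \<in> {..<n}" for i
    using that by (rule measurable_component_singleton)
  have "(\<integral>\<^sup>+ x. ennreal (nsq n x) \<partial>gpow n \<sigma>) = (\<integral>\<^sup>+ x. (\<Sum>i<n. ennreal ((x i)\<^sup>2)) \<partial>gpow n \<sigma>)"
    by (simp add: sum_ennreal)
  also have "\<dots> = (\<Sum>i<n. \<integral>\<^sup>+ x. ennreal ((x i)\<^sup>2) \<partial>gpow n \<sigma>)"
    by (rule nn_integral_sum) (use cm in \<open>auto intro!: measurable_compose[OF cm]\<close>)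
  also have "\<dots> = (\<Sum>i<n. \<integral>\<^sup>+ t. ennreal (t\<^sup>2) \<partial>gauss \<sigma>)"
  proof (rule sum.cong[OF refl])
    fix i assume i: "i \<in> {..<n}"
    have "(\<integral>\<^sup>+ t. ennreal (t\<^sup>2) \<partial>distr (gpow n \<sigma>) (gauss \<sigma>) (\<lambda>x. x i)) = (\<integral>\<^sup>+ x. ennreal ((x i)\<^sup>2) \<partial>gpow n \<sigma>)"
      by (rule nn_integral_distr[OF cm[OF i]]) measurable
    moreover have "distr (gpow n \<sigma>) (gauss \<sigma>) (\<lambda>x. x i) = gauss \<sigma>"
      using distr_PiM_component[of "{..<n}" "\<lambda>_. gauss \<sigma>" i] N.prob_space_axioms i by blast
    ultimately show "(\<integral>\<^sup>+ x. ennreal ((x i)\<^sup>2) \<partial>gpow n \<sigma>) = (\<integral>\<^sup>+ t. ennreal (t\<^sup>2) \<partial>gauss \<sigma>)" by simp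
  qed
  also have "\<dots> < \<infinity>" using fin by (simp add: ennreal_mult_less_top of_nat_less_top)
  finally show ?thesis .
qed

text \<open>A ramp of slope 1/\<delta> from -1 to 1 across the layer of half-width
  \<open>\<delta>\<close> around \<open>m\<close>, a Lipschitz substitute for the sign of u -
  m.\<close>

definition clamp1 :: "real \<Rightarrow> real \<Rightarrow> real \<Rightarrow> real" where
  "clamp1 m \<delta> u = max (-1) (min 1 ((u - m) / \<delta>))"

text \<open>Starting above the layer the ramp cannot rise. Starting more than
  \<open>\<kappa>\<close> below it, a rise requires b - a > \<kappa>, hence b - a is at most (b -
  a)\<up>2/\<kappa>, with the exponent denoting the square. So a first-order increment survives only
  when \<open>a\<close> is in the slightly widened layer.\<close>

lemma clamp1_increment:
  assumes "\<delta> > 0" "\<kappa> > 0"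
  shows "max 0 (clamp1 m \<delta> b - clamp1 m \<delta> a)
    \<le> (1 / \<delta>) * ((if \<bar>a - m\<bar> \<le> \<delta> + \<kappa> then max 0 (b - a) else 0) + (b - a)\<^sup>2 / \<kappa>)" (is "?L \<le> (1 / \<delta>) * (?I + ?Q)")
proof -
  have Q: "0 \<le> ?Q" using assms by simp
  have d: "1 / \<delta> > 0" using assms by simp
  show ?thesis
  proof (cases "b \<le> a")
    case True
    then have "(b - m) / \<delta> \<le> (a - m) / \<delta>" using assms by (simp add: divide_right_mono)
    then have "?L = 0" unfolding clamp1_def by simp
    then show ?thesis using Q d by simp
  next
    case False
    then have "(a - m) / \<delta> \<le> (b - m) / \<delta>" using assms by (simp add: divide_right_mono)
    then have lip: "?L \<le> (b - m) / \<delta> - (a - m) / \<delta>" unfolding clamp1_def by linarith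
    also have "\<dots> = (1 / \<delta>) * (b - a)" by (simp add: diff_divide_distrib)
    finally have lip: "?L \<le> (1 / \<delta>) * (b - a)" .
    consider "\<bar>a - m\<bar> \<le> \<delta> + \<kappa>" | "a > m + \<delta> + \<kappa>" | "a < m - \<delta> - \<kappa>" by linarith
    then show ?thesis
    proof cases
      case 1
      have "(1 / \<delta>) * (b - a) \<le> (1 / \<delta>) * (?I + ?Q)"
        using d Q 1 False by (intro mult_left_mono) auto
      then show ?thesis using lip by linarith
    next
      case 2
      then have "(a - m) / \<delta> \<ge> 1" using assms by (simp add: field_simps)
      then have "?L = 0" unfolding clamp1_def by simp
      then show ?thesis using Q d by simp
    next
      case 3
      then have a: "(a - m) / \<delta> \<le> -1" using assms by (simp add: field_simps)
      show ?thesis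
      proof (cases "b \<le> m - \<delta>")
        case True
        then have "(b - m) / \<delta> \<le> -1" using assms by (simp add: field_simps)
        then have "?L = 0" using a unfolding clamp1_def by simp
        then show ?thesis using Q d by simp
      next
        case b: False
        then have "\<kappa> * (b - a) \<le> (b - a) * (b - a)" using 3 False by (intro mult_right_mono) auto
        then have "b - a \<le> ?Q" using assms by (simp add: field_simps power2_eq_square)
        then have "(1 / \<delta>) * (b - a) \<le> (1 / \<delta>) * (?I + ?Q)"
          using d by (intro mult_left_mono) auto
        then show ?thesis using lip by linarith
      qed
    qed
  qed
qed

text \<open>The slack \<open>\<zeta>\<close> allows an infimal convolution whose infimum is not attained.\<close>

definition semiconcave_lip :: "nat \<Rightarrow> real \<Rightarrow> ((nat \<Rightarrow> real) \<Rightarrow> real) \<Rightarrow> bool" where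
  "semiconcave_lip n C G \<longleftrightarrow>
    (\<forall>x\<in>PiE {..<n} (\<lambda>_. UNIV). \<forall>\<zeta>>0. \<exists>v. nsq n v \<le> 1 \<and> (\<forall>x'\<in>PiE {..<n} (\<lambda>_. UNIV).
       G x' \<le> G x + (\<Sum>i<n. v i * (x' i - x i)) + C * nsq n (\<lambda>i. x' i - x i) + \<zeta>)) \<and>
    (\<forall>x\<in>PiE {..<n} (\<lambda>_. UNIV). \<forall>x'\<in>PiE {..<n} (\<lambda>_. UNIV). (G x' - G x)\<^sup>2 \<le> nsq n (\<lambda>i. x' i - x i))"

lemma comb_in: "comb n c x s y \<in> PiE {..<n} (\<lambda>_. UNIV)"
  unfolding comb_def by auto

lemma comb_trivial:
  "x \<in> PiE {..<n} (\<lambda>_. UNIV) \<Longrightarrow> comb n 1 x 0 y = x"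
  "y \<in> PiE {..<n} (\<lambda>_. UNIV) \<Longrightarrow> comb n 0 x 1 y = y"
  unfolding comb_def by (simp_all add: PiE_restrict)

lemma sin_cos_small:
  fixes h :: real
  assumes "0 < h" "h \<le> 1"
  shows "\<bar>cos h - 1\<bar> \<le> h\<^sup>2 / 2" "(cos h - 1)\<^sup>2 \<le> h\<^sup>2" "\<bar>sin h\<bar> \<le> h" "(sin h)\<^sup>2 \<le> h\<^sup>2"
proof -
  have s: "\<bar>sin t\<bar> \<le> \<bar>t\<bar>" for t :: real by (rule abs_sin_x_le_abs_x)
  have "(sin (h/2))\<^sup>2 \<le> (h/2)\<^sup>2" using s[of "h/2"] by (rule abs_le_square_iff[THEN iffD1])
  moreover have "cos h = 1 - 2 * (sin (h/2))\<^sup>2" using cos_double_sin[of "h/2"] by simp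
  ultimately show c: "\<bar>cos h - 1\<bar> \<le> h\<^sup>2 / 2" by (simp add: power_divide)
  have "h\<^sup>2 / 2 \<le> h" using assms using mult_left_mono[of h 1 h] by (simp add: power2_eq_square)
  then have "\<bar>cos h - 1\<bar> \<le> \<bar>h\<bar>" using c assms by linarith
  then show "(cos h - 1)\<^sup>2 \<le> h\<^sup>2" by (rule abs_le_square_iff[THEN iffD1])
  show "\<bar>sin h\<bar> \<le> h" using s[of h] assms by simp
  show "(sin h)\<^sup>2 \<le> h\<^sup>2" using s[of h] by (rule abs_le_square_iff[THEN iffD1])
qed

text \<open>Semiconcavity bounds increments from above only. Rotations by \<open>h\<close> and by
  \<open>-h\<close> are therefore added: their linear terms have opposite signs, and the two
  positive parts together give one absolute value of the linear form instead of two.\<close>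

lemma two_sided_step:
  assumes G: "semiconcave_lip n C G" and C: "C \<ge> 0" and \<delta>: "\<delta> > 0" and \<kappa>: "\<kappa> > 0" and h: "0 < h" "h \<le> 1"
    and x: "x \<in> PiE {..<n} (\<lambda>_. UNIV)"
  shows "\<exists>v. nsq n v \<le> 1 \<and> (\<forall>y.
    max 0 (clamp1 m \<delta> (G (comb n (cos h) x (sin h) y)) - clamp1 m \<delta> (G x)) +
    max 0 (clamp1 m \<delta> (G (comb n (cos h) x (- sin h) y)) - clamp1 m \<delta> (G x))
    \<le> (1 / \<delta>) * ((if \<bar>G x - m\<bar> \<le> \<delta> + \<kappa> then h * \<bar>\<Sum>i<n. v i * y i\<bar> else 0)
        + h\<^sup>2 * (3 + 4 * C + 4 / \<kappa>) * (1 + nsq n x + nsq n y)))"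
proof -
  note sc = sin_cos_small[OF h]
  have h2: "h\<^sup>2 > 0" using h by simp
  \<comment> \<open>The slack is taken to be the square of \<open>h\<close>, so that it joins the
    second-order error.\<close>
  obtain v where v: "nsq n v \<le> 1" and Gv: "\<And>x'. x' \<in> PiE {..<n} (\<lambda>_. UNIV) \<Longrightarrow>
      G x' \<le> G x + (\<Sum>i<n. v i * (x' i - x i)) + C * nsq n (\<lambda>i. x' i - x i) + h\<^sup>2"
    using G x h2 unfolding semiconcave_lip_def by meson
  have GL: "(G x' - G x)\<^sup>2 \<le> nsq n (\<lambda>i. x' i - x i)" if "x' \<in> PiE {..<n} (\<lambda>_. UNIV)" for x'
    using G x that unfolding semiconcave_lip_def by blast
  have vx: "\<bar>\<Sum>i<n. v i * x i\<bar> \<le> (1 + nsq n x) / 2"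
  proof -
    have "\<bar>\<Sum>i<n. v i * x i\<bar> \<le> (\<Sum>i<n. \<bar>v i * x i\<bar>)" by (rule sum_abs)
    also have "\<dots> \<le> (\<Sum>i<n. ((v i)\<^sup>2 + (x i)\<^sup>2) / 2)"
    proof (rule sum_mono)
      fix i
      have "0 \<le> (\<bar>v i\<bar> - \<bar>x i\<bar>)\<^sup>2" by simp
      then show "\<bar>v i * x i\<bar> \<le> ((v i)\<^sup>2 + (x i)\<^sup>2) / 2" by (simp add: power2_diff abs_mult)
    qed
    also have "\<dots> = (nsq n v + nsq n x) / 2" by (simp add: sum.distrib flip: sum_divide_distrib)
    also have "\<dots> \<le> (1 + nsq n x) / 2" using v by (intro divide_right_mono add_right_mono) auto
    finally show ?thesis .
  qed
  have "max 0 (clamp1 m \<delta> (G (comb n (cos h) x (sin h) y)) - clamp1 m \<delta> (G x)) +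
    max 0 (clamp1 m \<delta> (G (comb n (cos h) x (- sin h) y)) - clamp1 m \<delta> (G x))
    \<le> (1 / \<delta>) * ((if \<bar>G x - m\<bar> \<le> \<delta> + \<kappa> then h * \<bar>\<Sum>i<n. v i * y i\<bar> else 0)
        + h\<^sup>2 * (3 + 4 * C + 4 / \<kappa>) * (1 + nsq n x + nsq n y))" for y
  proof -
    define W where "W = 2 * h\<^sup>2 * (nsq n x + nsq n y)"
    define \<alpha> where "\<alpha> = (cos h - 1) * (\<Sum>i<n. v i * x i)"
    define \<beta> where "\<beta> = sin h * (\<Sum>i<n. v i * y i)"
    have W0: "0 \<le> W" unfolding W_def using nsq_nonneg[of x n] nsq_nonneg[of y n] by simp
    have step: "max 0 (G (comb n (cos h) x s y) - G x) \<le> max 0 (\<alpha> + s * (\<Sum>i<n. v i * y i)) + C * W + h\<^sup>2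
        \<and> (G (comb n (cos h) x s y) - G x)\<^sup>2 \<le> W" if s: "s\<^sup>2 \<le> h\<^sup>2" for s
    proof -
      let ?x = "comb n (cos h) x s y"
      have xi: "?x i - x i = (cos h - 1) * x i + s * y i" if "i < n" for i
        using that by (simp add: comb_def algebra_simps)
      have "nsq n (\<lambda>i. ?x i - x i) = (\<Sum>i<n. ((cos h - 1) * x i + s * y i)\<^sup>2)"
        by (intro sum.cong refl) (simp add: xi)
      also have "\<dots> \<le> (\<Sum>i<n. 2 * (cos h - 1)\<^sup>2 * (x i)\<^sup>2 + 2 * s\<^sup>2 * (y i)\<^sup>2)"
      proof (rule sum_mono)
        fix i
        have "(p + q)\<^sup>2 \<le> 2 * p\<^sup>2 + 2 * q\<^sup>2" for p q :: real
          using zero_le_power2[of "p - q"] unfolding power2_sum power2_diff by linarith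
        from this[of "(cos h - 1) * x i" "s * y i"]
        show "((cos h - 1) * x i + s * y i)\<^sup>2 \<le> 2 * (cos h - 1)\<^sup>2 * (x i)\<^sup>2 + 2 * s\<^sup>2 * (y i)\<^sup>2"
          by (simp add: power_mult_distrib)
      qed
      also have "\<dots> = 2 * ((cos h - 1)\<^sup>2 * nsq n x + s\<^sup>2 * nsq n y)"
        by (simp add: sum.distrib sum_distrib_left algebra_simps)
      also have "\<dots> \<le> 2 * (h\<^sup>2 * nsq n x + h\<^sup>2 * nsq n y)"
        using sc(2) s by (intro mult_left_mono add_mono mult_right_mono nsq_nonneg) auto
      finally have w: "nsq n (\<lambda>i. ?x i - x i) \<le> W" unfolding W_def by (simp add: algebra_simps)
      have "(\<Sum>i<n. v i * (?x i - x i)) = (\<Sum>i<n. (cos h - 1) * (v i * x i) + s * (v i * y i))"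
        by (intro sum.cong refl) (simp add: xi algebra_simps)
      also have "\<dots> = \<alpha> + s * (\<Sum>i<n. v i * y i)"
        unfolding \<alpha>_def by (simp add: sum.distrib sum_distrib_left)
      finally have "G ?x - G x \<le> \<alpha> + s * (\<Sum>i<n. v i * y i) + C * nsq n (\<lambda>i. ?x i - x i) + h\<^sup>2"
        using Gv[OF comb_in, of "cos h" x s y] by linarith
      moreover have "C * nsq n (\<lambda>i. ?x i - x i) \<le> C * W" using w C by (rule mult_left_mono)
      moreover have "0 \<le> C * W" using C W0 by simp
      ultimately have "max 0 (G ?x - G x) \<le> max 0 (\<alpha> + s * (\<Sum>i<n. v i * y i)) + C * W + h\<^sup>2"
        using h2 by linarith
      then show ?thesis using GL[OF comb_in, of "cos h" x s y] w by linarith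
    qed
    have sp: "max 0 (G (comb n (cos h) x (sin h) y) - G x) \<le> max 0 (\<alpha> + \<beta>) + C * W + h\<^sup>2"
        "(G (comb n (cos h) x (sin h) y) - G x)\<^sup>2 \<le> W"
      using step[of "sin h"] sc(4) by (auto simp: \<beta>_def)
    have sm: "max 0 (G (comb n (cos h) x (- sin h) y) - G x) \<le> max 0 (\<alpha> - \<beta>) + C * W + h\<^sup>2"
        "(G (comb n (cos h) x (- sin h) y) - G x)\<^sup>2 \<le> W"
      using step[of "- sin h"] sc(4) by (auto simp: \<beta>_def)
    \<comment> \<open>The cancellation on which the sharp constant depends: \<open>\<beta>\<close>
      is of first order in \<open>h\<close> and is counted once, while \<open>\<alpha>\<close> is of
      second order.\<close>
    have ab: "max 0 (\<alpha> + \<beta>) + max 0 (\<alpha> - \<beta>) \<le> 2 * \<bar>\<alpha>\<bar> + \<bar>\<beta>\<bar>" by linarith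
    have "\<bar>\<alpha>\<bar> \<le> h\<^sup>2 / 2 * ((1 + nsq n x) / 2)"
      unfolding \<alpha>_def abs_mult using sc(1) vx by (intro mult_mono) auto
    also have "\<dots> \<le> h\<^sup>2 / 2 * (1 + nsq n x + nsq n y)"
      using nsq_nonneg[of x n] nsq_nonneg[of y n] by (intro mult_left_mono) auto
    finally have a: "2 * \<bar>\<alpha>\<bar> \<le> h\<^sup>2 * (1 + nsq n x + nsq n y)" by simp
    have b: "\<bar>\<beta>\<bar> \<le> h * \<bar>\<Sum>i<n. v i * y i\<bar>"
      unfolding \<beta>_def abs_mult using sc(3) by (intro mult_right_mono) auto
    define E where "E = 1 + nsq n x + nsq n y"
    have E1: "1 \<le> E" unfolding E_def using nsq_nonneg[of x n] nsq_nonneg[of y n] by linarith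
    have WE: "W \<le> 2 * h\<^sup>2 * E" unfolding W_def E_def by (intro mult_left_mono) auto
    have CW: "C * W \<le> C * (2 * h\<^sup>2 * E)" using WE C by (rule mult_left_mono)
    have Wk: "W / \<kappa> \<le> 2 * h\<^sup>2 * E / \<kappa>" using WE \<kappa> by (intro divide_right_mono) auto
    have hE: "h\<^sup>2 \<le> h\<^sup>2 * E" using E1 h2 by simp
    have inc: "max 0 (clamp1 m \<delta> (G u) - clamp1 m \<delta> (G x))
        \<le> (1 / \<delta>) * ((if \<bar>G x - m\<bar> \<le> \<delta> + \<kappa> then max 0 (G u - G x) else 0) + W / \<kappa>)" if "(G u - G x)\<^sup>2 \<le> W" for u
    proof -
      have "(G u - G x)\<^sup>2 / \<kappa> \<le> W / \<kappa>" using that \<kappa> by (intro divide_right_mono) auto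
      then have "(1 / \<delta>) * ((if \<bar>G x - m\<bar> \<le> \<delta> + \<kappa> then max 0 (G u - G x) else 0) + (G u - G x)\<^sup>2 / \<kappa>)
          \<le> (1 / \<delta>) * ((if \<bar>G x - m\<bar> \<le> \<delta> + \<kappa> then max 0 (G u - G x) else 0) + W / \<kappa>)"
        using \<delta> by (intro mult_left_mono add_left_mono) auto
      then show ?thesis using clamp1_increment[OF \<delta> \<kappa>, of m "G u" "G x"] by linarith
    qed
    \<comment> \<open>Origin of \<open>3 + 4 * C + 4 / \<kappa>\<close>: the 3 comes from the two
      slacks and the term 2|\<alpha>|; \<open>C * W\<close> and \<open>W / \<kappa>\<close> each
      occur twice, and \<open>W\<close> is at most 2 \<open>h\<^sup>2 * E\<close>.\<close>
    have main: "(if \<bar>G x - m\<bar> \<le> \<delta> + \<kappa> then max 0 (G (comb n (cos h) x (sin h) y) - G x) else 0) + W / \<kappa>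
       + ((if \<bar>G x - m\<bar> \<le> \<delta> + \<kappa> then max 0 (G (comb n (cos h) x (- sin h) y) - G x) else 0) + W / \<kappa>)
       \<le> (if \<bar>G x - m\<bar> \<le> \<delta> + \<kappa> then h * \<bar>\<Sum>i<n. v i * y i\<bar> else 0) + h\<^sup>2 * (3 + 4 * C + 4 / \<kappa>) * E"
    proof -
      have "h\<^sup>2 * (3 + 4 * C + 4 / \<kappa>) * E = 3 * (h\<^sup>2 * E) + 2 * (C * (2 * h\<^sup>2 * E)) + 2 * (2 * h\<^sup>2 * E / \<kappa>)"
        by (simp add: algebra_simps)
      moreover have "0 \<le> C * (2 * h\<^sup>2 * E)" "0 \<le> h\<^sup>2 * E" using C E1 by auto
      note R = calculation this
      show ?thesis
      proof (cases "\<bar>G x - m\<bar> \<le> \<delta> + \<kappa>")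
        case True
        show ?thesis unfolding if_P[OF True]
          using R sp(1) sm(1) ab a[folded E_def] b CW Wk hE by linarith
      next
        case False
        show ?thesis unfolding if_not_P[OF False]
          using R Wk by linarith
      qed
    qed
    have "(1 / \<delta>) * ((if \<bar>G x - m\<bar> \<le> \<delta> + \<kappa> then max 0 (G (comb n (cos h) x (sin h) y) - G x) else 0) + W / \<kappa>)
       + (1 / \<delta>) * ((if \<bar>G x - m\<bar> \<le> \<delta> + \<kappa> then max 0 (G (comb n (cos h) x (- sin h) y) - G x) else 0) + W / \<kappa>)
       \<le> (1 / \<delta>) * ((if \<bar>G x - m\<bar> \<le> \<delta> + \<kappa> then h * \<bar>\<Sum>i<n. v i * y i\<bar> else 0) + h\<^sup>2 * (3 + 4 * C + 4 / \<kappa>) * E)"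
      unfolding distrib_left[symmetric] using main \<delta> by (intro mult_left_mono) auto
    then show ?thesis
      using inc[OF sp(2)] inc[OF sm(2)] unfolding E_def by linarith
  qed
  then show ?thesis using v by blast
qed

lemma comb_measurable:
  "(\<lambda>p. comb n c (fst p) s (snd p)) \<in> measurable (gpow n \<sigma> \<Otimes>\<^sub>M gpow n \<sigma>) (gpow n \<sigma>)"
  unfolding comb_def
proof (rule measurable_restrict)
  fix i assume i: "i \<in> {..<n}"
  have c: "(\<lambda>x. x i) \<in> measurable (gpow n \<sigma>) borel"
    using measurable_component_singleton[OF i, of "\<lambda>_. gauss \<sigma>"] by (simp cong: measurable_cong_sets)
  have [measurable]: "(\<lambda>p. fst p i) \<in> measurable (gpow n \<sigma> \<Otimes>\<^sub>M gpow n \<sigma>) borel" "(\<lambda>p. snd p i) \<in> measurable (gpow n \<sigma> \<Otimes>\<^sub>M gpow n \<sigma>) borel"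
    using measurable_compose[OF measurable_fst c] measurable_compose[OF measurable_snd c] by blast+
  have "(\<lambda>p. c * fst p i + s * snd p i) \<in> measurable (gpow n \<sigma> \<Otimes>\<^sub>M gpow n \<sigma>) borel" by measurable
  then show "(\<lambda>p. c * fst p i + s * snd p i) \<in> measurable (gpow n \<sigma> \<Otimes>\<^sub>M gpow n \<sigma>) (gauss \<sigma>)"
    by (simp cong: measurable_cong_sets)
qed

lemma prob_space_gpow: "\<sigma> > 0 \<Longrightarrow> prob_space (gpow n \<sigma>)"
  by (intro prob_space_PiM prob_space_gauss)

lemma nn_integral_rotate_gpow:
  assumes \<sigma>: "\<sigma> > 0" and c: "c > 0" "c\<^sup>2 + s\<^sup>2 = 1"
    and F: "F \<in> borel_measurable (gpow n \<sigma> \<Otimes>\<^sub>M gpow n \<sigma>)"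
  shows "(\<integral>\<^sup>+ p. F (comb n c (fst p) s (snd p), comb n (- s) (fst p) c (snd p)) \<partial>(gpow n \<sigma> \<Otimes>\<^sub>M gpow n \<sigma>))
    = (\<integral>\<^sup>+ p. F p \<partial>(gpow n \<sigma> \<Otimes>\<^sub>M gpow n \<sigma>))"
proof -
  let ?P = "gpow n \<sigma> \<Otimes>\<^sub>M gpow n \<sigma>"
  let ?R = "\<lambda>p. (comb n c (fst p) s (snd p), comb n (- s) (fst p) c (snd p))"
  have R: "?R \<in> measurable ?P ?P" by (intro measurable_Pair comb_measurable)
  have "(\<integral>\<^sup>+ p. F p \<partial>distr ?P ?P ?R) = (\<integral>\<^sup>+ p. F (?R p) \<partial>?P)"
    using R by (rule nn_integral_distr) (use F in simp)
  moreover have "distr ?P ?P ?R = ?P"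
    using distr_rotate_gauss_power[OF \<sigma> c] by (simp add: case_prod_beta')
  ultimately show ?thesis by simp
qed

lemma (in prob_space) nn_integral_affine:
  assumes [measurable]: "f \<in> borel_measurable M" "q \<in> borel_measurable M"
  shows "(\<integral>\<^sup>+ y. a * f y + b * (k + q y) \<partial>M) = a * (\<integral>\<^sup>+ y. f y \<partial>M) + b * (k + (\<integral>\<^sup>+ y. q y \<partial>M))"
  by (simp add: nn_integral_add nn_integral_cmult emeasure_space_1)

text \<open>A decrease of \<open>g\<close> along the step is an increase along the reversed step. By
  rotation invariance its integral equals that of the increase for angle -h, so the absolute
  increment becomes the two-sided sum estimated in \<open>two_sided_step\<close>. For fixed
  \<open>x\<close>, integrating over \<open>y\<close> then leaves the mean of a Gaussian linear
  form.\<close>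

lemma nn_integral_one_step:
  fixes m :: real
  assumes \<sigma>: "\<sigma> > 0" and G: "semiconcave_lip n C G" and Gm: "G \<in> borel_measurable (gpow n \<sigma>)"
    and C: "C \<ge> 0" and \<delta>: "\<delta> > 0" and \<kappa>: "\<kappa> > 0" and h: "0 < h" "h \<le> 1"
  defines "P \<equiv> gpow n \<sigma>" and "M2 \<equiv> enn2real (\<integral>\<^sup>+ x. ennreal (nsq n x) \<partial>gpow n \<sigma>)" and "g \<equiv> \<lambda>x. clamp1 m \<delta> (G x)"
  shows "(\<integral>\<^sup>+ p. ennreal \<bar>g (fst p) - g (comb n (cos h) (fst p) (sin h) (snd p))\<bar> \<partial>(P \<Otimes>\<^sub>M P))
    \<le> ennreal ((h / \<delta>) * \<sigma> * sqrt (2 / pi) * measure P {x \<in> space P. \<bar>G x - m\<bar> \<le> \<delta> + \<kappa>}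
        + (h\<^sup>2 / \<delta>) * (3 + 4 * C + 4 / \<kappa>) * (1 + 2 * M2))"
proof -
  interpret P: prob_space P unfolding P_def using \<sigma> by (rule prob_space_gpow)
  interpret PP: pair_prob_space P P ..
  define B where "B = 3 + 4 * C + 4 / \<kappa>"
  have B0: "B \<ge> 0" unfolding B_def using C \<kappa> by simp
  define A where "A = {x \<in> space P. \<bar>G x - m\<bar> \<le> \<delta> + \<kappa>}"
  have Gm' [measurable]: "G \<in> borel_measurable P" using Gm unfolding P_def .
  have Am [measurable]: "A \<in> sets P" unfolding A_def by measurable
  have gm: "g \<in> borel_measurable P" unfolding g_def clamp1_def by measurable
  have cm: "(\<lambda>p. comb n c (fst p) s (snd p)) \<in> measurable (P \<Otimes>\<^sub>M P) P" for c s
    unfolding P_def by (rule comb_measurable)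
  have gc [measurable]: "(\<lambda>p. g (comb n c (fst p) s (snd p))) \<in> borel_measurable (P \<Otimes>\<^sub>M P)" for c s
    by (rule measurable_compose[OF cm gm])
  have gf [measurable]: "(\<lambda>p. g (fst p)) \<in> borel_measurable (P \<Otimes>\<^sub>M P)"
    by (rule measurable_compose[OF measurable_fst gm])
  let ?c = "cos h" and ?s = "sin h"
  have c: "?c > 0" using h pi_gt3 by (intro cos_gt_zero_pi) auto
  have cs: "?c\<^sup>2 + ?s\<^sup>2 = 1" by simp
  have spP: "space P = PiE {..<n} (\<lambda>_. UNIV)" unfolding P_def by (rule space_gpow)
  have M2: "ennreal M2 = (\<integral>\<^sup>+ x. ennreal (nsq n x) \<partial>P)" "M2 \<ge> 0"
    unfolding M2_def P_def using gauss_second_moment_finite[OF \<sigma>, of n] by auto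
  have nsqm [measurable]: "(\<lambda>x. nsq n x) \<in> borel_measurable P"
  proof -
    have "(\<lambda>x. x i) \<in> borel_measurable P" if "i \<in> {..<n}" for i
      using measurable_component_singleton[OF that, of "\<lambda>_. gauss \<sigma>"] unfolding P_def by (simp cong: measurable_cong_sets)
    then show ?thesis by (intro borel_measurable_sum borel_measurable_power)
  qed
  define F where "F q = ennreal (max 0 (g (comb n ?c (fst q) (- ?s) (snd q)) - g (fst q)))" for q
  have Fm: "F \<in> borel_measurable (P \<Otimes>\<^sub>M P)" unfolding F_def by measurable
  \<comment> \<open>Rotating the rotated pair back by \<open>h\<close> recovers its first vector;
    this is what exchanges the roles of start and end point.\<close>
  have rot: "(\<integral>\<^sup>+ p. ennreal (max 0 (g (fst p) - g (comb n ?c (fst p) ?s (snd p)))) \<partial>(P \<Otimes>\<^sub>M P)) = (\<integral>\<^sup>+ p. F p \<partial>(P \<Otimes>\<^sub>M P))"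
  proof -
    have "(\<integral>\<^sup>+ p. F p \<partial>(P \<Otimes>\<^sub>M P)) = (\<integral>\<^sup>+ p. F (comb n ?c (fst p) ?s (snd p), comb n (- ?s) (fst p) ?c (snd p)) \<partial>(P \<Otimes>\<^sub>M P))"
      unfolding P_def by (rule nn_integral_rotate_gpow[OF \<sigma> c cs Fm[unfolded P_def], symmetric])
    also have "\<dots> = (\<integral>\<^sup>+ p. ennreal (max 0 (g (fst p) - g (comb n ?c (fst p) ?s (snd p)))) \<partial>(P \<Otimes>\<^sub>M P))"
    proof (rule nn_integral_cong)
      fix p assume "p \<in> space (P \<Otimes>\<^sub>M P)"
      then have p: "fst p \<in> PiE {..<n} (\<lambda>_. UNIV)" by (auto simp: space_pair_measure spP)
      have "comb n ?c (comb n ?c (fst p) ?s (snd p)) (- ?s) (comb n (- ?s) (fst p) ?c (snd p)) = fst p"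
      proof
        fix i
        have "c * (c * a + s * b) + - s * (- s * a + c * b) = (c\<^sup>2 + s\<^sup>2) * a" for c s a b :: real
          by (simp add: power2_eq_square algebra_simps)
        from this[of ?c "fst p i" ?s "snd p i"]
        have "?c * (?c * fst p i + ?s * snd p i) + - ?s * (- ?s * fst p i + ?c * snd p i) = fst p i"
          unfolding cs by simp
        then show "comb n ?c (comb n ?c (fst p) ?s (snd p)) (- ?s) (comb n (- ?s) (fst p) ?c (snd p)) i = fst p i"
          using p by (auto simp: comb_def PiE_def extensional_def)
      qed
      then show "F (comb n ?c (fst p) ?s (snd p), comb n (- ?s) (fst p) ?c (snd p)) = ennreal (max 0 (g (fst p) - g (comb n ?c (fst p) ?s (snd p))))"
        by (simp add: F_def)
    qed
    finally show ?thesis ..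
  qed
  have "(\<integral>\<^sup>+ p. ennreal \<bar>g (fst p) - g (comb n ?c (fst p) ?s (snd p))\<bar> \<partial>(P \<Otimes>\<^sub>M P))
      = (\<integral>\<^sup>+ p. ennreal (max 0 (g (comb n ?c (fst p) ?s (snd p)) - g (fst p))) + ennreal (max 0 (g (fst p) - g (comb n ?c (fst p) ?s (snd p)))) \<partial>(P \<Otimes>\<^sub>M P))"
    by (intro nn_integral_cong) (simp add: ennreal_plus[symmetric] max_def abs_if del: ennreal_plus)
  also have "\<dots> = (\<integral>\<^sup>+ p. ennreal (max 0 (g (comb n ?c (fst p) ?s (snd p)) - g (fst p))) \<partial>(P \<Otimes>\<^sub>M P)) + (\<integral>\<^sup>+ p. F p \<partial>(P \<Otimes>\<^sub>M P))"
    unfolding rot[symmetric] by (rule nn_integral_add) measurable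
  also have "\<dots> = (\<integral>\<^sup>+ p. ennreal (max 0 (g (comb n ?c (fst p) ?s (snd p)) - g (fst p))) + F p \<partial>(P \<Otimes>\<^sub>M P))"
    by (rule nn_integral_add[symmetric]) (use Fm in measurable)
  also have "\<dots> = (\<integral>\<^sup>+ x. \<integral>\<^sup>+ y. ennreal (max 0 (g (comb n ?c x ?s y) - g x)) + F (x, y) \<partial>P \<partial>P)"
    by (subst P.nn_integral_fst[symmetric]) (use Fm in \<open>auto intro!: borel_measurable_add gc gf\<close>)
  also have "\<dots> \<le> (\<integral>\<^sup>+ x. ennreal ((h / \<delta>) * \<sigma> * sqrt (2 / pi)) * indicator A x + ennreal (h\<^sup>2 / \<delta> * B) * (ennreal (1 + M2) + ennreal (nsq n x)) \<partial>P)"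
  proof (rule nn_integral_mono)
    fix x assume x: "x \<in> space P"
    then have xE: "x \<in> PiE {..<n} (\<lambda>_. UNIV)" unfolding spP .
    obtain v where v: "nsq n v \<le> 1" and vy: "\<And>y.
      max 0 (clamp1 m \<delta> (G (comb n (cos h) x (sin h) y)) - clamp1 m \<delta> (G x)) +
      max 0 (clamp1 m \<delta> (G (comb n (cos h) x (- sin h) y)) - clamp1 m \<delta> (G x))
      \<le> (1 / \<delta>) * ((if \<bar>G x - m\<bar> \<le> \<delta> + \<kappa> then h * \<bar>\<Sum>i<n. v i * y i\<bar> else 0) + h\<^sup>2 * B * (1 + nsq n x + nsq n y))"
      using two_sided_step[OF G C \<delta> \<kappa> h xE, of m] unfolding B_def by blast
    have vm [measurable]: "(\<lambda>y. \<Sum>i<n. v i * y i) \<in> borel_measurable P"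
    proof -
      have "(\<lambda>x. x i) \<in> borel_measurable P" if "i \<in> {..<n}" for i
        using measurable_component_singleton[OF that, of "\<lambda>_. gauss \<sigma>"] unfolding P_def by (simp cong: measurable_cong_sets)
      then show ?thesis by (intro borel_measurable_sum borel_measurable_times borel_measurable_const)
    qed
    have "(\<integral>\<^sup>+ y. ennreal (max 0 (g (comb n ?c x ?s y) - g x)) + F (x, y) \<partial>P)
       \<le> (\<integral>\<^sup>+ y. ennreal (h / \<delta>) * indicator A x * ennreal \<bar>\<Sum>i<n. v i * y i\<bar> + ennreal (h\<^sup>2 / \<delta> * B) * (ennreal (1 + nsq n x) + ennreal (nsq n y)) \<partial>P)"
    proof (rule nn_integral_mono)
      fix y
      have "ennreal (max 0 (g (comb n ?c x ?s y) - g x)) + F (x, y) = ennreal (max 0 (g (comb n ?c x ?s y) - g x) + max 0 (g (comb n ?c x (- ?s) y) - g x))"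
        unfolding F_def fst_conv snd_conv by (rule ennreal_plus[symmetric]) simp_all
      also have "\<dots> \<le> ennreal ((1 / \<delta>) * ((if \<bar>G x - m\<bar> \<le> \<delta> + \<kappa> then h * \<bar>\<Sum>i<n. v i * y i\<bar> else 0) + h\<^sup>2 * B * (1 + nsq n x + nsq n y)))"
        using vy[of y] unfolding g_def by (rule ennreal_leI)
      also have "(1 / \<delta>) * ((if \<bar>G x - m\<bar> \<le> \<delta> + \<kappa> then h * \<bar>\<Sum>i<n. v i * y i\<bar> else 0) + h\<^sup>2 * B * (1 + nsq n x + nsq n y))
          = (h / \<delta>) * indicator A x * \<bar>\<Sum>i<n. v i * y i\<bar> + (h\<^sup>2 / \<delta> * B) * ((1 + nsq n x) + nsq n y)"
      proof -
        have i: "(if \<bar>G x - m\<bar> \<le> \<delta> + \<kappa> then t else 0) = indicator A x * t" for t :: real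
          using x by (simp add: A_def)
        have "(1 / \<delta>) * (i * (h * a) + k * B * (1 + p + q)) = (h / \<delta>) * i * a + (k / \<delta> * B) * ((1 + p) + q)" for i a k p q :: real
          using \<delta> by (simp add: field_simps)
        then show ?thesis unfolding i .
      qed
      also have "ennreal \<dots> = ennreal (h / \<delta>) * indicator A x * ennreal \<bar>\<Sum>i<n. v i * y i\<bar> + ennreal (h\<^sup>2 / \<delta> * B) * (ennreal (1 + nsq n x) + ennreal (nsq n y))"
      proof -
        have "ennreal (\<alpha> * i * a + \<beta> * ((1 + p) + q)) = ennreal \<alpha> * ennreal i * ennreal a + ennreal \<beta> * (ennreal (1 + p) + ennreal q)"
          if "0 \<le> \<alpha>" "0 \<le> i" "0 \<le> a" "0 \<le> \<beta>" "0 \<le> p" "0 \<le> q" for \<alpha> i a \<beta> p q :: real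
          using that by (simp add: ennreal_mult ennreal_plus)
        from this[of "h / \<delta>" "indicator A x" "\<bar>\<Sum>i<n. v i * y i\<bar>" "h\<^sup>2 / \<delta> * B" "nsq n x" "nsq n y"]
        show ?thesis using h \<delta> B0 nsq_nonneg[of x n] nsq_nonneg[of y n] by (simp add: ennreal_indicator)
      qed
      finally show "ennreal (max 0 (g (comb n ?c x ?s y) - g x)) + F (x, y)
        \<le> ennreal (h / \<delta>) * indicator A x * ennreal \<bar>\<Sum>i<n. v i * y i\<bar> + ennreal (h\<^sup>2 / \<delta> * B) * (ennreal (1 + nsq n x) + ennreal (nsq n y))" .
    qed
    also have "\<dots> = ennreal (h / \<delta>) * indicator A x * (\<integral>\<^sup>+ y. ennreal \<bar>\<Sum>i<n. v i * y i\<bar> \<partial>P) + ennreal (h\<^sup>2 / \<delta> * B) * (ennreal (1 + nsq n x) + ennreal M2)"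
      unfolding M2(1) by (rule P.nn_integral_affine) measurable
    also have "\<dots> \<le> ennreal (h / \<delta>) * indicator A x * ennreal (\<sigma> * sqrt (2 / pi)) + ennreal (h\<^sup>2 / \<delta> * B) * (ennreal (1 + nsq n x) + ennreal M2)"
      using nn_integral_abs_linear_gauss[OF \<sigma> v] unfolding P_def[symmetric] by (intro add_right_mono mult_left_mono) auto
    also have "\<dots> = ennreal ((h / \<delta>) * \<sigma> * sqrt (2 / pi)) * indicator A x + ennreal (h\<^sup>2 / \<delta> * B) * (ennreal (1 + M2) + ennreal (nsq n x))"
    proof -
      have e1: "ennreal ((h / \<delta>) * \<sigma> * sqrt (2 / pi)) = ennreal (h / \<delta>) * ennreal (\<sigma> * sqrt (2 / pi))"
        using h \<delta> \<sigma> by (subst ennreal_mult[symmetric]) (auto simp: mult.assoc)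
      have e2: "ennreal (1 + nsq n x) + ennreal M2 = ennreal (1 + M2) + ennreal (nsq n x)"
        using M2(2) nsq_nonneg[of x n] by (simp add: ennreal_plus[symmetric] add.commute add.left_commute del: ennreal_plus)
      show ?thesis unfolding e1 e2 by (simp only: ac_simps)
    qed
    finally show "(\<integral>\<^sup>+ y. ennreal (max 0 (g (comb n ?c x ?s y) - g x)) + F (x, y) \<partial>P) \<le> ennreal ((h / \<delta>) * \<sigma> * sqrt (2 / pi)) * indicator A x + ennreal (h\<^sup>2 / \<delta> * B) * (ennreal (1 + M2) + ennreal (nsq n x))" .
  qed
  also have "\<dots> = ennreal ((h / \<delta>) * \<sigma> * sqrt (2 / pi)) * emeasure P A + ennreal (h\<^sup>2 / \<delta> * B) * (ennreal (1 + M2) + ennreal M2)"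
    unfolding M2(1) nn_integral_indicator[OF Am, symmetric] by (rule P.nn_integral_affine) measurable
  also have "\<dots> = ennreal ((h / \<delta>) * \<sigma> * sqrt (2 / pi) * measure P A + (h\<^sup>2 / \<delta>) * B * (1 + 2 * M2))"
    unfolding P.emeasure_eq_measure using h \<delta> \<sigma> M2(2) B0 by (simp add: ennreal_mult[symmetric] ennreal_plus[symmetric] del: ennreal_plus)
  finally show ?thesis unfolding A_def B_def .
qed

text \<open>Rotating from one Gaussian vector to an independent one in \<open>K\<close> steps of angle \<open>pi / (2 * K)\<close>, each
  step costs the mean of a Gaussian linear form of norm at most the angle, up to an error of order
  \<open>1 / K\<^sup>2\<close>.\<close>

lemma gaussian_cheeger:
  fixes m :: real
  assumes \<sigma>: "\<sigma> > 0" and G: "semiconcave_lip n C G" and Gm: "G \<in> borel_measurable (gpow n \<sigma>)"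
    and C: "C \<ge> 0" and \<delta>: "\<delta> > 0" and \<kappa>: "\<kappa> > 0"
  defines "P \<equiv> gpow n \<sigma>" and "g \<equiv> \<lambda>x. clamp1 m \<delta> (G x)"
  shows "(\<integral>\<^sup>+ p. ennreal \<bar>g (fst p) - g (snd p)\<bar> \<partial>(P \<Otimes>\<^sub>M P))
    \<le> ennreal ((\<sigma> / \<delta>) * sqrt (pi / 2) * measure P {x \<in> space P. \<bar>G x - m\<bar> \<le> \<delta> + \<kappa>})" (is "?L \<le> ennreal ?a")
proof -
  define M2 where "M2 = enn2real (\<integral>\<^sup>+ x. ennreal (nsq n x) \<partial>gpow n \<sigma>)"
  define B where "B = (3 + 4 * C + 4 / \<kappa>) * (1 + 2 * M2)"
  define A where "A = measure P {x \<in> space P. \<bar>G x - m\<bar> \<le> \<delta> + \<kappa>}"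
  have spP: "space P = PiE {..<n} (\<lambda>_. UNIV)" unfolding P_def by (rule space_gpow)
  have [measurable]: "G \<in> borel_measurable P" using Gm unfolding P_def .
  have gm: "g \<in> borel_measurable P" unfolding g_def clamp1_def by measurable
  have gc [measurable]: "(\<lambda>p. g (comb n c (fst p) s (snd p))) \<in> borel_measurable (P \<Otimes>\<^sub>M P)" for c s
    using measurable_compose[OF comb_measurable gm[unfolded P_def]] unfolding P_def .
  have gf [measurable]: "(\<lambda>p. g (fst p)) \<in> borel_measurable (P \<Otimes>\<^sub>M P)"
    by (rule measurable_compose[OF measurable_fst gm])
  \<comment> \<open>With \<open>K \<ge> 2\<close> the step angle is at most pi/4, hence at most 1,
    as the one-step estimate requires.\<close>
  have bound: "?L \<le> ennreal (?a + (pi / 2)\<^sup>2 / \<delta> * B / real K)" if K: "K \<ge> 2" for K :: nat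
  proof -
    define h where "h = pi / (2 * real K)"
    have K0: "real K > 0" using K by simp
    have h: "0 < h" "h \<le> 1" "real K * h = pi / 2"
    proof -
      show "0 < h" using K0 by (simp add: h_def)
      have "pi \<le> 2 * real K" using pi_less_4 K by linarith
      then show "h \<le> 1" using K0 by (simp add: h_def)
      show "real K * h = pi / 2" using K0 by (simp add: h_def)
    qed
    define X where "X k p = comb n (cos (real k * h)) (fst p) (sin (real k * h)) (snd p)" for k :: nat and p
    define F where "F q = ennreal \<bar>g (fst q) - g (comb n (cos h) (fst q) (sin h) (snd q))\<bar>" for q
    have Fm: "F \<in> borel_measurable (P \<Otimes>\<^sub>M P)" unfolding F_def by measurable
    have X0: "X 0 p = fst p" "X K p = snd p" if "p \<in> space (P \<Otimes>\<^sub>M P)" for p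
    proof -
      have "fst p \<in> space P" "snd p \<in> space P" using that unfolding space_pair_measure by (simp_all add: mem_Times_iff)
      note pE = this[unfolded spP]
      show "X 0 p = fst p" unfolding X_def using comb_trivial(1)[OF pE(1)] by simp
      show "X K p = snd p" unfolding X_def h(3) cos_pi_half sin_pi_half by (rule comb_trivial(2)[OF pE(2)])
    qed
    \<comment> \<open>The vector at angle k h and its orthogonal companion form a rotated pair with
      the original joint law, and the next vector is the rotation of this pair by \<open>h\<close>.
      So all steps have equal cost.\<close>
    have step: "(\<integral>\<^sup>+ p. ennreal \<bar>g (X k p) - g (X (Suc k) p)\<bar> \<partial>(P \<Otimes>\<^sub>M P)) = (\<integral>\<^sup>+ p. F p \<partial>(P \<Otimes>\<^sub>M P))" if k: "k < K" for k
    proof -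
      let ?c = "cos (real k * h)" and ?s = "sin (real k * h)"
      have "real k * h < real K * h" using k h(1) by simp
      then have "real k * h < pi / 2" using h(3) by simp
      moreover have "0 \<le> real k * h" using h(1) by simp
      ultimately have c: "?c > 0" by (intro cos_gt_zero_pi) auto
      have cs: "?c\<^sup>2 + ?s\<^sup>2 = 1" by simp
      have "(\<integral>\<^sup>+ p. F p \<partial>(P \<Otimes>\<^sub>M P)) = (\<integral>\<^sup>+ p. F (comb n ?c (fst p) ?s (snd p), comb n (- ?s) (fst p) ?c (snd p)) \<partial>(P \<Otimes>\<^sub>M P))"
        unfolding P_def by (rule nn_integral_rotate_gpow[OF \<sigma> c cs Fm[unfolded P_def], symmetric])
      also have "\<dots> = (\<integral>\<^sup>+ p. ennreal \<bar>g (X k p) - g (X (Suc k) p)\<bar> \<partial>(P \<Otimes>\<^sub>M P))"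
      proof (rule nn_integral_cong)
        fix p
        have ang: "real (Suc k) * h = h + real k * h" by (simp add: algebra_simps)
        have "comb n (cos h) (comb n ?c (fst p) ?s (snd p)) (sin h) (comb n (- ?s) (fst p) ?c (snd p)) = X (Suc k) p"
          unfolding X_def ang cos_add sin_add comb_def by (rule restrict_ext) (simp add: algebra_simps)
        then show "F (comb n ?c (fst p) ?s (snd p), comb n (- ?s) (fst p) ?c (snd p)) = ennreal \<bar>g (X k p) - g (X (Suc k) p)\<bar>"
          unfolding F_def fst_conv snd_conv by (simp add: X_def)
      qed
      finally show ?thesis by simp
    qed
    have "?L \<le> (\<integral>\<^sup>+ p. (\<Sum>k<K. ennreal \<bar>g (X k p) - g (X (Suc k) p)\<bar>) \<partial>(P \<Otimes>\<^sub>M P))"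
    proof (rule nn_integral_mono)
      fix p assume p: "p \<in> space (P \<Otimes>\<^sub>M P)"
      have "g (X 0 p) - g (X K p) = (\<Sum>k<K. g (X k p) - g (X (Suc k) p))"
        by (rule sum_lessThan_telescope'[symmetric])
      then have "\<bar>g (X 0 p) - g (X K p)\<bar> \<le> (\<Sum>k<K. \<bar>g (X k p) - g (X (Suc k) p)\<bar>)"
        by (simp add: sum_abs)
      then have "ennreal \<bar>g (X 0 p) - g (X K p)\<bar> \<le> ennreal (\<Sum>k<K. \<bar>g (X k p) - g (X (Suc k) p)\<bar>)"
        by (rule ennreal_leI)
      then show "ennreal \<bar>g (fst p) - g (snd p)\<bar> \<le> (\<Sum>k<K. ennreal \<bar>g (X k p) - g (X (Suc k) p)\<bar>)"
        unfolding X0[OF p] by (simp add: sum_ennreal)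
    qed
    also have "\<dots> = (\<Sum>k<K. \<integral>\<^sup>+ p. ennreal \<bar>g (X k p) - g (X (Suc k) p)\<bar> \<partial>(P \<Otimes>\<^sub>M P))"
      unfolding X_def by (rule nn_integral_sum) measurable
    also have "\<dots> = (\<Sum>k<K. \<integral>\<^sup>+ p. F p \<partial>(P \<Otimes>\<^sub>M P))"
      by (rule sum.cong[OF refl]) (simp add: step)
    also have "\<dots> = ennreal (real K) * (\<integral>\<^sup>+ p. F p \<partial>(P \<Otimes>\<^sub>M P))"
      by (simp add: ennreal_of_nat_eq_real_of_nat)
    also have "\<dots> \<le> ennreal (real K) * ennreal ((h / \<delta>) * \<sigma> * sqrt (2 / pi) * A + (h\<^sup>2 / \<delta>) * (3 + 4 * C + 4 / \<kappa>) * (1 + 2 * M2))"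
      using nn_integral_one_step[OF \<sigma> G Gm C \<delta> \<kappa> h(1,2), of m]
      unfolding F_def g_def A_def P_def M2_def by (intro mult_left_mono) auto
    also have "\<dots> = ennreal (real K * ((h / \<delta>) * \<sigma> * sqrt (2 / pi) * A + (h\<^sup>2 / \<delta>) * (3 + 4 * C + 4 / \<kappa>) * (1 + 2 * M2)))"
      by (rule ennreal_mult'[symmetric]) simp
    also have "real K * ((h / \<delta>) * \<sigma> * sqrt (2 / pi) * A + (h\<^sup>2 / \<delta>) * (3 + 4 * C + 4 / \<kappa>) * (1 + 2 * M2))
        = ?a + (pi / 2)\<^sup>2 / \<delta> * B / real K"
    proof -
      have hK: "h = (pi / 2) / real K" using h(3) K0 by (simp add: field_simps)
      \<comment> \<open>The total angle pi/2 times the mean absolute value sqrt(2/pi) of a standard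
        Gaussian yields the final constant.\<close>
      have "(pi / 2) * sqrt (2 / pi) = sqrt ((pi / 2)\<^sup>2 * (2 / pi))"
        unfolding real_sqrt_mult by simp
      also have "(pi / 2)\<^sup>2 * (2 / pi) = pi / 2" by (simp add: power2_eq_square)
      finally have sq: "(pi / 2) * sqrt (2 / pi) = sqrt (pi / 2)" .
      have "real K * ((h / \<delta>) * \<sigma> * sqrt (2 / pi) * A) = (\<sigma> / \<delta>) * ((real K * h) * sqrt (2 / pi)) * A"
        by (simp add: field_simps)
      also have "\<dots> = ?a" unfolding h(3) sq A_def by simp
      finally have 1: "real K * ((h / \<delta>) * \<sigma> * sqrt (2 / pi) * A) = ?a" .
      have "real K * ((h\<^sup>2 / \<delta>) * (3 + 4 * C + 4 / \<kappa>) * (1 + 2 * M2)) = ((real K * h) * h) / \<delta> * B"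
        unfolding B_def by (simp add: power2_eq_square)
      also have "\<dots> = (pi / 2)\<^sup>2 / \<delta> * B / real K"
        unfolding h(3) by (simp add: hK power2_eq_square)
      finally show ?thesis using 1 by (simp add: distrib_left)
    qed
    finally show ?thesis .
  qed
  have "(\<lambda>K. ?a + (pi / 2)\<^sup>2 / \<delta> * B / real K) \<longlonglongrightarrow> ?a + 0"
    by (intro tendsto_add tendsto_const lim_const_over_n)
  then have "(\<lambda>K. ennreal (?a + (pi / 2)\<^sup>2 / \<delta> * B / real K)) \<longlonglongrightarrow> ennreal ?a"
    by (intro tendsto_ennrealI) simp
  then show ?thesis
    by (rule Lim_bounded2[where N=2]) (use bound in auto)
qed

section \<open>Gaussian and interval pyramids\<close>

lemma full_pm_space_gaussian_line:
  assumes \<sigma>: "\<sigma> > 0"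
  shows "full_pm_space (gaussian_line \<sigma>)"
proof -
  interpret N: prob_space "gauss \<sigma>" using \<sigma> by (rule prob_space_gauss)
  have pm: "pm_space (gaussian_line \<sigma>)"
    unfolding gaussian_line_def by (rule pm_space_euclidean) (auto intro: N.prob_space_axioms)
  have "UNIV \<subseteq> pm_support (gaussian_line \<sigma>)"
  proof
    fix x :: real
    have "emeasure (gauss \<sigma>) U > 0" if U: "open U" "x \<in> U" for U
    proof (rule ccontr)
      assume "\<not> emeasure (gauss \<sigma>) U > 0"
      then have "U \<in> null_sets (gauss \<sigma>)" using U by (intro null_setsI) (auto simp: borel_open)
      then have "AE y in lborel. y \<in> U \<longrightarrow> ennreal (normal_density 0 \<sigma> y) = 0"
        using null_sets_density_iff[of "\<lambda>y. ennreal (normal_density 0 \<sigma> y)" lborel U] by auto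
      then have "AE y in lborel. y \<notin> U"
      proof eventually_elim
        case (elim y)
        then show ?case using normal_density_pos[OF \<sigma>, of 0 y] by (auto simp: ennreal_eq_0_iff)
      qed
      then have "emeasure lborel U = 0"
        using AE_iff_measurable[of U lborel "\<lambda>y. y \<notin> U"] U by (simp add: borel_open)
      moreover obtain e where e: "e > 0" "ball x e \<subseteq> U" using U openE by blast
      have "emeasure lborel {x<..<x+e} \<le> emeasure lborel U"
        using e U by (intro emeasure_mono) (auto simp: borel_open subset_iff dist_real_def)
      ultimately show False using e(1) by simp
    qed
    then show "x \<in> pm_support (gaussian_line \<sigma>)" unfolding pm_support_def by simp
  qed
  then show ?thesis unfolding full_pm_space_def using pm by auto
qed

lemma fst_interval_pm: "fst (interval_pm r) = submetric euclidean_metric {0..r}"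
  and snd_interval_pm: "snd (interval_pm r) = scale_measure (ennreal (1 / r)) (restrict_space lborel {0..r})"
  by (simp_all add: interval_pm_def)

lemma sets_interval_pm: "sets (snd (interval_pm r)) = sets (restrict_space borel {0..r})"
  by (simp add: snd_interval_pm sets_restrict_space)

lemma emeasure_interval_pm:
  assumes "A \<in> sets borel" "A \<subseteq> {0..r}"
  shows "emeasure (snd (interval_pm r)) A = ennreal (1 / r) * emeasure lborel A"
  using assms by (simp add: snd_interval_pm emeasure_restrict_space)

lemma full_pm_space_interval_pm:
  assumes r: "r > 0"
  shows "full_pm_space (interval_pm r)"
proof -
  let ?S = "{0..r} :: real set"
  let ?E = "(euclidean_metric, return borel (0::real))"
  have E: "pm_space ?E" by (intro pm_space_euclidean prob_space_return) auto
  have sets: "sets (snd (interval_pm r)) = sets (borel_sigma (submetric euclidean_metric ?S))"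
    using sets_restrict_borel_sigma[OF E, of ?S] r by (simp add: sets_interval_pm sets_restrict_space)
  have sp: "space (snd (interval_pm r)) = ?S"
    using sets_eq_imp_space_eq[OF sets_interval_pm] by (simp add: space_restrict_space)
  interpret Sub: Submetric "UNIV :: real set" dist ?S
    by (simp add: Submetric_def Submetric_axioms_def Met_TC.Metric_space_axioms)
  have "Sub.sub.mcomplete"
    using pm_space_euclidean[of "return borel (0::real)"] prob_space_return[of "0::real" borel]
    by (intro Sub.closedin_mcomplete_imp_mcomplete) (auto simp: pm_space_def mcomplete_of_def)
  then have comp: "mcomplete_of (submetric euclidean_metric ?S)"
    unfolding mcomplete_of_def by simp
  obtain x where "dense_seq (euclidean_metric :: real metric) x" using pm_space_dense_seq[OF E] by auto
  then obtain y where y: "dense_seq (submetric euclidean_metric ?S) y" using dense_seq_subset[of _ x ?S] r by (metis atLeastatMost_empty_iff2 linorder_not_less less_imp_le mspace_euclidean_metric top_greatest)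
  have prob: "prob_space (snd (interval_pm r))"
    by (rule prob_spaceI) (use r in \<open>simp add: sp emeasure_interval_pm ennreal_mult[symmetric]\<close>)
  have pm: "pm_space (interval_pm r)"
    unfolding pm_space_def fst_interval_pm using comp dense_seq_separable[OF y] sp sets prob by simp
  have "?S \<subseteq> pm_support (interval_pm r)"
  proof
    fix x assume x: "x \<in> ?S"
    have "emeasure (snd (interval_pm r)) U > 0" if U: "openin (mtopology_of (submetric euclidean_metric ?S)) U" "x \<in> U" for U
    proof -
      obtain T where T: "open T" "U = T \<inter> ?S"
        using U(1) unfolding mtopology_of_submetric openin_subtopology by auto
      then obtain e where e: "e > 0" "ball x e \<subseteq> T" using U(2) openE[of T x] by blast
      define p where "p = max 0 (x - e/2)"
      define q where "q = min r (x + e/2)"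
      have pq: "p < q" "{p..q} \<subseteq> U"
        using x e r T(2) by (auto simp: p_def q_def subset_iff dist_real_def)
      have "0 < emeasure lborel {p..q}" using pq(1) by simp
      also have "\<dots> \<le> emeasure lborel U" using pq(2) T by (intro emeasure_mono) auto
      finally have "0 < emeasure lborel U" .
      moreover have "0 < ennreal (1 / r)" using r by simp
      ultimately have "0 < ennreal (1 / r) * emeasure lborel U" by (simp add: ennreal_zero_less_mult_iff)
      then show ?thesis using T by (subst emeasure_interval_pm) auto
    qed
    then show "x \<in> pm_support (interval_pm r)" using x unfolding pm_support_def fst_interval_pm by auto
  qed
  then show ?thesis unfolding full_pm_space_def
    using pm pm_support_subset[of "interval_pm r"] by (auto simp: fst_interval_pm)
qed

text \<open>The normalised Gaussian distribution function pushes the Gaussian to the uniform law; its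
  Lipschitz constant is the maximal density, attained at the median.\<close>

lemma lip_le_interval_gaussian:
  assumes r: "r > 0"
  shows "lip_le (interval_pm r) (gaussian_line (r / sqrt (2 * pi)))"
proof -
  define \<sigma> where "\<sigma> = r / sqrt (2 * pi)"
  have \<sigma>: "\<sigma> > 0" using r by (simp add: \<sigma>_def)
  interpret N: prob_space "gauss \<sigma>" using \<sigma> by (rule prob_space_gauss)
  interpret N: real_distribution "gauss \<sigma>" by standard auto
  interpret N: cdf_distribution "gauss \<sigma>" by standard
  let ?M = "snd (interval_pm r)"
  have dens: "normal_density 0 \<sigma> x \<le> 1 / r" for x
  proof -
    \<comment> \<open>This choice of \<open>\<sigma>\<close> makes the maximal Gaussian density
      equal to the uniform density 1/r.\<close>
    have "2 * pi * \<sigma>\<^sup>2 = r\<^sup>2" by (simp add: \<sigma>_def power_divide)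
    then have "normal_density 0 \<sigma> x = 1 / r * exp (- x\<^sup>2 / (2 * \<sigma>\<^sup>2))"
      using r by (simp add: normal_density_def)
    also have "\<dots> \<le> 1 / r * 1" using r by (intro mult_left_mono) auto
    finally show ?thesis by simp
  qed
  have inc: "N.C y - N.C x \<le> (y - x) / r" if "x \<le> y" for x y
  proof -
    have "emeasure (gauss \<sigma>) {x<..y} = (\<integral>\<^sup>+ t. ennreal (normal_density 0 \<sigma> t) * indicator {x<..y} t \<partial>lborel)"
      by (rule emeasure_density) auto
    also have "\<dots> \<le> (\<integral>\<^sup>+ t. ennreal (1 / r) * indicator {x<..y} t \<partial>lborel)"
      using dens by (intro nn_integral_mono mult_right_mono ennreal_leI) auto
    also have "\<dots> = ennreal (1 / r) * ennreal (y - x)" using that by (simp add: nn_integral_cmult_indicator)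
    also have "\<dots> = ennreal ((y - x) / r)" using r that by (simp add: ennreal_mult[symmetric])
    finally have "N.prob {x<..y} \<le> (y - x) / r"
      using r that by (simp add: N.emeasure_eq_measure)
    then show ?thesis
      using N.cdf_diff_eq[of x y] that by (cases "x = y") auto
  qed
  define f where "f x = r * N.C x" for x
  have C01: "0 \<le> N.C x" "N.C x \<le> 1" for x using N.cdf_nonneg N.cdf_bounded_prob by auto
  have f_in: "f x \<in> {0..r}" for x
    using mult_left_mono[OF C01(2)[of x], of r] C01(1)[of x] r by (simp add: f_def)
  have f_inc: "0 \<le> f y - f x \<and> f y - f x \<le> y - x" if "x \<le> y" for x y
  proof -
    have "N.C x \<le> N.C y" using that by (rule N.cdf_nondecreasing)
    moreover have "r * (N.C y - N.C x) \<le> r * ((y - x) / r)" using inc[OF that] r by (intro mult_left_mono) auto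
    moreover have "r * ((y - x) / r) = y - x" using r by simp
    ultimately show ?thesis using r by (simp add: f_def flip: right_diff_distrib)
  qed
  have lip: "one_lipschitz euclidean_metric (submetric euclidean_metric {0..r}) f"
    unfolding one_lipschitz_def
  proof (intro conjI ballI)
    fix x y :: real
    show "mdist (submetric euclidean_metric {0..r}) (f x) (f y) \<le> mdist euclidean_metric x y"
      using f_inc[of x y] f_inc[of y x] by (cases "x \<le> y") (auto simp: dist_real_def)
  qed (use f_in in auto)
  have fm: "f \<in> borel_measurable borel" unfolding f_def by measurable
  have fM: "f \<in> measurable (gauss \<sigma>) ?M"
    using fm f_in measurable_cong_sets[OF _ sets_interval_pm, of "gauss \<sigma>" borel r]
    by (simp add: measurable_restrict_space2)
  have cont: "isCont N.C x" for x
  proof -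
    have "emeasure (gauss \<sigma>) {x} = 0" by (subst emeasure_density) (auto simp: nn_integral_cmult_indicator nn_integral_0_iff_AE AE_lborel_singleton)
    then show ?thesis unfolding N.isCont_cdf by (simp add: measure_def)
  qed
  \<comment> \<open>A Gaussian has no atoms, so its distribution function is continuous and the
    quantile function is an exact right inverse of it.\<close>
  have CI: "N.C (N.I u) = u" if u: "0 < u" "u < 1" for u
  proof (rule antisym)
    show "u \<le> N.C (N.I u)" using N.pseudoinverse[OF u, of "N.I u"] by simp
    show "N.C (N.I u) \<le> u"
    proof (rule tendsto_upperbound)
      show "(N.C \<longlongrightarrow> N.C (N.I u)) (at_left (N.I u))"
        using cont[of "N.I u"] unfolding isCont_def by (rule filterlim_mono) (auto simp: at_within_le_at)
      show "\<forall>\<^sub>F x in at_left (N.I u). N.C x \<le> u"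
        unfolding eventually_at_filter using N.pseudoinverse[OF u] by (intro always_eventually) (metis lessThan_iff linorder_not_le less_imp_le)
    qed simp
  qed
  let ?V = "restrict_space lborel {0<..<1::real}"
  have "distr (gauss \<sigma>) ?M f = ?M"
  proof (rule measure_eqI)
    fix A assume "A \<in> sets (distr (gauss \<sigma>) ?M f)"
    then have AM: "A \<in> sets ?M" by simp
    then have A: "A \<in> sets borel" "A \<subseteq> {0..r}" unfolding sets_interval_pm by (auto simp: sets_restrict_space_iff)
    have Im: "N.I \<in> measurable ?V borel"
      using N.measurable_CI by (simp cong: measurable_cong_sets add: sets_restrict_space)
    have fA: "f -` A \<in> sets borel" using measurable_sets[OF fm A(1)] by simp
    have rA: "(\<lambda>u. r * u) -` A \<in> sets borel" using measurable_sets[of "\<lambda>u. r * u" borel borel A] A(1) by simp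
    have "emeasure (distr (gauss \<sigma>) ?M f) A = emeasure (gauss \<sigma>) (f -` A)"
      using emeasure_distr[OF fM AM] by simp
    also have "\<dots> = emeasure (distr ?V borel N.I) (f -` A)"
      by (simp only: N.distr_I_eq_M)
    also have "\<dots> = emeasure ?V (N.I -` (f -` A) \<inter> space ?V)"
      by (rule emeasure_distr[OF Im fA])
    also have "N.I -` (f -` A) \<inter> space ?V = (\<lambda>u. r * u) -` A \<inter> {0<..<1}"
      using CI by (auto simp: space_restrict_space f_def)
    also have "emeasure ?V \<dots> = emeasure lborel ((\<lambda>u. r * u) -` A \<inter> {0<..<1})"
      using rA by (intro emeasure_restrict_space) auto
    also have "\<dots> = emeasure lborel ((\<lambda>u. r * u) -` A)"
    proof (rule emeasure_eq_AE)
      show "AE u in lborel. u \<in> (\<lambda>u. r * u) -` A \<inter> {0<..<1} \<longleftrightarrow> u \<in> (\<lambda>u. r * u) -` A"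
        using AE_lborel_singleton[of 0] AE_lborel_singleton[of 1]
      proof eventually_elim
        case (elim u)
        have "u \<in> {0..1}" if "r * u \<in> A"
          using that A(2) r mult_le_cancel_left_pos[of r u 1] by (auto simp: zero_le_mult_iff)
        then show ?case using elim by auto
      qed
    qed (use rA in auto)
    also have "\<dots> = (\<integral>\<^sup>+ u. indicator A (r * u) \<partial>lborel)"
    proof -
      have "(\<lambda>u. r * u) -` A \<in> sets lborel" using rA by simp
      from nn_integral_indicator[OF this] have "emeasure lborel ((\<lambda>u. r * u) -` A) = (\<integral>\<^sup>+ u. indicator ((\<lambda>u. r * u) -` A) u \<partial>lborel)" by (rule sym)
      also have "\<dots> = (\<integral>\<^sup>+ u. indicator A (r * u) \<partial>lborel)"
        by (rule nn_integral_cong) (simp split: split_indicator)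
      finally show ?thesis .
    qed
    also have "\<dots> = ennreal (1 / r) * (\<integral>\<^sup>+ u. indicator A u \<partial>lborel)"
      using nn_integral_real_affine[of "indicator A" r 0] A(1) r
      by (simp add: mult.assoc[symmetric] ennreal_mult[symmetric])
    also have "\<dots> = emeasure ?M A" using A by (simp add: emeasure_interval_pm)
    finally show "emeasure (distr (gauss \<sigma>) ?M f) A = emeasure ?M A" .
  qed simp
  then show ?thesis
    unfolding lip_le_def \<sigma>_def[symmetric] gaussian_line_simps fst_interval_pm using lip by blast
qed

section \<open>Lower bound for a Gaussian dominating an interval\<close>

lemma dist_power_euclidean: "(mdist (power_metric n euclidean_metric) x y)\<^sup>2 = nsq n (\<lambda>i. x i - y i)" for x y :: "nat \<Rightarrow> real"
  unfolding mdist_power_metric by (simp add: sum_nonneg dist_real_def)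

lemma semiconcave_lip_measurable:
  assumes \<sigma>: "\<sigma> > 0" and G: "semiconcave_lip n C G"
  shows "G \<in> borel_measurable (gpow n \<sigma>)"
proof -
  have "one_lipschitz (power_metric n euclidean_metric) euclidean_metric G"
    unfolding one_lipschitz_def
  proof (intro conjI ballI)
    fix x y assume "x \<in> mspace (power_metric n (euclidean_metric :: real metric))" "y \<in> mspace (power_metric n (euclidean_metric :: real metric))"
    then have "(G x - G y)\<^sup>2 \<le> nsq n (\<lambda>i. x i - y i)"
      using G unfolding semiconcave_lip_def by (simp add: mspace_power_metric)
    then have "(G x - G y)\<^sup>2 \<le> (mdist (power_metric n euclidean_metric) x y)\<^sup>2" unfolding dist_power_euclidean .
    then show "mdist euclidean_metric (G x) (G y) \<le> mdist (power_metric n euclidean_metric) x y"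
      using abs_le_square_iff[of "G x - G y" "mdist (power_metric n euclidean_metric) x y"] by (simp add: dist_real_def)
  qed simp
  then show ?thesis
    using one_lipschitz_borel_measurable[OF full_pm_space_imp_pm_space[OF full_pm_space_power_pm[OF full_pm_space_gaussian_line[OF \<sigma>]]], of n G]
    by simp
qed

text \<open>Inf-convolution with the semiconcave function \<open>sqrt (|x|\<^sup>2 + \<eta>\<^sup>2)\<close> regularises a Lipschitz
  function from above without increasing its Lipschitz constant.\<close>

lemma semiconcave_approximation:
  fixes G0 :: "(nat \<Rightarrow> real) \<Rightarrow> real"
  assumes G0: "one_lipschitz (power_metric n euclidean_metric) euclidean_metric G0" and \<eta>: "\<eta> > 0"
  shows "\<exists>G. semiconcave_lip n (1 / (2 * \<eta>)) G \<and> (\<forall>x\<in>PiE {..<n} (\<lambda>_. UNIV). G0 x \<le> G x \<and> G x \<le> G0 x + \<eta>)"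
proof -
  define S where "S = PiE {..<n} (\<lambda>_. UNIV :: real set)"
  define D where "D = mdist (power_metric n (euclidean_metric :: real metric))"
  have mS: "mspace (power_metric n (euclidean_metric :: real metric)) = S" by (simp add: mspace_power_metric S_def)
  have D2: "(D x y)\<^sup>2 = nsq n (\<lambda>i. x i - y i)" for x y unfolding D_def by (rule dist_power_euclidean)
  have D0: "0 \<le> D x y" for x y unfolding D_def by simp
  have tri: "D x z \<le> D x y + D y z" if "x \<in> S" "y \<in> S" "z \<in> S" for x y z
    unfolding D_def using that by (intro mdist_triangle) (auto simp: mS)
  have com: "D x y = D y x" for x y unfolding D_def by (rule mdist_commute)
  have lip0: "\<bar>G0 x - G0 y\<bar> \<le> D x y" if "x \<in> S" "y \<in> S" for x y
    using G0 that unfolding one_lipschitz_def mS D_def by (simp add: dist_real_def)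
  define q where "q x p = sqrt ((D x p)\<^sup>2 + \<eta>\<^sup>2)" for x p
  have qD: "D x p \<le> q x p" "\<eta> \<le> q x p" for x p
    unfolding q_def using D0[of x p] \<eta> by (simp_all add: real_le_rsqrt)
  have q_lip: "q x' p \<le> q x p + D x' x" if "x \<in> S" "x' \<in> S" "p \<in> S" for x x' p
  proof -
    have q2: "(q x p)\<^sup>2 = (D x p)\<^sup>2 + \<eta>\<^sup>2" unfolding q_def by simp
    have "(D x' p)\<^sup>2 \<le> (D x' x + D x p)\<^sup>2" using tri[OF that(2,1,3)] D0 by (intro power_mono) auto
    also have "\<dots> = (D x' x)\<^sup>2 + 2 * D x' x * D x p + (D x p)\<^sup>2" by (simp add: power2_sum)
    also have "\<dots> \<le> (D x' x)\<^sup>2 + 2 * D x' x * q x p + (D x p)\<^sup>2"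
      using qD(1) D0 by (intro add_mono mult_left_mono) auto
    finally have "(D x' p)\<^sup>2 + \<eta>\<^sup>2 \<le> (q x p + D x' x)\<^sup>2" using q2 by (simp add: power2_sum mult.commute mult.left_commute)
    then show ?thesis unfolding q_def[of x'] using qD(2)[of x p] \<eta> D0[of x' x] by (intro real_le_lsqrt) auto
  qed
  define G where "G x = (INF p\<in>S. G0 p + q x p)" for x
  have lower: "G0 x \<le> G0 p + q x p" if "x \<in> S" "p \<in> S" for x p
    using lip0[OF that] qD(1)[of x p] by linarith
  have bdd: "bdd_below ((\<lambda>p. G0 p + q x p) ` S)" if "x \<in> S" for x
    using lower[OF that] by (intro bdd_belowI2)
  have G_le: "G x \<le> G0 p + q x p" if "x \<in> S" "p \<in> S" for x p
    unfolding G_def by (rule cINF_lower[OF bdd[OF that(1)] that(2)])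
  have G_ge: "c \<le> G x" if "x \<in> S" "\<And>p. p \<in> S \<Longrightarrow> c \<le> G0 p + q x p" for x c
    unfolding G_def using that by (intro cINF_greatest) auto
  have G_near: "\<exists>p\<in>S. G0 p + q x p < G x + \<zeta>" if "x \<in> S" "\<zeta> > 0" for x \<zeta>
  proof (rule ccontr)
    assume "\<not> ?thesis"
    then have "G x + \<zeta> \<le> G x" using that(1) by (intro G_ge) (auto simp: not_less)
    then show False using that(2) by simp
  qed
  have G_lip1: "G x' \<le> G x + D x' x" if xx: "x \<in> S" "x' \<in> S" for x x'
  proof -
    have "G x' - D x' x \<le> G x"
    proof (rule G_ge[OF xx(1)])
      fix p assume p: "p \<in> S"
      show "G x' - D x' x \<le> G0 p + q x p" using G_le[OF xx(2) p] q_lip[OF xx p] by linarith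
    qed
    then show ?thesis by linarith
  qed
  have G_lip: "(G x' - G x)\<^sup>2 \<le> nsq n (\<lambda>i. x' i - x i)" if "x \<in> S" "x' \<in> S" for x x'
  proof -
    have "\<bar>G x' - G x\<bar> \<le> \<bar>D x' x\<bar>" using G_lip1[OF that] G_lip1[OF that(2,1)] com[of x x'] by linarith
    then have "(G x' - G x)\<^sup>2 \<le> (D x' x)\<^sup>2" by (rule abs_le_square_iff[THEN iffD1])
    then show ?thesis unfolding D2 .
  qed
  have semi: "\<exists>v. nsq n v \<le> 1 \<and> (\<forall>x'\<in>S. G x' \<le> G x + (\<Sum>i<n. v i * (x' i - x i)) + 1 / (2 * \<eta>) * nsq n (\<lambda>i. x' i - x i) + \<zeta>)"
    if x: "x \<in> S" and \<zeta>: "\<zeta> > 0" for x \<zeta>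
  proof -
    obtain p where p: "p \<in> S" "G0 p + q x p < G x + \<zeta>" using G_near[OF x \<zeta>] by blast
    define Q where "Q = q x p"
    have Q1: "Q \<ge> \<eta>" unfolding Q_def by (rule qD(2))
    have Q2: "Q > 0" using Q1 \<eta> by linarith
    have Q3: "Q\<^sup>2 = nsq n (\<lambda>i. x i - p i) + \<eta>\<^sup>2" unfolding Q_def q_def D2[symmetric] by simp
    note Q = Q1 Q2 Q3
    \<comment> \<open>The gradient at \<open>x\<close> of the smooth function \<open>q\<close> with
      its second argument fixed at the near-minimiser \<open>p\<close>; its norm is below 1 because
      of the added \<open>\<eta>\<close> term.\<close>
    define v where "v i = (x i - p i) / Q" for i
    have "nsq n v = nsq n (\<lambda>i. x i - p i) / Q\<^sup>2"
      unfolding v_def by (simp add: power_divide sum_divide_distrib)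
    also have "\<dots> \<le> 1"
    proof -
      have "nsq n (\<lambda>i. x i - p i) \<le> Q\<^sup>2" using Q3 by simp
      then show ?thesis using Q2 by (subst divide_le_eq_1_pos) auto
    qed
    finally have v: "nsq n v \<le> 1" .
    have "G x' \<le> G x + (\<Sum>i<n. v i * (x' i - x i)) + 1 / (2 * \<eta>) * nsq n (\<lambda>i. x' i - x i) + \<zeta>" if x': "x' \<in> S" for x'
    proof -
      define L where "L = (\<Sum>i<n. (x i - p i) * (x' i - x i))"
      define W where "W = nsq n (\<lambda>i. x' i - x i)"
      have W0: "0 \<le> W" unfolding W_def by (rule nsq_nonneg)
      have "(x' i - p i)\<^sup>2 = (x i - p i)\<^sup>2 + 2 * ((x i - p i) * (x' i - x i)) + (x' i - x i)\<^sup>2" for i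
        by (simp add: power2_eq_square algebra_simps)
      then have "nsq n (\<lambda>i. x' i - p i) = nsq n (\<lambda>i. x i - p i) + 2 * L + W"
        unfolding L_def W_def by (simp add: sum.distrib sum_distrib_left)
      then have sq: "(D x' p)\<^sup>2 + \<eta>\<^sup>2 = Q\<^sup>2 + 2 * L + W" unfolding D2 Q(3) by simp
      \<comment> \<open>The tangent of the square root lies above its graph. Since
        \<open>Q \<ge> \<eta>\<close>, the quadratic remainder has coefficient at most 1/(2\<eta>),
        which is the semiconcavity constant.\<close>
      have "q x' p \<le> Q + (2 * L + W) / (2 * Q)"
      proof -
        have "(Q + (2 * L + W) / (2 * Q))\<^sup>2 = Q\<^sup>2 + (2 * L + W) + ((2 * L + W) / (2 * Q))\<^sup>2"
          using Q(2) by (simp add: power2_sum)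
        then have "Q\<^sup>2 + 2 * L + W \<le> (Q + (2 * L + W) / (2 * Q))\<^sup>2" by simp
        moreover have "0 \<le> Q + (2 * L + W) / (2 * Q)"
        proof -
          have "0 \<le> (D x' p)\<^sup>2 + \<eta>\<^sup>2" by simp
          then have "0 \<le> 2 * Q\<^sup>2 + (2 * L + W)" using sq by (smt (verit) zero_le_power2)
          then have "0 \<le> (2 * Q\<^sup>2 + (2 * L + W)) / (2 * Q)" using Q(2) by simp
          also have "\<dots> = Q + (2 * L + W) / (2 * Q)" using Q(2) by (simp add: add_divide_distrib power2_eq_square)
          finally show ?thesis .
        qed
        ultimately show ?thesis unfolding q_def sq by (intro real_le_lsqrt) auto
      qed
      moreover have "(2 * L + W) / (2 * Q) = L / Q + W / (2 * Q)" by (simp add: add_divide_distrib)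
      moreover have "W / (2 * Q) \<le> W / (2 * \<eta>)" using Q(1) \<eta> W0 by (intro divide_left_mono) auto
      moreover have "L / Q = (\<Sum>i<n. v i * (x' i - x i))"
        unfolding L_def v_def by (simp add: sum_divide_distrib)
      moreover have "1 / (2 * \<eta>) * W = W / (2 * \<eta>)" by simp
      ultimately show ?thesis
        using G_le[OF x' p(1)] p(2) unfolding W_def[symmetric] Q_def[symmetric] by linarith
    qed
    then show ?thesis using v by blast
  qed
  have "semiconcave_lip n (1 / (2 * \<eta>)) G"
    unfolding semiconcave_lip_def S_def[symmetric] using semi G_lip by blast
  moreover have "G0 x \<le> G x \<and> G x \<le> G0 x + \<eta>" if x: "x \<in> S" for x
  proof
    show "G0 x \<le> G x" using lower[OF x] by (intro G_ge x)
    have "D x x = 0" unfolding D_def using x mS by simp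
    then have "q x x = \<eta>" unfolding q_def using \<eta> by simp
    then show "G x \<le> G0 x + \<eta>" using G_le[OF x x] by simp
  qed
  ultimately show ?thesis unfolding S_def by blast
qed

lemma clamp1_eq:
  assumes "\<delta> > 0"
  shows "u \<le> m - \<delta> \<Longrightarrow> clamp1 m \<delta> u = - 1" "u \<ge> m + \<delta> \<Longrightarrow> clamp1 m \<delta> u = 1"
proof -
  assume "u \<le> m - \<delta>"
  then have "(u - m) / \<delta> \<le> -1" using assms by (simp add: divide_le_eq)
  then show "clamp1 m \<delta> u = - 1" unfolding clamp1_def by linarith
next
  assume "u \<ge> m + \<delta>"
  then have "(u - m) / \<delta> \<ge> 1" using assms by (simp add: le_divide_eq)
  then show "clamp1 m \<delta> u = 1" unfolding clamp1_def by linarith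
qed

text \<open>The Cheeger-type inequality applied to a steep clamp of a coordinate of an almost uniform image,
  at the median: the two level sets have mass about \<open>1/2\<close>, the transition layer about \<open>2 \<delta> / r\<close>.\<close>

lemma interval_gaussian_bound:
  assumes r: "r > 0" and \<sigma>: "\<sigma> > 0" and \<epsilon>: "0 < \<epsilon>" "\<epsilon> < 1" and \<delta>: "\<delta> > 0"
    and Y: "pm_space Y" "lip_le Y (power_pm n (gaussian_line \<sigma>))" "box_ok (interval_pm r) Y \<epsilon>"
    and p: "0 \<le> 1 / 2 - (\<delta> + \<epsilon>) / r - \<epsilon>"
  shows "4 * (1 / 2 - (\<delta> + \<epsilon>) / r - \<epsilon>)\<^sup>2 \<le> (\<sigma> / \<delta>) * sqrt (pi / 2) * (\<epsilon> + (2 * \<delta> + 4 * \<epsilon>) / r)"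
proof -
  let ?P = "gpow n \<sigma>" and ?J = "snd (interval_pm r)"
  interpret P: prob_space ?P using \<sigma> by (rule prob_space_gpow)
  interpret PP: pair_prob_space ?P ?P ..
  interpret U: prob_space unit_leb by (rule prob_space_unit_leb)
  define m where "m = r / 2"
  define d where "d = mdist (fst Y)"
  obtain a b I where ab: "parameter (interval_pm r) a" "parameter Y b" "I \<in> sets borel" "I \<subseteq> {0..1}" "measure lborel I \<ge> 1 - \<epsilon>"
    "\<And>s t. s\<in>I \<Longrightarrow> t\<in>I \<Longrightarrow> \<bar>mdist (fst (interval_pm r)) (a s) (a t) - d (b s) (b t)\<bar> \<le> \<epsilon>"
    using Y(3) unfolding box_ok_def d_def by blast
  have am: "a \<in> measurable unit_leb ?J" "distr unit_leb ?J a = ?J" using ab(1) unfolding parameter_def by blast+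
  have bm: "b \<in> measurable unit_leb (snd Y)" "distr unit_leb (snd Y) b = snd Y" using ab(2) unfolding parameter_def by blast+
  have spJ: "space ?J = {0..r}"
    using sets_eq_imp_space_eq[OF sets_interval_pm] by (simp add: space_restrict_space)
  have spY: "space (snd Y) = mspace (fst Y)" using Y(1) unfolding pm_space_def by blast
  have a_in: "0 \<le> a t" "a t \<le> r" if "t \<in> {0..1}" for t
    using measurable_space[OF am(1), of t] that by (simp_all add: spJ)
  have b_in: "b t \<in> mspace (fst Y)" if "t \<in> {0..1}" for t
    using measurable_space[OF bm(1), of t] that spY by simp
  have I01: "t \<in> {0..1}" if "t \<in> I" for t using that ab(4) by blast
  have near: "\<bar>\<bar>a s - a t\<bar> - d (b s) (b t)\<bar> \<le> \<epsilon>" if "s \<in> I" "t \<in> I" for s t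
    using ab(6)[OF that] by (simp add: fst_interval_pm dist_real_def)
  have Ine: "I \<noteq> {}" using ab(5) \<epsilon> by auto
  have Ipr: "U.prob ({0..1} - I) \<le> \<epsilon>" and IU: "I \<in> sets unit_leb"
  proof -
    show IU: "I \<in> sets unit_leb" using ab(3,4) by (simp add: sets_restrict_space_iff)
    have "U.prob I = measure lborel I" using ab(4) by (simp add: measure_restrict_space)
    then show "U.prob ({0..1} - I) \<le> \<epsilon>" using U.prob_compl[OF IU] ab(5) by simp
  qed
  \<comment> \<open>A McShane extension: prescribing the value \<open>a s\<close> at the point
    \<open>b s\<close> is compatible with constant 1 up to \<open>\<epsilon>\<close> on
    \<open>I\<close>. It yields a 1-Lipschitz function on all of \<open>Y\<close> that reproduces
    the interval coordinate there within \<open>\<epsilon>\<close>.\<close>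
  define H where "H y = (INF s\<in>I. a s + d (b s) y)" for y
  have bdd: "bdd_below ((\<lambda>s. a s + d (b s) y) ` I)" for y
  proof (rule bdd_belowI2)
    fix s assume "s \<in> I"
    then show "0 \<le> a s + d (b s) y" using a_in(1)[OF I01] by (simp add: d_def)
  qed
  have H_le: "H y \<le> a s + d (b s) y" if "s \<in> I" for s y
    unfolding H_def by (rule cINF_lower[OF bdd that])
  have H_ge: "c \<le> H y" if "\<And>s. s \<in> I \<Longrightarrow> c \<le> a s + d (b s) y" for c y
    unfolding H_def by (rule cINF_greatest[OF Ine that])
  have H_lip1: "H y \<le> H z + d y z" if yz: "y \<in> mspace (fst Y)" "z \<in> mspace (fst Y)" for y z
  proof -
    have "H y - d y z \<le> H z"
    proof (rule H_ge)
      fix s assume s: "s \<in> I"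
      have "d (b s) y \<le> d (b s) z + d z y"
        unfolding d_def by (rule mdist_triangle[OF b_in[OF I01[OF s]] yz(2,1)])
      then show "H y - d y z \<le> a s + d (b s) z"
        using H_le[OF s, of y] mdist_commute[of "fst Y" y z] unfolding d_def by linarith
    qed
    then show ?thesis by linarith
  qed
  have Hlip: "one_lipschitz (fst Y) euclidean_metric H"
    unfolding one_lipschitz_def
  proof (intro conjI ballI)
    fix y z assume yz: "y \<in> mspace (fst Y)" "z \<in> mspace (fst Y)"
    have "\<bar>H y - H z\<bar> \<le> d y z"
      using H_lip1[OF yz] H_lip1[OF yz(2,1)] mdist_commute[of "fst Y" y z] unfolding d_def by linarith
    then show "mdist euclidean_metric (H y) (H z) \<le> mdist (fst Y) y z" by (simp add: dist_real_def d_def)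
  qed simp
  have Hm: "H \<in> borel_measurable (snd Y)" by (rule one_lipschitz_borel_measurable[OF Y(1) Hlip])
  have Hb: "H (b t) \<le> a t" "a t - \<epsilon> \<le> H (b t)" if t: "t \<in> I" for t
  proof -
    have "d (b t) (b t) = 0" unfolding d_def using b_in[OF I01[OF t]] by simp
    then show "H (b t) \<le> a t" using H_le[OF t, of "b t"] by simp
    show "a t - \<epsilon> \<le> H (b t)"
    proof (rule H_ge)
      fix s assume s: "s \<in> I"
      show "a t - \<epsilon> \<le> a s + d (b s) (b t)" using near[OF s t] by linarith
    qed
  qed
  obtain \<phi> where \<phi>: "one_lipschitz (power_metric n euclidean_metric) (fst Y) \<phi>" "distr ?P (snd Y) \<phi> = snd Y"
    using Y(2) unfolding lip_le_def by auto
  have \<phi>m: "\<phi> \<in> measurable ?P (snd Y)"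
    using one_lipschitz_measurable[of "power_pm n (gaussian_line \<sigma>)" Y \<phi>] \<phi>(1) Y(1)
      full_pm_space_imp_pm_space[OF full_pm_space_power_pm[OF full_pm_space_gaussian_line[OF \<sigma>]]] by simp
  define G0 where "G0 x = H (\<phi> x)" for x
  have G0lip: "one_lipschitz (power_metric n euclidean_metric) euclidean_metric G0"
    unfolding one_lipschitz_def
  proof (intro conjI ballI)
    fix x y assume xy: "x \<in> mspace (power_metric n (euclidean_metric :: real metric))" "y \<in> mspace (power_metric n (euclidean_metric :: real metric))"
    then have im: "\<phi> x \<in> mspace (fst Y)" "\<phi> y \<in> mspace (fst Y)" using \<phi>(1) unfolding one_lipschitz_def by auto
    have "mdist euclidean_metric (G0 x) (G0 y) \<le> mdist (fst Y) (\<phi> x) (\<phi> y)"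
      using Hlip im unfolding one_lipschitz_def G0_def by blast
    also have "\<dots> \<le> mdist (power_metric n euclidean_metric) x y"
      using \<phi>(1) xy unfolding one_lipschitz_def by blast
    finally show "mdist euclidean_metric (G0 x) (G0 y) \<le> mdist (power_metric n euclidean_metric) x y" .
  qed simp
  obtain G where G: "semiconcave_lip n (1 / (2 * \<epsilon>)) G" and GG: "\<And>x. x \<in> PiE {..<n} (\<lambda>_. UNIV) \<Longrightarrow> G0 x \<le> G x \<and> G x \<le> G0 x + \<epsilon>"
    using semiconcave_approximation[OF G0lip \<epsilon>(1)] by blast
  have GG': "G0 x \<le> G x" "G x \<le> G0 x + \<epsilon>" if "x \<in> space ?P" for x
    using GG[of x] that by (simp_all add: space_gpow)
  have Gm [measurable]: "G \<in> borel_measurable ?P" by (rule semiconcave_lip_measurable[OF \<sigma> G])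
  have G0m [measurable]: "G0 \<in> borel_measurable ?P" unfolding G0_def by (rule measurable_compose[OF \<phi>m Hm])
  have Hbm [measurable]: "(\<lambda>t. H (b t)) \<in> borel_measurable unit_leb" by (rule measurable_compose[OF bm(1) Hm])
  have abm [measurable]: "a \<in> borel_measurable unit_leb"
  proof -
    have "(\<lambda>x. x) \<in> measurable (restrict_space borel {0..r}) borel" by (rule measurable_restrict_space1) simp
    then have "(\<lambda>x. x) \<in> measurable ?J borel"
      unfolding measurable_cong_sets[OF sets_interval_pm refl] .
    from measurable_compose[OF am(1) this] show ?thesis .
  qed
  have law: "P.prob {x \<in> space ?P. G0 x \<in> B} = U.prob {t \<in> {0..1}. H (b t) \<in> B}" if B: "B \<in> sets borel" for B
  proof -
    have HB: "H -` B \<inter> space (snd Y) \<in> sets (snd Y)" by (rule measurable_sets[OF Hm B])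
    have "P.prob {x \<in> space ?P. G0 x \<in> B} = measure (distr ?P (snd Y) \<phi>) (H -` B \<inter> space (snd Y))"
      unfolding measure_distr[OF \<phi>m HB]
      by (rule arg_cong[where f="measure _"]) (use measurable_space[OF \<phi>m] in \<open>auto simp: G0_def\<close>)
    also have "\<dots> = measure (distr unit_leb (snd Y) b) (H -` B \<inter> space (snd Y))" unfolding \<phi>(2) bm(2) ..
    also have "\<dots> = U.prob {t \<in> {0..1}. H (b t) \<in> B}"
      unfolding measure_distr[OF bm(1) HB]
      by (rule arg_cong[where f="measure _"]) (use measurable_space[OF bm(1)] in auto)
    finally show ?thesis .
  qed
  have alaw: "U.prob {t \<in> {0..1}. u \<le> a t \<and> a t \<le> w} = (w - u) / r" if uw: "0 \<le> u" "u \<le> w" "w \<le> r" for u w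
  proof -
    have uwJ: "{u..w} \<in> sets ?J" using uw unfolding sets_interval_pm by (simp add: sets_restrict_space_iff)
    have "U.prob {t \<in> {0..1}. u \<le> a t \<and> a t \<le> w} = measure (distr unit_leb ?J a) {u..w}"
      unfolding measure_distr[OF am(1) uwJ] by (rule arg_cong[where f="measure _"]) auto
    also have "\<dots> = measure ?J {u..w}" unfolding am(2) ..
    also have "emeasure ?J {u..w} = ennreal ((w - u) / r)"
      using uw r by (subst emeasure_interval_pm) (auto simp: ennreal_mult[symmetric])
    then have "measure ?J {u..w} = (w - u) / r" using uw r by (simp add: measure_def)
    finally show ?thesis .
  qed
  have \<delta>m: "0 \<le> m - \<delta> - \<epsilon>" "m + \<delta> + \<epsilon> \<le> r"
  proof -
    have "(\<delta> + \<epsilon>) / r \<le> 1 / 2" using p \<epsilon> by linarith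
    then have "\<delta> + \<epsilon> \<le> r / 2" using r by (simp add: divide_le_eq)
    then show "0 \<le> m - \<delta> - \<epsilon>" "m + \<delta> + \<epsilon> \<le> r" unfolding m_def by linarith+
  qed
  define A where "A = {x \<in> space ?P. \<bar>G x - m\<bar> \<le> \<delta> + \<epsilon>}"
  define A1 where "A1 = {x \<in> space ?P. G x \<le> m - \<delta>}"
  define A2 where "A2 = {x \<in> space ?P. m + \<delta> \<le> G x}"
  have Am [measurable]: "A \<in> sets ?P" "A1 \<in> sets ?P" "A2 \<in> sets ?P" unfolding A_def A1_def A2_def by measurable
  have PA: "P.prob A \<le> \<epsilon> + (2 * \<delta> + 4 * \<epsilon>) / r"
  proof -
    \<comment> \<open>The layer for \<open>G\<close> has half-width \<delta> + \<epsilon>. Passing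
      from \<open>G\<close> to \<open>G0\<close> widens it downwards by \<epsilon>, and passing from
      \<open>H\<close> back to \<open>a\<close> widens it upwards by \<epsilon>, which makes
      2\<delta> + 4\<epsilon> in all, cut to the interval.\<close>
    define u where "u = max 0 (m - \<delta> - 2 * \<epsilon>)"
    define w where "w = min r (m + \<delta> + 2 * \<epsilon>)"
    have uw: "0 \<le> u" "u \<le> w" "w \<le> r" "w - u \<le> 2 * \<delta> + 4 * \<epsilon>"
      using r \<delta> \<epsilon> unfolding u_def w_def m_def by linarith+
    have "P.prob A \<le> P.prob {x \<in> space ?P. G0 x \<in> {m - \<delta> - 2 * \<epsilon>..m + \<delta> + \<epsilon>}}"
    proof (rule P.finite_measure_mono)
      show "A \<subseteq> {x \<in> space ?P. G0 x \<in> {m - \<delta> - 2 * \<epsilon>..m + \<delta> + \<epsilon>}}"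
      proof
        fix x assume "x \<in> A"
        then have x: "x \<in> space ?P" "\<bar>G x - m\<bar> \<le> \<delta> + \<epsilon>" unfolding A_def by auto
        then have "m - \<delta> - 2 * \<epsilon> \<le> G0 x" "G0 x \<le> m + \<delta> + \<epsilon>" using GG'[OF x(1)] by linarith+
        then show "x \<in> {x \<in> space ?P. G0 x \<in> {m - \<delta> - 2 * \<epsilon>..m + \<delta> + \<epsilon>}}" using x(1) by simp
      qed
    qed measurable
    also have "\<dots> = U.prob {t \<in> {0..1}. H (b t) \<in> {m - \<delta> - 2 * \<epsilon>..m + \<delta> + \<epsilon>}}" by (rule law) simp
    also have "\<dots> \<le> U.prob (({0..1} - I) \<union> {t \<in> {0..1}. u \<le> a t \<and> a t \<le> w})"
    proof (rule U.finite_measure_mono)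
      show "{t \<in> {0..1}. H (b t) \<in> {m - \<delta> - 2 * \<epsilon>..m + \<delta> + \<epsilon>}} \<subseteq> ({0..1} - I) \<union> {t \<in> {0..1}. u \<le> a t \<and> a t \<le> w}"
      proof
        fix t assume "t \<in> {t \<in> {0..1}. H (b t) \<in> {m - \<delta> - 2 * \<epsilon>..m + \<delta> + \<epsilon>}}"
        then have t: "t \<in> {0..1}" "m - \<delta> - 2 * \<epsilon> \<le> H (b t)" "H (b t) \<le> m + \<delta> + \<epsilon>" by auto
        show "t \<in> ({0..1} - I) \<union> {t \<in> {0..1}. u \<le> a t \<and> a t \<le> w}"
        proof (cases "t \<in> I")
          case True
          have "u \<le> a t" "a t \<le> w" using Hb[OF True] t(2,3) a_in[OF t(1)] unfolding u_def w_def by linarith+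
          then show ?thesis using t(1) by blast
        qed (use t in blast)
      qed
      have "{t \<in> space unit_leb. u \<le> a t \<and> a t \<le> w} \<in> sets unit_leb" by measurable
      then show "({0..1} - I) \<union> {t \<in> {0..1}. u \<le> a t \<and> a t \<le> w} \<in> sets unit_leb"
        using sets.compl_sets[OF IU] by (intro sets.Un) simp_all
    qed
    also have "\<dots> \<le> U.prob ({0..1} - I) + U.prob {t \<in> {0..1}. u \<le> a t \<and> a t \<le> w}"
    proof (rule measure_Un_le)
      show "{0..1} - I \<in> sets unit_leb" using sets.compl_sets[OF IU] by simp
      have "{t \<in> space unit_leb. u \<le> a t \<and> a t \<le> w} \<in> sets unit_leb" by measurable
      then show "{t \<in> {0..1}. u \<le> a t \<and> a t \<le> w} \<in> sets unit_leb" by simp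
    qed
    also have "\<dots> \<le> \<epsilon> + (2 * \<delta> + 4 * \<epsilon>) / r"
      unfolding alaw[OF uw(1-3)] using Ipr uw(4) r by (intro add_mono divide_right_mono) auto
    finally show ?thesis .
  qed
  \<comment> \<open>A lower bound for the mass on either side of the layer: half the interval, less
    \<delta> + \<epsilon> in length and less the exceptional mass \<epsilon>.\<close>
  define p where "p = 1 / 2 - (\<delta> + \<epsilon>) / r - \<epsilon>"
  have low: "p \<le> P.prob {x \<in> space ?P. G0 x \<in> B}"
    if B: "B \<in> sets borel" and uw: "0 \<le> u" "u \<le> w" "w \<le> r" "(w - u) / r - \<epsilon> = p"
      and sub: "\<And>t. t \<in> I \<Longrightarrow> u \<le> a t \<Longrightarrow> a t \<le> w \<Longrightarrow> H (b t) \<in> B" for B u w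
  proof -
    have "(w - u) / r = U.prob {t \<in> {0..1}. u \<le> a t \<and> a t \<le> w}" by (rule alaw[OF uw(1-3), symmetric])
    also have "\<dots> \<le> U.prob (({0..1} - I) \<union> {t \<in> {0..1}. H (b t) \<in> B})"
    proof (rule U.finite_measure_mono)
      show "{t \<in> {0..1}. u \<le> a t \<and> a t \<le> w} \<subseteq> ({0..1} - I) \<union> {t \<in> {0..1}. H (b t) \<in> B}"
        using sub by blast
      have "(\<lambda>t. H (b t)) -` B \<inter> space unit_leb \<in> sets unit_leb" by (rule measurable_sets[OF Hbm B])
      then show "({0..1} - I) \<union> {t \<in> {0..1}. H (b t) \<in> B} \<in> sets unit_leb"
        using sets.compl_sets[OF IU] by (intro sets.Un) (simp_all add: vimage_def Int_def conj_commute)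
    qed
    also have "\<dots> \<le> U.prob ({0..1} - I) + U.prob {t \<in> {0..1}. H (b t) \<in> B}"
    proof (rule measure_Un_le)
      show "{0..1} - I \<in> sets unit_leb" using sets.compl_sets[OF IU] by simp
      have "(\<lambda>t. H (b t)) -` B \<inter> space unit_leb \<in> sets unit_leb" by (rule measurable_sets[OF Hbm B])
      then show "{t \<in> {0..1}. H (b t) \<in> B} \<in> sets unit_leb" by (simp add: vimage_def Int_def conj_commute)
    qed
    finally show ?thesis using Ipr uw(4) unfolding law[OF B] by linarith
  qed
  have pA1: "p \<le> P.prob A1"
  proof -
    have e: "(m - \<delta> - \<epsilon> - 0) / r - \<epsilon> = p" unfolding p_def m_def using r by (simp add: field_simps)
    have "p \<le> P.prob {x \<in> space ?P. G0 x \<in> {..m - \<delta> - \<epsilon>}}"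
    proof (rule low[OF _ _ _ _ e])
      show "0 \<le> m - \<delta> - \<epsilon>" by (rule \<delta>m(1))
      show "m - \<delta> - \<epsilon> \<le> r" using \<delta> \<epsilon> r unfolding m_def by linarith
      fix t assume t: "t \<in> I" "a t \<le> m - \<delta> - \<epsilon>"
      show "H (b t) \<in> {..m - \<delta> - \<epsilon>}" using Hb(1)[OF t(1)] t(2) by simp
    qed simp_all
    also have "\<dots> \<le> P.prob A1"
    proof (rule P.finite_measure_mono)
      show "{x \<in> space ?P. G0 x \<in> {..m - \<delta> - \<epsilon>}} \<subseteq> A1" unfolding A1_def using GG'(2) by fastforce
    qed (rule Am)
    finally show ?thesis .
  qed
  have pA2: "p \<le> P.prob A2"
  proof -
    have e: "(r - (m + \<delta> + \<epsilon>)) / r - \<epsilon> = p" unfolding p_def m_def using r by (simp add: field_simps)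
    have "p \<le> P.prob {x \<in> space ?P. G0 x \<in> {m + \<delta>..}}"
    proof (rule low[OF _ _ _ _ e])
      show "m + \<delta> + \<epsilon> \<le> r" by (rule \<delta>m(2))
      show "0 \<le> m + \<delta> + \<epsilon>" using \<delta> \<epsilon> r unfolding m_def by linarith
      fix t assume t: "t \<in> I" "m + \<delta> + \<epsilon> \<le> a t"
      show "H (b t) \<in> {m + \<delta>..}" using Hb(2)[OF t(1)] t(2) by simp
    qed simp_all
    also have "\<dots> \<le> P.prob A2"
    proof (rule P.finite_measure_mono)
      show "{x \<in> space ?P. G0 x \<in> {m + \<delta>..}} \<subseteq> A2" unfolding A2_def using GG'(1) by fastforce
    qed (rule Am)
    finally show ?thesis .
  qed
  have p0: "0 \<le> p" unfolding p_def by (rule p)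
  let ?g = "\<lambda>x. clamp1 m \<delta> (G x)"
  \<comment> \<open>Each of the two products of opposite level sets has mass at least the square of
    \<open>p\<close>, and on both of them the clamp differs by 2.\<close>
  have "ennreal (4 * p\<^sup>2) \<le> ennreal (4 * (P.prob A1 * P.prob A2))"
  proof (rule ennreal_leI)
    have "p * p \<le> P.prob A1 * P.prob A2" using pA1 pA2 p0 by (intro mult_mono) auto
    then show "4 * p\<^sup>2 \<le> 4 * (P.prob A1 * P.prob A2)" by (simp add: power2_eq_square)
  qed
  also have "\<dots> = 2 * (emeasure ?P A1 * emeasure ?P A2) + 2 * (emeasure ?P A2 * emeasure ?P A1)"
  proof -
    have "ennreal (4 * (P.prob A1 * P.prob A2)) = ennreal (2 * (P.prob A1 * P.prob A2) + 2 * (P.prob A2 * P.prob A1))" by simp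
    also have "\<dots> = ennreal (2 * (P.prob A1 * P.prob A2)) + ennreal (2 * (P.prob A2 * P.prob A1))"
      by (rule ennreal_plus) simp_all
    finally show ?thesis by (simp add: P.emeasure_eq_measure ennreal_mult)
  qed
  also have "\<dots> = 2 * emeasure (?P \<Otimes>\<^sub>M ?P) (A1 \<times> A2) + 2 * emeasure (?P \<Otimes>\<^sub>M ?P) (A2 \<times> A1)"
    using Am by (simp add: P.emeasure_pair_measure_Times)
  also have "\<dots> = (\<integral>\<^sup>+ q. 2 * indicator (A1 \<times> A2) q + 2 * indicator (A2 \<times> A1) q \<partial>(?P \<Otimes>\<^sub>M ?P))"
    using Am by (subst nn_integral_add) (auto simp: nn_integral_cmult_indicator)
  also have "\<dots> \<le> (\<integral>\<^sup>+ q. ennreal \<bar>?g (fst q) - ?g (snd q)\<bar> \<partial>(?P \<Otimes>\<^sub>M ?P))"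
  proof (rule nn_integral_mono)
    fix q :: "(nat \<Rightarrow> real) \<times> (nat \<Rightarrow> real)"
    have c1: "?g x = -1" if "x \<in> A1" for x using that clamp1_eq(1)[OF \<delta>] unfolding A1_def by simp
    have c2: "?g x = 1" if "x \<in> A2" for x using that clamp1_eq(2)[OF \<delta>] unfolding A2_def by simp
    have dj: "x \<notin> A2" if "x \<in> A1" for x using that \<delta> unfolding A1_def A2_def by auto
    consider "q \<in> A1 \<times> A2" | "q \<in> A2 \<times> A1" | "q \<notin> A1 \<times> A2" "q \<notin> A2 \<times> A1" by blast
    then show "2 * indicator (A1 \<times> A2) q + 2 * indicator (A2 \<times> A1) q \<le> ennreal \<bar>?g (fst q) - ?g (snd q)\<bar>"
    proof cases
      case 1
      then have "q \<notin> A2 \<times> A1" "fst q \<in> A1" "snd q \<in> A2" using dj by auto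
      then show ?thesis using 1 c1 c2 by simp
    next
      case 2
      then have "q \<notin> A1 \<times> A2" "fst q \<in> A2" "snd q \<in> A1" using dj by auto
      then show ?thesis using 2 c1 c2 by simp
    qed simp
  qed
  also have "\<dots> \<le> ennreal ((\<sigma> / \<delta>) * sqrt (pi / 2) * P.prob A)"
    unfolding A_def by (rule gaussian_cheeger[OF \<sigma> G Gm _ \<delta> \<epsilon>(1)]) (use \<epsilon> in simp)
  also have "\<dots> \<le> ennreal ((\<sigma> / \<delta>) * sqrt (pi / 2) * (\<epsilon> + (2 * \<delta> + 4 * \<epsilon>) / r))"
    using PA \<sigma> \<delta> by (intro ennreal_leI mult_left_mono) auto
  finally have "ennreal (4 * p\<^sup>2) \<le> ennreal ((\<sigma> / \<delta>) * sqrt (pi / 2) * (\<epsilon> + (2 * \<delta> + 4 * \<epsilon>) / r))" .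
  moreover have "0 \<le> (\<sigma> / \<delta>) * sqrt (pi / 2) * (\<epsilon> + (2 * \<delta> + 4 * \<epsilon>) / r)" using \<sigma> \<delta> \<epsilon> r by simp
  ultimately show ?thesis unfolding p_def by (simp add: ennreal_le_iff)
qed

text \<open>Letting \<epsilon> and then \<delta> tend to 0 turns the estimate into 1 \<le> \<sigma>
  sqrt(pi/2) 2/r. The order matters, because the bound contains \<epsilon>/\<delta>.\<close>

lemma interval_in_gaussian_pyramid:
  assumes r: "r > 0" and \<sigma>: "\<sigma> > 0" and I: "class_of (interval_pm r) \<in> infinite_power (gaussian_line \<sigma>)"
  shows "r / sqrt (2 * pi) \<le> \<sigma>"
proof -
  have bound: "4 * (1 / 2 - (\<delta> + \<epsilon>) / r - \<epsilon>)\<^sup>2 \<le> (\<sigma> / \<delta>) * sqrt (pi / 2) * (\<epsilon> + (2 * \<delta> + 4 * \<epsilon>) / r)"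
    if "0 < \<epsilon>" "\<epsilon> < 1" "\<delta> > 0" "0 \<le> 1 / 2 - (\<delta> + \<epsilon>) / r - \<epsilon>" for \<epsilon> \<delta>
  proof -
    have "\<epsilon> / 2 > 0" using that by simp
    from in_box_closureD[OF I[unfolded infinite_power_def] this] obtain Z n where
      Z: "lip_le (rep_pm_class Z) (power_pm n (gaussian_line \<sigma>))" "box_class (class_of (interval_pm r)) Z < \<epsilon> / 2"
      unfolding pyramid_of_def by auto
    then obtain e where e: "0 < e" "e < \<epsilon> / 2" "box_ok (rep_pm_class (class_of (interval_pm r))) (rep_pm_class Z) e"
      unfolding box_class_less_iff by blast
    have f: "full_pm_space (interval_pm r)" by (rule full_pm_space_interval_pm[OF r])
    have "box_ok (interval_pm r) (rep_pm_class Z) (0 + e + \<epsilon> / 2)"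
      by (rule box_ok_triangle[OF pm_iso_box_ok[OF pm_iso_class_of[OF f]] e(3) \<open>\<epsilon> / 2 > 0\<close>])
         (use full_pm_space_imp_pm_space[OF f] in auto)
    then have "box_ok (interval_pm r) (rep_pm_class Z) \<epsilon>" by (rule box_ok_mono) (use e in simp)
    then show ?thesis by (rule interval_gaussian_bound[OF r \<sigma> that(1-3) pm_space_rep Z(1) _ that(4)])
  qed
  have bound2: "4 * (1 / 2 - \<delta> / r)\<^sup>2 \<le> \<sigma> * sqrt (pi / 2) * (2 / r)" if \<delta>: "\<delta> > 0" "\<delta> < r / 2" for \<delta>
  proof -
    have l: "((\<lambda>\<epsilon>. 4 * (1 / 2 - (\<delta> + \<epsilon>) / r - \<epsilon>)\<^sup>2) \<longlongrightarrow> 4 * (1 / 2 - (\<delta> + 0) / r - 0)\<^sup>2) (at_right 0)"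
      by (intro tendsto_intros) (use r in auto)
    have u: "((\<lambda>\<epsilon>. (\<sigma> / \<delta>) * sqrt (pi / 2) * (\<epsilon> + (2 * \<delta> + 4 * \<epsilon>) / r)) \<longlongrightarrow> (\<sigma> / \<delta>) * sqrt (pi / 2) * (0 + (2 * \<delta> + 4 * 0) / r)) (at_right 0)"
      by (intro tendsto_intros) (use r in auto)
    have "((\<lambda>\<epsilon>. 1 / 2 - (\<delta> + \<epsilon>) / r - \<epsilon>) \<longlongrightarrow> 1 / 2 - (\<delta> + 0) / r - 0) (at_right 0)"
      by (intro tendsto_intros) (use r in auto)
    moreover have "0 < 1 / 2 - (\<delta> + 0) / r - 0" using \<delta> r by (simp add: field_simps)
    ultimately have "\<forall>\<^sub>F \<epsilon> in at_right 0. 0 < 1 / 2 - (\<delta> + \<epsilon>) / r - \<epsilon>" by (rule order_tendstoD(1))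
    moreover have "\<forall>\<^sub>F \<epsilon> in at_right 0. \<epsilon> < (1::real)" by (rule eventually_at_rightI[of 0 1]) simp_all
    moreover have "\<forall>\<^sub>F \<epsilon> in at_right 0. 0 < (\<epsilon>::real)" by (rule eventually_at_right_less)
    ultimately have "\<forall>\<^sub>F \<epsilon> in at_right 0. 4 * (1 / 2 - (\<delta> + \<epsilon>) / r - \<epsilon>)\<^sup>2 \<le> (\<sigma> / \<delta>) * sqrt (pi / 2) * (\<epsilon> + (2 * \<delta> + 4 * \<epsilon>) / r)"
      by eventually_elim (use bound \<delta>(1) in simp)
    from tendsto_le[OF _ u l this] show ?thesis using \<delta>(1) by (simp add: field_simps)
  qed
  have l: "((\<lambda>\<delta>. 4 * (1 / 2 - \<delta> / r)\<^sup>2) \<longlongrightarrow> 4 * (1 / 2 - 0 / r)\<^sup>2) (at_right 0)"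
    by (intro tendsto_intros) (use r in auto)
  have "\<forall>\<^sub>F \<delta> in at_right 0. 4 * (1 / 2 - \<delta> / r)\<^sup>2 \<le> \<sigma> * sqrt (pi / 2) * (2 / r)"
    by (rule eventually_at_rightI[of 0 "r/2"]) (use bound2 r in auto)
  from tendsto_upperbound[OF l this] have "4 * (1 / 2)\<^sup>2 \<le> \<sigma> * sqrt (pi / 2) * (2 / r)" by simp
  then have "1 \<le> \<sigma> * (2 * sqrt (pi / 2)) / r" by (simp add: power2_eq_square mult.commute mult.left_commute)
  moreover have "2 * sqrt (pi / 2) = sqrt (2 * pi)"
  proof -
    have "2 * sqrt (pi / 2) = sqrt (4 * (pi / 2))" unfolding real_sqrt_mult by simp
    then show ?thesis by simp
  qed
  ultimately have "r \<le> \<sigma> * sqrt (2 * pi)" using r by (simp add: le_divide_eq)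
  then show ?thesis by (simp add: divide_le_eq)
qed

section \<open>Laws on the line in an idempotent pyramid\<close>

lemma supp_pm_map:
  assumes Y: "pm_space Y"
    and f: "one_lipschitz (fst X) (fst Y) f" "f \<in> measurable (snd X) (snd Y)" "distr (snd X) (snd Y) f = snd Y"
    and supp: "\<And>x. x \<in> mspace (fst X) \<Longrightarrow> f x \<in> pm_support Y" and sp: "space (snd X) = mspace (fst X)"
  shows "one_lipschitz (fst X) (fst (supp_pm Y)) f" "f \<in> measurable (snd X) (snd (supp_pm Y))"
    "distr (snd X) (snd (supp_pm Y)) f = snd (supp_pm Y)"
proof -
  let ?S = "pm_support Y"
  have S: "?S \<in> sets (snd Y)" using pm_support_sets[OF Y] .
  have m: "f \<in> measurable (snd X) (restrict_space (snd Y) ?S)"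
  proof (rule measurable_restrict_space2[OF _ f(2)])
    show "f \<in> space (snd X) \<rightarrow> ?S" unfolding sp using supp by (rule Pi_I)
  qed
  have "distr (snd X) (restrict_space (snd Y) ?S) f = restrict_space (snd Y) ?S"
  proof (rule measure_eqI)
    fix A assume "A \<in> sets (distr (snd X) (restrict_space (snd Y) ?S) f)"
    then have A: "A \<in> sets (restrict_space (snd Y) ?S)" by simp
    then have A': "A \<in> sets (snd Y)" "A \<subseteq> ?S" using S by (auto simp: sets_restrict_space_iff)
    have "emeasure (distr (snd X) (restrict_space (snd Y) ?S) f) A = emeasure (distr (snd X) (snd Y) f) A"
      using A' m A f(2) by (simp add: emeasure_distr)
    also have "\<dots> = emeasure (restrict_space (snd Y) ?S) A"
      using A' S f(3) by (simp add: emeasure_restrict_space)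
    finally show "emeasure (distr (snd X) (restrict_space (snd Y) ?S) f) A = emeasure (restrict_space (snd Y) ?S) A" .
  qed simp
  then show "distr (snd X) (snd (supp_pm Y)) f = snd (supp_pm Y)" unfolding supp_pm_def by simp
  show "f \<in> measurable (snd X) (snd (supp_pm Y))" using m unfolding supp_pm_def by simp
  have "one_lipschitz (fst X) (submetric (fst Y) ?S) f"
    using f(1) supp by (auto simp: one_lipschitz_def)
  then show "one_lipschitz (fst X) (fst (supp_pm Y)) f" unfolding supp_pm_def by simp
qed

text \<open>Here \<open>X\<close> may be an l2-product carrying its product sigma-algebra, which is
  not compared with the Borel sets of the product metric. Measurability of \<open>f\<close> is
  therefore a hypothesis, where \<open>lip_le_trans\<close> derives it.\<close>

lemma lip_le_trans_measurable:
  assumes f: "one_lipschitz (fst X) (fst Y) f" "f \<in> measurable (snd X) (snd Y)" "distr (snd X) (snd Y) f = snd Y"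
    and Z: "lip_le Z Y" and p: "pm_space Y" "pm_space Z"
  shows "lip_le Z X"
proof -
  obtain g where g: "one_lipschitz (fst Y) (fst Z) g" "distr (snd Y) (snd Z) g = snd Z"
    using Z unfolding lip_le_def by blast
  have gm: "g \<in> measurable (snd Y) (snd Z)" by (rule one_lipschitz_measurable[OF g(1) p])
  have "one_lipschitz (fst X) (fst Z) (g \<circ> f)"
    unfolding one_lipschitz_def
  proof (intro conjI ballI)
    show "g \<circ> f \<in> mspace (fst X) \<rightarrow> mspace (fst Z)" using f(1) g(1) by (auto simp: one_lipschitz_def)
    fix x y assume xy: "x \<in> mspace (fst X)" "y \<in> mspace (fst X)"
    then have "f x \<in> mspace (fst Y)" "f y \<in> mspace (fst Y)" using f(1) by (auto simp: one_lipschitz_def)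
    then have "mdist (fst Z) (g (f x)) (g (f y)) \<le> mdist (fst Y) (f x) (f y)" using g(1) by (simp add: one_lipschitz_def)
    also have "\<dots> \<le> mdist (fst X) x y" using f(1) xy by (simp add: one_lipschitz_def)
    finally show "mdist (fst Z) ((g \<circ> f) x) ((g \<circ> f) y) \<le> mdist (fst X) x y" by simp
  qed
  moreover have "distr (snd X) (snd Z) (g \<circ> f) = snd Z"
    using distr_distr[OF gm f(2)] f(3) g(2) by simp
  ultimately show ?thesis unfolding lip_le_def by blast
qed

lemma lip_le_class_of_iff:
  assumes X: "full_pm_space X" and Z: "pm_space Z"
  shows "lip_le (rep_pm_class (class_of X)) Z \<longleftrightarrow> lip_le X Z"
proof
  assume a: "lip_le X Z"
  show "lip_le (rep_pm_class (class_of X)) Z"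
    by (rule lip_le_trans[OF lip_le_class_of(1)[OF X] a Z full_pm_space_imp_pm_space[OF X] pm_space_rep])
next
  assume a: "lip_le (rep_pm_class (class_of X)) Z"
  show "lip_le X Z"
    by (rule lip_le_trans[OF lip_le_class_of(2)[OF X] a Z pm_space_rep full_pm_space_imp_pm_space[OF X]])
qed

lemma pyramid_downward:
  "P \<in> pyramids \<Longrightarrow> X \<in> P \<Longrightarrow> lip_le (rep_pm_class Y) (rep_pm_class X) \<Longrightarrow> Y \<in> P"
  unfolding pyramids_def lip_le_class_def by blast

lemma pyramid_downward_class_of:
  assumes "P \<in> pyramids" "X \<in> P" "full_pm_space Y" "lip_le Y (rep_pm_class X)"
  shows "class_of Y \<in> P"
  by (rule pyramid_downward[OF assms(1,2)]) (simp add: lip_le_class_of_iff[OF assms(3) pm_space_rep] assms(4))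

lemma pyramid_closed: "P \<in> pyramids \<Longrightarrow> box_closure P = P"
  unfolding pyramids_def by blast

lemma idempotent_prod:
  assumes "l2_idempotent P" "X \<in> P" "Y \<in> P" "lip_le (rep_pm_class Z) (prod_pm (rep_pm_class X) (rep_pm_class Y))"
  shows "Z \<in> P"
proof -
  have "Z \<in> (\<Union>X\<in>P. \<Union>Y\<in>P. pyramid_of (prod_pm (rep_pm_class X) (rep_pm_class Y)))"
    using assms(2-4) unfolding pyramid_of_def by blast
  then have "Z \<in> pyramid_prod P P" unfolding pyramid_prod_def by (rule subsetD[OF subset_box_closure])
  then show ?thesis using assms(1) unfolding l2_idempotent_def by simp
qed

section \<open>Laws on the line as isomorphism classes\<close>

definition line :: "real measure \<Rightarrow> real metric_measure" where
  "line \<mu> = (euclidean_metric, \<mu>)"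

text \<open>A law need not charge every interval, whereas classes are represented with full support;
  hence the passage to the support.\<close>

definition line_class :: "real measure \<Rightarrow> pm_class" where
  "line_class \<mu> = class_of (supp_pm (line \<mu>))"

lemma line_simps [simp]: "fst (line \<mu>) = euclidean_metric" "snd (line \<mu>) = \<mu>"
  by (simp_all add: line_def)

lemma pm_space_line: "real_distribution \<mu> \<Longrightarrow> pm_space (line \<mu>)"
  unfolding line_def by (rule pm_space_euclidean) (auto simp: real_distribution_def real_distribution_axioms_def)

lemma full_pm_space_supp_line: "real_distribution \<mu> \<Longrightarrow> full_pm_space (supp_pm (line \<mu>))"
  by (intro full_pm_space_supp_pm pm_space_line)

lemma pm_support_line:
  assumes "real_distribution \<mu>"
  shows "x \<in> pm_support (line \<mu>) \<longleftrightarrow> (\<forall>e>0. emeasure \<mu> (ball x e) > 0)"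
proof
  assume "x \<in> pm_support (line \<mu>)"
  then show "\<forall>e>0. emeasure \<mu> (ball x e) > 0"
    using pm_support_pos[of x "line \<mu>"] by simp
next
  assume r: "\<forall>e>0. emeasure \<mu> (ball x e) > 0"
  have sb: "sets \<mu> = sets borel" using assms by (simp add: real_distribution_def real_distribution_axioms_def)
  have "emeasure \<mu> U > 0" if U: "open U" "x \<in> U" for U
  proof -
    obtain e where e: "e > 0" "ball x e \<subseteq> U" using openE[OF U] by blast
    have "emeasure \<mu> (ball x e) \<le> emeasure \<mu> U" using e(2) U(1) sb by (intro emeasure_mono) (auto simp: borel_open)
    then show ?thesis using r e(1) by (meson order_less_le_trans)
  qed
  then show "x \<in> pm_support (line \<mu>)" unfolding pm_support_def by simp
qed

lemma supp_line_map:
  assumes \<mu>: "real_distribution \<mu>" and f: "one_lipschitz (fst Z) euclidean_metric f" "f \<in> borel_measurable (snd Z)"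
    "distr (snd Z) borel f = \<mu>" and sp: "space (snd Z) = mspace (fst Z)"
    and s: "\<And>z. z \<in> mspace (fst Z) \<Longrightarrow> f z \<in> pm_support (line \<mu>)"
  shows "one_lipschitz (fst Z) (fst (supp_pm (line \<mu>))) f" "f \<in> measurable (snd Z) (snd (supp_pm (line \<mu>)))"
    "distr (snd Z) (snd (supp_pm (line \<mu>))) f = snd (supp_pm (line \<mu>))"
proof -
  have sb: "sets \<mu> = sets borel" using \<mu> by (simp add: real_distribution_def real_distribution_axioms_def)
  have m: "f \<in> measurable (snd Z) (snd (line \<mu>))" unfolding line_simps by (subst measurable_cong_sets[OF refl sb]) (rule f(2))
  have "distr (snd Z) \<mu> f = distr (snd Z) borel f" by (rule distr_cong) (auto simp: sb)
  then have d: "distr (snd Z) (snd (line \<mu>)) f = snd (line \<mu>)" using f(3) by simp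
  have l: "one_lipschitz (fst Z) (fst (line \<mu>)) f" using f(1) by simp
  from supp_pm_map[OF pm_space_line[OF \<mu>] l m d s sp]
  show "one_lipschitz (fst Z) (fst (supp_pm (line \<mu>))) f" "f \<in> measurable (snd Z) (snd (supp_pm (line \<mu>)))"
    "distr (snd Z) (snd (supp_pm (line \<mu>))) f = snd (supp_pm (line \<mu>))" by blast+
qed

lemma lip_le_line_class:
  assumes \<mu>: "real_distribution \<mu>" and f: "one_lipschitz (fst Z) euclidean_metric f" "f \<in> borel_measurable (snd Z)"
    "distr (snd Z) borel f = \<mu>" and sp: "space (snd Z) = mspace (fst Z)"
    and s: "\<And>z. z \<in> mspace (fst Z) \<Longrightarrow> f z \<in> pm_support (line \<mu>)"
  shows "lip_le (rep_pm_class (line_class \<mu>)) Z"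
proof (rule lip_le_trans_measurable[OF supp_line_map[OF assms]])
  note full = full_pm_space_supp_line[OF \<mu>]
  show "lip_le (rep_pm_class (line_class \<mu>)) (supp_pm (line \<mu>))"
    unfolding line_class_def by (rule lip_le_class_of(1)[OF full])
  show "pm_space (supp_pm (line \<mu>))" by (rule full_pm_space_imp_pm_space[OF full])
qed simp_all

text \<open>The preimage of a ball around \<open>f z\<close> contains a ball around
  \<open>z\<close>, which has positive mass by full support. So \<open>f\<close> takes all its
  values in the support of the image law, and the map into \<open>supp_pm\<close> is defined
  everywhere and not just almost everywhere.\<close>

lemma line_class_image:
  assumes P: "P \<in> pyramids" and X: "X \<in> P" and f: "one_lipschitz (fst (rep_pm_class X)) euclidean_metric f"
  shows "line_class (distr (snd (rep_pm_class X)) borel f) \<in> P" "real_distribution (distr (snd (rep_pm_class X)) borel f)"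
proof -
  let ?X = "rep_pm_class X"
  let ?\<mu> = "distr (snd ?X) borel f"
  interpret X: prob_space "snd ?X" using pm_space_rep[of X] unfolding pm_space_def by blast
  have fm: "f \<in> borel_measurable (snd ?X)" by (rule one_lipschitz_borel_measurable[OF pm_space_rep f])
  have sp: "space (snd ?X) = mspace (fst ?X)" using pm_space_rep[of X] unfolding pm_space_def by blast
  show \<mu>: "real_distribution ?\<mu>" by (rule X.real_distribution_distr[OF fm])
  have "lip_le (rep_pm_class (line_class ?\<mu>)) ?X"
  proof (rule lip_le_line_class[OF \<mu> f fm refl sp])
    fix z assume z: "z \<in> mspace (fst ?X)"
    have zs: "z \<in> pm_support ?X" using z full_pm_space_rep[of X] unfolding full_pm_space_def by blast
    show "f z \<in> pm_support (line ?\<mu>)"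
      unfolding pm_support_line[OF \<mu>]
    proof (intro allI impI)
      fix e :: real assume e: "e > 0"
      have "z \<in> mball_of (fst ?X) z e" using z e by simp
      then have "0 < emeasure (snd ?X) (mball_of (fst ?X) z e)" by (rule pm_support_pos[OF zs openin_mball_of])
      also have "\<dots> \<le> emeasure (snd ?X) (f -` ball (f z) e \<inter> space (snd ?X))"
      proof (rule emeasure_mono)
        show "f -` ball (f z) e \<inter> space (snd ?X) \<in> sets (snd ?X)" by (rule measurable_sets[OF fm]) simp
        show "mball_of (fst ?X) z e \<subseteq> f -` ball (f z) e \<inter> space (snd ?X)"
        proof
          fix y assume y: "y \<in> mball_of (fst ?X) z e"
          then have ym: "y \<in> mspace (fst ?X)" "mdist (fst ?X) z y < e" by auto
          have "dist (f z) (f y) \<le> mdist (fst ?X) z y" using f z ym(1) unfolding one_lipschitz_def by simp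
          then show "y \<in> f -` ball (f z) e \<inter> space (snd ?X)" using ym sp by simp
        qed
      qed
      also have "\<dots> = emeasure ?\<mu> (ball (f z) e)" by (rule emeasure_distr[OF fm, symmetric]) simp
      finally show "0 < emeasure ?\<mu> (ball (f z) e)" .
    qed
  qed
  then show "line_class ?\<mu> \<in> P" by (rule pyramid_downward[OF P X])
qed

lemma supp_line_inclusion:
  assumes \<mu>: "real_distribution \<mu>"
  shows "(\<lambda>x. x) \<in> measurable (snd (supp_pm (line \<mu>))) borel" "distr (snd (supp_pm (line \<mu>))) borel (\<lambda>x. x) = \<mu>"
proof -
  let ?S = "supp_pm (line \<mu>)" and ?T = "pm_support (line \<mu>)"
  have sb: "sets \<mu> = sets borel" using \<mu> by (simp add: real_distribution_def real_distribution_axioms_def)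
  have T: "?T \<in> sets \<mu>" using pm_support_sets[OF pm_space_line[OF \<mu>]] by simp
  interpret M: prob_space \<mu> using \<mu> by (simp add: real_distribution_def)
  have "(\<lambda>x. x) \<in> measurable (restrict_space \<mu> ?T) \<mu>" by (rule measurable_restrict_space1) simp
  then have "(\<lambda>x. x) \<in> measurable (restrict_space \<mu> ?T) borel" by (subst measurable_cong_sets[OF refl sb, symmetric])
  then show inc: "(\<lambda>x. x) \<in> measurable (snd ?S) borel" unfolding supp_pm_def by simp
  show "distr (snd ?S) borel (\<lambda>x. x) = \<mu>"
  proof (rule measure_eqI)
    fix A assume "A \<in> sets (distr (snd ?S) borel (\<lambda>x. x))"
    then have A: "A \<in> sets borel" by simp
    have "emeasure (distr (snd ?S) borel (\<lambda>x. x)) A = emeasure (snd ?S) (A \<inter> space (snd ?S))"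
      using emeasure_distr[OF inc A] by simp
    also have "\<dots> = emeasure \<mu> (A \<inter> ?T)"
    proof -
      have "space (snd ?S) = ?T" using sets.sets_into_space[OF T] by (simp add: supp_pm_def space_restrict_space Int_absorb2)
      moreover have "emeasure (restrict_space \<mu> ?T) (A \<inter> ?T) = emeasure \<mu> (A \<inter> ?T)"
        using T by (intro emeasure_restrict_space) (auto intro: sets.Int)
      ultimately show ?thesis by (simp add: supp_pm_def)
    qed
    also have "\<dots> = emeasure \<mu> A"
    proof (rule emeasure_eq_AE)
      have "M.prob ?T = 1" using emeasure_pm_support[OF pm_space_line[OF \<mu>]] by (simp add: measure_def)
      then have "AE x in \<mu>. x \<in> ?T" using M.AE_in_set_eq_1[OF T] by simp
      then show "AE x in \<mu>. x \<in> A \<inter> ?T \<longleftrightarrow> x \<in> A" by eventually_elim auto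
    qed (use A T sb in auto)
    finally show "emeasure (distr (snd ?S) borel (\<lambda>x. x)) A = emeasure \<mu> A" .
  qed (simp add: sb)
qed

text \<open>The representative consists of real numbers with an unrelated metric; \<open>i\<close>
  interprets its points as points of the support of the law.\<close>

lemma rep_line_class:
  assumes \<mu>: "real_distribution \<mu>"
  defines "R \<equiv> rep_pm_class (line_class \<mu>)"
  shows "\<exists>i. one_lipschitz (fst R) euclidean_metric i \<and> i \<in> borel_measurable (snd R) \<and>
    distr (snd R) borel i = \<mu> \<and> (\<forall>z\<in>mspace (fst R). i z \<in> pm_support (line \<mu>))"
proof -
  let ?S = "supp_pm (line \<mu>)" and ?T = "pm_support (line \<mu>)"
  have f: "full_pm_space ?S" by (rule full_pm_space_supp_line[OF \<mu>])
  obtain i where i: "one_lipschitz (fst R) (fst ?S) i" "distr (snd R) (snd ?S) i = snd ?S"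
    using lip_le_class_of(2)[OF f] unfolding R_def line_class_def lip_le_def by blast
  have im: "i \<in> measurable (snd R) (snd ?S)"
    by (rule one_lipschitz_measurable[OF i(1) _ full_pm_space_imp_pm_space[OF f]]) (simp add: R_def)
  note inc = supp_line_inclusion[OF \<mu>]
  have T': "mspace (fst ?S) = ?T" "mdist (fst ?S) = dist" by (simp_all add: supp_pm_def)
  have l: "one_lipschitz (fst R) euclidean_metric i" using i(1) unfolding one_lipschitz_def T' by simp
  have s: "\<forall>z\<in>mspace (fst R). i z \<in> ?T" using i(1) unfolding one_lipschitz_def T' by blast
  have m: "i \<in> borel_measurable (snd R)" using measurable_comp[OF im inc(1)] by (simp add: o_def)
  have "distr (snd R) borel i = \<mu>"
    using distr_distr[OF inc(1) im] i(2) inc(2) by (simp add: o_def)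
  then show ?thesis using l m s by blast
qed

section \<open>Linear combinations and normalised sums\<close>

lemma cauchy_schwarz_2:
  fixes c s a b :: real
  assumes "c\<^sup>2 + s\<^sup>2 \<le> 1"
  shows "\<bar>c * a + s * b\<bar> \<le> sqrt (a\<^sup>2 + b\<^sup>2)"
proof (rule real_le_rsqrt)
  have "\<bar>c * a + s * b\<bar>\<^sup>2 = (c\<^sup>2 + s\<^sup>2) * (a\<^sup>2 + b\<^sup>2) - (c * b - s * a)\<^sup>2"
    by (simp add: power2_eq_square algebra_simps)
  also have "\<dots> \<le> (c\<^sup>2 + s\<^sup>2) * (a\<^sup>2 + b\<^sup>2)" by simp
  also have "\<dots> \<le> 1 * (a\<^sup>2 + b\<^sup>2)" using assms by (intro mult_right_mono) auto
  finally show "\<bar>c * a + s * b\<bar>\<^sup>2 \<le> a\<^sup>2 + b\<^sup>2" by simp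
qed

text \<open>By the Cauchy-Schwarz inequality (x, y) -> c x + s y is 1-Lipschitz on the l2-product,
  so idempotency puts the law of the combination of independent variables into
  \<open>P\<close>.\<close>

lemma line_class_combination:
  assumes idem: "l2_idempotent P" and mem: "line_class \<mu> \<in> P" "line_class \<nu> \<in> P"
    and \<mu>: "real_distribution \<mu>" and \<nu>: "real_distribution \<nu>" and cs: "c\<^sup>2 + s\<^sup>2 \<le> 1"
  shows "line_class (distr (\<mu> \<Otimes>\<^sub>M \<nu>) borel (\<lambda>p. c * fst p + s * snd p)) \<in> P"
    "real_distribution (distr (\<mu> \<Otimes>\<^sub>M \<nu>) borel (\<lambda>p. c * fst p + s * snd p))"
proof -
  let ?F = "\<lambda>p::real \<times> real. c * fst p + s * snd p"
  let ?R = "rep_pm_class (line_class \<mu>)" and ?T = "rep_pm_class (line_class \<nu>)"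
  define \<rho> where "\<rho> = distr (\<mu> \<Otimes>\<^sub>M \<nu>) borel ?F"
  interpret M: prob_space \<mu> using \<mu> by (simp add: real_distribution_def)
  interpret N: prob_space \<nu> using \<nu> by (simp add: real_distribution_def)
  interpret MN: pair_prob_space \<mu> \<nu> ..
  have sb: "sets \<mu> = sets borel" "sets \<nu> = sets borel"
    using \<mu> \<nu> by (simp_all add: real_distribution_def real_distribution_axioms_def)
  have sbb: "sets (\<mu> \<Otimes>\<^sub>M \<nu>) = sets (borel \<Otimes>\<^sub>M borel)" using sb by (rule sets_pair_measure_cong)
  have Fm0: "?F \<in> borel_measurable (borel \<Otimes>\<^sub>M borel)" by measurable
  have Fm: "?F \<in> borel_measurable (\<mu> \<Otimes>\<^sub>M \<nu>)" using Fm0 measurable_cong_sets[OF sbb refl] by blast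
  have \<rho>: "real_distribution \<rho>" unfolding \<rho>_def by (rule MN.real_distribution_distr[OF Fm])
  obtain i where i: "one_lipschitz (fst ?R) euclidean_metric i" "i \<in> borel_measurable (snd ?R)"
    "distr (snd ?R) borel i = \<mu>" "\<And>z. z\<in>mspace (fst ?R) \<Longrightarrow> i z \<in> pm_support (line \<mu>)"
    using rep_line_class[OF \<mu>] by blast
  obtain j where j: "one_lipschitz (fst ?T) euclidean_metric j" "j \<in> borel_measurable (snd ?T)"
    "distr (snd ?T) borel j = \<nu>" "\<And>z. z\<in>mspace (fst ?T) \<Longrightarrow> j z \<in> pm_support (line \<nu>)"
    using rep_line_class[OF \<nu>] by blast
  let ?Z = "prod_pm ?R ?T"
  define f where "f z = c * i (fst z) + s * j (snd z)" for z
  have pair: "(\<lambda>(x, y). (i x, j y)) \<in> measurable (snd ?R \<Otimes>\<^sub>M snd ?T) (borel \<Otimes>\<^sub>M borel)"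
    unfolding case_prod_beta using measurable_compose[OF measurable_fst i(2)] measurable_compose[OF measurable_snd j(2)]
    by (intro measurable_Pair) auto
  have f_eq: "f = ?F \<circ> (\<lambda>(x, y). (i x, j y))" by (auto simp: f_def fun_eq_iff)
  have fm: "f \<in> borel_measurable (snd ?Z)"
    unfolding f_eq prod_pm_def snd_conv by (rule measurable_comp[OF pair Fm0])
  have fd: "distr (snd ?Z) borel f = \<rho>"
  proof -
    have "\<mu> \<Otimes>\<^sub>M \<nu> = distr (snd ?R \<Otimes>\<^sub>M snd ?T) (borel \<Otimes>\<^sub>M borel) (\<lambda>(x, y). (i x, j y))"
      using pair_measure_distr[OF i(2) j(2)] N.sigma_finite_measure_axioms unfolding i(3) j(3) by blast
    then have "\<rho> = distr (distr (snd ?R \<Otimes>\<^sub>M snd ?T) (borel \<Otimes>\<^sub>M borel) (\<lambda>(x, y). (i x, j y))) borel ?F"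
      unfolding \<rho>_def by simp
    also have "\<dots> = distr (snd ?R \<Otimes>\<^sub>M snd ?T) borel f"
      unfolding f_eq by (rule distr_distr[OF Fm0 pair])
    finally show ?thesis by (simp add: prod_pm_def)
  qed
  have spR: "space (snd ?R) = mspace (fst ?R)" "space (snd ?T) = mspace (fst ?T)"
    using pm_space_rep unfolding pm_space_def by blast+
  have spZ: "space (snd ?Z) = mspace (fst ?Z)" by (simp add: prod_pm_def space_pair_measure spR)
  have fl: "one_lipschitz (fst ?Z) euclidean_metric f"
    unfolding one_lipschitz_def
  proof (intro conjI ballI)
    fix z w assume z: "z \<in> mspace (fst ?Z)" and w: "w \<in> mspace (fst ?Z)"
    then have zw: "fst z \<in> mspace (fst ?R)" "snd z \<in> mspace (fst ?T)" "fst w \<in> mspace (fst ?R)" "snd w \<in> mspace (fst ?T)"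
      by (auto simp: prod_pm_def)
    have "\<bar>i (fst z) - i (fst w)\<bar> \<le> mdist (fst ?R) (fst z) (fst w)" "\<bar>j (snd z) - j (snd w)\<bar> \<le> mdist (fst ?T) (snd z) (snd w)"
      using i(1) j(1) zw unfolding one_lipschitz_def by (simp_all add: dist_real_def)
    then have sq: "(i (fst z) - i (fst w))\<^sup>2 \<le> (mdist (fst ?R) (fst z) (fst w))\<^sup>2"
       "(j (snd z) - j (snd w))\<^sup>2 \<le> (mdist (fst ?T) (snd z) (snd w))\<^sup>2"
      by (simp_all add: abs_le_square_iff[symmetric])
    have "\<bar>f z - f w\<bar> = \<bar>c * (i (fst z) - i (fst w)) + s * (j (snd z) - j (snd w))\<bar>"
      by (simp add: f_def algebra_simps)
    also have "\<dots> \<le> sqrt ((i (fst z) - i (fst w))\<^sup>2 + (j (snd z) - j (snd w))\<^sup>2)" by (rule cauchy_schwarz_2[OF cs])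
    also have "\<dots> \<le> sqrt ((mdist (fst ?R) (fst z) (fst w))\<^sup>2 + (mdist (fst ?T) (snd z) (snd w))\<^sup>2)"
      using sq by (intro real_sqrt_le_mono add_mono)
    also have "\<dots> = mdist (fst ?Z) z w" by (simp add: prod_pm_def prod_dist_def case_prod_beta)
    finally show "mdist euclidean_metric (f z) (f w) \<le> mdist (fst ?Z) z w" by (simp add: dist_real_def)
  qed simp
  have "lip_le (rep_pm_class (line_class \<rho>)) ?Z"
  proof (rule lip_le_line_class[OF \<rho> fl fm fd spZ])
    fix z assume "z \<in> mspace (fst ?Z)"
    then have zz: "fst z \<in> mspace (fst ?R)" "snd z \<in> mspace (fst ?T)" by (auto simp: prod_pm_def)
    define x where "x = i (fst z)"
    define y where "y = j (snd z)"
    have x: "x \<in> pm_support (line \<mu>)" and y: "y \<in> pm_support (line \<nu>)" using i(4) j(4) zz unfolding x_def y_def by blast+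
    show "f z \<in> pm_support (line \<rho>)"
      unfolding pm_support_line[OF \<rho>]
    proof (intro allI impI)
      fix e :: real assume e: "e > 0"
      \<comment> \<open>Small enough that moving \<open>x\<close> and \<open>y\<close> by less than
        \<open>q\<close> moves the combination by less than \<open>e\<close>; the summand 1 covers c
        = s = 0.\<close>
      define q where "q = e / (1 + \<bar>c\<bar> + \<bar>s\<bar>)"
      have q: "q > 0" using e by (simp add: q_def add_pos_nonneg)
      have qe: "(\<bar>c\<bar> + \<bar>s\<bar>) * q < e"
      proof -
        have "(1 + \<bar>c\<bar> + \<bar>s\<bar>) * q = e" unfolding q_def by (simp add: add_pos_nonneg)
        then show ?thesis using q by (simp add: distrib_right)
      qed
      have "0 < emeasure \<mu> (ball x q) * emeasure \<nu> (ball y q)"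
        using x y q unfolding pm_support_line[OF \<mu>] pm_support_line[OF \<nu>] by (simp add: ennreal_zero_less_mult_iff)
      also have "\<dots> = emeasure (\<mu> \<Otimes>\<^sub>M \<nu>) (ball x q \<times> ball y q)"
        using sb by (intro N.emeasure_pair_measure_Times[symmetric]) auto
      also have "\<dots> \<le> emeasure (\<mu> \<Otimes>\<^sub>M \<nu>) (?F -` ball (f z) e \<inter> space (\<mu> \<Otimes>\<^sub>M \<nu>))"
      proof (rule emeasure_mono)
        show "?F -` ball (f z) e \<inter> space (\<mu> \<Otimes>\<^sub>M \<nu>) \<in> sets (\<mu> \<Otimes>\<^sub>M \<nu>)" by (rule measurable_sets[OF Fm]) simp
        show "ball x q \<times> ball y q \<subseteq> ?F -` ball (f z) e \<inter> space (\<mu> \<Otimes>\<^sub>M \<nu>)"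
        proof
          fix p assume p: "p \<in> ball x q \<times> ball y q"
          then have pq: "\<bar>x - fst p\<bar> < q" "\<bar>y - snd p\<bar> < q" by (auto simp: dist_real_def)
          have "\<bar>f z - ?F p\<bar> = \<bar>c * (x - fst p) + s * (y - snd p)\<bar>" by (simp add: f_def x_def y_def algebra_simps)
          also have "\<dots> \<le> \<bar>c\<bar> * \<bar>x - fst p\<bar> + \<bar>s\<bar> * \<bar>y - snd p\<bar>" using abs_triangle_ineq by (simp add: abs_mult[symmetric])
          also have "\<dots> \<le> \<bar>c\<bar> * q + \<bar>s\<bar> * q" using pq by (intro add_mono mult_left_mono) auto
          also have "\<dots> < e" using qe by (simp add: distrib_right)
          finally have "?F p \<in> ball (f z) e" by (simp add: dist_real_def)
          moreover have "space (\<mu> \<Otimes>\<^sub>M \<nu>) = UNIV"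
            using sets_eq_imp_space_eq[OF sbb] by (simp add: space_pair_measure)
          ultimately show "p \<in> ?F -` ball (f z) e \<inter> space (\<mu> \<Otimes>\<^sub>M \<nu>)" by simp
        qed
      qed
      also have "\<dots> = emeasure \<rho> (ball (f z) e)" unfolding \<rho>_def by (rule emeasure_distr[OF Fm, symmetric]) simp
      finally show "0 < emeasure \<rho> (ball (f z) e)" .
    qed
  qed
  then show "line_class (distr (\<mu> \<Otimes>\<^sub>M \<nu>) borel ?F) \<in> P"
    unfolding \<rho>_def[symmetric] by (rule idempotent_prod[OF idem mem])
  show "real_distribution (distr (\<mu> \<Otimes>\<^sub>M \<nu>) borel ?F)" using \<rho> unfolding \<rho>_def .
qed

lemma sets_real_distribution: "real_distribution \<mu> \<Longrightarrow> sets \<mu> = sets borel"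
  by (simp add: real_distribution_def real_distribution_axioms_def)

text \<open>The coordinates of the infinite product are the independent, identically distributed
  sequence for the central limit theorem.\<close>

lemma indep_vars_coordinates:
  fixes i :: nat and \<mu> :: "real measure" and \<Omega> :: "(nat \<Rightarrow> real) measure"
  assumes \<mu>: "real_distribution \<mu>"
  defines "\<Omega> \<equiv> PiM UNIV (\<lambda>_. \<mu>)"
  shows "prob_space \<Omega>" "prob_space.indep_vars \<Omega> (\<lambda>_. borel) (\<lambda>i \<omega>. \<omega> i) UNIV"
    "distr \<Omega> borel (\<lambda>\<omega>. \<omega> i) = \<mu>"
proof -
  interpret M: prob_space \<mu> using \<mu> by (simp add: real_distribution_def)
  interpret P: product_prob_space "\<lambda>_. \<mu>" "UNIV :: nat set" by unfold_locales
  note sb = sets_real_distribution[OF \<mu>]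
  show "prob_space \<Omega>" unfolding \<Omega>_def by (rule P.prob_space_axioms)
  have comp: "distr \<Omega> \<mu> (\<lambda>\<omega>. \<omega> i) = \<mu>" for i
    unfolding \<Omega>_def by (rule distr_PiM_component) (simp_all add: M.prob_space_axioms)
  have compb: "distr \<Omega> borel (\<lambda>\<omega>. \<omega> i) = \<mu>" for i
  proof -
    have "distr \<Omega> borel (\<lambda>\<omega>. \<omega> i) = distr \<Omega> \<mu> (\<lambda>\<omega>. \<omega> i)" by (rule distr_cong) (auto simp: sb)
    then show ?thesis using comp by simp
  qed
  then show "distr \<Omega> borel (\<lambda>\<omega>. \<omega> i) = \<mu>" .
  have cm: "(\<lambda>\<omega>. \<omega> i) \<in> measurable \<Omega> borel" for i
  proof -
    have "(\<lambda>\<omega>. \<omega> i) \<in> measurable \<Omega> \<mu>" unfolding \<Omega>_def by (rule measurable_component_singleton) simp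
    then show ?thesis by (subst measurable_cong_sets[OF refl sb, symmetric])
  qed
  show "prob_space.indep_vars \<Omega> (\<lambda>_. borel) (\<lambda>i \<omega>. \<omega> i) UNIV"
    unfolding \<Omega>_def
  proof (subst P.indep_vars_iff_distr_eq_PiM')
    show "(\<lambda>\<omega>. \<omega> (i::nat)) \<in> measurable (PiM (UNIV :: nat set) (\<lambda>_. \<mu>)) borel" for i using cm[of i] unfolding \<Omega>_def .
    have "distr (PiM (UNIV :: nat set) (\<lambda>_. \<mu>)) (PiM UNIV (\<lambda>_. borel)) (\<lambda>x. \<lambda>i\<in>UNIV. x i) = distr (PiM (UNIV :: nat set) (\<lambda>_. \<mu>)) (PiM (UNIV :: nat set) (\<lambda>_. \<mu>)) (\<lambda>x. x)"
      by (rule distr_cong) (auto intro!: sets_PiM_cong simp: sb)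
    also have "\<dots> = PiM (UNIV :: nat set) (\<lambda>_. \<mu>)" by (simp add: distr_id2)
    also have "\<dots> = (\<Pi>\<^sub>M i\<in>UNIV. distr (PiM (UNIV :: nat set) (\<lambda>_. \<mu>)) borel (\<lambda>\<omega>. \<omega> i))"
      using compb unfolding \<Omega>_def by simp
    finally show "distr (PiM (UNIV :: nat set) (\<lambda>_. \<mu>)) (PiM UNIV (\<lambda>_. borel)) (\<lambda>x. \<lambda>i\<in>UNIV. x i) = (\<Pi>\<^sub>M i\<in>UNIV. distr (PiM (UNIV :: nat set) (\<lambda>_. \<mu>)) borel (\<lambda>\<omega>. \<omega> i))" .
  qed simp
qed

text \<open>The normalised sum of k + 1 terms is the combination of the new term and the normalised
  sum of k terms with coefficients sqrt(1/(k+1)) and sqrt(k/(k+1)), whose squares add up to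
  1.\<close>

lemma normalised_sum_in_pyramid:
  assumes idem: "l2_idempotent P" and mem: "line_class \<mu> \<in> P" and \<mu>: "real_distribution \<mu>"
  defines "\<Omega> \<equiv> PiM (UNIV :: nat set) (\<lambda>_. \<mu>)"
  shows "line_class (distr \<Omega> borel (\<lambda>\<omega>. (\<Sum>i<Suc n. \<omega> i) / sqrt (real (Suc n)))) \<in> P \<and>
    real_distribution (distr \<Omega> borel (\<lambda>\<omega>. (\<Sum>i<Suc n. \<omega> i) / sqrt (real (Suc n))))"
proof (induction n)
  case 0
  show ?case using mem \<mu> indep_vars_coordinates(3)[OF \<mu>, of 0] unfolding \<Omega>_def by simp
next
  case (Suc n)
  interpret O: prob_space \<Omega> unfolding \<Omega>_def by (rule indep_vars_coordinates(1)[OF \<mu>])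
  define k where "k = Suc n"
  define T where "T \<omega> = (\<Sum>i<k. \<omega> i) / sqrt (real k)" for \<omega> :: "nat \<Rightarrow> real"
  define c where "c = 1 / sqrt (real (Suc k))"
  define s where "s = sqrt (real k) / sqrt (real (Suc k))"
  have k: "real k > 0" unfolding k_def by simp
  have cs: "c\<^sup>2 + s\<^sup>2 \<le> 1" using k by (simp add: c_def s_def power_divide add_divide_distrib[symmetric])
  have X: "distr \<Omega> borel (\<lambda>\<omega>. \<omega> k) = \<mu>" unfolding \<Omega>_def by (rule indep_vars_coordinates(3)[OF \<mu>])
  have "O.indep_var borel (\<lambda>\<omega>. \<omega> k) borel (\<lambda>\<omega>. \<Sum>i<k. \<omega> i)"
    by (rule O.indep_vars_sum) (use O.indep_vars_subset[OF indep_vars_coordinates(2)[OF \<mu>, folded \<Omega>_def]] in auto)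
  from O.indep_var_compose[OF this, of "\<lambda>x. x" borel "\<lambda>t. t / sqrt (real k)" borel]
  have ind: "O.indep_var borel (\<lambda>\<omega>. \<omega> k) borel T" unfolding T_def by (simp add: o_def)
  then have rv: "(\<lambda>\<omega>. \<omega> k) \<in> borel_measurable \<Omega>" "T \<in> borel_measurable \<Omega>"
    and joint: "distr \<Omega> borel (\<lambda>\<omega>. \<omega> k) \<Otimes>\<^sub>M distr \<Omega> borel T = distr \<Omega> (borel \<Otimes>\<^sub>M borel) (\<lambda>\<omega>. (\<omega> k, T \<omega>))"
    unfolding O.indep_var_distribution_eq by blast+
  have IH: "line_class (distr \<Omega> borel T) \<in> P" "real_distribution (distr \<Omega> borel T)"
    using Suc.IH unfolding T_def k_def by blast+
  note comb = line_class_combination[OF idem mem IH(1) \<mu> IH(2) cs]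
  have Fm: "(\<lambda>p. c * fst p + s * snd p) \<in> borel_measurable (borel \<Otimes>\<^sub>M borel :: (real \<times> real) measure)" by measurable
  have pm: "(\<lambda>\<omega>. (\<omega> k, T \<omega>)) \<in> measurable \<Omega> (borel \<Otimes>\<^sub>M borel)" using rv by (rule measurable_Pair)
  have "distr (\<mu> \<Otimes>\<^sub>M distr \<Omega> borel T) borel (\<lambda>p. c * fst p + s * snd p) = distr \<Omega> borel (\<lambda>\<omega>. c * \<omega> k + s * T \<omega>)"
    using distr_distr[OF Fm pm] unfolding joint[symmetric] X by (simp add: o_def)
  also have "(\<lambda>\<omega>. c * \<omega> k + s * T \<omega>) = (\<lambda>\<omega>. (\<Sum>i<Suc k. \<omega> i) / sqrt (real (Suc k)))"
    using k by (simp add: fun_eq_iff c_def s_def T_def add_divide_distrib)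
  finally show ?case using comb unfolding k_def by simp
qed

text \<open>The joint law of the two variables on the plane serves as common parameter space;
  closeness of the variables controls the difference of distances twice, hence the halved
  tolerance.\<close>

lemma box_ok_line:
  assumes \<Omega>: "prob_space \<Omega>" and Y: "Y \<in> borel_measurable \<Omega>" "Z \<in> borel_measurable \<Omega>"
    and near: "measure \<Omega> {\<omega> \<in> space \<Omega>. \<bar>Y \<omega> - Z \<omega>\<bar> \<le> \<epsilon> / 2} \<ge> 1 - \<epsilon>"
  shows "box_ok (line (distr \<Omega> borel Y)) (line (distr \<Omega> borel Z)) \<epsilon>"
proof -
  interpret O: prob_space \<Omega> by fact
  let ?p = "\<lambda>\<omega>. (Y \<omega>, Z \<omega>)"
  let ?J = "distr \<Omega> borel ?p"
  have p: "?p \<in> measurable \<Omega> (borel :: (real \<times> real) measure)" using Y by (rule borel_measurable_Pair)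
  have fs: "fst \<in> measurable ?J (borel :: real measure)" "snd \<in> measurable ?J (borel :: real measure)"
    using measurable_fst[of "borel :: real measure" "borel :: real measure"] measurable_snd[of "borel :: real measure" "borel :: real measure"]
    by (simp_all add: borel_prod)
  have S: "{p :: real \<times> real. \<bar>fst p - snd p\<bar> \<le> \<epsilon> / 2} \<in> sets borel"
    by (intro borel_closed closed_Collect_le continuous_intros)
  show ?thesis
  proof (rule box_okI[where \<Omega>="?J" and A=fst and B=snd and S="{p. \<bar>fst p - snd p\<bar> \<le> \<epsilon> / 2}"])
    show "prob_space ?J" by (rule O.prob_space_distr[OF p])
    then show "lebesgue_image ?J" by (rule lebesgue_image_polish) simp
    have fs': "fst \<in> borel_measurable (borel :: (real \<times> real) measure)" "snd \<in> borel_measurable (borel :: (real \<times> real) measure)"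
      using fs by simp_all
    show "fst \<in> measurable ?J (snd (line (distr \<Omega> borel Y)))" "snd \<in> measurable ?J (snd (line (distr \<Omega> borel Z)))"
      using fs by (simp_all cong: measurable_cong_sets)
    have "distr ?J borel fst = distr \<Omega> borel Y" "distr ?J borel snd = distr \<Omega> borel Z"
      using distr_distr[OF fs'(1) p] distr_distr[OF fs'(2) p] by (simp_all add: o_def)
    moreover have "distr ?J (distr \<Omega> borel Y) fst = distr ?J borel fst" "distr ?J (distr \<Omega> borel Z) snd = distr ?J borel snd"
      by (rule distr_cong; simp)+
    ultimately show "distr ?J (snd (line (distr \<Omega> borel Y))) fst = snd (line (distr \<Omega> borel Y))"
      "distr ?J (snd (line (distr \<Omega> borel Z))) snd = snd (line (distr \<Omega> borel Z))" by simp_all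
    show "{p. \<bar>fst p - snd p\<bar> \<le> \<epsilon> / 2} \<in> sets ?J" using S by simp
    have "measure ?J {p. \<bar>fst p - snd p\<bar> \<le> \<epsilon> / 2} = measure \<Omega> {\<omega> \<in> space \<Omega>. \<bar>Y \<omega> - Z \<omega>\<bar> \<le> \<epsilon> / 2}"
      unfolding measure_distr[OF p S] by (rule arg_cong[where f="measure _"]) auto
    then show "measure ?J {p. \<bar>fst p - snd p\<bar> \<le> \<epsilon> / 2} \<ge> 1 - \<epsilon>" using near by simp
    fix x y :: "real \<times> real" assume "x \<in> {p. \<bar>fst p - snd p\<bar> \<le> \<epsilon> / 2}" "y \<in> {p. \<bar>fst p - snd p\<bar> \<le> \<epsilon> / 2}"
    then have "\<bar>fst x - snd x\<bar> \<le> \<epsilon> / 2" "\<bar>fst y - snd y\<bar> \<le> \<epsilon> / 2" by simp_all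
    then have "\<bar>\<bar>fst x - fst y\<bar> - \<bar>snd x - snd y\<bar>\<bar> \<le> \<epsilon>" by linarith
    then show "\<bar>mdist (fst (line (distr \<Omega> borel Y))) (fst x) (fst y) - mdist (fst (line (distr \<Omega> borel Z))) (snd x) (snd y)\<bar> \<le> \<epsilon>"
      by (simp add: dist_real_def)
  qed
qed

lemma box_ok_supp_line:
  assumes \<mu>: "real_distribution \<mu>" and \<epsilon>: "0 \<le> \<epsilon>"
  shows "box_ok (line \<mu>) (supp_pm (line \<mu>)) \<epsilon>"
proof -
  let ?S = "supp_pm (line \<mu>)"
  note inc = supp_line_inclusion[OF \<mu>] and sb = sets_real_distribution[OF \<mu>]
  have pm: "pm_space ?S" by (rule full_pm_space_imp_pm_space[OF full_pm_space_supp_line[OF \<mu>]])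
  then interpret S: prob_space "snd ?S" unfolding pm_space_def by blast
  show ?thesis
  proof (rule box_okI[where \<Omega>="snd ?S" and A="\<lambda>x. x" and B="\<lambda>x. x" and S="space (snd ?S)"])
    show "(\<lambda>x. x) \<in> measurable (snd ?S) (snd (line \<mu>))"
      unfolding line_simps by (subst measurable_cong_sets[OF refl sb]) (rule inc(1))
    have "distr (snd ?S) \<mu> (\<lambda>x. x) = distr (snd ?S) borel (\<lambda>x. x)" by (rule distr_cong) (auto simp: sb)
    then show "distr (snd ?S) (snd (line \<mu>)) (\<lambda>x. x) = snd (line \<mu>)" using inc(2) by simp
    show "lebesgue_image (snd ?S)" by (rule pm_space_lebesgue_image[OF pm])
  qed (use \<epsilon> S.prob_space S.prob_space_axioms in \<open>simp_all add: distr_id2 supp_pm_def\<close>)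
qed

lemma distr_gauss_scale:
  assumes \<sigma>: "\<sigma> > 0" and k: "k > 0"
  shows "distr (gauss \<sigma>) borel (\<lambda>x. k * x) = gauss (k * \<sigma>)"
proof -
  interpret N: prob_space "gauss \<sigma>" using \<sigma> by (rule prob_space_gauss)
  have "distr (gauss \<sigma>) lborel (\<lambda>x. x) = distr (gauss \<sigma>) (gauss \<sigma>) (\<lambda>x. x)" by (rule distr_cong) auto
  then have "distributed (gauss \<sigma>) lborel (\<lambda>x. x) (normal_density 0 \<sigma>)"
    unfolding distributed_def by (simp add: distr_id2)
  from N.normal_density_affine[OF this \<sigma>, of k 0]
  have "distr (gauss \<sigma>) lborel (\<lambda>x. k * x) = gauss (k * \<sigma>)" using k unfolding distributed_def by simp
  moreover have "distr (gauss \<sigma>) lborel (\<lambda>x. k * x) = distr (gauss \<sigma>) borel (\<lambda>x. k * x)" by (rule distr_cong) auto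
  ultimately show ?thesis by simp
qed

text \<open>By idempotency the normalised sums stay in the pyramid; the central limit theorem and
  Skorohod's coupling put their Gaussian limit in its box closure.\<close>

lemma gaussian_in_idempotent_pyramid:
  assumes P: "P \<in> pyramids" "l2_idempotent P" and mem: "line_class \<mu> \<in> P" and \<mu>: "real_distribution \<mu>"
    and int: "integrable \<mu> (\<lambda>x. x\<^sup>2)" and mean: "(\<integral>x. x \<partial>\<mu>) = 0" and var: "(\<integral>x. x\<^sup>2 \<partial>\<mu>) = \<sigma>\<^sup>2" and \<sigma>: "\<sigma> > 0"
  shows "class_of (gaussian_line \<sigma>) \<in> P"
proof -
  define \<Omega> where "\<Omega> = PiM (UNIV :: nat set) (\<lambda>_. \<mu>)"
  interpret O: prob_space \<Omega> unfolding \<Omega>_def by (rule indep_vars_coordinates(1)[OF \<mu>])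
  have ind: "O.indep_vars (\<lambda>_. borel) (\<lambda>i \<omega>. \<omega> i) UNIV" unfolding \<Omega>_def by (rule indep_vars_coordinates(2)[OF \<mu>])
  have law: "distr \<Omega> borel (\<lambda>\<omega>. \<omega> i) = \<mu>" for i unfolding \<Omega>_def by (rule indep_vars_coordinates(3)[OF \<mu>])
  have cm [measurable]: "(\<lambda>\<omega>. \<omega> i) \<in> borel_measurable \<Omega>" for i
    using ind unfolding O.indep_vars_def2 by simp
  have e0: "O.expectation (\<lambda>\<omega>. \<omega> i) = 0" for i
    using integral_distr[OF cm, of "\<lambda>x. x" i] mean unfolding law by simp
  have e2: "O.expectation (\<lambda>\<omega>. (\<omega> i)\<^sup>2) = \<sigma>\<^sup>2" for i
    using integral_distr[OF cm, of "\<lambda>x. x\<^sup>2" i] var unfolding law by simp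
  have i2: "integrable \<Omega> (\<lambda>\<omega>. (\<omega> i)\<^sup>2)" for i
    using integrable_distr_eq[OF cm, of "\<lambda>x. x\<^sup>2" i] int unfolding law by simp
  \<comment> \<open>The central limit theorem normalises to unit variance; the factor
    \<open>\<sigma>\<close> is restored afterwards, because the sums in the pyramid are divided by
    sqrt n only.\<close>
  define \<mu>' where "\<mu>' n = distr \<Omega> borel (\<lambda>\<omega>. (\<Sum>i<n. \<omega> i) / sqrt (real n * \<sigma>\<^sup>2))" for n
  have clt: "weak_conv_m \<mu>' std_normal_distribution"
    unfolding \<mu>'_def
    by (rule O.central_limit_theorem_zero_mean[OF ind e0 \<sigma> i2 _ law]) (simp add: e0 e2)
  have rd: "real_distribution (\<mu>' n)" for n
    unfolding \<mu>'_def by (rule O.real_distribution_distr) measurable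
  \<comment> \<open>Weak convergence alone gives no common parameters. Variables with the same laws
    that converge pointwise on one space do.\<close>
  obtain \<Theta> :: "real measure" and Ys :: "nat \<Rightarrow> real \<Rightarrow> real" and Y where \<Theta>: "prob_space \<Theta>" "\<And>n. Ys n \<in> measurable \<Theta> borel"
    "\<And>n. distr \<Theta> borel (Ys n) = \<mu>' n" "Y \<in> measurable \<Theta> lborel" "distr \<Theta> borel Y = std_normal_distribution"
    "\<And>x. x \<in> space \<Theta> \<Longrightarrow> (\<lambda>n. Ys n x) \<longlonglongrightarrow> Y x"
    using Skorohod[OF rd real_dist_normal_dist clt] by blast
  interpret T: prob_space \<Theta> by fact
  have Ym [measurable]: "Y \<in> borel_measurable \<Theta>" using \<Theta>(4) by simp
  note \<Theta>(2)[measurable]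
  define L where "L n = distr \<Omega> borel (\<lambda>\<omega>. (\<Sum>i<Suc n. \<omega> i) / sqrt (real (Suc n)))" for n
  have LP: "line_class (L n) \<in> P" "real_distribution (L n)" for n
    using normalised_sum_in_pyramid[OF P(2) mem \<mu>, of n] unfolding L_def \<Omega>_def by blast+
  have sm: "(\<lambda>x. \<sigma> * x) \<in> borel_measurable (borel :: real measure)" by measurable
  have L: "L n = distr \<Theta> borel (\<lambda>x. \<sigma> * Ys (Suc n) x)" for n
  proof -
    have "distr (\<mu>' (Suc n)) borel (\<lambda>x. \<sigma> * x) = distr \<Omega> borel ((\<lambda>x. \<sigma> * x) \<circ> (\<lambda>\<omega>. (\<Sum>i<Suc n. \<omega> i) / sqrt (real (Suc n) * \<sigma>\<^sup>2)))"
      unfolding \<mu>'_def by (rule distr_distr[OF sm]) measurable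
    also have "(\<lambda>x. \<sigma> * x) \<circ> (\<lambda>\<omega>. (\<Sum>i<Suc n. \<omega> i) / sqrt (real (Suc n) * \<sigma>\<^sup>2)) = (\<lambda>\<omega>. (\<Sum>i<Suc n. \<omega> i) / sqrt (real (Suc n)))"
      using \<sigma> by (simp add: fun_eq_iff real_sqrt_mult del: sum.lessThan_Suc)
    finally have "L n = distr (distr \<Theta> borel (Ys (Suc n))) borel (\<lambda>x. \<sigma> * x)" unfolding L_def \<Theta>(3) by simp
    also have "\<dots> = distr \<Theta> borel (\<lambda>x. \<sigma> * Ys (Suc n) x)" using distr_distr[OF sm \<Theta>(2)] by (simp add: o_def)
    finally show ?thesis .
  qed
  have N: "gauss \<sigma> = distr \<Theta> borel (\<lambda>x. \<sigma> * Y x)"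
    using distr_distr[OF sm Ym] distr_gauss_scale[of 1 \<sigma>] \<sigma> unfolding \<Theta>(5) by (simp add: o_def)
  have "class_of (gaussian_line \<sigma>) \<in> box_closure P"
    unfolding box_closure_def
  proof (intro CollectI allI impI)
    fix e :: real assume e: "e > 0"
    define \<epsilon> where "\<epsilon> = e / 4"
    have \<epsilon>: "\<epsilon> > 0" using e by (simp add: \<epsilon>_def)
    \<comment> \<open>Requiring closeness for all later indices makes these events increasing;
      pointwise convergence says that they exhaust the space, so some index gives closeness with
      probability above 1 - \<epsilon>.\<close>
    define A where "A n = {x \<in> space \<Theta>. \<forall>k\<ge>n. \<bar>\<sigma> * Ys (Suc k) x - \<sigma> * Y x\<bar> \<le> \<epsilon> / 2}" for n
    have Am [measurable]: "A n \<in> sets \<Theta>" for n unfolding A_def by measurable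
    have "(\<lambda>n. T.prob (A n)) \<longlonglongrightarrow> T.prob (\<Union>n. A n)"
      by (rule T.finite_Lim_measure_incseq) (auto simp: A_def incseq_def)
    moreover have "(\<Union>n. A n) = space \<Theta>"
    proof (rule equalityI[OF _ subsetI])
      fix x assume x: "x \<in> space \<Theta>"
      have "(\<lambda>n. \<sigma> * Ys (Suc n) x) \<longlonglongrightarrow> \<sigma> * Y x"
        by (intro tendsto_intros LIMSEQ_Suc \<Theta>(6)[OF x])
      then obtain n where n: "\<And>k. k \<ge> n \<Longrightarrow> dist (\<sigma> * Ys (Suc k) x) (\<sigma> * Y x) < \<epsilon> / 2"
        using \<epsilon> unfolding lim_sequentially by (metis half_gt_zero)
      then have "x \<in> A n" using x unfolding A_def by (auto simp: dist_real_def intro: less_imp_le)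
      then show "x \<in> (\<Union>n. A n)" by blast
    qed (auto simp: A_def)
    ultimately have "(\<lambda>n. T.prob (A n)) \<longlonglongrightarrow> 1" using T.prob_space by simp
    then have "eventually (\<lambda>n. 1 - \<epsilon> < T.prob (A n)) sequentially" using \<epsilon> by (intro order_tendstoD(1)) auto
    then obtain n where n: "1 - \<epsilon> < T.prob (A n)" using eventually_happens'[OF sequentially_bot] by blast
    have "T.prob (A n) \<le> T.prob {x \<in> space \<Theta>. \<bar>\<sigma> * Ys (Suc n) x - \<sigma> * Y x\<bar> \<le> \<epsilon> / 2}"
      by (rule T.finite_measure_mono) (auto simp: A_def)
    then have "box_ok (line (distr \<Theta> borel (\<lambda>x. \<sigma> * Ys (Suc n) x))) (line (distr \<Theta> borel (\<lambda>x. \<sigma> * Y x))) \<epsilon>"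
      using n by (intro box_ok_line[OF \<Theta>(1)]) auto
    then have b: "box_ok (line (gauss \<sigma>)) (line (L n)) \<epsilon>" unfolding L[symmetric] N[symmetric] by (rule box_ok_sym)
    have "box_ok (line (gauss \<sigma>)) (supp_pm (line (L n))) (\<epsilon> + 0 + \<epsilon>)"
      by (rule box_ok_triangle[OF b box_ok_supp_line[OF LP(2) order_refl] \<epsilon> pm_space_line[OF LP(2)]])
    moreover have "line (gauss \<sigma>) = gaussian_line \<sigma>" by (simp add: line_def gaussian_line_def)
    ultimately have "box_class (class_of (gaussian_line \<sigma>)) (line_class (L n)) < e"
      unfolding line_class_def using full_pm_space_gaussian_line[OF \<sigma>] full_pm_space_supp_line[OF LP(2)] \<epsilon> e
      by (intro box_class_class_of_less[where \<epsilon>="\<epsilon> + 0 + \<epsilon>"]) (simp_all add: \<epsilon>_def)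
    then show "\<exists>Z\<in>P. box_class (class_of (gaussian_line \<sigma>)) Z < e" using LP(1) by blast
  qed
  then show ?thesis unfolding pyramid_closed[OF P(1)] .
qed

section \<open>Scaled Gaussians, and powers inside an idempotent pyramid\<close>

lemma lip_le_gaussian_mono:
  assumes "0 < s" "s \<le> \<sigma>"
  shows "lip_le (gaussian_line s) (gaussian_line \<sigma>)"
proof -
  have \<sigma>: "\<sigma> > 0" and k: "s / \<sigma> > 0" "s / \<sigma> \<le> 1" using assms by auto
  have "distr (gauss \<sigma>) (gauss s) (\<lambda>x. s / \<sigma> * x) = distr (gauss \<sigma>) borel (\<lambda>x. s / \<sigma> * x)" by (rule distr_cong) auto
  also have "\<dots> = gauss s" using distr_gauss_scale[OF \<sigma> k(1)] \<sigma> by simp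
  finally have "distr (snd (gaussian_line \<sigma>)) (snd (gaussian_line s)) (\<lambda>x. s / \<sigma> * x) = snd (gaussian_line s)"
    unfolding gaussian_line_simps .
  moreover have "one_lipschitz (fst (gaussian_line \<sigma>)) (fst (gaussian_line s)) (\<lambda>x. s / \<sigma> * x)"
  proof -
    have "dist (s / \<sigma> * x) (s / \<sigma> * y) \<le> dist x y" for x y
    proof -
      have "dist (s / \<sigma> * x) (s / \<sigma> * y) = s / \<sigma> * \<bar>x - y\<bar>"
        unfolding dist_real_def right_diff_distrib[symmetric] abs_mult using assms \<sigma> by simp
      also have "\<dots> \<le> 1 * \<bar>x - y\<bar>" using k by (intro mult_right_mono) auto
      finally show ?thesis by (simp add: dist_real_def)
    qed
    then show ?thesis unfolding one_lipschitz_def gaussian_line_simps by simp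
  qed
  ultimately show ?thesis unfolding lip_le_def by blast
qed

lemma lip_le_scale_gaussian:
  assumes t: "t > 0" and \<sigma>: "\<sigma> > 0"
  shows "lip_le (scale_pm t (gaussian_line \<sigma>)) (gaussian_line (t * \<sigma>))"
proof -
  have k: "t * \<sigma> > 0" "1 / t > 0" using assms by auto
  have "distr (gauss (t * \<sigma>)) (gauss \<sigma>) (\<lambda>x. 1 / t * x) = distr (gauss (t * \<sigma>)) borel (\<lambda>x. 1 / t * x)" by (rule distr_cong) auto
  also have "\<dots> = gauss \<sigma>" using distr_gauss_scale[OF k] t by simp
  finally have "distr (snd (gaussian_line (t * \<sigma>))) (snd (scale_pm t (gaussian_line \<sigma>))) (\<lambda>x. 1 / t * x) = snd (scale_pm t (gaussian_line \<sigma>))"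
    unfolding scale_pm_simps(3)[OF t] gaussian_line_simps .
  moreover have "one_lipschitz (fst (gaussian_line (t * \<sigma>))) (fst (scale_pm t (gaussian_line \<sigma>))) (\<lambda>x. 1 / t * x)"
  proof -
    have "t * dist (1 / t * x) (1 / t * y) \<le> dist x y" for x y
      unfolding dist_real_def right_diff_distrib[symmetric] abs_mult using t by simp
    then show ?thesis unfolding one_lipschitz_def scale_pm_simps[OF t] gaussian_line_simps by simp
  qed
  ultimately show ?thesis unfolding lip_le_def by blast
qed

text \<open>Induction on \<open>n\<close>. The empty power is a single point, which lies below
  \<open>X\<close>. For the step, writing a point of \<open>X\<close> into position \<open>n\<close>
  of a vector maps the l2-product of \<open>X\<close> and its n-th power isometrically and
  measure-preservingly onto the next power.\<close>

lemma class_of_power_in_idempotent: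
  assumes P: "P \<in> pyramids" "l2_idempotent P" and X: "full_pm_space X" and XP: "class_of X \<in> P"
  shows "class_of (power_pm n X) \<in> P"
proof (induction n)
  case 0
  have pX: "pm_space X" by (rule full_pm_space_imp_pm_space[OF X])
  then interpret X: prob_space "snd X" unfolding pm_space_def by blast
  let ?c = "\<lambda>_::'a. \<lambda>_::nat. undefined :: 'a"
  have m: "?c \<in> measurable (snd X) (PiM {..<0} (\<lambda>_. snd X))" by (simp add: space_PiM)
  have "distr (snd X) (PiM {..<0} (\<lambda>_. snd X)) ?c = PiM {..<0} (\<lambda>_. snd X)"
  proof (rule measure_eqI)
    interpret D: prob_space "distr (snd X) (PiM {..<0} (\<lambda>_. snd X)) ?c" by (rule X.prob_space_distr[OF m])
    interpret E: prob_space "PiM {..<0::nat} (\<lambda>_. snd X)" by (rule prob_space_PiM) (rule X.prob_space_axioms)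
    fix A assume "A \<in> sets (distr (snd X) (PiM {..<0} (\<lambda>_. snd X)) ?c)"
    then have "A \<subseteq> {\<lambda>_. undefined}" using sets.sets_into_space by (fastforce simp: space_PiM)
    then consider "A = {}" | "A = space (PiM {..<0::nat} (\<lambda>_. snd X))" by (auto simp: space_PiM)
    then show "emeasure (distr (snd X) (PiM {..<0} (\<lambda>_. snd X)) ?c) A = emeasure (PiM {..<0} (\<lambda>_. snd X)) A"
    proof cases
      case 2
      then show ?thesis using D.emeasure_space_1 E.emeasure_space_1 by simp
    qed simp
  qed simp
  then have "lip_le (power_pm 0 X) X"
    unfolding lip_le_def one_lipschitz_def
    by (intro exI[of _ ?c]) (simp add: mspace_power_metric mdist_power_metric)
  then have "lip_le (power_pm 0 X) (rep_pm_class (class_of X))"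
    by (rule lip_le_trans[OF _ lip_le_class_of(2)[OF X] pm_space_rep pX full_pm_space_imp_pm_space[OF full_pm_space_power_pm[OF X]]])
  then show ?case by (rule pyramid_downward_class_of[OF P(1) XP full_pm_space_power_pm[OF X]])
next
  case (Suc n)
  let ?A = "rep_pm_class (class_of X)" and ?B = "rep_pm_class (class_of (power_pm n X))"
  have pX: "pm_space X" by (rule full_pm_space_imp_pm_space[OF X])
  then interpret X: prob_space "snd X" unfolding pm_space_def by blast
  note fp = full_pm_space_power_pm[OF X]
  note pp = full_pm_space_imp_pm_space[OF fp]
  obtain i where i: "one_lipschitz (fst ?A) (fst X) i" "distr (snd ?A) (snd X) i = snd X"
    using lip_le_class_of(2)[OF X] unfolding lip_le_def by blast
  obtain j where j: "one_lipschitz (fst ?B) (fst (power_pm n X)) j" "distr (snd ?B) (snd (power_pm n X)) j = snd (power_pm n X)"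
    using lip_le_class_of(2)[OF fp[of n]] unfolding lip_le_def by blast
  have im: "i \<in> measurable (snd ?A) (snd X)" by (rule one_lipschitz_measurable[OF i(1) pm_space_rep pX])
  have jm: "j \<in> measurable (snd ?B) (snd (power_pm n X))" by (rule one_lipschitz_measurable[OF j(1) pm_space_rep pp])
  let ?u = "\<lambda>(x, w). w(n := x) :: nat \<Rightarrow> 'a"
  define f where "f = ?u \<circ> (\<lambda>(a, b). (i a, j b))"
  have ins: "{..<Suc n} = insert n {..<n}" by auto
  interpret W: prob_space "snd (power_pm n X)" using pp[of n] unfolding pm_space_def by blast
  have pr: "(\<lambda>(a, b). (i a, j b)) \<in> measurable (snd ?A \<Otimes>\<^sub>M snd ?B) (snd X \<Otimes>\<^sub>M snd (power_pm n X))"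
    unfolding case_prod_beta using measurable_compose[OF measurable_fst im] measurable_compose[OF measurable_snd jm]
    by (intro measurable_Pair) auto
  have um: "?u \<in> measurable (snd X \<Otimes>\<^sub>M snd (power_pm n X)) (snd (power_pm (Suc n) X))"
    unfolding snd_power_pm ins case_prod_beta
    by (rule measurable_fun_upd[where J="{..<n}"]) (auto intro: measurable_fst measurable_snd)
  have ud: "distr (snd X \<Otimes>\<^sub>M snd (power_pm n X)) (snd (power_pm (Suc n) X)) ?u = snd (power_pm (Suc n) X)"
    unfolding snd_power_pm ins by (rule distr_pair_PiM_eq_PiM) (simp_all add: X.prob_space_axioms)
  have "snd X \<Otimes>\<^sub>M snd (power_pm n X) = distr (snd ?A \<Otimes>\<^sub>M snd ?B) (snd X \<Otimes>\<^sub>M snd (power_pm n X)) (\<lambda>(a, b). (i a, j b))"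
    using pair_measure_distr[OF im jm] W.sigma_finite_measure_axioms unfolding i(2) j(2) by blast
  then have "distr (snd ?A \<Otimes>\<^sub>M snd ?B) (snd (power_pm (Suc n) X)) f = snd (power_pm (Suc n) X)"
    unfolding f_def using distr_distr[OF um pr] ud by simp
  then have fd: "distr (snd (prod_pm ?A ?B)) (snd (power_pm (Suc n) X)) f = snd (power_pm (Suc n) X)" by (simp add: prod_pm_def)
  have fm: "f \<in> measurable (snd (prod_pm ?A ?B)) (snd (power_pm (Suc n) X))"
    unfolding f_def prod_pm_def snd_conv by (rule measurable_comp[OF pr um])
  have fl: "one_lipschitz (fst (prod_pm ?A ?B)) (fst (power_pm (Suc n) X)) f"
    unfolding one_lipschitz_def
  proof (intro conjI ballI Pi_I)
    fix z assume "z \<in> mspace (fst (prod_pm ?A ?B))"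
    then have "fst z \<in> mspace (fst ?A)" "snd z \<in> mspace (fst ?B)" by (auto simp: prod_pm_def)
    then have "i (fst z) \<in> mspace (fst X)" "j (snd z) \<in> PiE {..<n} (\<lambda>_. mspace (fst X))"
      using i(1) j(1) by (auto simp: one_lipschitz_def mspace_power_metric)
    then show "f z \<in> mspace (fst (power_pm (Suc n) X))"
      unfolding fst_power_pm mspace_power_metric by (auto simp: f_def case_prod_beta PiE_iff extensional_def)
  next
    fix z w assume "z \<in> mspace (fst (prod_pm ?A ?B))" "w \<in> mspace (fst (prod_pm ?A ?B))"
    then have zw: "fst z \<in> mspace (fst ?A)" "snd z \<in> mspace (fst ?B)" "fst w \<in> mspace (fst ?A)" "snd w \<in> mspace (fst ?B)"
      by (auto simp: prod_pm_def)
    have a: "(mdist (fst X) (i (fst z)) (i (fst w)))\<^sup>2 \<le> (mdist (fst ?A) (fst z) (fst w))\<^sup>2"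
      using i(1) zw(1,3) unfolding one_lipschitz_def by (simp add: power_mono)
    have "mdist (fst (power_pm n X)) (j (snd z)) (j (snd w)) \<le> mdist (fst ?B) (snd z) (snd w)"
      using j(1) zw(2,4) unfolding one_lipschitz_def by simp
    then have "(mdist (fst (power_pm n X)) (j (snd z)) (j (snd w)))\<^sup>2 \<le> (mdist (fst ?B) (snd z) (snd w))\<^sup>2"
      by (rule power_mono) simp
    then have b: "(\<Sum>k<n. (mdist (fst X) (j (snd z) k) (j (snd w) k))\<^sup>2) \<le> (mdist (fst ?B) (snd z) (snd w))\<^sup>2"
      by (simp add: mdist_power_metric sum_nonneg)
    have "mdist (fst (power_pm (Suc n) X)) (f z) (f w) =
      sqrt ((\<Sum>k<n. (mdist (fst X) (j (snd z) k) (j (snd w) k))\<^sup>2) + (mdist (fst X) (i (fst z)) (i (fst w)))\<^sup>2)"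
      by (simp add: mdist_power_metric f_def case_prod_beta)
    also have "\<dots> \<le> sqrt ((mdist (fst ?A) (fst z) (fst w))\<^sup>2 + (mdist (fst ?B) (snd z) (snd w))\<^sup>2)"
      using a b by (intro real_sqrt_le_mono) linarith
    also have "\<dots> = mdist (fst (prod_pm ?A ?B)) z w" by (simp add: prod_pm_def prod_dist_def case_prod_beta)
    finally show "mdist (fst (power_pm (Suc n) X)) (f z) (f w) \<le> mdist (fst (prod_pm ?A ?B)) z w" .
  qed
  have "lip_le (rep_pm_class (class_of (power_pm (Suc n) X))) (prod_pm ?A ?B)"
    by (rule lip_le_trans_measurable[OF fl fm fd lip_le_class_of(1)[OF fp] pp pm_space_rep])
  then show ?case by (rule idempotent_prod[OF P(2) XP Suc.IH])
qed

lemma infinite_power_subset_idempotent: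
  assumes P: "P \<in> pyramids" "l2_idempotent P" and X: "full_pm_space X" and XP: "class_of X \<in> P"
  shows "infinite_power X \<subseteq> P"
proof -
  have "pyramid_of (power_pm n X) \<subseteq> P" for n
  proof
    note fp = full_pm_space_power_pm[OF X, of n]
    fix Y assume "Y \<in> pyramid_of (power_pm n X)"
    then have "lip_le (rep_pm_class Y) (power_pm n X)" unfolding pyramid_of_def by simp
    then have "lip_le (rep_pm_class Y) (rep_pm_class (class_of (power_pm n X)))"
      by (rule lip_le_trans[OF _ lip_le_class_of(2)[OF fp] pm_space_rep full_pm_space_imp_pm_space[OF fp] pm_space_rep])
    then show "Y \<in> P" by (rule pyramid_downward[OF P(1) class_of_power_in_idempotent[OF P X XP]])
  qed
  then have "infinite_power X \<subseteq> box_closure P"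
    unfolding infinite_power_def by (intro box_closure_mono) blast
  then show ?thesis unfolding pyramid_closed[OF P(1)] .
qed

section \<open>Observable variance\<close>

lemma one_lipschitz_euclidean_iff:
  fixes f :: "'a \<Rightarrow> real"
  shows "one_lipschitz d euclidean_metric f \<longleftrightarrow> (\<forall>x\<in>mspace d. \<forall>y\<in>mspace d. \<bar>f x - f y\<bar> \<le> mdist d x y)"
  by (simp add: one_lipschitz_def dist_real_def)

text \<open>After expansion of the square, the cross term vanishes for a centred function;
  boundedness provides the integrability.\<close>

lemma nn_integral_half_square_diff:
  fixes h :: "'a \<Rightarrow> real"
  assumes M: "prob_space M" and h [measurable]: "h \<in> borel_measurable M" and b: "\<And>x. x \<in> space M \<Longrightarrow> \<bar>h x\<bar> \<le> B"
    and mean: "(\<integral>x. h x \<partial>M) = 0"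
  shows "(\<integral>\<^sup>+ p. ennreal ((h (fst p) - h (snd p))\<^sup>2 / 2) \<partial>(M \<Otimes>\<^sub>M M)) = ennreal (\<integral>x. (h x)\<^sup>2 \<partial>M)"
proof -
  interpret M: prob_space M by fact
  have b2: "(h x)\<^sup>2 \<le> B\<^sup>2" if "x \<in> space M" for x
    using power_mono[OF b[OF that], of 2] by simp
  have i1: "integrable M h" by (rule M.integrable_const_bound[where B=B]) (use b in auto)
  have i2: "integrable M (\<lambda>x. (h x)\<^sup>2)" by (rule M.integrable_const_bound[where B="B\<^sup>2"]) (use b2 in auto)
  define s where "s = (\<integral>x. (h x)\<^sup>2 \<partial>M)"
  have s: "s \<ge> 0" unfolding s_def by (rule integral_nonneg_AE) simp
  have inner: "(\<integral>\<^sup>+ y. ennreal ((a - h y)\<^sup>2 / 2) \<partial>M) = ennreal (a\<^sup>2 / 2 + s / 2)" for a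
  proof -
    have e: "(\<lambda>y. (a - h y)\<^sup>2 / 2) = (\<lambda>y. a\<^sup>2 / 2 - a * h y + (h y)\<^sup>2 / 2)"
      by (rule ext) (simp add: power2_diff field_simps)
    have i: "integrable M (\<lambda>y. (a - h y)\<^sup>2 / 2)" unfolding e using i1 i2 by simp
    have "(\<integral>y. (a - h y)\<^sup>2 / 2 \<partial>M) = a\<^sup>2 / 2 + s / 2"
      unfolding e using i1 i2 mean by (simp add: s_def M.prob_space)
    then show ?thesis using nn_integral_eq_integral[OF i] by (simp only:) simp
  qed
  have "(\<integral>\<^sup>+ p. ennreal ((h (fst p) - h (snd p))\<^sup>2 / 2) \<partial>(M \<Otimes>\<^sub>M M)) = (\<integral>\<^sup>+ x. \<integral>\<^sup>+ y. ennreal ((h x - h y)\<^sup>2 / 2) \<partial>M \<partial>M)"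
    by (subst M.nn_integral_fst[symmetric]) simp_all
  also have "\<dots> = (\<integral>\<^sup>+ x. ennreal ((h x)\<^sup>2 / 2 + s / 2) \<partial>M)" unfolding inner ..
  also have "\<dots> = ennreal (\<integral>x. (h x)\<^sup>2 / 2 + s / 2 \<partial>M)"
    using i2 s by (intro nn_integral_eq_integral) auto
  also have "(\<integral>x. (h x)\<^sup>2 / 2 + s / 2 \<partial>M) = s" using i2 by (simp add: s_def M.prob_space)
  finally show ?thesis unfolding s_def .
qed

text \<open>A 1-Lipschitz function may have infinite second moment, while the central limit theorem
  needs a finite one. Truncation keeps the Lipschitz constant, and by Fatou's lemma a high enough
  truncation level still exceeds \<open>v\<close>. Subtracting the mean changes no difference of
  values.\<close>

lemma obs_variance_bounded_witness:
  assumes X: "pm_space X" and v: "ennreal v < obs_variance X"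
  shows "\<exists>h B. one_lipschitz (fst X) euclidean_metric h \<and> (\<forall>x. \<bar>h x\<bar> \<le> B) \<and>
    (\<integral>x. h x \<partial>snd X) = 0 \<and> v < (\<integral>x. (h x)\<^sup>2 \<partial>snd X)"
proof -
  interpret M: prob_space "snd X" using X unfolding pm_space_def by blast
  obtain f where f: "one_lipschitz (fst X) euclidean_metric f"
    and vf: "ennreal v < 1 / 2 * (\<integral>\<^sup>+ p. ennreal ((f (fst p) - f (snd p))\<^sup>2) \<partial>(snd X \<Otimes>\<^sub>M snd X))"
    using v unfolding obs_variance_def less_SUP_iff by blast
  have fm [measurable]: "f \<in> borel_measurable (snd X)" by (rule one_lipschitz_borel_measurable[OF X f])
  define g where "g n x = max (- real n) (min (real n) (f x))" for n x
  have gm [measurable]: "g n \<in> borel_measurable (snd X)" for n unfolding g_def by measurable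
  have half: "1 / 2 * ennreal a = ennreal (a / 2)" for a
  proof -
    have "1 / 2 * ennreal a = ennreal (1 / 2) * ennreal a" using divide_ennreal[of 1 2] by (simp del: divide_ennreal)
    also have "\<dots> = ennreal (a / 2)" by (subst ennreal_mult'[symmetric]) simp_all
    finally show ?thesis .
  qed
  have "1 / 2 * (\<integral>\<^sup>+ p. ennreal ((f (fst p) - f (snd p))\<^sup>2) \<partial>(snd X \<Otimes>\<^sub>M snd X))
    = (\<integral>\<^sup>+ p. ennreal ((f (fst p) - f (snd p))\<^sup>2 / 2) \<partial>(snd X \<Otimes>\<^sub>M snd X))"
    by (subst nn_integral_cmult[symmetric]) (simp_all add: half)
  also have "\<dots> = (\<integral>\<^sup>+ p. liminf (\<lambda>n. ennreal ((g n (fst p) - g n (snd p))\<^sup>2 / 2)) \<partial>(snd X \<Otimes>\<^sub>M snd X))"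
  proof (rule nn_integral_cong)
    fix p
    obtain N where N: "\<bar>f (fst p)\<bar> \<le> real N" "\<bar>f (snd p)\<bar> \<le> real N"
      using real_arch_simple[of "max \<bar>f (fst p)\<bar> \<bar>f (snd p)\<bar>"] by auto
    have "eventually (\<lambda>n. ennreal ((g n (fst p) - g n (snd p))\<^sup>2 / 2) = ennreal ((f (fst p) - f (snd p))\<^sup>2 / 2)) sequentially"
      unfolding eventually_sequentially
    proof (intro exI[of _ N] allI impI)
      fix n assume "N \<le> n"
      then have "real N \<le> real n" by simp
      then have "g n (fst p) = f (fst p)" "g n (snd p) = f (snd p)" using N unfolding g_def by linarith+
      then show "ennreal ((g n (fst p) - g n (snd p))\<^sup>2 / 2) = ennreal ((f (fst p) - f (snd p))\<^sup>2 / 2)" by simp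
    qed
    then have "(\<lambda>n. ennreal ((g n (fst p) - g n (snd p))\<^sup>2 / 2)) \<longlonglongrightarrow> ennreal ((f (fst p) - f (snd p))\<^sup>2 / 2)"
      by (rule tendsto_eventually)
    from lim_imp_Liminf[OF sequentially_bot this]
    show "ennreal ((f (fst p) - f (snd p))\<^sup>2 / 2) = liminf (\<lambda>n. ennreal ((g n (fst p) - g n (snd p))\<^sup>2 / 2))" by simp
  qed
  also have "\<dots> \<le> liminf (\<lambda>n. \<integral>\<^sup>+ p. ennreal ((g n (fst p) - g n (snd p))\<^sup>2 / 2) \<partial>(snd X \<Otimes>\<^sub>M snd X))"
    by (rule nn_integral_liminf) measurable
  finally have "ennreal v < liminf (\<lambda>n. \<integral>\<^sup>+ p. ennreal ((g n (fst p) - g n (snd p))\<^sup>2 / 2) \<partial>(snd X \<Otimes>\<^sub>M snd X))"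
    using vf by (rule order_less_le_trans[rotated])
  then obtain n where n: "ennreal v < (\<integral>\<^sup>+ p. ennreal ((g n (fst p) - g n (snd p))\<^sup>2 / 2) \<partial>(snd X \<Otimes>\<^sub>M snd X))"
    using eventually_happens'[OF sequentially_bot less_LiminfD] by blast
  define c where "c = (\<integral>x. g n x \<partial>snd X)"
  define h where "h x = g n x - c" for x
  have hm [measurable]: "h \<in> borel_measurable (snd X)" unfolding h_def by measurable
  have gb: "\<bar>g n x\<bar> \<le> real n" for x unfolding g_def by linarith
  have hb: "\<bar>h x\<bar> \<le> real n + \<bar>c\<bar>" for x using gb[of x] unfolding h_def by linarith
  have gi: "integrable (snd X) (g n)" by (rule M.integrable_const_bound[where B="real n"]) (use gb in auto)
  have h0: "(\<integral>x. h x \<partial>snd X) = 0" unfolding h_def using gi by (simp add: c_def M.prob_space)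
  have "one_lipschitz (fst X) euclidean_metric h"
    unfolding one_lipschitz_euclidean_iff
  proof (intro ballI)
    fix x y assume "x \<in> mspace (fst X)" "y \<in> mspace (fst X)"
    then have "\<bar>f x - f y\<bar> \<le> mdist (fst X) x y" using f unfolding one_lipschitz_euclidean_iff by blast
    moreover have "\<bar>h x - h y\<bar> \<le> \<bar>f x - f y\<bar>" unfolding h_def g_def by linarith
    ultimately show "\<bar>h x - h y\<bar> \<le> mdist (fst X) x y" by linarith
  qed
  moreover have "v < (\<integral>x. (h x)\<^sup>2 \<partial>snd X)"
  proof -
    have "ennreal v < ennreal (\<integral>x. (h x)\<^sup>2 \<partial>snd X)"
      using n nn_integral_half_square_diff[OF M.prob_space_axioms hm hb h0] unfolding h_def by simp
    then show ?thesis using ennreal_leI[of "\<integral>x. (h x)\<^sup>2 \<partial>snd X" v] by (meson not_le)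
  qed
  ultimately show ?thesis using hb h0 by blast
qed

text \<open>The witness has variance strictly above \<open>v\<close>, so the central limit theorem
  gives a wider Gaussian than claimed; contracting it yields deviation sqrt v.\<close>

lemma gaussian_in_pyramid_variance:
  assumes P: "P \<in> pyramids" "l2_idempotent P" and v: "v > 0" "ennreal v < pyramid_variance P"
  shows "class_of (gaussian_line (sqrt v)) \<in> P"
proof -
  obtain X where X: "X \<in> P" "ennreal v < obs_variance (rep_pm_class X)"
    using v(2) unfolding pyramid_variance_def less_SUP_iff by blast
  let ?X = "rep_pm_class X"
  obtain h B where h: "one_lipschitz (fst ?X) euclidean_metric h" "\<And>x. \<bar>h x\<bar> \<le> B"
    "(\<integral>x. h x \<partial>snd ?X) = 0" "v < (\<integral>x. (h x)\<^sup>2 \<partial>snd ?X)"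
    using obs_variance_bounded_witness[OF pm_space_rep X(2)] by blast
  define \<sigma> where "\<sigma> = sqrt (\<integral>x. (h x)\<^sup>2 \<partial>snd ?X)"
  have \<sigma>: "sqrt v < \<sigma>" "0 < sqrt v" using h(4) v(1) unfolding \<sigma>_def by (simp_all add: real_sqrt_less_mono)
  then have \<sigma>0: "\<sigma> > 0" by linarith
  interpret M: prob_space "snd ?X" using pm_space_rep unfolding pm_space_def by blast
  have hm [measurable]: "h \<in> borel_measurable (snd ?X)" by (rule one_lipschitz_borel_measurable[OF pm_space_rep h(1)])
  let ?\<mu> = "distr (snd ?X) borel h"
  have b2: "(h x)\<^sup>2 \<le> B\<^sup>2" for x using power_mono[OF h(2)[of x], of 2] by simp
  have "integrable (snd ?X) (\<lambda>x. (h x)\<^sup>2)" by (rule M.integrable_const_bound[where B="B\<^sup>2"]) (use b2 in auto)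
  then have i2: "integrable ?\<mu> (\<lambda>x. x\<^sup>2)" by (subst integrable_distr_eq) simp_all
  have e1: "(\<integral>x. x \<partial>?\<mu>) = 0" using h(3) by (subst integral_distr) simp_all
  have e2: "(\<integral>x. x\<^sup>2 \<partial>?\<mu>) = \<sigma>\<^sup>2"
  proof -
    have "(\<integral>x. x\<^sup>2 \<partial>?\<mu>) = (\<integral>x. (h x)\<^sup>2 \<partial>snd ?X)" by (subst integral_distr) simp_all
    also have "\<dots> = \<sigma>\<^sup>2" using h(4) v(1) unfolding \<sigma>_def by simp
    finally show ?thesis .
  qed
  note img = line_class_image[OF P(1) X(1) h(1)]
  have "class_of (gaussian_line \<sigma>) \<in> P"
    by (rule gaussian_in_idempotent_pyramid[OF P img i2 e1 e2 \<sigma>0])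
  moreover have "lip_le (gaussian_line (sqrt v)) (rep_pm_class (class_of (gaussian_line \<sigma>)))"
    using full_pm_space_gaussian_line[OF \<sigma>0] full_pm_space_gaussian_line[OF \<sigma>(2)] \<sigma>
    by (intro lip_le_trans[OF lip_le_gaussian_mono lip_le_class_of(2)] full_pm_space_imp_pm_space full_pm_space_rep) auto
  ultimately show ?thesis by (rule pyramid_downward_class_of[OF P(1) _ full_pm_space_gaussian_line[OF \<sigma>(2)]])
qed

text \<open>The distance from \<open>y\<close> differs by at least D/3 between the balls of radius
  D/3 around \<open>y\<close> and \<open>z\<close>, with D their distance, and by full support both
  balls have positive mass.\<close>

lemma obs_variance_pos:
  assumes X: "full_pm_space X" and yz: "y \<in> mspace (fst X)" "z \<in> mspace (fst X)" "y \<noteq> z"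
  shows "obs_variance X > 0"
proof -
  note pX = full_pm_space_imp_pm_space[OF X]
  interpret M: prob_space "snd X" using pX unfolding pm_space_def by blast
  define D where "D = mdist (fst X) y z"
  have D: "D > 0" using yz mdist_zero[of y "fst X" z] mdist_nonneg[of "fst X" y z] unfolding D_def by linarith
  let ?f = "mdist (fst X) y" and ?U = "mball_of (fst X) y (D / 3)" and ?V = "mball_of (fst X) z (D / 3)"
  have fl: "one_lipschitz (fst X) euclidean_metric ?f" by (rule one_lipschitz_mdist[OF yz(1)])
  have s: "?U \<in> sets (snd X)" "?V \<in> sets (snd X)" by (rule pm_space_openin_sets[OF pX openin_mball_of])+
  have "y \<in> pm_support X" "z \<in> pm_support X" using X yz unfolding full_pm_space_def by blast+
  moreover have "y \<in> ?U" "z \<in> ?V" using yz D by simp_all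
  ultimately have pos: "emeasure (snd X) ?U > 0" "emeasure (snd X) ?V > 0"
    using pm_support_pos[OF _ openin_mball_of, of y X y "D / 3"] pm_support_pos[OF _ openin_mball_of, of z X z "D / 3"] D by simp_all
  have "0 < ennreal ((D / 3)\<^sup>2) * (emeasure (snd X) ?U * emeasure (snd X) ?V)"
    using pos D by (simp add: ennreal_zero_less_mult_iff)
  also have "\<dots> = (\<integral>\<^sup>+ p. ennreal ((D / 3)\<^sup>2) * indicator (?U \<times> ?V) p \<partial>(snd X \<Otimes>\<^sub>M snd X))"
    using s by (subst nn_integral_cmult_indicator) (auto simp: M.emeasure_pair_measure_Times)
  also have "\<dots> \<le> (\<integral>\<^sup>+ p. ennreal ((?f (fst p) - ?f (snd p))\<^sup>2) \<partial>(snd X \<Otimes>\<^sub>M snd X))"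
  proof (rule nn_integral_mono)
    fix p
    have "(D / 3)\<^sup>2 \<le> (?f (fst p) - ?f (snd p))\<^sup>2" if p: "p \<in> ?U \<times> ?V"
    proof -
      have q: "fst p \<in> mspace (fst X)" "snd p \<in> mspace (fst X)" "mdist (fst X) y (fst p) < D / 3" "mdist (fst X) z (snd p) < D / 3"
        using p by auto
      have "D \<le> mdist (fst X) y (snd p) + mdist (fst X) (snd p) z"
        unfolding D_def by (rule mdist_triangle[OF yz(1) q(2) yz(2)])
      moreover have "mdist (fst X) (snd p) z = mdist (fst X) z (snd p)" by (rule mdist_commute)
      ultimately have "D / 3 \<le> ?f (snd p) - ?f (fst p)" using q(3,4) by linarith
      then have "(D / 3)\<^sup>2 \<le> (?f (snd p) - ?f (fst p))\<^sup>2" using D by (intro power_mono) auto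
      then show ?thesis unfolding power2_commute[of "?f (fst p)"] .
    qed
    then show "ennreal ((D / 3)\<^sup>2) * indicator (?U \<times> ?V) p \<le> ennreal ((?f (fst p) - ?f (snd p))\<^sup>2)"
      by (cases "p \<in> ?U \<times> ?V") (simp_all add: ennreal_leI)
  qed
  finally have "0 < 1 / 2 * (\<integral>\<^sup>+ p. ennreal ((?f (fst p) - ?f (snd p))\<^sup>2) \<partial>(snd X \<Otimes>\<^sub>M snd X))"
    by (simp add: ennreal_zero_less_mult_iff ennreal_zero_less_divide)
  then show ?thesis unfolding obs_variance_def less_SUP_iff using fl by blast
qed

text \<open>A full-support space with two distinct points has positive observable variance, so all
  members of the pyramid are single points.\<close>

lemma pyramid_variance_zero:
  assumes P: "P \<in> pyramids" and V: "pyramid_variance P = 0"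
  shows "P = {abs_pm_class one_point}"
proof -
  have "X = abs_pm_class one_point" if X: "X \<in> P" for X
  proof -
    let ?X = "rep_pm_class X"
    interpret M: prob_space "snd ?X" using pm_space_rep unfolding pm_space_def by blast
    have "obs_variance ?X \<le> pyramid_variance P" unfolding pyramid_variance_def using X by (rule SUP_upper)
    then have "obs_variance ?X = 0" using V by simp
    then have one: "y = z" if "y \<in> mspace (fst ?X)" "z \<in> mspace (fst ?X)" for y z
      using obs_variance_pos[OF full_pm_space_rep that] by (cases "y = z") simp_all
    obtain y where y: "y \<in> mspace (fst ?X)" using pm_space_nonempty[OF pm_space_rep] by blast
    have ms: "mspace (fst ?X) = {y}" using one[OF y] y by blast
    then have sp: "space (snd ?X) = {y}" using pm_space_rep[of X] unfolding pm_space_def by simp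
    have "pm_iso ?X one_point"
      unfolding pm_iso_def
    proof (intro exI[of _ "\<lambda>_. 0"] conjI)
      show "bij_betw (\<lambda>_. 0) (mspace (fst ?X)) (mspace (fst one_point))" unfolding ms by (simp add: one_point_def bij_betw_def)
      show "\<forall>x\<in>mspace (fst ?X). \<forall>y\<in>mspace (fst ?X). mdist (fst one_point) 0 0 = mdist (fst ?X) x y"
        unfolding ms by (simp add: one_point_def y)
      have m: "(\<lambda>_. 0) \<in> measurable (snd ?X) (count_space {0::real})" by simp
      have "distr (snd ?X) (count_space {0::real}) (\<lambda>_. 0) = return (count_space {0}) 0"
      proof (rule measure_eqI)
        fix A assume "A \<in> sets (distr (snd ?X) (count_space {0::real}) (\<lambda>_. 0))"
        then have "A = {} \<or> A = {0}" by auto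
        then show "emeasure (distr (snd ?X) (count_space {0::real}) (\<lambda>_. 0)) A = emeasure (return (count_space {0}) 0) A"
          using M.emeasure_space_1 by (auto simp: emeasure_distr[OF m])
      qed simp
      moreover have "distr (snd ?X) (return (count_space {0}) 0) (\<lambda>_. 0) = distr (snd ?X) (count_space {0::real}) (\<lambda>_. 0)"
        by (rule distr_cong) simp_all
      ultimately show "distr (snd ?X) (snd one_point) (\<lambda>_. 0) = snd one_point" by (simp add: one_point_def)
    qed
    then have "class_of ?X = class_of one_point" by (rule class_of_cong[OF _ full_pm_space_rep full_pm_space_one_point])
    then show ?thesis unfolding class_of_rep abs_pm_class_eq[OF full_pm_space_one_point] .
  qed
  moreover have "P \<noteq> {}" using P unfolding pyramids_def by blast
  ultimately show ?thesis by blast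
qed

section \<open>Gaussian lines of all variances generate every pyramid\<close>

text \<open>The deviation 1/sqrt(2 pi) is the one whose distribution function produces the uniform
  law of the unit interval; a parameter of \<open>X\<close> then follows it.\<close>

lemma gauss_pushforward_exists:
  assumes X: "pm_space X"
  shows "\<exists>g\<in>measurable (gauss (1 / sqrt (2 * pi))) (snd X). distr (gauss (1 / sqrt (2 * pi))) (snd X) g = snd X"
proof -
  let ?G = "gaussian_line (1 / sqrt (2 * pi))"
  obtain a where a: "a \<in> measurable unit_leb (snd X)" "distr unit_leb (snd X) a = snd X"
    using parameter_exists[OF X] unfolding parameter_def by blast
  have I: "snd (interval_pm 1) = unit_leb" unfolding snd_interval_pm by simp
  obtain \<phi> where \<phi>: "one_lipschitz (fst ?G) (fst (interval_pm 1)) \<phi>" "distr (snd ?G) (snd (interval_pm 1)) \<phi> = snd (interval_pm 1)"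
    using lip_le_interval_gaussian[of 1] unfolding lip_le_def by auto
  have \<phi>m: "\<phi> \<in> measurable (snd ?G) (snd (interval_pm 1))"
    by (rule one_lipschitz_measurable[OF \<phi>(1)]) (intro full_pm_space_imp_pm_space full_pm_space_gaussian_line full_pm_space_interval_pm; simp)+
  note \<phi>' = \<phi>m[unfolded I gaussian_line_simps] \<phi>(2)[unfolded I gaussian_line_simps]
  show ?thesis
  proof (rule bexI[of _ "a \<circ> \<phi>"])
    show "distr (gauss (1 / sqrt (2 * pi))) (snd X) (a \<circ> \<phi>) = snd X"
      using distr_distr[OF a(1) \<phi>'(1)] \<phi>'(2) a(2) by simp
    show "a \<circ> \<phi> \<in> measurable (gauss (1 / sqrt (2 * pi))) (snd X)" by (rule measurable_comp[OF \<phi>'(1) a(1)])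
  qed
qed

text \<open>Finitely many label classes carry mass above 1 - e/2, and inner regularity replaces each
  by a compact subset losing at most \<open>q\<close>, in total at most e/2. Classes with different
  labels are disjoint, so their compact parts have positive distance from each other.\<close>

lemma compact_label_classes:
  fixes M :: "real measure" and l :: "real \<Rightarrow> nat"
  assumes M: "prob_space M" "sets M = sets borel" and l: "l \<in> measurable M (count_space UNIV)" and e: "e > 0"
  shows "\<exists>N K. (\<forall>i<N. compact (K i) \<and> (\<forall>x\<in>K i. l x = i)) \<and> 1 - e \<le> measure M (\<Union>i<N. K i)"
proof -
  interpret M: prob_space M by fact
  have sp: "space M = UNIV" using sets_eq_imp_space_eq[OF M(2)] by simp
  define T where "T i = l -` {i}" for i
  have T: "T i \<in> sets M" for i using measurable_sets[OF l, of "{i}"] unfolding T_def sp by simp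
  have "(\<lambda>n. M.prob (\<Union>i<n. T i)) \<longlonglongrightarrow> M.prob (\<Union>n. \<Union>i<n. T i)"
    using T by (intro M.finite_Lim_measure_incseq monoI UN_mono) auto
  moreover have "(\<Union>n. \<Union>i<n. T i) = space M" unfolding sp T_def by auto
  ultimately have "(\<lambda>n. M.prob (\<Union>i<n. T i)) \<longlonglongrightarrow> 1" using M.prob_space by simp
  then have "eventually (\<lambda>n. 1 - e / 2 < M.prob (\<Union>i<n. T i)) sequentially" using e by (intro order_tendstoD(1)) auto
  then obtain N where N: "1 - e / 2 < M.prob (\<Union>i<N. T i)" using eventually_happens'[OF sequentially_bot] by blast
  define q where "q = e / (2 * (real N + 1))"
  have q: "q > 0" using e by (simp add: q_def)
  have "\<exists>C. compact C \<and> C \<subseteq> T i \<and> M.prob (T i) - q \<le> M.prob C" for i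
  proof (cases "M.prob (T i) - q < 0")
    case True
    then show ?thesis by (intro exI[of _ "{}"]) simp
  next
    case False
    then have "ennreal (M.prob (T i) - q) < ennreal (M.prob (T i))" using q by (intro ennreal_lessI) auto
    also have "\<dots> = emeasure M (T i)" by (rule M.emeasure_eq_measure[symmetric])
    also have "\<dots> = (SUP C\<in>{C. C \<subseteq> T i \<and> compact C}. emeasure M C)"
      using T M(2) by (intro inner_regular) auto
    finally obtain C where C: "C \<subseteq> T i" "compact C" "ennreal (M.prob (T i) - q) < emeasure M C"
      unfolding less_SUP_iff by blast
    have "M.prob (T i) - q \<le> M.prob C"
      using C(3) ennreal_leI[of "M.prob C" "M.prob (T i) - q"] unfolding M.emeasure_eq_measure by (meson not_le less_imp_le)
    then show ?thesis using C by blast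
  qed
  then obtain K where K: "\<And>i. compact (K i)" "\<And>i. K i \<subseteq> T i" "\<And>i. M.prob (T i) - q \<le> M.prob (K i)" by metis
  have Km: "K i \<in> sets M" for i using K(1)[of i] M(2) by (simp add: borel_compact)
  have disT: "disjoint_family_on T {..<N}" unfolding disjoint_family_on_def T_def by auto
  have disK: "disjoint_family_on K {..<N}" using disT K(2) unfolding disjoint_family_on_def by blast
  have "M.prob (\<Union>i<N. T i) = (\<Sum>i<N. M.prob (T i))"
    by (rule M.finite_measure_finite_Union) (use T disT in auto)
  also have "\<dots> \<le> (\<Sum>i<N. M.prob (K i) + q)" using K(3) by (intro sum_mono) (simp add: diff_le_eq)
  also have "\<dots> = (\<Sum>i<N. M.prob (K i)) + real N * q" by (simp add: sum.distrib)
  also have "(\<Sum>i<N. M.prob (K i)) = M.prob (\<Union>i<N. K i)"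
    by (rule M.finite_measure_finite_Union[symmetric]) (use Km disK in auto)
  finally have "1 - e / 2 < M.prob (\<Union>i<N. K i) + real N * q" using N by linarith
  moreover have "real N * q \<le> e / 2"
  proof -
    have "real N * q \<le> (real N + 1) * q" using q by simp
    also have "\<dots> = e / 2" unfolding q_def by (simp add: field_simps)
    finally show ?thesis .
  qed
  ultimately have "1 - e \<le> M.prob (\<Union>i<N. K i)" by linarith
  moreover have "\<forall>i<N. compact (K i) \<and> (\<forall>x\<in>K i. l x = i)" using K(1,2) unfolding T_def by blast
  ultimately show ?thesis by blast
qed

lemma Min_image_Lipschitz:
  fixes F G :: "'i \<Rightarrow> real"
  assumes J: "finite J" "J \<noteq> {}" and c: "\<And>j. j \<in> J \<Longrightarrow> \<bar>F j - G j\<bar> \<le> c"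
  shows "\<bar>Min (F ` J) - Min (G ` J)\<bar> \<le> c"
proof -
  have "Min (A ` J) \<le> Min (B ` J) + c" if AB: "\<And>j. j \<in> J \<Longrightarrow> \<bar>A j - B j\<bar> \<le> c" for A B :: "'i \<Rightarrow> real"
  proof -
    have "Min (B ` J) \<in> B ` J" using J by (intro Min_in) auto
    then obtain j where j: "j \<in> J" "Min (B ` J) = B j" by blast
    have "Min (A ` J) \<le> A j" using J j by simp
    then show ?thesis using AB[OF j(1)] j(2) by linarith
  qed
  from this[of F G] this[of G F] c show ?thesis by (simp add: abs_minus_commute abs_le_iff)
qed

lemma separated_compact_family:
  fixes K :: "nat \<Rightarrow> 'a::heine_borel set"
  assumes K: "\<And>i. i < N \<Longrightarrow> compact (K i)" and dis: "\<And>i j. i < N \<Longrightarrow> j < N \<Longrightarrow> i \<noteq> j \<Longrightarrow> K i \<inter> K j = {}"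
  shows "\<exists>\<delta>>0. \<forall>i<N. \<forall>j<N. i \<noteq> j \<longrightarrow> (\<forall>x\<in>K i. \<forall>y\<in>K j. \<delta> \<le> dist x y)"
proof -
  have "\<exists>\<delta>>0. i < N \<longrightarrow> j < N \<longrightarrow> i \<noteq> j \<longrightarrow> (\<forall>x\<in>K i. \<forall>y\<in>K j. \<delta> \<le> dist x y)" for i j
  proof (cases "i < N \<and> j < N \<and> i \<noteq> j")
    case True
    then have "compact (K i)" "closed (K j)" "K i \<inter> K j = {}" using K[of i] K[of j, THEN compact_imp_closed] dis[of i j] by simp_all
    from separate_compact_closed[OF this] show ?thesis by blast
  next
    case False
    then show ?thesis by (intro exI[of _ 1]) auto
  qed
  then obtain D where D: "\<And>i j. D i j > 0"
    "\<And>i j. i < N \<Longrightarrow> j < N \<Longrightarrow> i \<noteq> j \<Longrightarrow> (\<forall>x\<in>K i. \<forall>y\<in>K j. D i j \<le> dist x y)"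
    by metis
  define \<delta> where "\<delta> = Min (insert 1 ((\<lambda>(i, j). D i j) ` ({..<N} \<times> {..<N})))"
  have "\<delta> > 0" unfolding \<delta>_def using D(1) by auto
  moreover have "\<delta> \<le> D i j" if "i < N" "j < N" for i j
    unfolding \<delta>_def using that by (intro Min_le) auto
  ultimately show ?thesis using D(2) by (meson order_trans)
qed

text \<open>Each function is the McShane extension of its prescribed values on the compact sets.\<close>

lemma prescribed_lipschitz_functions:
  fixes K :: "nat \<Rightarrow> 'a::heine_borel set" and \<rho> :: "nat \<Rightarrow> nat \<Rightarrow> real"
  assumes K: "\<And>i. i < N \<Longrightarrow> compact (K i)" and dis: "\<And>i j. i < N \<Longrightarrow> j < N \<Longrightarrow> i \<noteq> j \<Longrightarrow> K i \<inter> K j = {}"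
    and \<rho>: "\<And>i j. 0 \<le> \<rho> i j"
  shows "\<exists>w L. L \<ge> 0 \<and> (\<forall>i<N. \<forall>y z. \<bar>w i y - w i z\<bar> \<le> L * dist y z) \<and> (\<forall>i<N. \<forall>j<N. \<forall>y\<in>K j. w i y = \<rho> i j)"
proof -
  have "\<exists>\<delta>>0. \<forall>i<N. \<forall>j<N. i \<noteq> j \<longrightarrow> (\<forall>x\<in>K i. \<forall>y\<in>K j. \<delta> \<le> dist x y)"
    by (rule separated_compact_family[OF K dis])
  then obtain \<delta> where \<delta>0: "\<delta> > 0" "\<forall>i<N. \<forall>j<N. i \<noteq> j \<longrightarrow> (\<forall>x\<in>K i. \<forall>y\<in>K j. \<delta> \<le> dist x y)"
    by (elim exE conjE)
  have \<delta>: "\<delta> > 0" "\<And>i j x y. i < N \<Longrightarrow> j < N \<Longrightarrow> i \<noteq> j \<Longrightarrow> x \<in> K i \<Longrightarrow> y \<in> K j \<Longrightarrow> \<delta> \<le> dist x y"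
    using \<delta>0 by simp_all
  define J where "J = {j. j < N \<and> K j \<noteq> {}}"
  have J: "finite J" unfolding J_def by simp
  define D where "D = (\<Sum>i<N. \<Sum>j<N. \<rho> i j)"
  have D: "\<rho> i j \<le> D" if "i < N" "j < N" for i j
  proof -
    have "\<rho> i j \<le> (\<Sum>j<N. \<rho> i j)" using that \<rho> by (intro member_le_sum) auto
    also have "\<dots> \<le> D" unfolding D_def using that \<rho> by (intro member_le_sum) (auto intro: sum_nonneg)
    finally show ?thesis .
  qed
  have D0: "D \<ge> 0" unfolding D_def using \<rho> by (intro sum_nonneg) auto
  \<comment> \<open>Points of different compact sets are at least \<open>\<delta>\<close> apart, so
    slope D/\<delta> makes the extension pay at least \<open>D\<close>, a bound for all prescribed
    values, away from the set in question. Hence the prescribed value is the minimum.\<close>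
  define L where "L = D / \<delta>"
  have L: "L \<ge> 0" using D0 \<delta>(1) by (simp add: L_def)
  define w where "w i y = (if J = {} then 0 else Min ((\<lambda>j. \<rho> i j + L * infdist y (K j)) ` J))" for i y
  have "\<bar>w i y - w i z\<bar> \<le> L * dist y z" for i y z
  proof (cases "J = {}")
    case True
    then show ?thesis using L by (simp add: w_def)
  next
    case False
    have "\<bar>(\<rho> i j + L * infdist y (K j)) - (\<rho> i j + L * infdist z (K j))\<bar> \<le> L * dist y z" for j
    proof -
      have "\<bar>(\<rho> i j + L * infdist y (K j)) - (\<rho> i j + L * infdist z (K j))\<bar> = L * \<bar>infdist y (K j) - infdist z (K j)\<bar>"
        using L by (simp add: right_diff_distrib[symmetric] abs_mult)
      also have "\<dots> \<le> L * dist y z" by (rule mult_left_mono[OF infdist_triangle_abs L])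
      finally show ?thesis .
    qed
    then show ?thesis unfolding w_def using False J by (simp add: Min_image_Lipschitz)
  qed
  moreover have "w i y = \<rho> i j" if ij: "i < N" "j < N" and y: "y \<in> K j" for i j y
  proof -
    have jJ: "j \<in> J" using ij y unfolding J_def by auto
    have "Min ((\<lambda>j. \<rho> i j + L * infdist y (K j)) ` J) = \<rho> i j"
    proof (rule Min_eqI)
      show "\<rho> i j \<in> (\<lambda>j. \<rho> i j + L * infdist y (K j)) ` J" using jJ y by (intro image_eqI[of _ _ j]) simp_all
      fix u assume "u \<in> (\<lambda>j. \<rho> i j + L * infdist y (K j)) ` J"
      then obtain k where k: "k < N" "K k \<noteq> {}" "u = \<rho> i k + L * infdist y (K k)" unfolding J_def by blast
      show "\<rho> i j \<le> u"
      proof (cases "k = j")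
        case True
        then show ?thesis using k y by simp
      next
        case False
        have "\<delta> \<le> infdist y (K k)"
          unfolding infdist_notempty[OF k(2)] using k ij y False \<delta>(2) by (intro cINF_greatest) auto
        then have "D \<le> L * infdist y (K k)"
          unfolding L_def using \<delta>(1) mult_left_mono[OF _ D0, of \<delta> "infdist y (K k)"] by (simp add: pos_le_divide_eq)
        then show ?thesis using D[OF ij] \<rho>[of i k] k(3) by linarith
      qed
    qed (use J in simp)
    then show ?thesis using jJ unfolding w_def by auto
  qed
  ultimately show ?thesis using L by blast
qed

text \<open>The lower bound controls the usual distance at small scales and the upper bound is
  Lipschitz, so \<open>d\<close> has the usual open sets and its Cauchy sequences are Cauchy in the
  usual sense.\<close>

lemma full_pm_space_gauss_metric:
  fixes d :: "real metric"
  assumes d: "mspace d = UNIV" and \<eta>: "\<eta> > 0" and lo: "\<And>y z. min \<bar>y - z\<bar> \<eta> \<le> mdist d y z"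
    and hi: "\<And>y z. mdist d y z \<le> L * \<bar>y - z\<bar>" and \<sigma>: "\<sigma> > 0"
  shows "full_pm_space (d, gauss \<sigma>)"
proof -
  have L: "L > 0" using order_trans[OF lo[of 1 0] hi[of 1 0]] \<eta> by (simp add: min_def split: if_splits)
  have op: "openin (mtopology_of d) U \<longleftrightarrow> open U" for U
    unfolding openin_mtopology_of open_contains_ball d
  proof (intro iffI conjI ballI)
    fix x assume h: "U \<subseteq> UNIV \<and> (\<forall>x\<in>U. \<exists>r>0. mball_of d x r \<subseteq> U)" and "x \<in> U"
    then obtain r where r: "r > 0" "mball_of d x r \<subseteq> U" by blast
    have "ball x (r / L) \<subseteq> mball_of d x r"
    proof
      fix y assume "y \<in> ball x (r / L)"
      then have "L * \<bar>x - y\<bar> < r" using L by (simp add: dist_real_def pos_less_divide_eq mult.commute)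
      then show "y \<in> mball_of d x r" using hi[of x y] by (simp add: d)
    qed
    then show "\<exists>e>0. ball x e \<subseteq> U" using r L by (intro exI[of _ "r / L"]) auto
  next
    fix x assume h: "\<forall>x\<in>U. \<exists>e>0. ball x e \<subseteq> U" and "x \<in> U"
    then obtain r where r: "r > 0" "ball x r \<subseteq> U" by blast
    have "mball_of d x (min r \<eta>) \<subseteq> ball x r"
    proof
      fix y assume "y \<in> mball_of d x (min r \<eta>)"
      then have "mdist d x y < r" "mdist d x y < \<eta>" by simp_all
      then have "\<bar>x - y\<bar> < r" using lo[of x y] by linarith
      then show "y \<in> ball x r" by (simp add: dist_real_def)
    qed
    then show "\<exists>s>0. mball_of d x s \<subseteq> U" using r \<eta> by (intro exI[of _ "min r \<eta>"]) auto
  qed simp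
  have top: "mtopology_of d = mtopology_of (euclidean_metric :: real metric)"
    by (rule topology_eq[THEN iffD2]) (simp add: op)
  have "mcomplete_of d"
    unfolding mcomplete_of_def Metric_space.mcomplete_def[OF Metric_space_mspace_mdist]
  proof (intro allI impI)
    fix s assume s: "Metric_space.MCauchy (mspace d) (mdist d) s"
    have "Cauchy s"
    proof (rule metric_CauchyI)
      fix e :: real assume e: "e > 0"
      then have "min e \<eta> > 0" using \<eta> by simp
      then obtain N where N: "\<And>m n. N \<le> m \<Longrightarrow> N \<le> n \<Longrightarrow> mdist d (s m) (s n) < min e \<eta>"
        using s unfolding Metric_space.MCauchy_def[OF Metric_space_mspace_mdist] by blast
      show "\<exists>M. \<forall>m\<ge>M. \<forall>n\<ge>M. dist (s m) (s n) < e"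
      proof (intro exI[of _ N] allI impI)
        fix m n assume "N \<le> m" "N \<le> n"
        then have "mdist d (s m) (s n) < e" "mdist d (s m) (s n) < \<eta>" using N[of m n] by simp_all
        then show "dist (s m) (s n) < e" using lo[of "s m" "s n"] unfolding dist_real_def by linarith
      qed
    qed
    then obtain x where x: "s \<longlonglongrightarrow> x" using Cauchy_convergent unfolding convergent_def by blast
    have "limitin (mtopology_of (euclidean_metric :: real metric)) s x sequentially"
      using x by (simp add: limitin_canonical_iff)
    then have "limitin (mtopology_of d) s x sequentially" unfolding top .
    then show "\<exists>x. limitin (Metric_space.mtopology (mspace d) (mdist d)) s x sequentially"
      unfolding mtopology_of_def by blast
  qed
  then show ?thesis
    using full_pm_space_gaussian_line[OF \<sigma>] unfolding full_pm_space_def pm_space_def pm_support_def borel_sigma_def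
    by (simp add: top d)
qed

text \<open>The maximum \<open>m\<close> alone is only a pseudometric. The truncated usual distance
  separates points and adds at most \<open>\<eta>\<close>.\<close>

lemma truncated_sup_metric:
  fixes w :: "nat \<Rightarrow> real \<Rightarrow> real" and N :: nat
  assumes \<eta>: "\<eta> > 0"
  defines "m \<equiv> \<lambda>y z. Max (insert 0 ((\<lambda>i. \<bar>w i y - w i z\<bar>) ` {..<N}))"
  shows "Metric_space UNIV (\<lambda>y z. min \<bar>y - z\<bar> \<eta> + m y z)"
proof
  have m0: "0 \<le> m y z" for y z unfolding m_def by (rule Max_ge) auto
  have mi: "\<bar>w i y - w i z\<bar> \<le> m y z" if "i < N" for i y z unfolding m_def using that by (intro Max_ge) auto
  show "0 \<le> min \<bar>y - z\<bar> \<eta> + m y z" for y z using m0[of y z] \<eta> by simp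
  show "min \<bar>y - z\<bar> \<eta> + m y z = min \<bar>z - y\<bar> \<eta> + m z y" for y z
    unfolding m_def by (simp add: abs_minus_commute)
  show "min \<bar>y - z\<bar> \<eta> + m y z = 0 \<longleftrightarrow> y = z" for y z
  proof
    assume "min \<bar>y - z\<bar> \<eta> + m y z = 0"
    then show "y = z" using m0[of y z] \<eta> by linarith
  next
    assume "y = z"
    moreover have "m z z = 0" unfolding m_def by (rule Max_eqI) auto
    ultimately show "min \<bar>y - z\<bar> \<eta> + m y z = 0" using \<eta> by simp
  qed
  show "min \<bar>x - z\<bar> \<eta> + m x z \<le> (min \<bar>x - y\<bar> \<eta> + m x y) + (min \<bar>y - z\<bar> \<eta> + m y z)" for x y z
  proof -
    have mxz: "m x z = Max (insert 0 ((\<lambda>i. \<bar>w i x - w i z\<bar>) ` {..<N}))" by (simp add: m_def)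
    have "m x z \<le> m x y + m y z"
      unfolding mxz
    proof (rule Max.boundedI)
      fix a assume "a \<in> insert 0 ((\<lambda>i. \<bar>w i x - w i z\<bar>) ` {..<N})"
      then consider "a = 0" | i where "i < N" "a = \<bar>w i x - w i z\<bar>" by blast
      then show "a \<le> m x y + m y z"
      proof cases
        case 1
        then show ?thesis using m0[of x y] m0[of y z] by linarith
      next
        case (2 i)
        then show ?thesis using mi[of i x y] mi[of i y z] by linarith
      qed
    qed auto
    moreover have "min \<bar>x - z\<bar> \<eta> \<le> min \<bar>x - y\<bar> \<eta> + min \<bar>y - z\<bar> \<eta>" using \<eta> by linarith
    ultimately show ?thesis by linarith
  qed
qed

text \<open>A Borel map from the line to the space is almost constant on finitely many compact sets of almost
  full measure. The line gets a metric in which these sets have the distances of their images.\<close>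

lemma all_gaussians_pyramid:
  assumes P: "P \<in> pyramids" and G: "\<And>\<sigma>. \<sigma> > 0 \<Longrightarrow> class_of (gaussian_line \<sigma>) \<in> P"
  shows "P = UNIV"
proof -
  define \<sigma> where "\<sigma> = 1 / sqrt (2 * pi)"
  have \<sigma>: "\<sigma> > 0" by (simp add: \<sigma>_def)
  interpret \<Omega>: prob_space "gauss \<sigma>" using \<sigma> by (rule prob_space_gauss)
  have "X0 \<in> box_closure P" for X0
    unfolding box_closure_def
  proof (intro CollectI allI impI)
    fix \<epsilon> :: real assume \<epsilon>: "\<epsilon> > 0"
    define e where "e = \<epsilon> / 4"
    have e: "e > 0" using \<epsilon> by (simp add: e_def)
    let ?X = "rep_pm_class X0"
    let ?d = "mdist (fst ?X)"
    obtain g where g: "g \<in> measurable (gauss \<sigma>) (snd ?X)" "distr (gauss \<sigma>) (snd ?X) g = snd ?X"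
      using gauss_pushforward_exists[OF pm_space_rep, of X0] unfolding \<sigma>_def by blast
    have spX: "space (snd ?X) = mspace (fst ?X)" using pm_space_rep[of X0] unfolding pm_space_def by blast
    have gX: "g x \<in> mspace (fst ?X)" for x using measurable_space[OF g(1), of x] unfolding spX by simp
    obtain l :: "real \<Rightarrow> nat" where l: "l \<in> measurable (snd ?X) (count_space UNIV)"
      "\<And>y z. y \<in> mspace (fst ?X) \<Longrightarrow> z \<in> mspace (fst ?X) \<Longrightarrow> l y = l z \<Longrightarrow> ?d y z < e"
      using countable_labels[OF pm_space_rep e, of X0] by blast
    have lg: "(\<lambda>x. l (g x)) \<in> measurable (gauss \<sigma>) (count_space UNIV)" by (rule measurable_compose[OF g(1) l(1)])
    have sb: "sets (gauss \<sigma>) = sets borel" by simp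
    obtain N K where K: "\<And>i. i < N \<Longrightarrow> compact (K i)" "\<And>i x. i < N \<Longrightarrow> x \<in> K i \<Longrightarrow> l (g x) = i"
      "1 - e \<le> measure (gauss \<sigma>) (\<Union>i<N. K i)"
      using compact_label_classes[OF \<Omega>.prob_space_axioms sb lg e] by blast
    have dis: "K i \<inter> K j = {}" if "i < N" "j < N" "i \<noteq> j" for i j using K(2) that by blast
    \<comment> \<open>One image point stands for all of \<open>K i\<close>; for an empty set this is
      merely some point of the space.\<close>
    define q where "q i = g (SOME x. x \<in> K i)" for i
    have q: "q i \<in> mspace (fst ?X)" for i unfolding q_def by (rule gX)
    have near: "?d (g x) (q i) < e" if "i < N" "x \<in> K i" for i x
    proof -
      have "(SOME x. x \<in> K i) \<in> K i" using that(2) by (rule someI)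
      then have "l (g x) = l (q i)" unfolding q_def using K(2) that by simp
      then show ?thesis by (rule l(2)[OF gX q])
    qed
    have "\<exists>w L. L \<ge> 0 \<and> (\<forall>i<N. \<forall>y z. \<bar>w i y - w i z\<bar> \<le> L * dist y z) \<and>
      (\<forall>i<N. \<forall>j<N. \<forall>y\<in>K j. w i y = ?d (q i) (q j))"
      by (rule prescribed_lipschitz_functions[where \<rho>="\<lambda>i j. ?d (q i) (q j)"]) (fact K(1) dis mdist_nonneg)+
    then obtain w L where w0: "L \<ge> 0" "\<forall>i<N. \<forall>y z. \<bar>w i y - w i z\<bar> \<le> L * dist y z"
      "\<forall>i<N. \<forall>j<N. \<forall>y\<in>K j. w i y = ?d (q i) (q j)"
      by (elim exE conjE)
    have w: "L \<ge> 0" "\<And>i y z. i < N \<Longrightarrow> \<bar>w i y - w i z\<bar> \<le> L * dist y z"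
      "\<And>i j y. i < N \<Longrightarrow> j < N \<Longrightarrow> y \<in> K j \<Longrightarrow> w i y = ?d (q i) (q j)"
      using w0 by simp_all
    define m where "m y z = Max (insert 0 ((\<lambda>i. \<bar>w i y - w i z\<bar>) ` {..<N}))" for y z
    \<comment> \<open>The functions \<open>w i\<close> prescribe the distances from the points
      \<open>q i\<close>, so the maximum \<open>m\<close> is a Kuratowski embedding into a sup-norm
      space, extended to the whole line. Being Lipschitz with constant 1 + L, the metric makes the
      line an image of a Gaussian line that is 1 + L times as wide.\<close>
    define d where "d = metric (UNIV, \<lambda>y z. min \<bar>y - z\<bar> e + m y z)"
    have ms: "Metric_space UNIV (\<lambda>y z. min \<bar>y - z\<bar> e + m y z)"
      unfolding m_def by (rule truncated_sup_metric[OF e])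
    have d: "mspace d = UNIV" "mdist d = (\<lambda>y z. min \<bar>y - z\<bar> e + m y z)"
      unfolding d_def using ms by (simp_all add: Metric_space.mspace_metric Metric_space.mdist_metric)
    have m0: "0 \<le> m y z" for y z unfolding m_def by (rule Max_ge) auto
    have mL: "m y z \<le> L * \<bar>y - z\<bar>" for y z
      unfolding m_def
    proof (rule Max.boundedI)
      fix a assume "a \<in> insert 0 ((\<lambda>i. \<bar>w i y - w i z\<bar>) ` {..<N})"
      then show "a \<le> L * \<bar>y - z\<bar>" using w(1) w(2)[of _ y z] by (auto simp: dist_real_def)
    qed auto
    have lo: "min \<bar>y - z\<bar> e \<le> mdist d y z" for y z using m0[of y z] unfolding d by linarith
    have hi: "mdist d y z \<le> (1 + L) * \<bar>y - z\<bar>" for y z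
      unfolding d distrib_right by (intro add_mono mL) simp
    define Y where "Y = (d, gauss \<sigma>)"
    have Y: "full_pm_space Y" unfolding Y_def by (rule full_pm_space_gauss_metric[OF d(1) e lo hi \<sigma>])
    have k: "1 + L > 0" using w(1) by linarith
    then have k\<sigma>: "(1 + L) * \<sigma> > 0" using \<sigma> by simp
    have "distr (gauss ((1 + L) * \<sigma>)) (gauss \<sigma>) (\<lambda>x. 1 / (1 + L) * x) = gauss \<sigma>"
    proof -
      have "distr (gauss ((1 + L) * \<sigma>)) (gauss \<sigma>) (\<lambda>x. 1 / (1 + L) * x) = distr (gauss ((1 + L) * \<sigma>)) borel (\<lambda>x. 1 / (1 + L) * x)"
        by (rule distr_cong) auto
      also have "\<dots> = gauss \<sigma>" using distr_gauss_scale[OF k\<sigma>, of "1 / (1 + L)"] k by simp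
      finally show ?thesis .
    qed
    moreover have "mdist d (1 / (1 + L) * x) (1 / (1 + L) * y) \<le> dist x y" for x y
    proof -
      have "mdist d (1 / (1 + L) * x) (1 / (1 + L) * y) \<le> (1 + L) * \<bar>1 / (1 + L) * (x - y)\<bar>"
        using hi unfolding right_diff_distrib .
      also have "\<dots> = dist x y" using k by (simp add: abs_mult dist_real_def)
      finally show ?thesis .
    qed
    ultimately have YG: "lip_le Y (gaussian_line ((1 + L) * \<sigma>))"
      unfolding lip_le_def one_lipschitz_def by (intro exI[of _ "\<lambda>x. 1 / (1 + L) * x"]) (simp add: Y_def d(1))
    note fG = full_pm_space_gaussian_line[OF k\<sigma>]
    have "lip_le Y (rep_pm_class (class_of (gaussian_line ((1 + L) * \<sigma>))))"
      by (rule lip_le_trans[OF YG lip_le_class_of(2)[OF fG] pm_space_rep full_pm_space_imp_pm_space[OF fG] full_pm_space_imp_pm_space[OF Y]])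
    then have YP: "class_of Y \<in> P" by (rule pyramid_downward_class_of[OF P G[OF k\<sigma>] Y])
    \<comment> \<open>The error consists of one \<open>e\<close> from the truncated distance and two
      from replacing \<open>g s\<close> and \<open>g t\<close> by the representatives of their
      pieces.\<close>
    have "box_ok ?X Y (3 * e)"
    proof (rule box_okI[where \<Omega>="gauss \<sigma>" and A=g and B="\<lambda>x. x" and S="\<Union>i<N. K i"])
      show "lebesgue_image (gauss \<sigma>)" by (rule lebesgue_image_polish[OF \<Omega>.prob_space_axioms sb])
      show "(\<Union>i<N. K i) \<in> sets (gauss \<sigma>)" using K(1) by (auto simp: borel_compact)
      show "1 - 3 * e \<le> measure (gauss \<sigma>) (\<Union>i<N. K i)" using K(3) e by linarith
      fix s t assume "s \<in> (\<Union>i<N. K i)" "t \<in> (\<Union>i<N. K i)"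
      then obtain a b where ab: "a < N" "s \<in> K a" "b < N" "t \<in> K b" by blast
      \<comment> \<open>By the triangle inequality no index gives more than the distance of the
        representatives, and the index \<open>a\<close> attains it.\<close>
      have "m s t = ?d (q a) (q b)"
        unfolding m_def
      proof (rule Max_eqI)
        have "\<bar>w a s - w a t\<bar> = ?d (q a) (q b)" using w(3) ab q by simp
        then show "?d (q a) (q b) \<in> insert 0 ((\<lambda>i. \<bar>w i s - w i t\<bar>) ` {..<N})" using ab(1) by (intro insertI2 image_eqI[of _ _ a]) simp_all
        fix u assume "u \<in> insert 0 ((\<lambda>i. \<bar>w i s - w i t\<bar>) ` {..<N})"
        then consider "u = 0" | i where "i < N" "u = \<bar>w i s - w i t\<bar>" by blast
        then show "u \<le> ?d (q a) (q b)"
        proof cases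
          case (2 i)
          have "u = \<bar>?d (q i) (q a) - ?d (q i) (q b)\<bar>" using 2 w(3) ab by simp
          moreover have "?d (q i) (q a) \<le> ?d (q i) (q b) + ?d (q b) (q a)" "?d (q i) (q b) \<le> ?d (q i) (q a) + ?d (q a) (q b)"
            by (rule mdist_triangle[OF q q q])+
          moreover have "?d (q b) (q a) = ?d (q a) (q b)" by (rule mdist_commute)
          ultimately show ?thesis by linarith
        qed simp
      qed simp
      then have dY: "\<bar>mdist d s t - ?d (q a) (q b)\<bar> \<le> e" unfolding d using e by simp
      have n: "?d (g s) (q a) < e" "?d (g t) (q b) < e" using near[OF ab(1,2)] near[OF ab(3,4)] by simp_all
      have c: "?d (q a) (g s) = ?d (g s) (q a)" "?d (q b) (g t) = ?d (g t) (q b)" by (rule mdist_commute)+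
      have "?d (g s) (g t) \<le> ?d (g s) (q a) + ?d (q a) (g t)" "?d (q a) (g t) \<le> ?d (q a) (q b) + ?d (q b) (g t)"
        "?d (q a) (q b) \<le> ?d (q a) (g s) + ?d (g s) (q b)" "?d (g s) (q b) \<le> ?d (g s) (g t) + ?d (g t) (q b)"
        by (rule mdist_triangle[OF gX q gX] mdist_triangle[OF q q gX] mdist_triangle[OF q gX q] mdist_triangle[OF gX gX q])+
      then show "\<bar>?d (g s) (g t) - mdist (fst Y) s t\<bar> \<le> 3 * e" using dY n unfolding c Y_def fst_conv by linarith
    qed (use g \<Omega>.prob_space_axioms in \<open>simp_all add: Y_def distr_id2\<close>)
    moreover have "3 * e < \<epsilon>" using \<epsilon> by (simp add: e_def)
    ultimately have "box_class (class_of ?X) (class_of Y) < \<epsilon>"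
      using e by (intro box_class_class_of_less[OF _ _ _ full_pm_space_rep Y]) auto
    then show "\<exists>Y\<in>P. box_class X0 Y < \<epsilon>" using YP unfolding class_of_rep by blast
  qed
  then show ?thesis unfolding pyramid_closed[OF P] by blast
qed

section \<open>The functional\<close>

abbreviation gaussian_power :: "real \<Rightarrow> pm_class set" where
  "gaussian_power \<sigma> \<equiv> infinite_power (gaussian_line \<sigma>)"

section \<open>Gaussian pyramids as a function of the deviation\<close>

lemma gaussian_power_mono:
  assumes "0 < s" "s \<le> \<sigma>"
  shows "gaussian_power s \<subseteq> gaussian_power \<sigma>"
proof -
  have \<sigma>: "\<sigma> > 0" using assms by linarith
  show ?thesis
    by (rule infinite_power_mono[OF lip_le_gaussian_mono[OF assms] full_pm_space_gaussian_line[OF \<sigma>] full_pm_space_gaussian_line[OF assms(1)]])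
qed

lemma scale_class_gaussian_power:
  assumes "X \<in> gaussian_power \<sigma>" "\<sigma> > 0" "t > 0"
  shows "scale_class t X \<in> gaussian_power (t * \<sigma>)"
  by (rule scale_class_infinite_power[OF assms(1,3) lip_le_scale_gaussian[OF assms(3,2)]])
    (use assms in \<open>simp_all add: full_pm_space_gaussian_line\<close>)

lemma lip_le_power_one:
  assumes X: "full_pm_space X"
  shows "lip_le X (power_pm 1 X)"
proof -
  interpret M: prob_space "snd X" using full_pm_space_imp_pm_space[OF X] unfolding pm_space_def by blast
  have "distr (PiM {..<1::nat} (\<lambda>_. snd X)) (snd X) (\<lambda>x. x 0) = snd X"
    by (rule distr_PiM_component) (simp_all add: M.prob_space_axioms)
  moreover have "one_lipschitz (power_metric 1 (fst X)) (fst X) (\<lambda>x. x 0)"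
    unfolding one_lipschitz_def by (auto simp: mspace_power_metric mdist_power_metric PiE_iff)
  ultimately show ?thesis unfolding lip_le_def by (intro exI[of _ "\<lambda>x. x 0"]) simp
qed

lemma class_of_in_infinite_power:
  assumes X: "full_pm_space X"
  shows "class_of X \<in> infinite_power X"
proof -
  have "lip_le (rep_pm_class (class_of X)) (power_pm 1 X)"
    using lip_le_power_one[OF X]
    by (simp add: lip_le_class_of_iff[OF X full_pm_space_imp_pm_space[OF full_pm_space_power_pm[OF X]]])
  then have "class_of X \<in> (\<Union>n\<in>{1..}. pyramid_of (power_pm n X))" unfolding pyramid_of_def by (intro UN_I[of 1]) simp_all
  then show ?thesis unfolding infinite_power_def by (rule subsetD[OF subset_box_closure])
qed

text \<open>Scaling by t < 1 near 1 moves \<open>X\<close> little in the box distance and brings it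
  from the Gaussian pyramid of deviation \<sigma>/t into that of \<sigma>, which is
  box-closed.\<close>

lemma gaussian_power_right_continuous:
  assumes \<sigma>: "\<sigma> > 0" and P: "\<And>s. s > \<sigma> \<Longrightarrow> P \<subseteq> gaussian_power s"
  shows "P \<subseteq> gaussian_power \<sigma>"
proof
  fix X assume X: "X \<in> P"
  have "X \<in> box_closure (gaussian_power \<sigma>)"
    unfolding box_closure_def
  proof (intro CollectI allI impI)
    fix e :: real assume e: "e > 0"
    obtain \<eta> where \<eta>: "\<eta> > 0" "\<And>t. t > 0 \<Longrightarrow> \<bar>t - 1\<bar> < \<eta> \<Longrightarrow> box_class X (scale_class t X) < e"
      using box_class_scale_class_near_one[OF e, of X] by blast
    define t where "t = 1 - min \<eta> 1 / 2"
    have t: "0 < t" "t < 1" "\<bar>t - 1\<bar> < \<eta>" using \<eta>(1) unfolding t_def by (auto simp: min_def)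
    have "\<sigma> < \<sigma> / t" using t \<sigma> by (simp add: pos_less_divide_eq)
    then have "X \<in> gaussian_power (\<sigma> / t)" using P X by blast
    then have "scale_class t X \<in> gaussian_power (t * (\<sigma> / t))"
      using t \<sigma> by (intro scale_class_gaussian_power) auto
    then have "scale_class t X \<in> gaussian_power \<sigma>" using t by simp
    then show "\<exists>Y\<in>gaussian_power \<sigma>. box_class X Y < e" using \<eta>(2)[OF t(1,3)] by blast
  qed
  then show "X \<in> gaussian_power \<sigma>" unfolding box_closure_infinite_power .
qed

text \<open>A Gaussian shrunk by t < 1 lies below the Gaussian of deviation t \<sigma> and is
  box-close to the original when t is near 1, so box-closedness of \<open>P\<close>
  suffices.\<close>

lemma gaussian_left_continuous:
  assumes P: "P \<in> pyramids" and \<sigma>: "\<sigma> > 0" and G: "\<And>s. 0 < s \<Longrightarrow> s < \<sigma> \<Longrightarrow> class_of (gaussian_line s) \<in> P"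
  shows "class_of (gaussian_line \<sigma>) \<in> P"
proof -
  let ?W = "class_of (gaussian_line \<sigma>)"
  note fs = full_pm_space_gaussian_line[OF \<sigma>]
  have "?W \<in> box_closure P"
    unfolding box_closure_def
  proof (intro CollectI allI impI)
    fix e :: real assume e: "e > 0"
    have e2: "e / 2 > 0" using e by simp
    obtain \<eta> where \<eta>: "\<eta> > 0" "\<And>t. t > 0 \<Longrightarrow> \<bar>t - 1\<bar> < \<eta> \<Longrightarrow> box_ok (scale_pm t (gaussian_line \<sigma>)) (gaussian_line \<sigma>) (e / 2)"
      using box_ok_scale_near_one[OF full_pm_space_imp_pm_space[OF fs] e2] by blast
    define t where "t = 1 - min \<eta> 1 / 2"
    have t: "0 < t" "t < 1" "\<bar>t - 1\<bar> < \<eta>" using \<eta>(1) unfolding t_def by (auto simp: min_def)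
    have t\<sigma>: "0 < t * \<sigma>" "t * \<sigma> < \<sigma>" using t \<sigma> by simp_all
    let ?S = "scale_pm t (gaussian_line \<sigma>)"
    have fS: "full_pm_space ?S" by (rule full_pm_space_scale_pm[OF t(1) fs])
    note fT = full_pm_space_gaussian_line[OF t\<sigma>(1)]
    have "lip_le ?S (rep_pm_class (class_of (gaussian_line (t * \<sigma>))))"
      by (rule lip_le_trans[OF lip_le_scale_gaussian[OF t(1) \<sigma>] lip_le_class_of(2)[OF fT] pm_space_rep
            full_pm_space_imp_pm_space[OF fT] full_pm_space_imp_pm_space[OF fS]])
    then have SP: "class_of ?S \<in> P" by (rule pyramid_downward_class_of[OF P G[OF t\<sigma>] fS])
    have "box_class ?W (class_of ?S) < e"
      by (rule box_class_class_of_less[OF box_ok_sym[OF \<eta>(2)[OF t(1,3)]] _ _ fs fS]) (use e in auto)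
    then show "\<exists>Y\<in>P. box_class ?W Y < e" using SP by blast
  qed
  then show ?thesis unfolding pyramid_closed[OF P] .
qed

text \<open>A pyramid below no Gaussian pyramid receives the value infinity, the infimum of the
  empty set. Restricting to positive deviations keeps the Gaussian densities meaningful; the value 0
  is still reached as an infimum.\<close>

definition gaussian_size :: "pm_class set \<Rightarrow> ennreal" where
  "gaussian_size P = (INF \<sigma>\<in>{\<sigma>. \<sigma> > 0 \<and> P \<subseteq> gaussian_power \<sigma>}. ennreal \<sigma>)"

lemma gaussian_size_le: "\<sigma> > 0 \<Longrightarrow> P \<subseteq> gaussian_power \<sigma> \<Longrightarrow> gaussian_size P \<le> ennreal \<sigma>"
  unfolding gaussian_size_def by (rule INF_lower) simp

lemma gaussian_size_geI:
  "(\<And>\<sigma>. \<sigma> > 0 \<Longrightarrow> P \<subseteq> gaussian_power \<sigma> \<Longrightarrow> c \<le> ennreal \<sigma>) \<Longrightarrow> c \<le> gaussian_size P"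
  unfolding gaussian_size_def by (rule INF_greatest) simp

lemma gaussian_size_lessD:
  assumes "gaussian_size P < ennreal s"
  shows "P \<subseteq> gaussian_power s"
proof -
  obtain \<sigma> where \<sigma>: "\<sigma> > 0" "P \<subseteq> gaussian_power \<sigma>" "ennreal \<sigma> < ennreal s"
    using assms unfolding gaussian_size_def INF_less_iff by blast
  have "\<sigma> \<le> s" using \<sigma>(3) ennreal_leI[of s \<sigma>] by (meson linear not_le)
  then show ?thesis using gaussian_power_mono[OF \<sigma>(1)] \<sigma>(2) by blast
qed

lemma gaussian_size_mono: "P \<subseteq> Q \<Longrightarrow> gaussian_size P \<le> gaussian_size Q"
  by (rule gaussian_size_geI, rule gaussian_size_le) auto

text \<open>Intervals distinguish the Gaussian pyramids: the one of length \<sigma> sqrt(2 pi)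
  belongs to the pyramid of deviation \<sigma>, and to that of deviation s only when \<sigma> \<le>
  s.\<close>

lemma gaussian_size_gaussian_power:
  assumes \<sigma>: "\<sigma> > 0"
  shows "gaussian_size (gaussian_power \<sigma>) = ennreal \<sigma>"
proof (rule antisym)
  show "gaussian_size (gaussian_power \<sigma>) \<le> ennreal \<sigma>" by (rule gaussian_size_le[OF \<sigma> order_refl])
  show "ennreal \<sigma> \<le> gaussian_size (gaussian_power \<sigma>)"
  proof (rule gaussian_size_geI)
    fix s :: real assume s: "s > 0" "gaussian_power \<sigma> \<subseteq> gaussian_power s"
    define r where "r = \<sigma> * sqrt (2 * pi)"
    have r: "r > 0" "r / sqrt (2 * pi) = \<sigma>" using \<sigma> by (simp_all add: r_def)
    have "infinite_power (interval_pm r) \<subseteq> gaussian_power \<sigma>"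
      using infinite_power_mono[OF lip_le_interval_gaussian[OF r(1)]] full_pm_space_interval_pm[OF r(1)] full_pm_space_gaussian_line[OF \<sigma>]
      unfolding r(2) by blast
    then have "class_of (interval_pm r) \<in> gaussian_power s"
      using class_of_in_infinite_power[OF full_pm_space_interval_pm[OF r(1)]] s(2) by blast
    then have "\<sigma> \<le> s" using interval_in_gaussian_pyramid[OF r(1) s(1)] r(2) by simp
    then show "ennreal \<sigma> \<le> ennreal s" by (rule ennreal_leI)
  qed
qed

lemma gaussian_size_interval_pyramid:
  assumes r: "r > 0"
  shows "gaussian_size (interval_pyramid r) = ennreal (r / sqrt (2 * pi))"
  unfolding interval_pyramid_def
proof (rule antisym)
  have s: "r / sqrt (2 * pi) > 0" using r by simp
  show "gaussian_size (infinite_power (interval_pm r)) \<le> ennreal (r / sqrt (2 * pi))"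
    by (rule gaussian_size_le[OF s infinite_power_mono[OF lip_le_interval_gaussian[OF r] full_pm_space_gaussian_line[OF s] full_pm_space_interval_pm[OF r]]])
  show "ennreal (r / sqrt (2 * pi)) \<le> gaussian_size (infinite_power (interval_pm r))"
  proof (rule gaussian_size_geI)
    fix \<sigma> :: real assume \<sigma>: "\<sigma> > 0" "infinite_power (interval_pm r) \<subseteq> gaussian_power \<sigma>"
    have "class_of (interval_pm r) \<in> gaussian_power \<sigma>"
      using class_of_in_infinite_power[OF full_pm_space_interval_pm[OF r]] \<sigma>(2) by blast
    from ennreal_leI[OF interval_in_gaussian_pyramid[OF r \<sigma>(1) this]]
    show "ennreal (r / sqrt (2 * pi)) \<le> ennreal \<sigma>" .
  qed
qed

section \<open>Homogeneity, semicontinuity and rigidity\<close>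

lemma gaussian_size_scale_ge:
  assumes t: "t > 0"
  shows "ennreal t * gaussian_size P \<le> gaussian_size (scale_pyramid t P)"
proof (rule gaussian_size_geI)
  fix \<sigma> :: real assume \<sigma>: "\<sigma> > 0" "scale_pyramid t P \<subseteq> gaussian_power \<sigma>"
  have t': "1 / t > 0" using t by simp
  have "P \<subseteq> gaussian_power (1 / t * \<sigma>)"
  proof
    fix X assume "X \<in> P"
    then have "scale_class t X \<in> gaussian_power \<sigma>" using \<sigma>(2) unfolding scale_pyramid_eq[OF t] by blast
    from scale_class_gaussian_power[OF this \<sigma>(1) t'] show "X \<in> gaussian_power (1 / t * \<sigma>)"
      unfolding scale_class_inverse[OF t] .
  qed
  then have "gaussian_size P \<le> ennreal (1 / t * \<sigma>)" using t \<sigma>(1) by (intro gaussian_size_le) auto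
  then have "ennreal t * gaussian_size P \<le> ennreal t * ennreal (1 / t * \<sigma>)" by (rule mult_left_mono) simp
  also have "\<dots> = ennreal \<sigma>" using t \<sigma>(1) by (simp add: ennreal_mult'[symmetric])
  finally show "ennreal t * gaussian_size P \<le> ennreal \<sigma>" .
qed

text \<open>The upper bound is the lower bound for the factor 1/t, applied to the scaled
  pyramid.\<close>

lemma gaussian_size_scale:
  assumes t: "t > 0"
  shows "gaussian_size (scale_pyramid t P) = ennreal t * gaussian_size P"
proof (rule antisym)
  have t': "1 / t > 0" using t by simp
  have "scale_pyramid (1 / t) (scale_pyramid t P) = P"
    unfolding scale_pyramid_eq[OF t] scale_pyramid_eq[OF t'] image_image scale_class_inverse[OF t] by simp
  then have "ennreal (1 / t) * gaussian_size (scale_pyramid t P) \<le> gaussian_size P"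
    using gaussian_size_scale_ge[OF t', of "scale_pyramid t P"] by simp
  then have "ennreal t * (ennreal (1 / t) * gaussian_size (scale_pyramid t P)) \<le> ennreal t * gaussian_size P"
    by (rule mult_left_mono) simp
  moreover have "ennreal t * ennreal (1 / t) = 1" using t by (simp add: ennreal_mult'[symmetric])
  ultimately show "gaussian_size (scale_pyramid t P) \<le> ennreal t * gaussian_size P"
    by (simp add: mult.assoc[symmetric])
qed (rule gaussian_size_scale_ge[OF t])

text \<open>A member of the limit is a box limit of members of \<open>S n\<close>, infinitely many
  of which lie in the box-closed Gaussian pyramid. Asking for infinitely many indices suits an
  argument by contradiction.\<close>

lemma gaussian_power_weakly_closed:
  assumes conv: "weakly_converges S P" and freq: "\<exists>\<^sub>F n in sequentially. S n \<subseteq> gaussian_power s"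
  shows "P \<subseteq> gaussian_power s"
proof
  fix X assume X: "X \<in> P"
  obtain x where x: "\<And>n. x n \<in> S n" "(\<lambda>n. box_class (x n) X) \<longlonglongrightarrow> 0"
    using conv X unfolding weakly_converges_def by blast
  have "X \<in> box_closure (gaussian_power s)"
    unfolding box_closure_def
  proof (intro CollectI allI impI)
    fix e :: real assume "e > 0"
    then have "\<forall>\<^sub>F n in sequentially. box_class (x n) X < e" using x(2) by (rule order_tendstoD(2)[rotated])
    from frequently_eventually_frequently[OF freq this]
    obtain n where n: "S n \<subseteq> gaussian_power s" "box_class (x n) X < e" using frequently_ex by blast
    then have "x n \<in> gaussian_power s" "box_class X (x n) < e" using x(1)[of n] box_class_sym[of X "x n"] by auto
    then show "\<exists>Y\<in>gaussian_power s. box_class X Y < e" by blast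
  qed
  then show "X \<in> gaussian_power s" unfolding box_closure_infinite_power .
qed

text \<open>If the value were at most \<open>c\<close> along infinitely many indices, all those
  pyramids would lie below one Gaussian pyramid of deviation s, with s strictly between c and the
  value at the limit, and so would the limit.\<close>

lemma lsc_gaussian_size: "lsc_functional gaussian_size"
  unfolding lsc_functional_def openin_weak_topology weakly_open_def
proof (intro allI conjI ballI impI)
  fix c P and S :: "nat \<Rightarrow> pm_class set"
  assume P: "P \<in> {P \<in> pyramids. c < gaussian_size P}" and S: "(\<forall>n. S n \<in> pyramids) \<and> weakly_converges S P"
  from P have "c < gaussian_size P" by simp
  \<comment> \<open>A number strictly between is finite and positive, hence a genuine standard
    deviation.\<close>
  then obtain z where z: "c < z" "z < gaussian_size P" using dense by blast
  then have "z \<noteq> \<infinity>" by auto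
  define s where "s = enn2real z"
  have sz: "ennreal s = z" unfolding s_def using \<open>z \<noteq> \<infinity>\<close> by (simp add: less_top)
  have s: "s > 0" using z(1) sz by (metis ennreal_less_zero_iff not_gr_zero not_less_zero order_le_less_trans zero_le)
  show "\<forall>\<^sub>F n in sequentially. S n \<in> {P \<in> pyramids. c < gaussian_size P}"
  proof (rule ccontr)
    assume "\<not> ?thesis"
    then have "\<exists>\<^sub>F n in sequentially. \<not> c < gaussian_size (S n)" using S unfolding not_eventually by simp
    then have "\<exists>\<^sub>F n in sequentially. S n \<subseteq> gaussian_power s"
    proof (rule frequently_elim1)
      fix n assume "\<not> c < gaussian_size (S n)"
      then have "gaussian_size (S n) < ennreal s" using z(1) unfolding sz by (meson not_less order_le_less_trans)
      then show "S n \<subseteq> gaussian_power s" by (rule gaussian_size_lessD)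
    qed
    then have "P \<subseteq> gaussian_power s" using S by (intro gaussian_power_weakly_closed) auto
    from gaussian_size_le[OF s this] show False using z(2) unfolding sz by simp
  qed
qed auto

lemma idempotent_gaussian_size:
  assumes P: "P \<in> pyramids" "l2_idempotent P" and F: "gaussian_size P = ennreal_sqrt (pyramid_variance P)"
  shows "P = gaussian_pyramid (pyramid_variance P)"
proof -
  define V where "V = pyramid_variance P"
  consider "V = 0" | "V = \<infinity>" | v where "V = ennreal v" "v > 0"
    by (cases V rule: ennreal_cases) (auto simp: less_le)
  then show ?thesis
  proof cases
    case 1
    then show ?thesis using pyramid_variance_zero[OF P(1)] unfolding V_def gaussian_pyramid_def by simp
  next
    case 2
    have "class_of (gaussian_line \<sigma>) \<in> P" if \<sigma>: "\<sigma> > 0" for \<sigma>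
      using gaussian_in_pyramid_variance[OF P, of "\<sigma>\<^sup>2"] \<sigma> 2 unfolding V_def by (simp add: less_top[symmetric])
    then have "P = UNIV" by (rule all_gaussians_pyramid[OF P(1)])
    then show ?thesis using 2 unfolding V_def gaussian_pyramid_def by simp
  next
    case (3 v)
    have sv: "sqrt v > 0" using 3(2) by simp
    \<comment> \<open>The supremum defining the variance may not be attained, so Gaussians are first
      found for every smaller deviation.\<close>
    have "class_of (gaussian_line (sqrt v)) \<in> P"
    proof (rule gaussian_left_continuous[OF P(1) sv])
      fix s :: real assume s: "0 < s" "s < sqrt v"
      have "s\<^sup>2 < v" using s 3(2) real_less_rsqrt[of s v] by (smt (verit) real_sqrt_less_iff real_sqrt_abs)
      then have "ennreal (s\<^sup>2) < pyramid_variance P" using 3 unfolding V_def by (simp add: ennreal_lessI)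
      then show "class_of (gaussian_line s) \<in> P"
        using gaussian_in_pyramid_variance[OF P, of "s\<^sup>2"] s(1) by simp
    qed
    then have sub: "gaussian_power (sqrt v) \<subseteq> P"
      by (rule infinite_power_subset_idempotent[OF P full_pm_space_gaussian_line[OF sv]])
    have Fv: "gaussian_size P = ennreal (sqrt v)" using F 3 unfolding V_def ennreal_sqrt_def by simp
    have "P \<subseteq> gaussian_power (sqrt v)"
    proof (rule gaussian_power_right_continuous[OF sv])
      fix s assume s: "s > sqrt v"
      with sv have "s > 0" by (rule order_less_trans)
      with s have "gaussian_size P < ennreal s" unfolding Fv by (simp add: ennreal_lessI)
      then show "P \<subseteq> gaussian_power s" by (rule gaussian_size_lessD)
    qed
    with sub have "P = gaussian_power (sqrt v)" by blast
    then show ?thesis using 3 unfolding V_def gaussian_pyramid_def by simp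
  qed
qed

theorem theorem0p6:
  shows "\<exists>F :: pm_class set \<Rightarrow> ennreal.
    monotone_functional F \<and> homogeneous_functional F \<and> lsc_functional F \<and>
    (\<forall>\<sigma>::real. \<sigma> > 0 \<longrightarrow> F (gaussian_pyramid (ennreal (\<sigma>\<^sup>2))) = ennreal \<sigma>) \<and>
    (\<forall>r::real. r > 0 \<longrightarrow> F (interval_pyramid r) = ennreal (r / sqrt (2 * pi))) \<and>
    (\<forall>P\<in>pyramids. l2_idempotent P \<and> F P = ennreal_sqrt (pyramid_variance P) \<longrightarrow>
       P = gaussian_pyramid (pyramid_variance P))"
proof (intro exI[of _ gaussian_size] conjI allI impI ballI)
  show "monotone_functional gaussian_size"
    unfolding monotone_functional_def using gaussian_size_mono by blast
  have "gaussian_size (scale_pyramid t P) = ennreal (t powr 1) * gaussian_size P" if "t > 0" for t P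
    using gaussian_size_scale[OF that] that by simp
  then show "homogeneous_functional gaussian_size"
    unfolding homogeneous_functional_def by (intro exI[of _ 1]) simp
  show "lsc_functional gaussian_size" by (rule lsc_gaussian_size)
  show "gaussian_size (gaussian_pyramid (ennreal (\<sigma>\<^sup>2))) = ennreal \<sigma>" if "\<sigma> > 0" for \<sigma> :: real
    using gaussian_size_gaussian_power[OF that] that unfolding gaussian_pyramid_def by (simp add: ennreal_eq_0_iff)
  show "gaussian_size (interval_pyramid r) = ennreal (r / sqrt (2 * pi))" if "r > 0" for r :: real
    by (rule gaussian_size_interval_pyramid[OF that])
  show "P = gaussian_pyramid (pyramid_variance P)"
    if "P \<in> pyramids" "l2_idempotent P \<and> gaussian_size P = ennreal_sqrt (pyramid_variance P)" for P
    using idempotent_gaussian_size that by blast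
qed

end
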